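(* Fix $\alpha\in(0,1)$. Assume that (A1) $n,p\to\infty$ with $p/n\to c\in(0,1)$; (A2) $0<\lim_{p\to\infty}a_i<\infty$ for $i=1,\dots,6$; (A3) $0<\lim n^{1/2}\Delta^2<\infty$, $0<\lim n^{1/2}\Delta_I^2<\infty$ and $0<\lim n^{1/2}\Delta_\Sigma^2<\infty$ (limits as $n,p\to\infty$); and that $(\mu,\Sigma)\in\Omega_0$, i.e. $\dfrac{\Delta^2}{\Delta_I^2}=\dfrac{1}{\sqrt{(1-c)a_2}}$. Let $$\rho^\ast=\rho^\ast(c,a_1,a_2)=\left(\frac{a_1c\sqrt{a_2(1-c)}}{a_2(1-c)^2}+1\right)^{-1}.$$ Then the statistic $$T(\rho^\ast)=\rho^\ast\sqrt n\left(\frac{T^2}{n}-\frac{p}{N-p}\right)+(1-\rho^\ast)\sqrt n\,(D_n-1)$$ has maximum local asymptotic power in the class $\mathcal T=\{T(\rho):\rho\in[0,1]\}$, i.e. for every $\rho\in[0,1]$, $$\lim\Pr\left(\frac{T(\rho)}{\sigma(\rho,\hat c,\hat a_1,\hat a_2)}\ge z(\alpha)\right)\le\lim\Pr\left(\frac{T(\rho^\ast)}{\sigma(\rho^\ast,\hat c,\hat a_1,\hat a_2)}\ge z(\alpha)\right),$$ and this maximum local asymptotic power is $$\Phi\left(\frac{\sqrt{n(1-c)}\,\Delta^2}{\sqrt{c\left(a_1\sqrt{(1-c)/a_2}+1\right)}}-z(\alpha)\right),$$ in the sense that the difference between $\Pr\left(T(\rho^\ast)/\sigma(\rho^\ast,\hat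 c,\hat a_1,\hat a_2)\ge z(\alpha)\right)$ and this quantity tends to $0$.
   Context: For each $(N,p)$, $x_1,\dots,x_N$ are independent $p$-dimensional random vectors with distribution $\mathcal N_p(\mu,\Sigma)$, $\Sigma$ positive definite; $\mu_0\in\mathbb R^p$ is a given vector and one tests $H_0:\mu=\mu_0$ against $H_1:\mu\ne\mu_0$. Put $n=N-1$, $\hat c=p/n$, $\bar x=\frac1N\sum_{i=1}^N x_i$, $S=\frac1n\sum_{i=1}^N(x_i-\bar x)(x_i-\bar x)'$. The quantities $\mu,\mu_0,\Sigma$ may depend on $(n,p)$. Hotelling's statistic: $T^2=N(\bar x-\mu_0)'S^{-1}(\bar x-\mu_0)$. Dempster's statistic: $D_n=\dfrac{N(\bar x-\mu_0)'(\bar x-\mu_0)}{\operatorname{tr}S}$. For $\rho\in[0,1]$: $T(\rho)=\rho\sqrt n\left(\frac{T^2}{n}-\frac{p}{N-p}\right)+(1-\rho)\sqrt n(D_n-1)$. $a_i=\operatorname{tr}\Sigma^i/p$; $\hat a_1=\operatorname{tr}S/p$, $\hat a_2=\frac{n^2}{p(n+2)(n-1)}\left\{\operatorname{tr}S^2-\frac{(\operatorname{tr}S)^2}{n}\right\}$. $\Delta^2=(\mu-\mu_0)'\Sigma^{-1}(\mu-\mu_0)$, $\Delta_I^2=(\mu-\mu_0)'(\mu-\mu_0)$, $\Delta_\Sigma^2=(\mu-\mu_0)'\Sigma(\mu-\mu_0)$. $\sigma(\rho,c,a_1,a_2)>0$ is given by $\sigma^2(\rho,c,a_1,a_2)=\rho^2\frac{2c}{(1-c)^3}+(1-\rho)^2\frac{2a_2}{ca_1^2}+2\rho(1-\rho)\frac{2}{1-c}$.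 The test based on $T(\rho)$ rejects $H_0$ if $T(\rho)/\sigma(\rho,\hat c,\hat a_1,\hat a_2)\ge z(\alpha)$; its local asymptotic power is the limit of its rejection probability under (A1)–(A3). $\Phi$ is the standard normal distribution function and $z(\alpha)$ is the upper $100\alpha$ percentile of $\mathcal N(0,1)$. *)

theory Defs
  imports
    "HOL-Probability.Probability"
    "Jordan_Normal_Form.Determinant"
    "Jordan_Normal_Form.Gauss_Jordan_Elimination"
begin

unbundle no vec_syntax and no inner_syntax

text \<open>
  The dimension \<open>p\<close> varies along the asymptotics, so vectors and matrices are those of
  \<open>Jordan_Normal_Form\<close>, whose dimensions are terms. Several of their names also occur in
  \<open>HOL-Analysis\<close> and are therefore qualified.
\<close>

definition mtrace :: "real mat \<Rightarrow> real" where
  "mtrace A = (\<Sum>j<dim_row A. A $$ (j, j))"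

text \<open>The zero matrix is a junk value; the sample covariance matrix is singular only with
  probability zero once \<open>p < N\<close>.\<close>

definition minverse :: "real mat \<Rightarrow> real mat" where
  "minverse A = (case mat_inverse A of Some B \<Rightarrow> B | None \<Rightarrow> 0\<^sub>m (dim_row A) (dim_row A))"

definition quad_form :: "real mat \<Rightarrow> real Matrix.vec \<Rightarrow> real" where
  "quad_form A v = v \<bullet> (A *\<^sub>v v)"

definition pos_def_mat :: "nat \<Rightarrow> real mat \<Rightarrow> bool" where
  "pos_def_mat p A \<longleftrightarrow> A \<in> carrier_mat p p \<and> transpose_mat A = A \<and>
     (\<forall>v \<in> carrier_vec p. v \<noteq> 0\<^sub>v p \<longrightarrow> quad_form A v > 0)"

text \<open>Lebesgue measure on the space \<open>carrier_vec p\<close> of real vectors of dimension \<open>p\<close>, with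
  the Borel sets as its sigma-algebra.\<close>

definition lborel_vec :: "nat \<Rightarrow> real Matrix.vec measure" where
  "lborel_vec p = embed_measure (\<Pi>\<^sub>M j\<in>{..<p}. lborel) (Matrix.vec p)"

definition mvn_density :: "nat \<Rightarrow> real Matrix.vec \<Rightarrow> real mat \<Rightarrow> real Matrix.vec \<Rightarrow> real" where
  "mvn_density p \<mu> \<Sigma> x =
     exp (- quad_form (minverse \<Sigma>) (x - \<mu>) / 2) / sqrt ((2 * pi) ^ p * Determinant.det \<Sigma>)"

text \<open>\<open>X i\<close> for \<open>i < N\<close> are independent random vectors on \<open>M\<close> with distribution
  \<open>N\<^sub>p(\<mu>, \<Sigma>)\<close>.\<close>

definition normal_sample ::
  "'a measure \<Rightarrow> nat \<Rightarrow> nat \<Rightarrow> real Matrix.vec \<Rightarrow> real mat \<Rightarrow> (nat \<Rightarrow> 'a \<Rightarrow> real Matrix.vec) \<Rightarrow> bool"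
where
  "normal_sample M N p \<mu> \<Sigma> X \<longleftrightarrow>
     prob_space M \<and>
     prob_space.indep_vars M (\<lambda>_. lborel_vec p) X {..<N} \<and>
     (\<forall>i<N. distributed M (lborel_vec p) (X i) (\<lambda>x. ennreal (mvn_density p \<mu> \<Sigma> x)))"

definition sample_mean :: "nat \<Rightarrow> nat \<Rightarrow> (nat \<Rightarrow> real Matrix.vec) \<Rightarrow> real Matrix.vec" where
  "sample_mean N p x = Matrix.vec p (\<lambda>j. (\<Sum>i<N. x i $ j) / real N)"

definition sample_cov :: "nat \<Rightarrow> nat \<Rightarrow> (nat \<Rightarrow> real Matrix.vec) \<Rightarrow> real mat" where
  "sample_cov N p x = Matrix.mat p p (\<lambda>(j, l).
     (\<Sum>i<N. (x i - sample_mean N p x) $ j * (x i - sample_mean N p x) $ l) / real (N - 1))"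

definition hotelling_T2 ::
  "nat \<Rightarrow> nat \<Rightarrow> real Matrix.vec \<Rightarrow> (nat \<Rightarrow> real Matrix.vec) \<Rightarrow> real" where
  "hotelling_T2 N p \<mu>\<^sub>0 x =
     real N * quad_form (minverse (sample_cov N p x)) (sample_mean N p x - \<mu>\<^sub>0)"

definition dempster_D ::
  "nat \<Rightarrow> nat \<Rightarrow> real Matrix.vec \<Rightarrow> (nat \<Rightarrow> real Matrix.vec) \<Rightarrow> real" where
  "dempster_D N p \<mu>\<^sub>0 x =
     real N * ((sample_mean N p x - \<mu>\<^sub>0) \<bullet> (sample_mean N p x - \<mu>\<^sub>0))
       / mtrace (sample_cov N p x)"

definition T_stat ::
  "nat \<Rightarrow> nat \<Rightarrow> real Matrix.vec \<Rightarrow> real \<Rightarrow> (nat \<Rightarrow> real Matrix.vec) \<Rightarrow> real" where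
  "T_stat N p \<mu>\<^sub>0 \<rho> x = (let n = real (N - 1) in
     \<rho> * sqrt n * (hotelling_T2 N p \<mu>\<^sub>0 x / n - real p / (real N - real p))
     + (1 - \<rho>) * sqrt n * (dempster_D N p \<mu>\<^sub>0 x - 1))"

definition a_coef :: "nat \<Rightarrow> nat \<Rightarrow> real mat \<Rightarrow> real" where
  "a_coef i p \<Sigma> = mtrace (\<Sigma> ^\<^sub>m i) / real p"

definition a1_hat :: "nat \<Rightarrow> nat \<Rightarrow> (nat \<Rightarrow> real Matrix.vec) \<Rightarrow> real" where
  "a1_hat N p x = mtrace (sample_cov N p x) / real p"

definition a2_hat :: "nat \<Rightarrow> nat \<Rightarrow> (nat \<Rightarrow> real Matrix.vec) \<Rightarrow> real" where
  "a2_hat N p x = (let n = real (N - 1); S = sample_cov N p x in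
     n\<^sup>2 / (real p * (n + 2) * (n - 1)) * (mtrace (S ^\<^sub>m 2) - (mtrace S)\<^sup>2 / n))"

definition sigma_fun :: "real \<Rightarrow> real \<Rightarrow> real \<Rightarrow> real \<Rightarrow> real" where
  "sigma_fun \<rho> c a1 a2 = sqrt (\<rho>\<^sup>2 * (2 * c / (1 - c) ^ 3)
     + (1 - \<rho>)\<^sup>2 * (2 * a2 / (c * a1\<^sup>2))
     + 2 * \<rho> * (1 - \<rho>) * (2 / (1 - c)))"

definition std_normal_cdf :: "real \<Rightarrow> real" where
  "std_normal_cdf = cdf std_normal_distribution"

definition upper_percentile :: "real \<Rightarrow> real" where
  "upper_percentile \<alpha> = (THE z. 1 - std_normal_cdf z = \<alpha>)"

definition reject_prob ::
  "'a measure \<Rightarrow> nat \<Rightarrow> nat \<Rightarrow> real Matrix.vec \<Rightarrow> (nat \<Rightarrow> 'a \<Rightarrow> real Matrix.vec) \<Rightarrow> real \<Rightarrow> real \<Rightarrow> real"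
where
  "reject_prob M N p \<mu>\<^sub>0 X \<alpha> \<rho> = measure M {\<omega> \<in> space M.
     (let x = (\<lambda>i. X i \<omega>) in
       T_stat N p \<mu>\<^sub>0 \<rho> x
         / sigma_fun \<rho> (real p / real (N - 1)) (a1_hat N p x) (a2_hat N p x)
       \<ge> upper_percentile \<alpha>)}"

definition Delta2 :: "real Matrix.vec \<Rightarrow> real Matrix.vec \<Rightarrow> real mat \<Rightarrow> real" where
  "Delta2 \<mu> \<mu>\<^sub>0 \<Sigma> = quad_form (minverse \<Sigma>) (\<mu> - \<mu>\<^sub>0)"

definition DeltaI2 :: "real Matrix.vec \<Rightarrow> real Matrix.vec \<Rightarrow> real" where
  "DeltaI2 \<mu> \<mu>\<^sub>0 = (\<mu> - \<mu>\<^sub>0) \<bullet> (\<mu> - \<mu>\<^sub>0)"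

definition DeltaS2 :: "real Matrix.vec \<Rightarrow> real Matrix.vec \<Rightarrow> real mat \<Rightarrow> real" where
  "DeltaS2 \<mu> \<mu>\<^sub>0 \<Sigma> = quad_form \<Sigma> (\<mu> - \<mu>\<^sub>0)"

definition rho_star :: "real \<Rightarrow> real \<Rightarrow> real \<Rightarrow> real" where
  "rho_star c a1 a2 = inverse (a1 * c * sqrt (a2 * (1 - c)) / (a2 * (1 - c)\<^sup>2) + 1)"

end

theory Submission
  imports Defs
begin

text \<open>
  Why the theorem holds. A rotation of the sample space reduces everything to a standard Gaussian
  matrix: with \<open>\<Sigma> = L L'\<close> and \<open>B = L' L\<close>, the sample mean becomes a row \<open>g\<close>, the sample covariance
  matrix becomes \<open>L Y' Y L' / n\<close> with the remaining rows \<open>Y\<close>, independent of \<open>g\<close>, and the difference of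
  means becomes a shift of \<open>g\<close> to \<open>e = g + e0\<close>. In these coordinates Dempster's statistic is
  \<open>\<bar>L e\<bar>\<^sup>2\<close> divided by the trace of \<open>S\<close>, and Hotelling's is \<open>n \<bar>e\<bar>\<^sup>2 / V\<close>, where \<open>V\<close> is the least squared
  length \<open>\<bar>Y v\<bar>\<^sup>2\<close> of a vector \<open>v\<close> with \<open>v \<bullet> e = \<bar>e\<bar>\<close>. Rotating \<open>e\<close> to a coordinate axis does not change
  the law of \<open>Y\<close>, so \<open>V\<close> is independent of \<open>g\<close>, and eliminating the columns of \<open>Y\<close> one by one shows
  that it is a sum of \<open>N - p\<close> squares of independent standard normal variables
  (\<open>distr_vmin\<close>, \<open>vdir_inverse_gram\<close>, \<open>distr_row_Vstat\<close>).

  Expanding both quotients to first order, \<open>T(\<rho>)\<close> is a constant, plus a centred quadratic form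
  in \<open>g\<close> with matrix \<open>x I + y B\<close>, minus a multiple of \<open>V - (N - p)\<close>, plus a negligible term
  (\<open>cip_hot\<close>, \<open>cip_dem\<close>). The constant is the contribution \<open>\<rho> l / (1 - c) + (1 - \<rho>) l\<^sub>I / (c a\<^sub>1)\<close> of the
  shift, where \<open>l\<close> and \<open>l\<^sub>I\<close> are the limits of \<open>\<surd>n \<Delta>\<^sup>2\<close> and of \<open>\<surd>n \<Delta>\<^sub>I\<^sup>2\<close>. The characteristic function of a centred Gaussian quadratic
  form satisfies a perturbed linear differential equation, by Stein's identity, and is therefore
  close to a Gaussian one as soon as the fourth spectral moment is small
  (\<open>char_quadratic_bound\<close>). So the sum is asymptotically normal, with variance the
  function \<open>\<sigma>\<^sup>2\<close> at the limiting parameters. The estimates of \<open>a\<^sub>1\<close> and \<open>a\<^sub>2\<close> are consistent, by second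
  moments of sums over independent rows (\<open>cip_a2_form\<close>), and Slutsky's theorem gives the limiting
  power \<open>\<Phi>(b / \<sigma> - z)\<close>, where \<open>b\<close> is the constant above (\<open>rejection_limit\<close>).

  It remains to maximise \<open>b / \<sigma>\<close> over \<open>\<rho>\<close>. On \<open>\<Omega>\<^sub>0\<close> there are coordinates in which \<open>b\<close> is a multiple
  of \<open>x + y\<close> and \<open>\<sigma>\<^sup>2\<close> is a symmetric quadratic form in \<open>x\<close> and \<open>y\<close> that is smallest, for a given sum, on the
  diagonal; the diagonal is exactly \<open>\<rho> = \<rho>\<^sup>\<ast>\<close> (\<open>sigma_fun_maximal\<close>).
\<close>

section \<open>The standard Gaussian law on finitely many coordinates and its reflections\<close>

abbreviation gauss :: "'i set \<Rightarrow> ('i \<Rightarrow> real) measure" where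
  "gauss K \<equiv> \<Pi>\<^sub>M k\<in>K. std_normal_distribution"

interpretation product_lborel: product_sigma_finite "\<lambda>_::'i. lborel :: real measure" by standard

interpretation product_gauss: product_sigma_finite "\<lambda>_::'i. std_normal_distribution"
  by (simp add: product_sigma_finite_def prob_space_imp_sigma_finite prob_space_normal_density)

lemma prob_space_gauss: "prob_space (gauss K)"
  by (rule prob_space_PiM) (simp add: prob_space_normal_density)

lemma sets_gauss [measurable_cong, simp]: "sets (gauss K) = sets (\<Pi>\<^sub>M k\<in>K. borel)"
  by (rule sets_PiM_cong) auto

lemma space_gauss: "space (gauss K) = PiE K (\<lambda>_. UNIV)"
  by (simp add: space_PiM)

lemma sets_PiM_lborel [simp]: "sets (\<Pi>\<^sub>M k\<in>K. lborel) = sets (\<Pi>\<^sub>M k\<in>K. borel :: real measure)"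
  by (rule sets_PiM_cong) auto

text \<open>Invariance under rotations is easiest to see on the density, which depends on the squared length of the vector alone.\<close>
lemma gauss_eq_density:
  assumes "finite K"
  shows "gauss K = density (\<Pi>\<^sub>M k\<in>K. lborel) (\<lambda>x. \<Prod>k\<in>K. ennreal (std_normal_density (x k)))"
proof (rule product_gauss.PiM_eqI[symmetric, OF assms])
  fix A :: "'a \<Rightarrow> real set" assume A: "\<And>i. i \<in> K \<Longrightarrow> A i \<in> sets std_normal_distribution"
  then have A': "\<And>i. i \<in> K \<Longrightarrow> A i \<in> sets borel" by simp
  have "emeasure (density (\<Pi>\<^sub>M k\<in>K. lborel) (\<lambda>x. \<Prod>k\<in>K. ennreal (std_normal_density (x k)))) (Pi\<^sub>E K A)
     = (\<integral>\<^sup>+x. (\<Prod>k\<in>K. ennreal (std_normal_density (x k))) * indicator (Pi\<^sub>E K A) x \<partial>(\<Pi>\<^sub>M k\<in>K. lborel))"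
    by (rule emeasure_density) (use A' assms in \<open>auto intro!: sets_PiM_I_finite\<close>)
  also have "\<dots> = (\<integral>\<^sup>+x. (\<Prod>k\<in>K. ennreal (std_normal_density (x k)) * indicator (A k) (x k)) \<partial>(\<Pi>\<^sub>M k\<in>K. lborel))"
  proof (rule nn_integral_cong)
    fix x :: "'a \<Rightarrow> real" assume "x \<in> space (\<Pi>\<^sub>M k\<in>K. lborel)"
    then have "x \<in> extensional K" by (auto simp: space_PiM PiE_def)
    then have "indicator (Pi\<^sub>E K A) x = (\<Prod>k\<in>K. indicator (A k) (x k) :: ennreal)"
      using assms by (auto simp: indicator_def PiE_iff prod_zero_iff)
    then show "(\<Prod>k\<in>K. ennreal (std_normal_density (x k))) * indicator (Pi\<^sub>E K A) x
       = (\<Prod>k\<in>K. ennreal (std_normal_density (x k)) * indicator (A k) (x k))"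
      by (simp add: prod.distrib)
  qed
  also have "\<dots> = (\<Prod>k\<in>K. \<integral>\<^sup>+x. ennreal (std_normal_density x) * indicator (A k) x \<partial>lborel)"
    by (rule product_lborel.product_nn_integral_prod) (use A' assms in auto)
  also have "\<dots> = (\<Prod>k\<in>K. emeasure std_normal_distribution (A k))"
    by (rule prod.cong) (use A' in \<open>auto simp: emeasure_density\<close>)
  finally show "emeasure (density (\<Pi>\<^sub>M k\<in>K. lborel) (\<lambda>x. \<Prod>k\<in>K. ennreal (std_normal_density (x k)))) (Pi\<^sub>E K A)
    = (\<Prod>k\<in>K. emeasure std_normal_distribution (A k))" .
qed simp

text \<open>Translation invariance, one coordinate at a time by Tonelli. A reflection moves the entries other than a chosen one by such a translation once the inner product with \<open>u\<close> is held fixed.\<close>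
lemma nn_integral_PiM_lborel_translate:
  assumes "finite K" and f [measurable]: "f \<in> borel_measurable (\<Pi>\<^sub>M k\<in>K. (borel :: real measure))"
  shows "(\<integral>\<^sup>+x. f (\<lambda>k\<in>K. x k + t k) \<partial>(\<Pi>\<^sub>M k\<in>K. lborel)) = (\<integral>\<^sup>+x. f x \<partial>(\<Pi>\<^sub>M k\<in>K. lborel))"
  using assms
proof (induction K arbitrary: f rule: finite_induct)
  case empty
  then show ?case by (simp add: PiM_empty nn_integral_count_space_finite)
next
  case (insert a K)
  note [measurable] = insert.prems
  have e: "(\<lambda>k\<in>insert a K. (x(a:=s)) k + t k) = (\<lambda>k\<in>K. x k + t k)(a := s + t a)" for x s
    using insert.hyps by (auto simp: fun_eq_iff)
  have "(\<integral>\<^sup>+x. f (\<lambda>k\<in>insert a K. x k + t k) \<partial>(\<Pi>\<^sub>M k\<in>insert a K. lborel))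
     = (\<integral>\<^sup>+s. (\<integral>\<^sup>+x. f (\<lambda>k\<in>insert a K. (x(a:=s)) k + t k) \<partial>(\<Pi>\<^sub>M k\<in>K. lborel)) \<partial>lborel)"
    by (rule product_lborel.product_nn_integral_insert_rev) (use insert.hyps in \<open>auto simp del: fun_upd_apply\<close>)
  also have "\<dots> = (\<integral>\<^sup>+s. (\<integral>\<^sup>+x. f ((\<lambda>k\<in>K. x k + t k)(a := s + t a)) \<partial>(\<Pi>\<^sub>M k\<in>K. lborel)) \<partial>lborel)"
    by (simp only: e)
  also have "\<dots> = (\<integral>\<^sup>+s. (\<integral>\<^sup>+x. f (x(a := s + t a)) \<partial>(\<Pi>\<^sub>M k\<in>K. lborel)) \<partial>lborel)"
    by (intro nn_integral_cong insert.IH) measurable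
  also have "\<dots> = (\<integral>\<^sup>+s. (\<integral>\<^sup>+x. f (x(a := s)) \<partial>(\<Pi>\<^sub>M k\<in>K. lborel)) \<partial>lborel)"
  proof -
    interpret sigma_finite_measure "\<Pi>\<^sub>M k\<in>K. (lborel :: real measure)"
      by (rule product_lborel.sigma_finite) fact
    show ?thesis
      by (subst (2) nn_integral_real_affine[where c=1 and t="t a"]) (auto simp: add.commute)
  qed
  also have "\<dots> = (\<integral>\<^sup>+x. f x \<partial>(\<Pi>\<^sub>M k\<in>insert a K. lborel))"
    by (subst product_lborel.product_nn_integral_insert_rev) (use insert.hyps in auto)
  finally show ?case .
qed

text \<open>The Householder reflection in the hyperplane orthogonal to \<open>u\<close>. For \<open>u = 0\<close> the quotient is \<open>0\<close> and the map is the identity, so no case distinction is needed where \<open>u\<close> is a difference of two unit vectors that may coincide.\<close>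
definition reflection :: "'i set \<Rightarrow> ('i \<Rightarrow> real) \<Rightarrow> ('i \<Rightarrow> real) \<Rightarrow> 'i \<Rightarrow> real" where
  "reflection K u x = (\<lambda>k\<in>K. x k - 2 * (\<Sum>l\<in>K. u l * x l) / (\<Sum>l\<in>K. (u l)\<^sup>2) * u k)"

lemma measurable_reflection [measurable]:
  "reflection K u \<in> measurable (\<Pi>\<^sub>M k\<in>K. borel) (\<Pi>\<^sub>M k\<in>K. borel)"
  unfolding reflection_def by measurable

lemma reflection_null:
  assumes "finite K" "\<And>k. k \<in> K \<Longrightarrow> u k = 0"
  shows "reflection K u x = restrict x K"
  using assms by (auto simp: reflection_def fun_eq_iff)

lemma reflection_inner:
  assumes "finite K"
  shows "(\<Sum>k\<in>K. reflection K u x k * reflection K u y k) = (\<Sum>k\<in>K. x k * y k)"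
proof -
  define w a b where "w = (\<Sum>l\<in>K. (u l)\<^sup>2)" and "a = (\<Sum>l\<in>K. u l * x l)" and "b = (\<Sum>l\<in>K. u l * y l)"
  have "(\<Sum>k\<in>K. reflection K u x k * reflection K u y k)
    = (\<Sum>k\<in>K. x k * y k - 2 * a / w * (u k * y k) - 2 * b / w * (u k * x k) + 4 * a * b / w^2 * (u k)\<^sup>2)"
    by (intro sum.cong) (auto simp: reflection_def w_def a_def b_def algebra_simps power2_eq_square)
  also have "\<dots> = (\<Sum>k\<in>K. x k * y k) - 2 * a / w * b - 2 * b / w * a + 4 * a * b / w^2 * w"
    by (simp add: sum.distrib sum_subtractf sum_distrib_left[symmetric] sum_divide_distrib[symmetric])
       (simp add: w_def[symmetric] a_def[symmetric] b_def[symmetric])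
  also have "\<dots> = (\<Sum>k\<in>K. x k * y k)"
    by (cases "w = 0") (auto simp: field_simps power2_eq_square)
  finally show ?thesis .
qed

text \<open>The reflection along \<open>x - y\<close> exchanges \<open>x\<close> and \<open>y\<close> when they have the same length. All rotations below are of this kind, which avoids the change-of-variables theorem for general orthogonal maps.\<close>
lemma reflection_maps:
  assumes K: "finite K" and eq: "(\<Sum>k\<in>K. (x k)\<^sup>2) = (\<Sum>k\<in>K. (y k)\<^sup>2)" and k: "k \<in> K"
  shows "reflection K (\<lambda>k. x k - y k) x k = y k"
proof -
  define w where "w = (\<Sum>l\<in>K. (x l - y l)\<^sup>2)"
  have w: "w = 2 * (\<Sum>l\<in>K. (x l - y l) * x l)"
    using eq by (simp add: w_def power2_diff sum.distrib sum_subtractf sum_distrib_left algebra_simps power2_eq_square)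
  show ?thesis
  proof (cases "w = 0")
    case True
    then have "x k = y k" using K k by (auto simp: w_def sum_nonneg_eq_0_iff)
    then show ?thesis using k by (simp add: reflection_def)
  next
    case False
    then show ?thesis using k by (simp add: reflection_def w_def[symmetric] w[symmetric])
  qed
qed

lemma reflection_involution:
  assumes "finite K" "k \<in> K"
  shows "reflection K u (reflection K u x) k = x k"
proof -
  define w a where "w = (\<Sum>l\<in>K. (u l)\<^sup>2)" and "a = (\<Sum>l\<in>K. u l * x l)"
  have "(\<Sum>l\<in>K. u l * reflection K u x l) = (\<Sum>l\<in>K. u l * x l - 2 * a / w * (u l)\<^sup>2)"
    by (intro sum.cong) (auto simp: reflection_def w_def a_def algebra_simps power2_eq_square)
  also have "\<dots> = a - 2 * a / w * w"
    by (simp add: sum_subtractf sum_distrib_left[symmetric] sum_divide_distrib[symmetric])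
       (simp add: w_def[symmetric] a_def[symmetric])
  finally have b: "(\<Sum>l\<in>K. u l * reflection K u x l) = a - 2 * a / w * w" .
  have "reflection K u (reflection K u x) k = reflection K u x k - 2 * (a - 2 * a / w * w) / w * u k"
    using assms by (subst reflection_def) (simp add: b w_def[symmetric])
  also have "reflection K u x k = x k - 2 * a / w * u k"
    using assms by (simp add: reflection_def a_def w_def)
  finally show ?thesis
    by (cases "w = 0") (auto simp: field_simps)
qed

text \<open>In the coordinates that replace one entry \<open>x k0\<close> (with \<open>u k0\<close> nonzero) by the inner product of \<open>u\<close> and \<open>x\<close>, the reflection changes the sign of that coordinate and translates the other entries by an amount that depends on it alone. The substitution itself is affine in the single entry \<open>x k0\<close>, so one-dimensional integrals suffice.\<close>
lemma nn_integral_lborel_reflection: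
  assumes K: "finite K" and f [measurable]: "f \<in> borel_measurable (\<Pi>\<^sub>M k\<in>K. (borel :: real measure))"
  shows "(\<integral>\<^sup>+x. f (reflection K u x) \<partial>(\<Pi>\<^sub>M k\<in>K. lborel)) = (\<integral>\<^sup>+x. f x \<partial>(\<Pi>\<^sub>M k\<in>K. lborel))"
proof (cases "\<forall>k\<in>K. u k = 0")
  case True
  have "reflection K u x = x" if "x \<in> space (\<Pi>\<^sub>M k\<in>K. (lborel :: real measure))" for x
    using that True K by (auto simp: reflection_null space_PiM)
  then show ?thesis by (intro nn_integral_cong) simp
next
  case False
  then obtain a where a: "a \<in> K" "u a \<noteq> 0" by auto
  define I where "I = K - {a}"
  have I: "finite I" "a \<notin> I" and KI: "K = insert a I" using K a by (auto simp: I_def)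
  define w where "w = (\<Sum>l\<in>K. (u l)\<^sup>2)"
  have w: "w \<noteq> 0" using a K by (auto simp: w_def sum_nonneg_eq_0_iff)
  \<comment> \<open>the coordinate \<open>x a\<close> is replaced by \<open>s = \<Sum>l\<in>K. u l * x l\<close>\<close>
  define G where "G x s = f (x(a := (s - (\<Sum>l\<in>I. u l * x l)) / u a))" for x s
  have G[measurable]: "case_prod G \<in> borel_measurable ((\<Pi>\<^sub>M k\<in>I. borel) \<Otimes>\<^sub>M borel)"
  proof -
    have "(\<lambda>(x, s). x(a := (s - (\<Sum>l\<in>I. u l * x l)) / u a)) \<in> measurable ((\<Pi>\<^sub>M k\<in>I. borel) \<Otimes>\<^sub>M borel) (\<Pi>\<^sub>M k\<in>K. borel)"
      unfolding KI by measurable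
    from measurable_comp[OF this f] show ?thesis by (simp add: G_def comp_def split_beta')
  qed
  interpret I: sigma_finite_measure "\<Pi>\<^sub>M k\<in>I. (lborel :: real measure)"
    by (rule product_lborel.sigma_finite) fact
  interpret P: pair_sigma_finite "\<Pi>\<^sub>M k\<in>I. (lborel :: real measure)" "lborel :: real measure" ..
  have sub: "(\<integral>\<^sup>+t. h (u a * t + c) \<partial>lborel) = ennreal (1 / \<bar>u a\<bar>) * (\<integral>\<^sup>+s. h s \<partial>lborel)"
    if [measurable]: "h \<in> borel_measurable borel" for h :: "real \<Rightarrow> ennreal" and c
  proof -
    have "ennreal (1 / \<bar>u a\<bar>) * (\<integral>\<^sup>+s. h s \<partial>lborel) = ennreal (1 / \<bar>u a\<bar>) * (ennreal \<bar>u a\<bar> * (\<integral>\<^sup>+t. h (c + u a * t) \<partial>lborel))"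
      by (subst nn_integral_real_affine[OF _ a(2), of _ c]) auto
    also have "\<dots> = (\<integral>\<^sup>+t. h (c + u a * t) \<partial>lborel)"
      using a by (simp add: mult.assoc[symmetric] ennreal_mult'[symmetric])
    finally show ?thesis by (simp add: add.commute)
  qed
  have sumK: "(\<Sum>l\<in>K. u l * (x(a := t)) l) = u a * t + (\<Sum>l\<in>I. u l * x l)" for x t
  proof -
    have "(\<Sum>l\<in>I. u l * (x(a := t)) l) = (\<Sum>l\<in>I. u l * x l)"
      using I by (intro sum.cong) auto
    then show ?thesis using I by (simp add: KI)
  qed
  have fG: "f (x(a := t)) = G x (u a * t + (\<Sum>l\<in>I. u l * x l))" for x t
    using a by (simp add: G_def)
  have fH: "f (reflection K u (x(a := t))) = G (\<lambda>k\<in>I. x k + (- 2 * (u a * t + (\<Sum>l\<in>I. u l * x l)) / w * u k)) (- (u a * t + (\<Sum>l\<in>I. u l * x l)))"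
    if "x \<in> space (\<Pi>\<^sub>M k\<in>I. (lborel :: real measure))" for x t
  proof -
    define s where "s = u a * t + (\<Sum>l\<in>I. u l * x l)"
    define y where "y = (\<lambda>k\<in>I. x k + (- 2 * s / w * u k))"
    have wI: "w = (u a)\<^sup>2 + (\<Sum>l\<in>I. (u l)\<^sup>2)" using I by (simp add: w_def KI)
    have "(\<Sum>l\<in>I. u l * y l) = (\<Sum>l\<in>I. u l * x l - 2 * s / w * (u l)\<^sup>2)"
      by (intro sum.cong) (auto simp: y_def algebra_simps power2_eq_square)
    also have "\<dots> = (s - u a * t) - 2 * s / w * (w - (u a)\<^sup>2)"
      by (simp add: sum_subtractf sum_distrib_left[symmetric] sum_divide_distrib[symmetric] s_def wI)
    finally have "(- s - (\<Sum>l\<in>I. u l * y l)) / u a = t - 2 * s / w * u a"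
      using a w by (simp add: field_simps power2_eq_square)
    moreover have "reflection K u (x(a := t)) = (\<lambda>k\<in>K. (x(a := t)) k - 2 * s / w * u k)"
      unfolding reflection_def sumK s_def w_def ..
    ultimately have "reflection K u (x(a := t)) = y(a := (- s - (\<Sum>l\<in>I. u l * y l)) / u a)"
      using I by (auto simp: y_def fun_eq_iff KI)
    then show ?thesis by (simp add: G_def s_def y_def)
  qed
  have "(\<integral>\<^sup>+x. f (reflection K u x) \<partial>(\<Pi>\<^sub>M k\<in>K. lborel))
     = (\<integral>\<^sup>+x. \<integral>\<^sup>+t. f (reflection K u (x(a := t))) \<partial>lborel \<partial>(\<Pi>\<^sub>M k\<in>I. lborel))"
    unfolding KI using I f
    by (intro product_lborel.product_nn_integral_insert) (auto simp: KI)
  also have "\<dots> = (\<integral>\<^sup>+x. \<integral>\<^sup>+t. G (\<lambda>k\<in>I. x k + (- 2 * (u a * t + (\<Sum>l\<in>I. u l * x l)) / w * u k)) (- (u a * t + (\<Sum>l\<in>I. u l * x l))) \<partial>lborel \<partial>(\<Pi>\<^sub>M k\<in>I. lborel))"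
    by (intro nn_integral_cong) (simp add: fH)
  also have "\<dots> = (\<integral>\<^sup>+x. ennreal (1 / \<bar>u a\<bar>) * (\<integral>\<^sup>+s. G (\<lambda>k\<in>I. x k + (- 2 * s / w * u k)) (- s) \<partial>lborel) \<partial>(\<Pi>\<^sub>M k\<in>I. lborel))"
    by (intro nn_integral_cong sub) measurable
  also have "\<dots> = ennreal (1 / \<bar>u a\<bar>) * (\<integral>\<^sup>+x. (\<integral>\<^sup>+s. G (\<lambda>k\<in>I. x k + (- 2 * s / w * u k)) (- s) \<partial>lborel) \<partial>(\<Pi>\<^sub>M k\<in>I. lborel))"
    by (rule nn_integral_cmult) measurable
  also have "(\<integral>\<^sup>+x. (\<integral>\<^sup>+s. G (\<lambda>k\<in>I. x k + (- 2 * s / w * u k)) (- s) \<partial>lborel) \<partial>(\<Pi>\<^sub>M k\<in>I. lborel))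
    = (\<integral>\<^sup>+s. (\<integral>\<^sup>+x. G (\<lambda>k\<in>I. x k + (- 2 * s / w * u k)) (- s) \<partial>(\<Pi>\<^sub>M k\<in>I. lborel)) \<partial>lborel)"
    by (rule P.Fubini'[symmetric]) measurable
  also have "\<dots> = (\<integral>\<^sup>+s. (\<integral>\<^sup>+x. G x (- s) \<partial>(\<Pi>\<^sub>M k\<in>I. lborel)) \<partial>lborel)"
    by (intro nn_integral_cong nn_integral_PiM_lborel_translate[OF I(1)]) measurable
  also have "\<dots> = (\<integral>\<^sup>+s. (\<integral>\<^sup>+x. G x s \<partial>(\<Pi>\<^sub>M k\<in>I. lborel)) \<partial>lborel)"
  proof -
    have "(\<lambda>p. case_prod G (snd p, fst p)) \<in> borel_measurable (borel \<Otimes>\<^sub>M (\<Pi>\<^sub>M k\<in>I. borel))"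
      by (rule measurable_compose[OF _ G]) measurable
    then have "(\<lambda>(s, x). G x s) \<in> borel_measurable (borel \<Otimes>\<^sub>M (\<Pi>\<^sub>M k\<in>I. lborel))"
      by (simp add: split_beta' cong: measurable_cong_sets sets_pair_measure_cong)
    then have "(\<lambda>s. \<integral>\<^sup>+x. G x s \<partial>(\<Pi>\<^sub>M k\<in>I. lborel)) \<in> borel_measurable borel"
      by (rule I.borel_measurable_nn_integral)
    then show ?thesis
      by (subst nn_integral_real_affine[where c="-1" and t=0 and f="\<lambda>s. \<integral>\<^sup>+x. G x s \<partial>(\<Pi>\<^sub>M k\<in>I. lborel)"]) auto
  qed
  also have "\<dots> = (\<integral>\<^sup>+x. (\<integral>\<^sup>+s. G x s \<partial>lborel) \<partial>(\<Pi>\<^sub>M k\<in>I. lborel))"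
    by (rule P.Fubini') (use G in \<open>simp cong: measurable_cong_sets sets_pair_measure_cong\<close>)
  also have "ennreal (1 / \<bar>u a\<bar>) * \<dots> = (\<integral>\<^sup>+x. ennreal (1 / \<bar>u a\<bar>) * (\<integral>\<^sup>+s. G x s \<partial>lborel) \<partial>(\<Pi>\<^sub>M k\<in>I. lborel))"
    by (rule nn_integral_cmult[symmetric]) measurable
  also have "\<dots> = (\<integral>\<^sup>+x. \<integral>\<^sup>+t. G x (u a * t + (\<Sum>l\<in>I. u l * x l)) \<partial>lborel \<partial>(\<Pi>\<^sub>M k\<in>I. lborel))"
  proof (intro nn_integral_cong sub[symmetric])
    fix x :: "'a \<Rightarrow> real" assume "x \<in> space (\<Pi>\<^sub>M k\<in>I. lborel)"
    then have "x \<in> space (\<Pi>\<^sub>M k\<in>I. borel)" by (simp add: space_PiM)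
    from measurable_Pair2[OF G this] show "G x \<in> borel_measurable borel" by simp
  qed
  also have "\<dots> = (\<integral>\<^sup>+x. \<integral>\<^sup>+t. f (x(a := t)) \<partial>lborel \<partial>(\<Pi>\<^sub>M k\<in>I. lborel))"
    by (simp add: fG)
  also have "\<dots> = (\<integral>\<^sup>+x. f x \<partial>(\<Pi>\<^sub>M k\<in>K. lborel))"
    unfolding KI using I f
    by (intro product_lborel.product_nn_integral_insert[symmetric]) (auto simp: KI)
  finally show ?thesis .
qed

lemma prod_std_normal_density:
  "(\<Prod>k\<in>K. std_normal_density (x k)) = (1 / sqrt (2 * pi)) ^ card K * exp (- (\<Sum>k\<in>K. (x k)\<^sup>2) / 2)"
proof -
  have "(\<Prod>k\<in>K. std_normal_density (x k)) = (\<Prod>k\<in>K. 1 / sqrt (2 * pi)) * (\<Prod>k\<in>K. exp (- (x k)\<^sup>2 / 2))"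
    by (simp only: std_normal_density_def prod.distrib)
  also have "(\<Prod>k\<in>K. exp (- (x k)\<^sup>2 / 2)) = exp (- (\<Sum>k\<in>K. (x k)\<^sup>2) / 2)"
    by (cases "finite K") (simp_all add: exp_sum[symmetric] sum_negf sum_divide_distrib)
  finally show ?thesis by simp
qed

lemma nn_integral_gauss:
  assumes K: "finite K" and [measurable]: "f \<in> borel_measurable (\<Pi>\<^sub>M k\<in>K. (borel :: real measure))"
  shows "(\<integral>\<^sup>+x. f x \<partial>gauss K) = (\<integral>\<^sup>+x. ennreal (\<Prod>k\<in>K. std_normal_density (x k)) * f x \<partial>(\<Pi>\<^sub>M k\<in>K. lborel))"
  by (subst gauss_eq_density[OF K], subst nn_integral_density)
     (auto simp: prod_ennreal)

lemma distr_reflection_gauss: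
  assumes K: "finite K"
  shows "distr (gauss K) (\<Pi>\<^sub>M k\<in>K. borel) (reflection K u) = gauss K"
proof (rule measure_eqI)
  fix A assume "A \<in> sets (distr (gauss K) (\<Pi>\<^sub>M k\<in>K. borel) (reflection K u))"
  then have [measurable]: "A \<in> sets (\<Pi>\<^sub>M k\<in>K. borel)" by simp
  have norm: "(\<Prod>k\<in>K. std_normal_density (reflection K u x k)) = (\<Prod>k\<in>K. std_normal_density (x k))" for x
    using reflection_inner[OF K, of u x x] by (simp add: prod_std_normal_density power2_eq_square)
  have "emeasure (distr (gauss K) (\<Pi>\<^sub>M k\<in>K. borel) (reflection K u)) A
    = (\<integral>\<^sup>+x. indicator A x \<partial>distr (gauss K) (\<Pi>\<^sub>M k\<in>K. borel) (reflection K u))"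
    by simp
  also have "\<dots> = (\<integral>\<^sup>+x. indicator A (reflection K u x) \<partial>gauss K)"
    by (subst nn_integral_distr) auto
  also have "\<dots> = (\<integral>\<^sup>+x. ennreal (\<Prod>k\<in>K. std_normal_density (x k)) * indicator A (reflection K u x) \<partial>(\<Pi>\<^sub>M k\<in>K. lborel))"
    by (subst nn_integral_gauss[OF K]) auto
  also have "\<dots> = (\<integral>\<^sup>+x. ennreal (\<Prod>k\<in>K. std_normal_density (reflection K u x k)) * indicator A (reflection K u x) \<partial>(\<Pi>\<^sub>M k\<in>K. lborel))"
    by (simp only: norm)
  also have "\<dots> = (\<integral>\<^sup>+x. ennreal (\<Prod>k\<in>K. std_normal_density (x k)) * indicator A x \<partial>(\<Pi>\<^sub>M k\<in>K. lborel))"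
    by (rule nn_integral_lborel_reflection[OF K]) measurable
  also have "\<dots> = (\<integral>\<^sup>+x. indicator A x \<partial>gauss K)"
    by (subst nn_integral_gauss[OF K]) auto
  also have "\<dots> = emeasure (gauss K) A" by simp
  finally show "emeasure (distr (gauss K) (\<Pi>\<^sub>M k\<in>K. borel) (reflection K u)) A = emeasure (gauss K) A" .
qed simp

section \<open>Moments of all orders and Stein's identity\<close>

text \<open>The class of integrands used below: it contains the coordinates and is closed under polynomial operations, which settles every integrability side condition at once.\<close>
definition all_moments :: "'a measure \<Rightarrow> ('a \<Rightarrow> real) \<Rightarrow> bool" where
  "all_moments M f \<longleftrightarrow> f \<in> borel_measurable M \<and> (\<forall>q::nat. integrable M (\<lambda>x. \<bar>f x\<bar> ^ q))"

lemma all_moments_measurable: "all_moments M f \<Longrightarrow> f \<in> borel_measurable M"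
  by (simp add: all_moments_def)

lemma all_moments_integrable: "all_moments M f \<Longrightarrow> integrable M f"
proof -
  assume a: "all_moments M f"
  then have "integrable M (\<lambda>x. \<bar>f x\<bar> ^ 1)" unfolding all_moments_def by blast
  then show ?thesis using a by (auto simp: all_moments_def integrable_abs_iff)
qed

context prob_space
begin

lemma all_moments_const [intro, simp]: "all_moments M (\<lambda>_. c)"
  by (simp add: all_moments_def)

lemma all_moments_add [intro]:
  assumes "all_moments M f" "all_moments M g"
  shows "all_moments M (\<lambda>x. f x + g x)"
  unfolding all_moments_def
proof (intro conjI allI)
  have [measurable]: "f \<in> borel_measurable M" "g \<in> borel_measurable M"
    using assms by (auto simp: all_moments_def)
  show "(\<lambda>x. f x + g x) \<in> borel_measurable M" by measurable
  fix q :: nat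
  have "integrable M (\<lambda>x. 2 ^ q * (\<bar>f x\<bar> ^ q + \<bar>g x\<bar> ^ q))"
    using assms by (intro integrable_mult_right integrable_add) (auto simp: all_moments_def)
  then show "integrable M (\<lambda>x. \<bar>f x + g x\<bar> ^ q)"
  proof (rule Bochner_Integration.integrable_bound)
    show "AE x in M. norm (\<bar>f x + g x\<bar> ^ q) \<le> norm (2 ^ q * (\<bar>f x\<bar> ^ q + \<bar>g x\<bar> ^ q))"
    proof (rule AE_I2)
      fix x
      let ?m = "max \<bar>f x\<bar> \<bar>g x\<bar>"
      have "\<bar>f x + g x\<bar> ^ q \<le> (2 * ?m) ^ q" by (intro power_mono) linarith+
      also have "\<dots> = 2 ^ q * ?m ^ q" by (simp add: power_mult_distrib)
      also have "?m ^ q \<le> \<bar>f x\<bar> ^ q + \<bar>g x\<bar> ^ q" by (auto simp: max_def)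
      finally show "norm (\<bar>f x + g x\<bar> ^ q) \<le> norm (2 ^ q * (\<bar>f x\<bar> ^ q + \<bar>g x\<bar> ^ q))"
        by (simp add: power_abs[symmetric])
    qed
  qed measurable
qed

lemma all_moments_mult [intro]:
  assumes "all_moments M f" "all_moments M g"
  shows "all_moments M (\<lambda>x. f x * g x)"
  unfolding all_moments_def
proof (intro conjI allI)
  have [measurable]: "f \<in> borel_measurable M" "g \<in> borel_measurable M"
    using assms by (auto simp: all_moments_def)
  show "(\<lambda>x. f x * g x) \<in> borel_measurable M" by measurable
  fix q :: nat
  have "integrable M (\<lambda>x. \<bar>f x\<bar> ^ (2 * q) + \<bar>g x\<bar> ^ (2 * q))"
    using assms by (intro Bochner_Integration.integrable_add) (auto simp: all_moments_def)
  then show "integrable M (\<lambda>x. \<bar>f x * g x\<bar> ^ q)"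
  proof (rule Bochner_Integration.integrable_bound)
    show "AE x in M. norm (\<bar>f x * g x\<bar> ^ q) \<le> norm (\<bar>f x\<bar> ^ (2 * q) + \<bar>g x\<bar> ^ (2 * q))"
    proof (rule AE_I2)
      fix x
      have "a * b \<le> a\<^sup>2 + b\<^sup>2" if "a \<ge> 0" "b \<ge> 0" for a b :: real
        using sum_squares_bound[of a b] mult_nonneg_nonneg[OF that] by linarith
      from this[of "\<bar>f x\<bar> ^ q" "\<bar>g x\<bar> ^ q"]
      show "norm (\<bar>f x * g x\<bar> ^ q) \<le> norm (\<bar>f x\<bar> ^ (2 * q) + \<bar>g x\<bar> ^ (2 * q))"
        by (simp add: abs_mult power_mult_distrib power_mult[symmetric] mult.commute power_even_abs)
    qed
  qed measurable
qed

lemma all_moments_minus [intro]: "all_moments M f \<Longrightarrow> all_moments M (\<lambda>x. - f x)"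
  using all_moments_mult[OF all_moments_const[of "-1"]] by simp

lemma all_moments_diff [intro]:
  "all_moments M f \<Longrightarrow> all_moments M g \<Longrightarrow> all_moments M (\<lambda>x. f x - g x)"
  using all_moments_add[OF _ all_moments_minus] by simp

lemma all_moments_divide [intro]: "all_moments M f \<Longrightarrow> all_moments M (\<lambda>x. f x / c)"
  using all_moments_mult[OF _ all_moments_const[of "inverse c"]] by (simp add: divide_inverse)

lemma all_moments_power [intro]: "all_moments M f \<Longrightarrow> all_moments M (\<lambda>x. f x ^ k)"
  by (induction k) auto

lemma all_moments_sum [intro]: "(\<And>i. i \<in> I \<Longrightarrow> all_moments M (f i)) \<Longrightarrow> all_moments M (\<lambda>x. \<Sum>i\<in>I. f i x)"
  by (induction I rule: infinite_finite_induct) auto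

end

lemmas gauss_moments =
  prob_space.all_moments_const[OF prob_space_gauss] prob_space.all_moments_add[OF prob_space_gauss]
  prob_space.all_moments_diff[OF prob_space_gauss] prob_space.all_moments_minus[OF prob_space_gauss]
  prob_space.all_moments_mult[OF prob_space_gauss] prob_space.all_moments_divide[OF prob_space_gauss]
  prob_space.all_moments_power[OF prob_space_gauss] prob_space.all_moments_sum[OF prob_space_gauss]

lemma all_moments_coordinate [intro]:
  assumes "k \<in> K"
  shows "all_moments (gauss K) (\<lambda>x. x k)"
  unfolding all_moments_def
proof (intro conjI allI)
  show "(\<lambda>x. x k) \<in> borel_measurable (gauss K)" using assms by measurable
  fix q :: nat
  have "integrable std_normal_distribution (\<lambda>x. \<bar>x\<bar> ^ q)"
    using integrable_std_normal_distribution_moment[of q] integrable_abs[of std_normal_distribution "\<lambda>x. x ^ q"]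
    by (simp add: power_abs)
  then have "integrable (distr (gauss K) std_normal_distribution (\<lambda>x. x k)) (\<lambda>x. \<bar>x\<bar> ^ q)"
    using distr_PiM_component[OF _ assms, of "\<lambda>_. std_normal_distribution"] by (simp add: prob_space_normal_density)
  then show "integrable (gauss K) (\<lambda>x. \<bar>x k\<bar> ^ q)"
    by (rule integrable_distr[rotated]) (use assms in measurable)
qed

text \<open>The weight satisfies \<open>\<phi>' x = - x * \<phi> x\<close>, so the difference of the two sides is the integral of the derivative of \<open>f * \<phi>\<close> over the line.\<close>
lemma stein_identity:
  fixes f f' :: "real \<Rightarrow> complex"
  assumes der: "\<And>x. (f has_vector_derivative f' x) (at x)"
    and int: "integrable std_normal_distribution f"
      "integrable std_normal_distribution (\<lambda>x. of_real x * f x)"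
      "integrable std_normal_distribution f'"
    and cont: "continuous_on UNIV f'"
  shows "(LINT x|std_normal_distribution. of_real x * f x) = (LINT x|std_normal_distribution. f' x)"
proof -
  let ?\<phi> = std_normal_density
  have [measurable]: "f \<in> borel_measurable borel" "f' \<in> borel_measurable borel"
    using int by (auto dest: borel_measurable_integrable)
  define g where "g x = ?\<phi> x *\<^sub>R f' x - ?\<phi> x *\<^sub>R (of_real x * f x)" for x
  have der\<phi>: "(?\<phi> has_real_derivative - x * ?\<phi> x) (at x)" for x
  proof -
    have "((\<lambda>x. (1 / sqrt (2 * pi)) * exp (- x\<^sup>2 / 2)) has_real_derivative (1 / sqrt (2 * pi)) * (exp (- x\<^sup>2 / 2) * (- x))) (at x)"
      by (rule DERIV_cmult) (auto intro!: derivative_eq_intros)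
    then show ?thesis unfolding std_normal_density_def by (simp only: mult_ac)
  qed
  have F: "((\<lambda>x. ?\<phi> x *\<^sub>R f x) has_vector_derivative g x) (at x)" for x
    by (rule has_vector_derivative_eq_rhs, rule has_vector_derivative_scaleR[OF der\<phi> der])
       (simp add: g_def scaleR_conv_of_real algebra_simps)
  have contf: "continuous_on UNIV f"
    using der by (metis continuous_at_imp_continuous_on has_vector_derivative_continuous)
  have contg: "continuous_on UNIV g"
    unfolding g_def std_normal_density_def by (intro continuous_intros contf cont) auto
  have i1: "integrable lborel (\<lambda>x. ?\<phi> x *\<^sub>R f' x)" "integrable lborel (\<lambda>x. ?\<phi> x *\<^sub>R (of_real x * f x))"
      "integrable lborel (\<lambda>x. ?\<phi> x *\<^sub>R f x)"
    using int by (simp_all add: integrable_density normal_density_nonneg)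
  have [measurable]: "g \<in> borel_measurable borel" unfolding g_def[abs_def] by measurable
  have ig: "integrable lborel g"
    unfolding g_def[abs_def] by (rule Bochner_Integration.integrable_diff[OF i1(1,2)])
  \<comment> \<open>\<open>\<phi> f\<close> has limits at both ends since its derivative is integrable; they vanish since \<open>\<phi> f\<close> is integrable too\<close>
  have FTC: "(LBINT x:{-r..r}. g x) = ?\<phi> r *\<^sub>R f r - ?\<phi> (-r) *\<^sub>R f (-r)" if "r \<ge> 0" for r
    unfolding set_lebesgue_integral_def
    using that by (intro integral_FTC_atLeastAtMost) (auto intro: has_vector_derivative_at_within F continuous_on_subset[OF contg])
  define h where "h r = ?\<phi> r *\<^sub>R f r - ?\<phi> (-r) *\<^sub>R f (-r)" for r
  have lim: "((\<lambda>r. LBINT x:{-r..r}. g x) \<longlongrightarrow> (LINT x|lborel. g x)) at_top"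
    unfolding set_lebesgue_integral_def
  proof (rule integral_dominated_convergence_at_top[where w = "\<lambda>x. norm (g x)"])
    show "AE x in lborel. ((\<lambda>r. indicat_real {- r..r} x *\<^sub>R g x) \<longlongrightarrow> g x) at_top"
    proof (rule AE_I2)
      fix x
      have "eventually (\<lambda>r. indicat_real {- r..r} x *\<^sub>R g x = g x) at_top"
        using eventually_ge_at_top[of "\<bar>x\<bar>"] by eventually_elim (simp add: abs_le_iff)
      then show "((\<lambda>r. indicat_real {- r..r} x *\<^sub>R g x) \<longlongrightarrow> g x) at_top"
        by (rule tendsto_eventually)
    qed
    show "integrable lborel (\<lambda>x. norm (g x))" by (rule integrable_norm[OF ig])
    show "eventually (\<lambda>r. AE x in lborel. norm (indicat_real {- r..r} x *\<^sub>R g x) \<le> norm (g x)) at_top"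
      by (intro always_eventually allI AE_I2) (simp split: split_indicator)
  qed (measurable)
  have lim': "(h \<longlongrightarrow> (LINT x|lborel. g x)) at_top"
    by (rule Lim_transform_eventually[OF lim])
       (use eventually_ge_at_top[of 0] in eventually_elim, simp add: FTC h_def)
  have ih: "integrable lborel h"
    unfolding h_def
    using lborel_integrable_real_affine[OF i1(3), of "-1" 0]
    by (intro Bochner_Integration.integrable_diff i1) (simp_all only: add_0_left mult_minus1)
  have "(LINT x|lborel. g x) = 0"
  proof (rule ccontr)
    assume "(LINT x|lborel. g x) \<noteq> 0"
    define d where "d = norm (LINT x|lborel. g x)"
    then have d: "d > 0" using \<open>_ \<noteq> 0\<close> by simp
    have "((\<lambda>r. norm (h r)) \<longlongrightarrow> d) at_top" unfolding d_def by (intro tendsto_norm lim')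
    then have "eventually (\<lambda>r. norm (h r) > d / 2) at_top"
      by (rule order_tendstoD) (use d in simp)
    then obtain R where R: "\<And>r. r \<ge> R \<Longrightarrow> norm (h r) > d / 2"
      by (auto simp: eventually_at_top_linorder)
    define I where "I = (LINT x|lborel. norm (h x))"
    define n where "n = (2 * I + 1) / d + 1"
    have I0: "I \<ge> 0" unfolding I_def by simp
    then have n0: "n > 0" using d by (simp add: n_def add_nonneg_pos)
    have "(d / 2) * n = (LINT x|lborel. indicator {R..R+n} x * (d / 2))"
      using n0 by simp
    also have "\<dots> \<le> I" unfolding I_def
    proof (rule integral_mono)
      show "integrable lborel (\<lambda>x. indicator {R..R+n} x * (d / 2))"
        using n0 by (intro integrable_mult_left integrable_real_indicator) auto
      show "integrable lborel (\<lambda>x. norm (h x))" by (rule integrable_norm[OF ih])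
      show "indicator {R..R+n} x * (d / 2) \<le> norm (h x)" for x
        using R[of x] by (auto split: split_indicator intro: less_imp_le)
    qed
    finally have "(d / 2) * n \<le> I" .
    moreover have "(d / 2) * n = I + 1 / 2 + d / 2"
      using d by (simp add: n_def field_simps)
    ultimately show False using d by linarith
  qed
  moreover have "(LINT x|lborel. g x) = (LINT x|lborel. ?\<phi> x *\<^sub>R f' x) - (LINT x|lborel. ?\<phi> x *\<^sub>R (of_real x * f x))"
    unfolding g_def[abs_def] by (rule Bochner_Integration.integral_diff[OF i1(1,2)])
  ultimately have eq: "(LINT x|lborel. ?\<phi> x *\<^sub>R f' x) = (LINT x|lborel. ?\<phi> x *\<^sub>R (of_real x * f x))"
    by simp
  have D: "(LINT x|std_normal_distribution. k x) = (LINT x|lborel. ?\<phi> x *\<^sub>R k x)"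
    if [measurable]: "k \<in> borel_measurable borel" for k :: "real \<Rightarrow> complex"
    by (rule integral_density) (auto simp: normal_density_nonneg)
  have "(LINT x|std_normal_distribution. of_real x * f x) = (LINT x|lborel. ?\<phi> x *\<^sub>R (of_real x * f x))"
    by (rule D) measurable
  also have "\<dots> = (LINT x|std_normal_distribution. f' x)"
    unfolding eq[symmetric] by (rule D[symmetric]) measurable
  finally show ?thesis .
qed

section \<open>Integration by parts for quadratic forms\<close>

lemma (in prob_space) integrable_all_moments_bound:
  fixes f :: "'a \<Rightarrow> 'b::{banach, second_countable_topology}"
  assumes "all_moments M g" "f \<in> borel_measurable M" "\<And>x. x \<in> space M \<Longrightarrow> norm (f x) \<le> g x"
  shows "integrable M f"
  using all_moments_integrable[OF assms(1)] assms(2)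
  by (rule Bochner_Integration.integrable_bound) (use assms(3) in \<open>fastforce intro: AE_I2\<close>)

text \<open>One coordinate is integrated first, by Fubini, and there it is the one-dimensional identity.\<close>
lemma gauss_integration_by_parts:
  fixes F F' :: "('i \<Rightarrow> real) \<Rightarrow> complex"
  assumes K: "finite K" "a \<in> K"
    and der: "\<And>x t. x \<in> extensional K \<Longrightarrow> ((\<lambda>t. F (x(a := t))) has_vector_derivative F' (x(a := t))) (at t)"
    and cont: "\<And>x. x \<in> extensional K \<Longrightarrow> continuous_on UNIV (\<lambda>t. F' (x(a := t)))"
    and int: "integrable (gauss K) F" "integrable (gauss K) (\<lambda>x. of_real (x a) * F x)" "integrable (gauss K) F'"
  shows "(LINT x|gauss K. of_real (x a) * F x) = (LINT x|gauss K. F' x)"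
proof -
  define I where "I = K - {a}"
  have I: "finite I" "a \<notin> I" and KI: "K = insert a I" using K by (auto simp: I_def)
  interpret \<gamma>: prob_space std_normal_distribution by (simp add: prob_space_normal_density)
  interpret I: prob_space "gauss I" by (rule prob_space_gauss)
  interpret P: pair_prob_space std_normal_distribution "gauss I" ..
  have D: "distr (std_normal_distribution \<Otimes>\<^sub>M gauss I) (gauss K) (\<lambda>(t, x). x(a := t)) = gauss K"
    unfolding KI using distr_pair_PiM_eq_PiM[of I "\<lambda>_. std_normal_distribution" a]
    by (simp add: prob_space_normal_density)
  have m: "(\<lambda>(t, x). x(a := t)) \<in> measurable (std_normal_distribution \<Otimes>\<^sub>M gauss I) (gauss K)"
    unfolding KI by measurable
  have fib: "AE x in gauss I. integrable std_normal_distribution (\<lambda>t. G (x(a := t)))"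
    if G: "integrable (gauss K) G" for G :: "('i \<Rightarrow> real) \<Rightarrow> complex"
  proof -
    have "integrable (std_normal_distribution \<Otimes>\<^sub>M gauss I) (\<lambda>p. G ((\<lambda>(t, x). x(a := t)) p))"
      by (rule integrable_distr[OF m]) (simp add: D G)
    then have "integrable (std_normal_distribution \<Otimes>\<^sub>M gauss I) (\<lambda>(t, x). G (x(a := t)))"
      by (simp add: split_beta')
    then show ?thesis by (rule P.AE_integrable_snd)
  qed
  have split: "(LINT x|gauss K. G x) = (LINT x|gauss I. LINT t|std_normal_distribution. G (x(a := t)))"
    if G: "integrable (gauss K) G" for G :: "('i \<Rightarrow> real) \<Rightarrow> complex"
    unfolding KI using I G by (intro product_gauss.product_integral_insert) (auto simp: KI)
  have "(LINT x|gauss K. of_real (x a) * F x)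
      = (LINT x|gauss I. LINT t|std_normal_distribution. of_real t * F (x(a := t)))"
    by (subst split[OF int(2)]) simp
  also have "\<dots> = (LINT x|gauss I. LINT t|std_normal_distribution. F' (x(a := t)))"
  proof (rule integral_cong_AE)
    have "(\<lambda>x. LINT t|std_normal_distribution. G (x(a := t))) \<in> borel_measurable (gauss I)"
      if G: "integrable (gauss K) G" for G :: "('i \<Rightarrow> real) \<Rightarrow> complex"
    proof -
      have "G \<in> borel_measurable (gauss K)" using G by auto
      from measurable_compose[OF measurable_pair_swap' measurable_compose[OF m this]]
      have "(\<lambda>(x, t). G (x(a := t))) \<in> borel_measurable (gauss I \<Otimes>\<^sub>M std_normal_distribution)"
        by (simp add: split_beta')
      then show ?thesis by (rule sigma_finite_measure.borel_measurable_lebesgue_integral[OF product_gauss.sigma_finite_measures])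
    qed
    from this[OF int(2)] this[OF int(3)]
    show "(\<lambda>x. LINT t|std_normal_distribution. of_real t * F (x(a := t))) \<in> borel_measurable (gauss I)"
      "(\<lambda>x. LINT t|std_normal_distribution. F' (x(a := t))) \<in> borel_measurable (gauss I)"
      by simp_all
    have "AE x in gauss I. x \<in> space (gauss I)" by simp
    with fib[OF int(1)] fib[OF int(2)] fib[OF int(3)]
    show "AE x in gauss I. (LINT t|std_normal_distribution. of_real t * F (x(a := t)))
        = (LINT t|std_normal_distribution. F' (x(a := t)))"
    proof eventually_elim
      case (elim x)
      then have x: "x \<in> extensional K" by (auto simp: space_PiM PiE_def KI extensional_def)
      show ?case
        by (rule stein_identity[OF der[OF x] _ _ _ cont[OF x]]) (use elim in simp_all)
    qed
  qed
  also have "\<dots> = (LINT x|gauss K. F' x)" by (rule split[OF int(3), symmetric])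
  finally show ?thesis .
qed

definition quadratic :: "'i set \<Rightarrow> ('i \<Rightarrow> 'i \<Rightarrow> real) \<Rightarrow> ('i \<Rightarrow> real) \<Rightarrow> real" where
  "quadratic K C x = (\<Sum>a\<in>K. \<Sum>b\<in>K. C a b * x a * x b)"

text \<open>Matrices are functions of two indices here, restricted to an index set: the dimension has to vary with the sequence index, and the index sets are both intervals and products.\<close>
definition tr_on :: "'i set \<Rightarrow> ('i \<Rightarrow> 'i \<Rightarrow> real) \<Rightarrow> real" where
  "tr_on K C = (\<Sum>a\<in>K. C a a)"

definition centered :: "'i set \<Rightarrow> ('i \<Rightarrow> 'i \<Rightarrow> real) \<Rightarrow> ('i \<Rightarrow> real) \<Rightarrow> real" where
  "centered K C x = quadratic K C x - tr_on K C"

definition mvec :: "'i set \<Rightarrow> ('i \<Rightarrow> 'i \<Rightarrow> real) \<Rightarrow> ('i \<Rightarrow> real) \<Rightarrow> 'i \<Rightarrow> real" where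
  "mvec K C x a = (\<Sum>b\<in>K. C a b * x b)"

definition mmult :: "'i set \<Rightarrow> ('i \<Rightarrow> 'i \<Rightarrow> real) \<Rightarrow> ('i \<Rightarrow> 'i \<Rightarrow> real) \<Rightarrow> 'i \<Rightarrow> 'i \<Rightarrow> real" where
  "mmult K C D a b = (\<Sum>c\<in>K. C a c * D c b)"

definition frob2 :: "'i set \<Rightarrow> ('i \<Rightarrow> 'i \<Rightarrow> real) \<Rightarrow> real" where
  "frob2 K C = (\<Sum>a\<in>K. \<Sum>b\<in>K. (C a b)\<^sup>2)"

definition sym_on :: "'i set \<Rightarrow> ('i \<Rightarrow> 'i \<Rightarrow> real) \<Rightarrow> bool" where
  "sym_on K C \<longleftrightarrow> (\<forall>a\<in>K. \<forall>b\<in>K. C a b = C b a)"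

lemma frob2_nonneg [simp]: "frob2 K C \<ge> 0"
  by (simp add: frob2_def sum_nonneg)

lemma quadratic_mvec: "quadratic K C x = (\<Sum>a\<in>K. x a * mvec K C x a)"
  by (simp add: quadratic_def mvec_def sum_distrib_left mult_ac)

lemma sym_on_mmult:
  assumes "sym_on K C" shows "sym_on K (mmult K C C)"
  using assms unfolding sym_on_def mmult_def by (auto intro!: sum.cong simp: mult_ac)

lemma tr_on_mmult:
  assumes "sym_on K C" shows "tr_on K (mmult K C C) = frob2 K C"
  using assms unfolding tr_on_def mmult_def frob2_def sym_on_def
  by (auto intro!: sum.cong simp: power2_eq_square)

lemma sum_mvec_square:
  assumes "finite K" "sym_on K C"
  shows "(\<Sum>a\<in>K. (mvec K C x a)\<^sup>2) = quadratic K (mmult K C C) x"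
proof -
  have "(\<Sum>a\<in>K. (mvec K C x a)\<^sup>2) = (\<Sum>c\<in>K. \<Sum>a\<in>K. \<Sum>b\<in>K. (C c a * x a) * (C c b * x b))"
    by (simp add: mvec_def power2_eq_square sum_product)
  also have "\<dots> = (\<Sum>a\<in>K. \<Sum>c\<in>K. \<Sum>b\<in>K. (C c a * x a) * (C c b * x b))"
    by (rule sum.swap)
  also have "\<dots> = (\<Sum>a\<in>K. \<Sum>b\<in>K. \<Sum>c\<in>K. (C c a * x a) * (C c b * x b))"
    by (intro sum.cong refl sum.swap)
  also have "\<dots> = quadratic K (mmult K C C) x"
    unfolding quadratic_def mmult_def sum_distrib_right
    using assms(2) by (intro sum.cong refl) (auto simp: sym_on_def mult_ac)
  finally show ?thesis .
qed

lemma all_moments_quadratic [intro]: "all_moments (gauss K) (quadratic K C)"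
  unfolding quadratic_def[abs_def] by (intro gauss_moments all_moments_coordinate)

lemma all_moments_centered [intro]: "all_moments (gauss K) (centered K C)"
  unfolding centered_def[abs_def] by (intro gauss_moments all_moments_quadratic)

lemma all_moments_mvec [intro]: "all_moments (gauss K) (\<lambda>x. mvec K C x a)"
  unfolding mvec_def by (intro gauss_moments all_moments_coordinate)

lemma has_derivative_coordinate_update:
  "((\<lambda>t. (x(a := t)) b) has_real_derivative (if b = a then 1 else 0)) (at t)"
  by (auto intro!: derivative_eq_intros)

lemma has_derivative_centered:
  assumes "finite K" "a \<in> K" "sym_on K C"
  shows "((\<lambda>t. centered K C (x(a := t))) has_real_derivative 2 * mvec K C (x(a := t)) a) (at t)"
proof -
  let ?y = "x(a := t)"
  have "((\<lambda>t. centered K C (x(a := t))) has_real_derivative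
     (\<Sum>b\<in>K. \<Sum>c\<in>K. (C b c * (if b = a then 1 else 0)) * ?y c + (if c = a then 1 else 0) * (C b c * ?y b)) - 0) (at t)"
    unfolding centered_def quadratic_def
    by (intro DERIV_diff DERIV_const DERIV_sum DERIV_mult DERIV_cmult has_derivative_coordinate_update)
  moreover have "(\<Sum>b\<in>K. \<Sum>c\<in>K. (C b c * (if b = a then 1 else 0)) * ?y c + (if c = a then 1 else 0) * (C b c * ?y b))
     = (\<Sum>b\<in>K. if b = a then (\<Sum>c\<in>K. C b c * ?y c) else 0) + (\<Sum>b\<in>K. \<Sum>c\<in>K. if c = a then C b c * ?y b else 0)"
    by (simp only: sum.distrib[symmetric], intro sum.cong refl) (auto simp: sum.distrib intro!: sum.cong)
  moreover have "(\<Sum>b\<in>K. if b = a then (\<Sum>c\<in>K. C b c * ?y c) else 0) = mvec K C ?y a"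
    using assms by (simp only: sum.delta if_True mvec_def)
  moreover have "(\<Sum>b\<in>K. \<Sum>c\<in>K. if c = a then C b c * ?y b else 0) = (\<Sum>b\<in>K. C b a * ?y b)"
    using assms by (intro sum.cong refl) (simp only: sum.delta if_True)
  moreover have "(\<Sum>b\<in>K. C b a * ?y b) = mvec K C ?y a"
    unfolding mvec_def using assms by (intro sum.cong) (auto simp: sym_on_def)
  ultimately show ?thesis by simp
qed

lemma has_derivative_mvec:
  assumes "finite K" "a \<in> K"
  shows "((\<lambda>t. mvec K C (x(a := t)) a) has_real_derivative C a a) (at t)"
proof -
  have "((\<lambda>t. mvec K C (x(a := t)) a) has_real_derivative (\<Sum>b\<in>K. C a b * (if b = a then 1 else 0))) (at t)"
    unfolding mvec_def by (intro DERIV_sum DERIV_cmult has_derivative_coordinate_update)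
  moreover have "(\<Sum>b\<in>K. C a b * (if b = a then 1 else 0)) = (\<Sum>b\<in>K. if b = a then C a b else 0)"
    by (intro sum.cong) auto
  ultimately show ?thesis using assms by simp
qed

text \<open>Summing integration by parts over the coordinates of \<open>x * C x\<close>: the derivative of \<open>C x\<close> gives the trace, which cancels the centring, and the derivative of \<open>h\<close> gives twice the squared length of \<open>C x\<close>. With \<open>h = 1\<close>, \<open>h q = q\<close> and \<open>h q = exp (i t q)\<close> this yields the mean, the variance and a differential equation for the characteristic function.\<close>
lemma gauss_quadratic_identity:
  fixes h h' :: "real \<Rightarrow> complex"
  assumes K: "finite K" and C: "sym_on K C"
    and h: "\<And>q. (h has_vector_derivative h' q) (at q)" "continuous_on UNIV h'"
    and bd: "\<And>q. norm (h q) \<le> A + B * \<bar>q\<bar>" "\<And>q. norm (h' q) \<le> B"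
  shows "(LINT x|gauss K. of_real (centered K C x) * h (centered K C x))
    = 2 * (LINT x|gauss K. of_real (quadratic K (mmult K C C) x) * h' (centered K C x))"
proof -
  let ?Q = "centered K C" and ?v = "\<lambda>a x. mvec K C x a"
  have conth: "continuous_on UNIV h"
    using h(1) by (metis continuous_at_imp_continuous_on has_vector_derivative_continuous)
  have [measurable]: "h \<in> borel_measurable borel" "h' \<in> borel_measurable borel"
    by (intro borel_measurable_continuous_onI conth h(2))+
  have [measurable]: "?Q \<in> borel_measurable (gauss K)" "?v a \<in> borel_measurable (gauss K)" for a
    by (rule all_moments_measurable, blast)+
  note am = gauss_moments all_moments_centered all_moments_mvec all_moments_coordinate
  have B0: "B \<ge> 0" using bd(2)[of 0] norm_ge_zero order_trans by blast
  have am_abs: "all_moments (gauss K) (\<lambda>x. 1 + (f x)\<^sup>2)" if "all_moments (gauss K) f" for f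
    by (intro am that)
  have abs_le: "\<bar>r\<bar> \<le> 1 + r\<^sup>2" for r :: real
  proof -
    have "2 * \<bar>r\<bar> \<le> r\<^sup>2 + 1" using sum_squares_bound[of "\<bar>r\<bar>" 1] by simp
    then show ?thesis by linarith
  qed
  have ih: "integrable (gauss K) (\<lambda>x. of_real (f x) * h (?Q x))" if f: "all_moments (gauss K) f" for f
  proof (rule prob_space.integrable_all_moments_bound[OF prob_space_gauss])
    show "all_moments (gauss K) (\<lambda>x. (1 + (f x)\<^sup>2) * (\<bar>A\<bar> + B * (1 + (?Q x)\<^sup>2)))"
      by (intro am f)
    have [measurable]: "f \<in> borel_measurable (gauss K)" using f by (rule all_moments_measurable)
    show "(\<lambda>x. of_real (f x) * h (?Q x)) \<in> borel_measurable (gauss K)" by measurable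
    fix x
    have "norm (h (?Q x)) \<le> \<bar>A\<bar> + B * (1 + (?Q x)\<^sup>2)"
      using bd(1)[of "?Q x"] mult_left_mono[OF abs_le[of "?Q x"] B0] by linarith
    then show "norm (of_real (f x) * h (?Q x)) \<le> (1 + (f x)\<^sup>2) * (\<bar>A\<bar> + B * (1 + (?Q x)\<^sup>2))"
      using abs_le[of "f x"] by (auto simp: norm_mult intro!: mult_mono)
  qed
  have ih': "integrable (gauss K) (\<lambda>x. of_real (f x) * h' (?Q x))" if f: "all_moments (gauss K) f" for f
  proof (rule prob_space.integrable_all_moments_bound[OF prob_space_gauss])
    show "all_moments (gauss K) (\<lambda>x. (1 + (f x)\<^sup>2) * B)"
      by (intro am f)
    have [measurable]: "f \<in> borel_measurable (gauss K)" using f by (rule all_moments_measurable)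
    show "(\<lambda>x. of_real (f x) * h' (?Q x)) \<in> borel_measurable (gauss K)" by measurable
    fix x
    show "norm (of_real (f x) * h' (?Q x)) \<le> (1 + (f x)\<^sup>2) * B"
      using abs_le[of "f x"] bd(2) by (auto simp: norm_mult intro!: mult_mono)
  qed
  have one: "(LINT x|gauss K. of_real (x a) * (of_real (?v a x) * h (?Q x)))
     = (LINT x|gauss K. of_real (C a a) * h (?Q x)) + 2 * (LINT x|gauss K. of_real ((?v a x)\<^sup>2) * h' (?Q x))"
    if a: "a \<in> K" for a
  proof -
    have i1: "integrable (gauss K) (\<lambda>x. of_real (C a a) * h (?Q x))" by (intro ih am)
    have i2: "integrable (gauss K) (\<lambda>x. of_real ((?v a x)\<^sup>2) * h' (?Q x))" by (intro ih' am)
    have "(LINT x|gauss K. of_real (x a) * (of_real (?v a x) * h (?Q x)))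
      = (LINT x|gauss K. of_real (C a a) * h (?Q x) + 2 * (of_real ((?v a x)\<^sup>2) * h' (?Q x)))"
    proof (rule gauss_integration_by_parts[OF K a])
      show "integrable (gauss K) (\<lambda>x. of_real (?v a x) * h (?Q x))" by (intro ih am)
      have "integrable (gauss K) (\<lambda>x. of_real (x a * ?v a x) * h (?Q x))" by (intro ih am a)
      then show "integrable (gauss K) (\<lambda>x. of_real (x a) * (of_real (?v a x) * h (?Q x)))"
        by (simp add: mult.assoc)
      show "integrable (gauss K) (\<lambda>x. of_real (C a a) * h (?Q x) + 2 * (of_real ((?v a x)\<^sup>2) * h' (?Q x)))"
        by (rule Bochner_Integration.integrable_add[OF i1 integrable_mult_right[OF i2]])
      fix x :: "'a \<Rightarrow> real" and t :: real
      have d1: "((\<lambda>t. of_real (?v a (x(a := t)))) has_vector_derivative of_real (C a a)) (at t)" for t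
        using has_derivative_mvec[OF K a, of C x t]
        by (auto intro: has_vector_derivative_of_real simp: has_real_derivative_iff_has_vector_derivative)
      have d2: "((\<lambda>t. h (?Q (x(a := t)))) has_vector_derivative (2 * ?v a (x(a := t))) *\<^sub>R h' (?Q (x(a := t)))) (at t)" for t
        using vector_diff_chain_at[OF has_derivative_centered[OF K a C, of x t, unfolded has_real_derivative_iff_has_vector_derivative] h(1)]
        by (simp add: o_def)
      show "((\<lambda>t. of_real (?v a (x(a := t))) * h (?Q (x(a := t)))) has_vector_derivative
         of_real (C a a) * h (?Q (x(a := t))) + 2 * (of_real ((?v a (x(a := t)))\<^sup>2) * h' (?Q (x(a := t))))) (at t)"
        by (rule has_vector_derivative_eq_rhs, rule has_vector_derivative_mult[OF d1 d2])
           (simp add: scaleR_conv_of_real power2_eq_square algebra_simps)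
      have c1: "continuous_on UNIV (\<lambda>t. ?v a (x(a := t)))" "continuous_on UNIV (\<lambda>t. ?Q (x(a := t)))"
        using has_derivative_mvec[OF K a, of C x] has_derivative_centered[OF K a C, of x]
        by (auto intro!: continuous_at_imp_continuous_on dest: DERIV_isCont)
      show "continuous_on UNIV (\<lambda>t. of_real (C a a) * h (?Q (x(a := t))) + 2 * (of_real ((?v a (x(a := t)))\<^sup>2) * h' (?Q (x(a := t)))))"
        by (intro continuous_intros c1 continuous_on_compose2[OF conth c1(2)] continuous_on_compose2[OF h(2) c1(2)]) auto
    qed
    also have "\<dots> = (LINT x|gauss K. of_real (C a a) * h (?Q x)) + (LINT x|gauss K. 2 * (of_real ((?v a x)\<^sup>2) * h' (?Q x)))"
      by (rule Bochner_Integration.integral_add[OF i1 integrable_mult_right[OF i2]])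
    finally show ?thesis by (simp only: integral_mult_right_zero)
  qed
  have int1: "integrable (gauss K) (\<lambda>x. of_real (x a) * (of_real (?v a x) * h (?Q x)))" if "a \<in> K" for a
  proof -
    have "all_moments (gauss K) (\<lambda>x. x a * ?v a x)" by (intro am that)
    from ih[OF this] show ?thesis by (simp only: of_real_mult mult.assoc)
  qed
  have "(LINT x|gauss K. of_real (quadratic K C x) * h (?Q x))
     = (LINT x|gauss K. (\<Sum>a\<in>K. of_real (x a) * (of_real (?v a x) * h (?Q x))))"
    by (simp only: quadratic_mvec sum_distrib_right mult.assoc of_real_sum of_real_mult)
  also have "\<dots> = (\<Sum>a\<in>K. LINT x|gauss K. of_real (x a) * (of_real (?v a x) * h (?Q x)))"
    by (intro Bochner_Integration.integral_sum int1)
  also have "\<dots> = (\<Sum>a\<in>K. (LINT x|gauss K. of_real (C a a) * h (?Q x)) + 2 * (LINT x|gauss K. of_real ((?v a x)\<^sup>2) * h' (?Q x)))"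
    by (intro sum.cong refl one)
  also have "\<dots> = (\<Sum>a\<in>K. LINT x|gauss K. of_real (C a a) * h (?Q x)) + 2 * (\<Sum>a\<in>K. LINT x|gauss K. of_real ((?v a x)\<^sup>2) * h' (?Q x))"
    by (simp add: sum.distrib sum_distrib_left)
  also have "(\<Sum>a\<in>K. LINT x|gauss K. of_real (C a a) * h (?Q x)) = (LINT x|gauss K. of_real (tr_on K C) * h (?Q x))"
    by (simp only: tr_on_def of_real_sum integral_mult_right_zero sum_distrib_right[symmetric])
  also have "(\<Sum>a\<in>K. LINT x|gauss K. of_real ((?v a x)\<^sup>2) * h' (?Q x))
     = (LINT x|gauss K. (\<Sum>a\<in>K. of_real ((?v a x)\<^sup>2) * h' (?Q x)))"
    by (intro Bochner_Integration.integral_sum[symmetric] ih' am)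
  also have "\<dots> = (LINT x|gauss K. of_real (quadratic K (mmult K C C) x) * h' (?Q x))"
    by (simp only: sum_mvec_square[OF K C, symmetric] sum_distrib_right of_real_sum)
  finally have main: "(LINT x|gauss K. of_real (quadratic K C x) * h (?Q x))
     = (LINT x|gauss K. of_real (tr_on K C) * h (?Q x)) + 2 * (LINT x|gauss K. of_real (quadratic K (mmult K C C) x) * h' (?Q x))" .
  have "(LINT x|gauss K. of_real (?Q x) * h (?Q x))
     = (LINT x|gauss K. of_real (quadratic K C x) * h (?Q x) - of_real (tr_on K C) * h (?Q x))"
    by (simp only: centered_def of_real_diff left_diff_distrib)
  also have "\<dots> = (LINT x|gauss K. of_real (quadratic K C x) * h (?Q x)) - (LINT x|gauss K. of_real (tr_on K C) * h (?Q x))"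
    by (intro Bochner_Integration.integral_diff ih am all_moments_quadratic)
  also have "\<dots> = 2 * (LINT x|gauss K. of_real (quadratic K (mmult K C C) x) * h' (?Q x))"
    unfolding main by (rule add_diff_cancel_left')
  finally show ?thesis .
qed

section \<open>Variance and characteristic function of a centred quadratic form\<close>

lemma expectation_centered:
  assumes "finite K" "sym_on K C"
  shows "(LINT x|gauss K. centered K C x) = 0"
proof -
  have "(LINT x|gauss K. complex_of_real (centered K C x) * 1)
    = 2 * (LINT x|gauss K. of_real (quadratic K (mmult K C C) x) * 0)"
    by (rule gauss_quadratic_identity[OF assms, of "\<lambda>_. 1" "\<lambda>_. 0" 1 0]) auto
  then show ?thesis by simp
qed

lemma expectation_quadratic:
  assumes "finite K" "sym_on K C"
  shows "(LINT x|gauss K. quadratic K C x) = tr_on K C"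
proof -
  have "(LINT x|gauss K. centered K C x + tr_on K C) = 0 + tr_on K C"
    using expectation_centered[OF assms] all_moments_integrable[OF all_moments_centered[of K C]]
      prob_space.prob_space[OF prob_space_gauss, of K]
    by (subst Bochner_Integration.integral_add)
       (auto intro: all_moments_integrable gauss_moments)
  then show ?thesis by (simp add: centered_def)
qed

lemma expectation_centered_square:
  assumes "finite K" "sym_on K C"
  shows "(LINT x|gauss K. (centered K C x)\<^sup>2) = 2 * frob2 K C"
proof -
  have der: "(complex_of_real has_vector_derivative 1) (at q)" for q
    using has_vector_derivative_of_real[OF DERIV_ident, where 'a = complex] by simp
  have "(LINT x|gauss K. complex_of_real (centered K C x) * of_real (centered K C x))
    = 2 * (LINT x|gauss K. of_real (quadratic K (mmult K C C) x) * 1)"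
    by (rule gauss_quadratic_identity[OF assms der, of 0 1]) auto
  also have "\<dots> = of_real (2 * frob2 K C)"
    using expectation_quadratic[OF assms(1) sym_on_mmult[OF assms(2)]] tr_on_mmult[OF assms(2)] by simp
  finally have "complex_of_real (LINT x|gauss K. (centered K C x)\<^sup>2) = of_real (2 * frob2 K C)"
    by (simp only: power2_eq_square of_real_mult[symmetric] integral_complex_of_real)
  then show ?thesis by (simp only: of_real_eq_iff)
qed

lemma (in prob_space) has_vector_derivative_char:
  fixes X :: "'a \<Rightarrow> real"
  assumes X [measurable]: "X \<in> borel_measurable M" and X2: "integrable M (\<lambda>x. (X x)\<^sup>2)"
  shows "((\<lambda>t. LINT x|M. iexp (t * X x)) has_vector_derivative (LINT x|M. \<i> * X x * iexp (t * X x))) (at t)"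
proof -
  have X1: "integrable M X"
    using X2 X by (rule square_integrable_imp_integrable[rotated])
  have ie: "integrable M (\<lambda>x. iexp (s * X x))" for s
    by (rule integrable_const_bound[where B=1]) auto
  have iX: "integrable M (\<lambda>x. \<i> * X x * iexp (t * X x))"
    using X1 by (rule Bochner_Integration.integrable_bound) (auto simp: norm_mult)
  let ?C = "(LINT x|M. (X x)\<^sup>2) / 2"
  have bd: "norm ((LINT x|M. iexp (s * X x)) - (LINT x|M. iexp (t * X x)) - (s - t) *\<^sub>R (LINT x|M. \<i> * X x * iexp (t * X x))) \<le> (s - t)\<^sup>2 * ?C" for s
  proof -
    have "(LINT x|M. iexp (s * X x)) - (LINT x|M. iexp (t * X x)) - (s - t) *\<^sub>R (LINT x|M. \<i> * X x * iexp (t * X x))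
      = (LINT x|M. iexp (s * X x) - iexp (t * X x) - (s - t) *\<^sub>R (\<i> * X x * iexp (t * X x)))"
      using ie iX by (simp add: Bochner_Integration.integral_diff Bochner_Integration.integrable_diff)
    also have "norm \<dots> \<le> (LINT x|M. (s - t)\<^sup>2 / 2 * (X x)\<^sup>2)"
    proof (rule order_trans[OF integral_norm_bound Bochner_Integration.integral_mono[OF integrable_norm]])
      show "integrable M (\<lambda>x. iexp (s * X x) - iexp (t * X x) - (s - t) *\<^sub>R (\<i> * X x * iexp (t * X x)))"
        using ie iX by (intro Bochner_Integration.integrable_diff integrable_scaleR_right)
      show "integrable M (\<lambda>x. (s - t)\<^sup>2 / 2 * (X x)\<^sup>2)" using X2 by simp
      fix x
      let ?y = "(s - t) * X x"
      have "iexp (s * X x) = iexp (t * X x) * iexp ?y"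
        by (simp add: exp_add[symmetric] algebra_simps)
      then have "iexp (s * X x) - iexp (t * X x) - (s - t) *\<^sub>R (\<i> * X x * iexp (t * X x))
        = iexp (t * X x) * (iexp ?y - (\<Sum>k\<le>1. (\<i> * ?y) ^ k / fact k))"
        by (simp add: scaleR_conv_of_real algebra_simps)
      also have "norm \<dots> \<le> \<bar>?y\<bar> ^ Suc 1 / fact (Suc 1)"
        using iexp_approx1[of ?y 1] by (simp add: norm_mult)
      also have "\<dots> = (s - t)\<^sup>2 / 2 * (X x)\<^sup>2"
        by (simp add: power2_eq_square[symmetric] power_mult_distrib)
      finally show "norm (iexp (s * X x) - iexp (t * X x) - (s - t) *\<^sub>R (\<i> * X x * iexp (t * X x))) \<le> (s - t)\<^sup>2 / 2 * (X x)\<^sup>2" .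
    qed
    also have "\<dots> = (s - t)\<^sup>2 * ?C" using X2 by simp
    finally show ?thesis .
  qed
  show ?thesis
    unfolding has_vector_derivative_def has_derivative_at2
  proof (intro conjI bounded_linear_scaleR_left)
    have "((\<lambda>s. \<bar>s - t\<bar> * ?C) \<longlongrightarrow> \<bar>t - t\<bar> * ?C) (at t)" by (intro tendsto_intros)
    then have l: "((\<lambda>s. \<bar>s - t\<bar> * ?C) \<longlongrightarrow> 0) (at t)" by simp
    show "((\<lambda>y. (1 / norm (y - t)) *\<^sub>R ((LINT x|M. iexp (y * X x)) - ((LINT x|M. iexp (t * X x)) + (y - t) *\<^sub>R (LINT x|M. \<i> * X x * iexp (t * X x))))) \<longlongrightarrow> 0) (at t)"
    proof (rule Lim_null_comparison[OF _ l], rule eventually_at_filter[THEN iffD2], rule always_eventually, intro allI impI)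
      fix y assume "y \<noteq> t" "y \<in> UNIV"
      then have "norm ((1 / norm (y - t)) *\<^sub>R ((LINT x|M. iexp (y * X x)) - ((LINT x|M. iexp (t * X x)) + (y - t) *\<^sub>R (LINT x|M. \<i> * X x * iexp (t * X x)))))
        \<le> (1 / \<bar>y - t\<bar>) * ((y - t)\<^sup>2 * ?C)"
        using bd[of y] by (simp only: norm_scaleR diff_diff_eq) (intro mult_mono, auto)
      also have "\<dots> = \<bar>y - t\<bar> * ?C"
      proof -
        have gen: "a \<noteq> 0 \<Longrightarrow> (1 / a) * ((a * a) * b) = a * b" for a b :: real by simp
        have sq: "(y - t)\<^sup>2 = \<bar>y - t\<bar> * \<bar>y - t\<bar>" by (simp add: power2_eq_square)
        show ?thesis unfolding sq by (rule gen) (use \<open>y \<noteq> t\<close> in simp)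
      qed
      finally show "norm ((1 / norm (y - t)) *\<^sub>R ((LINT x|M. iexp (y * X x)) - ((LINT x|M. iexp (t * X x)) + (y - t) *\<^sub>R (LINT x|M. \<i> * X x * iexp (t * X x)))))
        \<le> \<bar>y - t\<bar> * ?C" .
    qed
  qed
qed

lemma (in prob_space) expectation_abs_le_sqrt:
  assumes [measurable]: "X \<in> borel_measurable M" and X2: "integrable M (\<lambda>x. (X x :: real)\<^sup>2)"
  shows "(LINT x|M. \<bar>X x\<bar>) \<le> sqrt (LINT x|M. (X x)\<^sup>2)"
proof (rule real_le_rsqrt)
  have X1: "integrable M X"
    using X2 by (rule square_integrable_imp_integrable[rotated]) simp
  have "0 \<le> variance (\<lambda>x. \<bar>X x\<bar>)" by (rule variance_positive)
  also have "variance (\<lambda>x. \<bar>X x\<bar>) = (LINT x|M. (X x)\<^sup>2) - (LINT x|M. \<bar>X x\<bar>)\<^sup>2"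
    using X1 X2 by (subst variance_eq) auto
  finally show "(LINT x|M. \<bar>X x\<bar>)\<^sup>2 \<le> (LINT x|M. (X x)\<^sup>2)" by simp
qed

text \<open>A normal approximation with an explicit error. The characteristic function \<open>\<psi>\<close> satisfies \<open>\<psi>' t = - 2 t (frob2 C \<psi> t + r t)\<close>, where \<open>r\<close> comes from replacing the quadratic form of \<open>C C\<close> by its mean \<open>frob2 C\<close>; by Cauchy and Schwarz \<open>r\<close> is at most the standard deviation of that form. Integrating the equation against \<open>exp (t\<^sup>2 frob2 C)\<close> gives the bound. It is small when the fourth spectral moment of \<open>C\<close> is small, that is, when no eigenvalue dominates, and needs no central limit theorem.\<close>
theorem char_quadratic_bound:
  assumes K: "finite K" and C: "sym_on K C"
  shows "norm ((LINT x|gauss K. iexp (t * centered K C x)) - exp (- t\<^sup>2 * frob2 K C))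
    \<le> 2 * t\<^sup>2 * sqrt (2 * frob2 K (mmult K C C))"
proof -
  let ?Q = "centered K C" and ?Q2 = "centered K (mmult K C C)"
  define \<kappa> \<epsilon> where "\<kappa> = frob2 K C" and "\<epsilon> = sqrt (2 * frob2 K (mmult K C C))"
  define \<phi> where "\<phi> t = (LINT x|gauss K. iexp (t * ?Q x))" for t
  interpret G: prob_space "gauss K" by (rule prob_space_gauss)
  have \<kappa>0: "\<kappa> \<ge> 0" and \<epsilon>0: "\<epsilon> \<ge> 0" by (simp_all add: \<kappa>_def \<epsilon>_def)
  note C2 = sym_on_mmult[OF C]
  have [measurable]: "?Q \<in> borel_measurable (gauss K)" "?Q2 \<in> borel_measurable (gauss K)"
    by (rule all_moments_measurable, rule all_moments_centered)+
  have der: "(\<phi> has_vector_derivative (- 2 * t) *\<^sub>R (\<kappa> *\<^sub>R \<phi> t + (LINT x|gauss K. ?Q2 x * iexp (t * ?Q x)))) (at t)" for t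
  proof -
    have "(\<phi> has_vector_derivative (LINT x|gauss K. \<i> * ?Q x * iexp (t * ?Q x))) (at t)"
      unfolding \<phi>_def
      by (rule G.has_vector_derivative_char)
         (auto intro: all_moments_integrable gauss_moments all_moments_centered)
    moreover have "(LINT x|gauss K. of_real (?Q x) * iexp (t * ?Q x))
      = 2 * (LINT x|gauss K. of_real (quadratic K (mmult K C C) x) * (\<i> * t * iexp (t * ?Q x)))"
    proof (rule gauss_quadratic_identity[OF K C, of "\<lambda>q. iexp (t * q)" "\<lambda>q. \<i> * t * iexp (t * q)" 1 "\<bar>t\<bar>"])
      show "((\<lambda>q. iexp (t * q)) has_vector_derivative \<i> * t * iexp (t * q)) (at q)" for q
      proof -
        have "((\<lambda>z. exp (\<i> * (of_real t * z))) has_field_derivative exp (\<i> * (of_real t * of_real q)) * (\<i> * of_real t)) (at (of_real q))"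
          by (auto intro!: derivative_eq_intros)
        from has_vector_derivative_real_field[OF this] show ?thesis by (simp add: mult_ac)
      qed
    qed (auto intro!: continuous_intros simp: norm_mult)
    moreover have "(LINT x|gauss K. of_real (quadratic K (mmult K C C) x) * (\<i> * t * iexp (t * ?Q x)))
       = \<i> * t * (LINT x|gauss K. of_real (quadratic K (mmult K C C) x) * iexp (t * ?Q x))"
      by (simp only: integral_mult_right_zero[symmetric] mult_ac)
    moreover have "(LINT x|gauss K. of_real (quadratic K (mmult K C C) x) * iexp (t * ?Q x))
       = \<kappa> *\<^sub>R \<phi> t + (LINT x|gauss K. ?Q2 x * iexp (t * ?Q x))"
    proof -
      have i1: "integrable (gauss K) (\<lambda>x. \<kappa> *\<^sub>R iexp (t * ?Q x))"
        by (intro integrable_scaleR_right G.integrable_const_bound[where B=1]) auto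
      have i2: "integrable (gauss K) (\<lambda>x. of_real (?Q2 x) * iexp (t * ?Q x))"
        using all_moments_integrable[OF all_moments_centered[of K "mmult K C C"]]
        by (rule Bochner_Integration.integrable_bound) (auto simp: norm_mult)
      have "of_real (quadratic K (mmult K C C) x) * iexp (t * ?Q x)
        = \<kappa> *\<^sub>R iexp (t * ?Q x) + of_real (?Q2 x) * iexp (t * ?Q x)" for x
        by (simp add: centered_def[of K "mmult K C C"] tr_on_mmult[OF C] \<kappa>_def scaleR_conv_of_real algebra_simps)
      then have "(LINT x|gauss K. of_real (quadratic K (mmult K C C) x) * iexp (t * ?Q x))
        = (LINT x|gauss K. \<kappa> *\<^sub>R iexp (t * ?Q x) + of_real (?Q2 x) * iexp (t * ?Q x))"
        by simp
      also have "\<dots> = (LINT x|gauss K. \<kappa> *\<^sub>R iexp (t * ?Q x)) + (LINT x|gauss K. of_real (?Q2 x) * iexp (t * ?Q x))"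
        by (rule Bochner_Integration.integral_add[OF i1 i2])
      finally show ?thesis by (simp only: \<phi>_def integral_scaleR_right)
    qed
    moreover have "(LINT x|gauss K. \<i> * ?Q x * iexp (t * ?Q x)) = \<i> * (LINT x|gauss K. of_real (?Q x) * iexp (t * ?Q x))"
      by (simp only: integral_mult_right_zero[symmetric] mult.assoc)
    ultimately show ?thesis
      by (simp only:) (simp add: scaleR_conv_of_real algebra_simps)
  qed
  have rem: "norm (LINT x|gauss K. ?Q2 x * iexp (t * ?Q x)) \<le> \<epsilon>" for t
  proof -
    have "norm (LINT x|gauss K. ?Q2 x * iexp (t * ?Q x)) \<le> (LINT x|gauss K. norm (?Q2 x * iexp (t * ?Q x)))"
      by (rule integral_norm_bound)
    also have "\<dots> = (LINT x|gauss K. \<bar>?Q2 x\<bar>)" by (simp add: norm_mult)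
    also have "\<dots> \<le> sqrt (LINT x|gauss K. (?Q2 x)\<^sup>2)"
      by (rule G.expectation_abs_le_sqrt) (auto intro: all_moments_integrable gauss_moments all_moments_centered)
    also have "\<dots> = \<epsilon>" by (simp only: expectation_centered_square[OF K C2] \<epsilon>_def)
    finally show ?thesis .
  qed
  define \<psi> where "\<psi> t = exp (\<kappa> * t\<^sup>2) *\<^sub>R \<phi> t" for t
  have der\<psi>: "(\<psi> has_vector_derivative (exp (\<kappa> * t\<^sup>2) * (- 2 * t)) *\<^sub>R (LINT x|gauss K. ?Q2 x * iexp (t * ?Q x))) (at t)" for t
  proof -
    have "((\<lambda>t. exp (\<kappa> * t\<^sup>2)) has_real_derivative exp (\<kappa> * t\<^sup>2) * (\<kappa> * (2 * t))) (at t)"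
      by (auto intro!: derivative_eq_intros)
    from has_vector_derivative_scaleR[OF this der[of t]] show ?thesis
      unfolding \<psi>_def by (rule has_vector_derivative_eq_rhs) (simp add: scaleR_conv_of_real algebra_simps)
  qed
  define \<psi>' where "\<psi>' s = (exp (\<kappa> * s\<^sup>2) * (- 2 * s)) *\<^sub>R (LINT x|gauss K. ?Q2 x * iexp (s * ?Q x))" for s
  have "norm (\<psi> t - \<psi> 0 - (t - 0) *\<^sub>R \<psi>' 0) \<le> norm (t - 0) * (exp (\<kappa> * t\<^sup>2) * (2 * \<bar>t\<bar>) * \<epsilon>)"
  proof (rule vector_differentiable_bound_linearization[where S = "closed_segment 0 t"])
    show "(\<psi> has_vector_derivative \<psi>' s) (at s within closed_segment 0 t)" for s
      using der\<psi>[of s] unfolding \<psi>'_def by (rule has_vector_derivative_at_within)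
    fix s assume "s \<in> closed_segment 0 t"
    then have s: "\<bar>s\<bar> \<le> \<bar>t\<bar>" by (auto simp: closed_segment_eq_real_ivl split: if_splits)
    then have "s\<^sup>2 \<le> t\<^sup>2" by (rule abs_le_square_iff[THEN iffD1])
    then have "exp (\<kappa> * s\<^sup>2) \<le> exp (\<kappa> * t\<^sup>2)" using \<kappa>0 by (simp add: mult_left_mono)
    then have "exp (\<kappa> * s\<^sup>2) * (2 * \<bar>s\<bar>) * norm (LINT x|gauss K. ?Q2 x * iexp (s * ?Q x)) \<le> exp (\<kappa> * t\<^sup>2) * (2 * \<bar>t\<bar>) * \<epsilon>"
      using s rem[of s] \<epsilon>0 by (intro mult_mono) auto
    then show "norm (\<psi>' s - \<psi>' 0) \<le> exp (\<kappa> * t\<^sup>2) * (2 * \<bar>t\<bar>) * \<epsilon>"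
      by (simp add: \<psi>'_def abs_mult)
  qed auto
  moreover have "\<psi>' 0 = 0" by (simp add: \<psi>'_def)
  moreover have "\<psi> 0 = 1" by (simp add: \<psi>_def \<phi>_def G.prob_space)
  ultimately have b: "norm (\<psi> t - 1) \<le> exp (\<kappa> * t\<^sup>2) * (2 * t\<^sup>2 * \<epsilon>)"
    by (simp add: power2_eq_square algebra_simps abs_mult_self_eq)
  have ee: "exp (- t\<^sup>2 * \<kappa>) * exp (\<kappa> * t\<^sup>2) = 1" by (simp add: exp_add[symmetric] mult.commute)
  then have "exp (- t\<^sup>2 * \<kappa>) *\<^sub>R \<psi> t = \<phi> t" by (simp only: \<psi>_def scaleR_scaleR scaleR_one)
  then have "\<phi> t - exp (- t\<^sup>2 * \<kappa>) = exp (- t\<^sup>2 * \<kappa>) *\<^sub>R (\<psi> t - 1)"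
    by (simp only: scaleR_diff_right of_real_def)
  also have "norm \<dots> \<le> exp (- t\<^sup>2 * \<kappa>) * (exp (\<kappa> * t\<^sup>2) * (2 * t\<^sup>2 * \<epsilon>))"
    using b by (simp add: mult_left_mono)
  also have "\<dots> = 2 * t\<^sup>2 * \<epsilon>" by (simp only: mult.assoc[symmetric] ee mult_1)
  finally show ?thesis by (simp only: \<phi>_def \<kappa>_def \<epsilon>_def)
qed

section \<open>Convergence in probability and Slutsky's theorem\<close>

text \<open>The property is only required on some measurable event of probability tending to one, so that it need not be measurable itself.\<close>
definition whp :: "(nat \<Rightarrow> 'a measure) \<Rightarrow> (nat \<Rightarrow> 'a \<Rightarrow> bool) \<Rightarrow> bool" where
  "whp M P \<longleftrightarrow> (\<exists>E. (\<forall>k. E k \<in> sets (M k)) \<and> (\<lambda>k. measure (M k) (E k)) \<longlonglongrightarrow> 1 \<and> (\<forall>k. \<forall>\<omega>\<in>E k. P k \<omega>))"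

lemma whp_mono_eventually:
  assumes P: "whp M P" and ev: "eventually (\<lambda>k. \<forall>\<omega>\<in>space (M k). P k \<omega> \<longrightarrow> Q k \<omega>) sequentially"
  shows "whp M Q"
proof -
  from P obtain E where E: "\<And>k. E k \<in> sets (M k)" "(\<lambda>k. measure (M k) (E k)) \<longlonglongrightarrow> 1" "\<And>k \<omega>. \<omega> \<in> E k \<Longrightarrow> P k \<omega>"
    unfolding whp_def by blast
  define E' where "E' k = (if \<forall>\<omega>\<in>space (M k). P k \<omega> \<longrightarrow> Q k \<omega> then E k else {})" for k
  have "eventually (\<lambda>k. measure (M k) (E k) = measure (M k) (E' k)) sequentially"
    using ev by eventually_elim (simp add: E'_def)
  then have "(\<lambda>k. measure (M k) (E' k)) \<longlonglongrightarrow> 1"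
    using E(2) by (rule Lim_transform_eventually[rotated])
  moreover have "E' k \<in> sets (M k)" for k
    using E(1) by (simp add: E'_def)
  moreover have "\<forall>\<omega>\<in>E' k. Q k \<omega>" for k
  proof
    fix \<omega> assume "\<omega> \<in> E' k"
    then have "\<omega> \<in> E k" "\<forall>\<omega>\<in>space (M k). P k \<omega> \<longrightarrow> Q k \<omega>" by (auto simp: E'_def split: if_splits)
    then show "Q k \<omega>" using E(3) sets.sets_into_space[OF E(1)] by blast
  qed
  ultimately show ?thesis unfolding whp_def by blast
qed

lemma whp_mono: "whp M P \<Longrightarrow> (\<And>k \<omega>. \<omega> \<in> space (M k) \<Longrightarrow> P k \<omega> \<Longrightarrow> Q k \<omega>) \<Longrightarrow> whp M Q"
  by (erule whp_mono_eventually) simp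

lemma whp_conj:
  assumes M: "\<And>k. prob_space (M k)" and "whp M P" "whp M Q"
  shows "whp M (\<lambda>k \<omega>. P k \<omega> \<and> Q k \<omega>)"
proof -
  from assms(2) obtain E where E: "\<And>k. E k \<in> sets (M k)" "(\<lambda>k. measure (M k) (E k)) \<longlonglongrightarrow> 1" "\<And>k \<omega>. \<omega> \<in> E k \<Longrightarrow> P k \<omega>"
    unfolding whp_def by blast
  from assms(3) obtain F where F: "\<And>k. F k \<in> sets (M k)" "(\<lambda>k. measure (M k) (F k)) \<longlonglongrightarrow> 1" "\<And>k \<omega>. \<omega> \<in> F k \<Longrightarrow> Q k \<omega>"
    unfolding whp_def by blast
  have "(\<lambda>k. measure (M k) (E k \<inter> F k)) \<longlonglongrightarrow> 1"
  proof (rule tendsto_sandwich[OF always_eventually always_eventually])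
    show "(\<lambda>k. measure (M k) (E k) + measure (M k) (F k) - 1) \<longlonglongrightarrow> 1"
      using tendsto_diff[OF tendsto_add[OF E(2) F(2)] tendsto_const[of 1]] by simp
    show "(\<lambda>k. 1) \<longlonglongrightarrow> (1::real)" by simp
    show "\<forall>k. measure (M k) (E k \<inter> F k) \<le> 1" using prob_space.prob_le_1[OF M] by simp
    show "\<forall>k. measure (M k) (E k) + measure (M k) (F k) - 1 \<le> measure (M k) (E k \<inter> F k)"
    proof
      fix k
      interpret prob_space "M k" by (rule M)
      have "prob (E k \<union> F k) = prob (E k) + prob (F k) - prob (E k \<inter> F k)"
        by (rule measure_Un3) (simp_all add: fmeasurable_eq_sets E(1) F(1))
      with prob_le_1[of "E k \<union> F k"] show "prob (E k) + prob (F k) - 1 \<le> prob (E k \<inter> F k)" by linarith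
    qed
  qed
  then show ?thesis unfolding whp_def using E F
    by (intro exI[of _ "\<lambda>k. E k \<inter> F k"]) (simp add: sets.Int)
qed

lemma whp_AE:
  assumes M: "\<And>k. prob_space (M k)" and "\<And>k. AE \<omega> in M k. P k \<omega>"
  shows "whp M P"
proof -
  have "\<exists>E. E \<in> sets (M k) \<and> measure (M k) E = 1 \<and> (\<forall>\<omega>\<in>E. P k \<omega>)" for k
  proof -
    interpret prob_space "M k" by (rule M)
    from AE_E[OF assms(2)[of k]] obtain N where N: "{\<omega> \<in> space (M k). \<not> P k \<omega>} \<subseteq> N" "emeasure (M k) N = 0" "N \<in> sets (M k)"
      by blast
    have "prob (space (M k) - N) = 1"
      using N by (subst prob_compl) (auto simp: measure_def)
    then show ?thesis using N by (intro exI[of _ "space (M k) - N"]) auto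
  qed
  then obtain E where "\<And>k. E k \<in> sets (M k)" "\<And>k. measure (M k) (E k) = 1" "\<And>k. \<forall>\<omega>\<in>E k. P k \<omega>"
    by metis
  then show ?thesis unfolding whp_def by (intro exI[of _ E]) simp
qed

text \<open>Convergence in probability to a constant, for functions on a sequence of different probability spaces.\<close>
definition cip :: "(nat \<Rightarrow> 'a measure) \<Rightarrow> (nat \<Rightarrow> 'a \<Rightarrow> real) \<Rightarrow> real \<Rightarrow> bool" where
  "cip M A a \<longleftrightarrow> (\<forall>\<epsilon>>0. whp M (\<lambda>k \<omega>. \<bar>A k \<omega> - a\<bar> < \<epsilon>))"

lemma cipD: "cip M A a \<Longrightarrow> \<epsilon> > 0 \<Longrightarrow> whp M (\<lambda>k \<omega>. \<bar>A k \<omega> - a\<bar> < \<epsilon>)"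
  by (simp add: cip_def)

text \<open>Continuity at the limit point is enough, which makes quotients and roots available although they are discontinuous elsewhere.\<close>
lemma cip_isCont:
  assumes "cip M A a" "isCont f a"
  shows "cip M (\<lambda>k \<omega>. f (A k \<omega>)) (f a)"
  unfolding cip_def
proof (intro allI impI)
  fix \<epsilon> :: real assume "\<epsilon> > 0"
  then obtain \<delta> where "\<delta> > 0" "\<And>y. \<bar>y - a\<bar> < \<delta> \<Longrightarrow> \<bar>f y - f a\<bar> < \<epsilon>"
    using assms(2) unfolding continuous_at_eps_delta dist_real_def by blast
  then show "whp M (\<lambda>k \<omega>. \<bar>f (A k \<omega>) - f a\<bar> < \<epsilon>)"
    by (auto intro: whp_mono[OF cipD[OF assms(1)]])
qed

text \<open>Identities among random quantities that fail on a null set, or where a denominator vanishes, may be used as if they held everywhere.\<close>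
lemma cip_whp_cong:
  assumes M: "\<And>k. prob_space (M k)" and "cip M A a" "whp M (\<lambda>k \<omega>. A k \<omega> = B k \<omega>)"
  shows "cip M B a"
  unfolding cip_def
proof (intro allI impI)
  fix \<epsilon> :: real assume "\<epsilon> > 0"
  from whp_conj[OF M cipD[OF assms(2) this] assms(3)]
  show "whp M (\<lambda>k \<omega>. \<bar>B k \<omega> - a\<bar> < \<epsilon>)" by (rule whp_mono) metis
qed

locale prob_space_sequence =
  fixes M :: "nat \<Rightarrow> 'a measure"
  assumes prob_space_M: "prob_space (M k)"
begin

lemma cip_tendsto:
  assumes "r \<longlonglongrightarrow> a" shows "cip M (\<lambda>k _. r k) a"
  unfolding cip_def
proof (intro allI impI)
  fix \<epsilon> :: real assume "\<epsilon> > 0"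
  have "whp M (\<lambda>_ _. True)" by (intro whp_AE prob_space_M) simp
  then show "whp M (\<lambda>k \<omega>. \<bar>r k - a\<bar> < \<epsilon>)"
    by (rule whp_mono_eventually) (use tendstoD[OF assms \<open>\<epsilon> > 0\<close>] in \<open>simp add: dist_real_def eventually_mono\<close>)
qed

lemma cip_add:
  assumes "cip M A a" "cip M B b" shows "cip M (\<lambda>k \<omega>. A k \<omega> + B k \<omega>) (a + b)"
  unfolding cip_def
proof (intro allI impI)
  fix \<epsilon> :: real assume "\<epsilon> > 0"
  then have "\<epsilon> / 2 > 0" by simp
  from whp_conj[OF prob_space_M cipD[OF assms(1) this] cipD[OF assms(2) this]]
  show "whp M (\<lambda>k \<omega>. \<bar>A k \<omega> + B k \<omega> - (a + b)\<bar> < \<epsilon>)"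
    by (rule whp_mono) linarith
qed

lemma cip_minus: "cip M A a \<Longrightarrow> cip M (\<lambda>k \<omega>. - A k \<omega>) (- a)"
  by (rule cip_isCont) auto

lemma cip_diff: "cip M A a \<Longrightarrow> cip M B b \<Longrightarrow> cip M (\<lambda>k \<omega>. A k \<omega> - B k \<omega>) (a - b)"
  using cip_add[OF _ cip_minus, of A a B b] by simp

lemma cip_mult:
  assumes "cip M A a" "cip M B b" shows "cip M (\<lambda>k \<omega>. A k \<omega> * B k \<omega>) (a * b)"
proof -
  have sq: "cip M (\<lambda>k \<omega>. (C k \<omega>)\<^sup>2) (c\<^sup>2)" if "cip M C c" for C c
    using that by (rule cip_isCont) (intro continuous_intros)
  have q: "cip M (\<lambda>k \<omega>. C k \<omega> / 4) (c / 4)" if "cip M C c" for C c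
    using that by (rule cip_isCont) (intro continuous_intros, simp)
  have "x * y = ((x + y)\<^sup>2 - (x - y)\<^sup>2) / 4" for x y :: real
    by (simp add: power2_eq_square algebra_simps)
  then show ?thesis
    by (simp only:) (intro q cip_diff sq cip_add assms)
qed

lemma cip_inverse: "cip M A a \<Longrightarrow> a \<noteq> 0 \<Longrightarrow> cip M (\<lambda>k \<omega>. inverse (A k \<omega>)) (inverse a)"
  by (rule cip_isCont) (auto intro!: continuous_intros)

lemma cip_divide: "cip M A a \<Longrightarrow> cip M B b \<Longrightarrow> b \<noteq> 0 \<Longrightarrow> cip M (\<lambda>k \<omega>. A k \<omega> / B k \<omega>) (a / b)"
  unfolding divide_inverse by (intro cip_mult cip_inverse)

lemma cip_power: "cip M A a \<Longrightarrow> cip M (\<lambda>k \<omega>. A k \<omega> ^ q) (a ^ q)"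
  by (rule cip_isCont) (auto intro!: continuous_intros)

lemma cip_sqrt: "cip M A a \<Longrightarrow> cip M (\<lambda>k \<omega>. sqrt (A k \<omega>)) (sqrt a)"
  by (rule cip_isCont) (auto intro!: isCont_real_sqrt)

lemma cip_zero_L1:
  assumes int: "\<And>k. integrable (M k) (A k)" and lim: "(\<lambda>k. LINT \<omega>|M k. \<bar>A k \<omega>\<bar>) \<longlonglongrightarrow> 0"
  shows "cip M A 0"
  unfolding cip_def
proof (intro allI impI)
  fix \<epsilon> :: real assume \<epsilon>: "\<epsilon> > 0"
  define E where "E k = {\<omega> \<in> space (M k). \<bar>A k \<omega>\<bar> < \<epsilon>}" for k
  have [measurable]: "A k \<in> borel_measurable (M k)" for k using int by auto
  have Ek: "E k \<in> sets (M k)" for k unfolding E_def by measurable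
  have "(\<lambda>k. measure (M k) (E k)) \<longlonglongrightarrow> 1"
  proof (rule tendsto_sandwich[OF always_eventually always_eventually])
    show "(\<lambda>k. 1 - (LINT \<omega>|M k. \<bar>A k \<omega>\<bar>) / \<epsilon>) \<longlonglongrightarrow> 1"
      using tendsto_diff[OF tendsto_const[of 1] tendsto_divide[OF lim tendsto_const[of \<epsilon>]]] \<epsilon> by simp
    show "(\<lambda>k. 1) \<longlonglongrightarrow> (1::real)" by simp
    show "\<forall>k. measure (M k) (E k) \<le> 1" using prob_space.prob_le_1[OF prob_space_M] by simp
    show "\<forall>k. 1 - (LINT \<omega>|M k. \<bar>A k \<omega>\<bar>) / \<epsilon> \<le> measure (M k) (E k)"
    proof
      fix k
      interpret prob_space "M k" by (rule prob_space_M)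
      have "prob {\<omega> \<in> space (M k). \<epsilon> \<le> \<bar>A k \<omega>\<bar>} \<le> (LINT \<omega>|M k. \<bar>A k \<omega>\<bar>) / \<epsilon>"
        using int \<epsilon> by (intro integral_Markov_inequality_measure[where A = "{}"]) auto
      moreover have "space (M k) - E k = {\<omega> \<in> space (M k). \<epsilon> \<le> \<bar>A k \<omega>\<bar>}" by (auto simp: E_def)
      ultimately show "1 - (LINT \<omega>|M k. \<bar>A k \<omega>\<bar>) / \<epsilon> \<le> prob (E k)"
        using prob_compl[OF Ek] by simp
    qed
  qed
  then show "whp M (\<lambda>k \<omega>. \<bar>A k \<omega> - 0\<bar> < \<epsilon>)"
    unfolding whp_def using Ek by (intro exI[of _ E]) (auto simp: E_def)
qed

lemma cip_zero_L2:
  assumes [measurable]: "\<And>k. A k \<in> borel_measurable (M k)"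
    and int: "\<And>k. integrable (M k) (\<lambda>\<omega>. (A k \<omega>)\<^sup>2)"
    and le: "\<And>k. (LINT \<omega>|M k. (A k \<omega>)\<^sup>2) \<le> r k" and lim: "r \<longlonglongrightarrow> 0"
  shows "cip M A 0"
proof -
  have "(\<lambda>k. LINT \<omega>|M k. \<bar>(A k \<omega>)\<^sup>2\<bar>) \<longlonglongrightarrow> 0"
    by (rule tendsto_sandwich[OF always_eventually always_eventually tendsto_const lim]) (use le in auto)
  from cip_zero_L1[OF int this] have "cip M (\<lambda>k \<omega>. sqrt ((A k \<omega>)\<^sup>2)) (sqrt 0)" by (rule cip_sqrt)
  then show ?thesis by (simp add: cip_def)
qed

text \<open>The laws of \<open>R k\<close> converge weakly by Levy's theorem. The event \<open>A k \<ge> z\<close> is squeezed between events on \<open>R k\<close> with thresholds \<open>z - b\<close> shifted by \<open>\<epsilon>\<close>, up to probability \<open>o(1)\<close>, and the normal distribution function is continuous. Only the rejection events of \<open>A\<close> are required to be measurable.\<close>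
lemma slutsky_std_normal:
  assumes R [measurable]: "\<And>k. R k \<in> borel_measurable (M k)"
    and char: "\<And>t. (\<lambda>k. LINT \<omega>|M k. iexp (t * R k \<omega>)) \<longlonglongrightarrow> exp (- t\<^sup>2 / 2)"
    and A: "\<And>k. {\<omega> \<in> space (M k). A k \<omega> \<ge> z} \<in> sets (M k)"
    and diff: "cip M (\<lambda>k \<omega>. A k \<omega> - R k \<omega>) b"
  shows "(\<lambda>k. measure (M k) {\<omega> \<in> space (M k). A k \<omega> \<ge> z}) \<longlonglongrightarrow> cdf std_normal_distribution (b - z)"
proof -
  let ?\<Phi> = "cdf std_normal_distribution"
  interpret N: real_distribution std_normal_distribution by (rule real_dist_normal_dist)
  define D where "D k = distr (M k) borel (R k)" for k
  have D: "real_distribution (D k)" for k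
    unfolding D_def by (rule prob_space.real_distribution_distr[OF prob_space_M]) simp
  have "weak_conv_m D std_normal_distribution"
  proof (rule levy_continuity[OF D real_dist_normal_dist])
    fix t
    have "char (D k) t = (LINT \<omega>|M k. iexp (t * R k \<omega>))" for k
      unfolding D_def char_def by (subst integral_distr) auto
    then show "(\<lambda>k. char (D k) t) \<longlonglongrightarrow> char std_normal_distribution t"
      using char[of t] by (simp add: char_std_normal_distribution)
  qed
  moreover have contN: "isCont ?\<Phi> x" for x
  proof -
    have "emeasure std_normal_distribution {x} = 0"
      by (subst emeasure_density) (auto simp: nn_integral_indicator_singleton)
    then show ?thesis by (simp add: N.isCont_cdf measure_def)
  qed
  ultimately have cdf_lim: "(\<lambda>k. cdf (D k) x) \<longlonglongrightarrow> ?\<Phi> x" for x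
    unfolding weak_conv_m_def weak_conv_def by blast
  have symm: "?\<Phi> x = 1 - ?\<Phi> (- x)" for x
  proof -
    have d: "distr std_normal_distribution borel uminus = std_normal_distribution"
    proof (rule Levy_uniqueness)
      show "real_distribution (distr std_normal_distribution borel uminus)"
        by (rule N.real_distribution_distr) simp
      show "real_distribution std_normal_distribution" by (rule real_dist_normal_dist)
      have "char (distr std_normal_distribution borel uminus) t = char std_normal_distribution (- t)" for t
        unfolding char_def by (subst integral_distr) auto
      then show "char (distr std_normal_distribution borel uminus) = char std_normal_distribution"
        by (simp add: fun_eq_iff char_std_normal_distribution)
    qed
    have "?\<Phi> (-x) = measure (distr std_normal_distribution borel uminus) {..-x}" by (simp add: cdf_def d)
    also have "\<dots> = measure std_normal_distribution {x..}"
      by (subst measure_distr) (auto intro!: arg_cong[where f="measure _"])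
    also have "\<dots> = 1 - measure std_normal_distribution {..<x}"
      using N.prob_compl[of "{..<x}"] by (simp add: Compl_eq_Diff_UNIV[symmetric])
    also have "measure std_normal_distribution {..<x} = ?\<Phi> x"
    proof -
      have "((\<lambda>y. ?\<Phi> y) \<longlongrightarrow> measure std_normal_distribution {..<x}) (at_left x)" by (rule N.cdf_at_left)
      moreover have "((\<lambda>y. ?\<Phi> y) \<longlongrightarrow> ?\<Phi> x) (at_left x)"
        using contN[of x] by (simp add: isCont_def filterlim_at_split)
      ultimately show ?thesis using tendsto_unique trivial_limit_at_left_real by blast
    qed
    finally show ?thesis by simp
  qed
  have contN': "isCont (\<lambda>e. 1 - ?\<Phi> (z - b + e)) 0" "isCont (\<lambda>e. 1 - ?\<Phi> (z - b - e)) 0"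
    by (intro continuous_diff continuous_const isCont_o2[OF _ contN] continuous_add continuous_ident)+
  show ?thesis
  proof (rule LIMSEQ_I)
    fix \<eta> :: real assume \<eta>: "\<eta> > 0"
    let ?L = "?\<Phi> (b - z)"
    have L: "?L = 1 - ?\<Phi> (z - b)" using symm[of "b - z"] by simp
    have "eventually (\<lambda>e. 1 - ?\<Phi> (z - b + e) > ?L - \<eta> / 2 \<and> 1 - ?\<Phi> (z - b - e) < ?L + \<eta> / 2) (at_right 0)"
    proof -
      have "eventually (\<lambda>e. 1 - ?\<Phi> (z - b + e) > ?L - \<eta> / 2) (at 0)"
        using contN'(1) \<eta> L by (intro order_tendstoD(1)[of _ "?L"]) (auto simp: isCont_def)
      moreover have "eventually (\<lambda>e. 1 - ?\<Phi> (z - b - e) < ?L + \<eta> / 2) (at 0)"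
        using contN'(2) \<eta> L by (intro order_tendstoD(2)[of _ "?L"]) (auto simp: isCont_def)
      ultimately have "eventually (\<lambda>e. 1 - ?\<Phi> (z - b + e) > ?L - \<eta> / 2 \<and> 1 - ?\<Phi> (z - b - e) < ?L + \<eta> / 2) (at 0)"
        by (rule eventually_conj)
      then show ?thesis by (simp add: eventually_at_split)
    qed
    then obtain e0 where "e0 > 0" "\<And>e. 0 < e \<Longrightarrow> e < e0 \<Longrightarrow> 1 - ?\<Phi> (z - b + e) > ?L - \<eta> / 2 \<and> 1 - ?\<Phi> (z - b - e) < ?L + \<eta> / 2"
      by (auto simp: eventually_at_right_field)
    then obtain e where e: "e > 0" "1 - ?\<Phi> (z - b + e) > ?L - \<eta> / 2" "1 - ?\<Phi> (z - b - e) < ?L + \<eta> / 2"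
      by (metis dense)
    from cipD[OF diff e(1)] obtain E where E: "\<And>k. E k \<in> sets (M k)" "(\<lambda>k. measure (M k) (E k)) \<longlonglongrightarrow> 1"
      "\<And>k \<omega>. \<omega> \<in> E k \<Longrightarrow> \<bar>A k \<omega> - R k \<omega> - b\<bar> < e"
      unfolding whp_def by blast
    let ?p = "\<lambda>k. measure (M k) {\<omega> \<in> space (M k). A k \<omega> \<ge> z}"
    have lower: "?p k \<ge> measure (M k) (E k) - cdf (D k) (z - b + e)" 
     and upper: "?p k \<le> 2 - measure (M k) (E k) - cdf (D k) (z - b - e)" for k
    proof -
      interpret prob_space "M k" by (rule prob_space_M)
      have cdfD: "cdf (D k) x = prob {\<omega> \<in> space (M k). R k \<omega> \<le> x}" for x
        unfolding cdf_def D_def by (subst measure_distr) (auto intro!: arg_cong[where f=prob])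
      have "E k \<subseteq> {\<omega> \<in> space (M k). A k \<omega> \<ge> z} \<union> {\<omega> \<in> space (M k). R k \<omega> \<le> z - b + e}"
        using E(3)[of _ k] sets.sets_into_space[OF E(1)[of k]] by (fastforce simp: abs_less_iff)
      then have "prob (E k) \<le> prob ({\<omega> \<in> space (M k). A k \<omega> \<ge> z} \<union> {\<omega> \<in> space (M k). R k \<omega> \<le> z - b + e})"
        using A by (intro finite_measure_mono) auto
      also have "\<dots> \<le> ?p k + prob {\<omega> \<in> space (M k). R k \<omega> \<le> z - b + e}"
        using A by (intro measure_subadditive) auto
      finally show "?p k \<ge> prob (E k) - cdf (D k) (z - b + e)" by (simp add: cdfD)
      have "{\<omega> \<in> space (M k). A k \<omega> \<ge> z} \<subseteq> (space (M k) - E k) \<union> (space (M k) - {\<omega> \<in> space (M k). R k \<omega> \<le> z - b - e})"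
        using E(3)[of _ k] by (fastforce simp: abs_less_iff)
      then have "?p k \<le> prob ((space (M k) - E k) \<union> (space (M k) - {\<omega> \<in> space (M k). R k \<omega> \<le> z - b - e}))"
        using A E(1) by (intro finite_measure_mono) auto
      also have "\<dots> \<le> prob (space (M k) - E k) + prob (space (M k) - {\<omega> \<in> space (M k). R k \<omega> \<le> z - b - e})"
        using E(1) by (intro measure_subadditive) auto
      finally show "?p k \<le> 2 - prob (E k) - cdf (D k) (z - b - e)"
        using prob_compl[OF E(1)[of k]] prob_compl[of "{\<omega> \<in> space (M k). R k \<omega> \<le> z - b - e}"]
        by (simp add: cdfD)
    qed
    have "eventually (\<lambda>k. measure (M k) (E k) - cdf (D k) (z - b + e) > ?L - \<eta> / 2) sequentially"
      by (rule order_tendstoD(1)[OF tendsto_diff[OF E(2) cdf_lim] e(2)])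
    moreover have "eventually (\<lambda>k. 2 - measure (M k) (E k) - cdf (D k) (z - b - e) < ?L + \<eta> / 2) sequentially"
      using e(3) by (intro order_tendstoD(2)[OF tendsto_diff[OF tendsto_diff[OF tendsto_const E(2)] cdf_lim]]) simp
    ultimately have "eventually (\<lambda>k. norm (?p k - ?L) < \<eta>) sequentially"
    proof eventually_elim
      case (elim k)
      then show ?case using lower[of k] upper[of k] \<eta> by (simp add: abs_less_iff)
    qed
    then show "\<exists>no. \<forall>k\<ge>no. norm (?p k - ?L) < \<eta>" by (simp add: eventually_sequentially)
  qed
qed

end

section \<open>Shortest normalised combination of the columns of a Gaussian matrix\<close>

text \<open>Reflections in pairwise orthogonal directions commute and their composition subtracts all the projections at once. This form is what acting on every row, or on every column, of a matrix by the same reflection amounts to.\<close>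
lemma distr_reflections_gauss:
  assumes K: "finite K" and J: "finite J"
    and orth: "\<And>b b'. b \<in> J \<Longrightarrow> b' \<in> J \<Longrightarrow> b \<noteq> b' \<Longrightarrow> (\<Sum>l\<in>K. U b l * U b' l) = 0"
  shows "distr (gauss K) (\<Pi>\<^sub>M k\<in>K. borel)
    (\<lambda>x. \<lambda>k\<in>K. x k - (\<Sum>b\<in>J. 2 * (\<Sum>l\<in>K. U b l * x l) / (\<Sum>l\<in>K. (U b l)\<^sup>2) * U b k)) = gauss K"
  using J orth
proof (induction J rule: finite_induct)
  case empty
  have "distr (gauss K) (\<Pi>\<^sub>M k\<in>K. borel) (\<lambda>x. \<lambda>k\<in>K. x k) = distr (gauss K) (gauss K) (\<lambda>x. x)"
    by (rule distr_cong) (auto simp: space_gauss)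
  also have "\<dots> = gauss K" by (rule distr_id)
  finally show ?case by (simp only: sum.empty diff_zero)
next
  case (insert a J)
  define T where "T x = (\<lambda>k\<in>K. x k - (\<Sum>b\<in>J. 2 * (\<Sum>l\<in>K. U b l * x l) / (\<Sum>l\<in>K. (U b l)\<^sup>2) * U b k))" for x
  have T [measurable]: "T \<in> measurable (\<Pi>\<^sub>M k\<in>K. borel) (\<Pi>\<^sub>M k\<in>K. borel)"
    unfolding T_def by measurable
  have IH: "distr (gauss K) (\<Pi>\<^sub>M k\<in>K. borel) T = gauss K"
    unfolding T_def by (rule insert.IH) (use insert.prems in auto)
  have "(\<Sum>l\<in>K. U a l * T x l) = (\<Sum>l\<in>K. U a l * x l)" for x
  proof -
    have "(\<Sum>l\<in>K. U a l * T x l) = (\<Sum>l\<in>K. U a l * x l) - (\<Sum>l\<in>K. \<Sum>b\<in>J. 2 * (\<Sum>l\<in>K. U b l * x l) / (\<Sum>l\<in>K. (U b l)\<^sup>2) * (U a l * U b l))"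
      by (simp add: T_def right_diff_distrib sum_subtractf sum_distrib_left mult_ac)
    also have "(\<Sum>l\<in>K. \<Sum>b\<in>J. 2 * (\<Sum>l\<in>K. U b l * x l) / (\<Sum>l\<in>K. (U b l)\<^sup>2) * (U a l * U b l))
      = (\<Sum>b\<in>J. 2 * (\<Sum>l\<in>K. U b l * x l) / (\<Sum>l\<in>K. (U b l)\<^sup>2) * (\<Sum>l\<in>K. U a l * U b l))"
      by (subst sum.swap) (simp only: sum_distrib_left)
    also have "\<dots> = 0" using insert.prems[of a] insert.hyps by (intro sum.neutral) auto
    finally show ?thesis by simp
  qed
  then have E1: "(\<lambda>x. \<lambda>k\<in>K. x k - (\<Sum>b\<in>insert a J. 2 * (\<Sum>l\<in>K. U b l * x l) / (\<Sum>l\<in>K. (U b l)\<^sup>2) * U b k))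
     = (\<lambda>x. reflection K (U a) (T x))"
    using insert.hyps by (auto simp: fun_eq_iff reflection_def T_def)
  have E2: "distr (gauss K) (\<Pi>\<^sub>M k\<in>K. borel) (\<lambda>x. reflection K (U a) (T x))
     = distr (distr (gauss K) (\<Pi>\<^sub>M k\<in>K. borel) T) (\<Pi>\<^sub>M k\<in>K. borel) (reflection K (U a))"
    by (subst distr_distr) (auto simp: comp_def)
  show ?case unfolding E1 E2 IH by (rule distr_reflection_gauss[OF K])
qed

definition reflect_rows :: "'i set \<Rightarrow> 'j set \<Rightarrow> ('i \<Rightarrow> real) \<Rightarrow> ('i \<times> 'j \<Rightarrow> real) \<Rightarrow> 'i \<times> 'j \<Rightarrow> real" where
  "reflect_rows R C u Y = (\<lambda>(i, j)\<in>R \<times> C. reflection R u (\<lambda>l. Y (l, j)) i)"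

definition reflect_cols :: "'i set \<Rightarrow> 'j set \<Rightarrow> ('j \<Rightarrow> real) \<Rightarrow> ('i \<times> 'j \<Rightarrow> real) \<Rightarrow> 'i \<times> 'j \<Rightarrow> real" where
  "reflect_cols R C u Y = (\<lambda>(i, j)\<in>R \<times> C. reflection C u (\<lambda>l. Y (i, l)) j)"

lemma distr_reflect_rows:
  assumes R: "finite R" and C: "finite C"
  shows "distr (gauss (R \<times> C)) (\<Pi>\<^sub>M k\<in>R \<times> C. borel) (reflect_rows R C u) = gauss (R \<times> C)"
proof -
  define U where "U j = (\<lambda>(i, k). if k = j then u i else 0)" for j :: 'b
  have s: "(\<Sum>l\<in>R \<times> C. U j l * x l) = (\<Sum>i\<in>R. u i * x (i, j))" if "j \<in> C" for j x
  proof -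
    have "(\<Sum>l\<in>R \<times> C. U j l * x l) = (\<Sum>i\<in>R. \<Sum>k\<in>C. if k = j then u i * x (i, k) else 0)"
      unfolding sum.cartesian_product by (intro sum.cong) (auto simp: U_def)
    then show ?thesis using that C by simp
  qed
  have s2: "(\<Sum>l\<in>R \<times> C. (U j l)\<^sup>2) = (\<Sum>i\<in>R. (u i)\<^sup>2)" if "j \<in> C" for j
    using s[OF that, of "U j"] by (simp add: power2_eq_square) (simp add: U_def)
  have e: "reflect_rows R C u = (\<lambda>x. \<lambda>k\<in>R \<times> C. x k - (\<Sum>b\<in>C. 2 * (\<Sum>l\<in>R \<times> C. U b l * x l) / (\<Sum>l\<in>R \<times> C. (U b l)\<^sup>2) * U b k))"
  proof (rule ext, rule ext, clarify)
    fix x i j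
    show "reflect_rows R C u x (i, j) = (\<lambda>k\<in>R \<times> C. x k - (\<Sum>b\<in>C. 2 * (\<Sum>l\<in>R \<times> C. U b l * x l) / (\<Sum>l\<in>R \<times> C. (U b l)\<^sup>2) * U b k)) (i, j)"
    proof (cases "(i, j) \<in> R \<times> C")
      case True
      then have "(\<Sum>b\<in>C. 2 * (\<Sum>l\<in>R \<times> C. U b l * x l) / (\<Sum>l\<in>R \<times> C. (U b l)\<^sup>2) * U b (i, j))
        = (\<Sum>b\<in>C. if b = j then 2 * (\<Sum>l\<in>R. u l * x (l, b)) / (\<Sum>l\<in>R. (u l)\<^sup>2) * u i else 0)"
        by (intro sum.cong refl) (simp only: s s2, simp add: U_def)
      also have "\<dots> = 2 * (\<Sum>l\<in>R. u l * x (l, j)) / (\<Sum>l\<in>R. (u l)\<^sup>2) * u i"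
        using True C by simp
      finally show ?thesis using True by (simp add: reflect_rows_def reflection_def)
    next
      case False
      then show ?thesis by (simp only: reflect_rows_def restrict_apply if_False)
    qed
  qed
  show ?thesis unfolding e
  proof (rule distr_reflections_gauss)
    fix b b' assume "b \<in> C" "b' \<in> C" "b \<noteq> b'"
    then show "(\<Sum>l\<in>R \<times> C. U b l * U b' l) = 0" by (subst s) (auto simp: U_def)
  qed (use R C in auto)
qed

lemma distr_reflect_cols:
  assumes R: "finite R" and C: "finite C"
  shows "distr (gauss (R \<times> C)) (\<Pi>\<^sub>M k\<in>R \<times> C. borel) (reflect_cols R C u) = gauss (R \<times> C)"
proof -
  define U where "U i = (\<lambda>(k, j). if k = i then u j else 0)" for i :: 'a
  have s: "(\<Sum>l\<in>R \<times> C. U i l * x l) = (\<Sum>j\<in>C. u j * x (i, j))" if "i \<in> R" for i x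
  proof -
    have "(\<Sum>l\<in>R \<times> C. U i l * x l) = (\<Sum>k\<in>R. \<Sum>j\<in>C. U i (k, j) * x (k, j))"
      by (simp add: sum.cartesian_product split_beta')
    also have "\<dots> = (\<Sum>k\<in>R. if k = i then (\<Sum>j\<in>C. u j * x (k, j)) else 0)"
      by (intro sum.cong) (auto simp: U_def)
    finally show ?thesis using that R by simp
  qed
  have s2: "(\<Sum>l\<in>R \<times> C. (U i l)\<^sup>2) = (\<Sum>j\<in>C. (u j)\<^sup>2)" if "i \<in> R" for i
    using s[OF that, of "U i"] by (simp add: power2_eq_square) (simp add: U_def)
  have e: "reflect_cols R C u = (\<lambda>x. \<lambda>k\<in>R \<times> C. x k - (\<Sum>b\<in>R. 2 * (\<Sum>l\<in>R \<times> C. U b l * x l) / (\<Sum>l\<in>R \<times> C. (U b l)\<^sup>2) * U b k))"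
  proof (rule ext, rule ext, clarify)
    fix x i j
    show "reflect_cols R C u x (i, j) = (\<lambda>k\<in>R \<times> C. x k - (\<Sum>b\<in>R. 2 * (\<Sum>l\<in>R \<times> C. U b l * x l) / (\<Sum>l\<in>R \<times> C. (U b l)\<^sup>2) * U b k)) (i, j)"
    proof (cases "(i, j) \<in> R \<times> C")
      case True
      then have "(\<Sum>b\<in>R. 2 * (\<Sum>l\<in>R \<times> C. U b l * x l) / (\<Sum>l\<in>R \<times> C. (U b l)\<^sup>2) * U b (i, j))
        = (\<Sum>b\<in>R. if b = i then 2 * (\<Sum>l\<in>C. u l * x (b, l)) / (\<Sum>l\<in>C. (u l)\<^sup>2) * u j else 0)"
        by (intro sum.cong refl) (simp only: s s2, simp add: U_def)
      also have "\<dots> = 2 * (\<Sum>l\<in>C. u l * x (i, l)) / (\<Sum>l\<in>C. (u l)\<^sup>2) * u j"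
        using True R by simp
      finally show ?thesis using True by (simp add: reflect_cols_def reflection_def)
    next
      case False
      then show ?thesis by (simp only: reflect_cols_def restrict_apply if_False)
    qed
  qed
  show ?thesis unfolding e
  proof (rule distr_reflections_gauss)
    fix b b' assume "b \<in> R" "b' \<in> R" "b \<noteq> b'"
    then show "(\<Sum>l\<in>R \<times> C. U b l * U b' l) = 0" by (subst s) (auto simp: U_def)
  qed (use R C in auto)
qed

definition sqlen :: "'i set \<Rightarrow> 'j set \<Rightarrow> ('i \<times> 'j \<Rightarrow> real) \<Rightarrow> ('j \<Rightarrow> real) \<Rightarrow> real" where
  "sqlen R C Y v = (\<Sum>i\<in>R. (\<Sum>j\<in>C. Y (i, j) * v j)\<^sup>2)"

text \<open>The squared distance of column \<open>j0\<close> from the span of the other columns. Written as an infimum it needs no linear independence, and it behaves well when rows and columns are deleted.\<close>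
definition vmin :: "'i set \<Rightarrow> 'j set \<Rightarrow> ('i \<times> 'j \<Rightarrow> real) \<Rightarrow> 'j \<Rightarrow> real" where
  "vmin R C Y j0 = (INF v\<in>{v. v j0 = 1}. sqlen R C Y v)"

lemma sqlen_nonneg [simp]: "sqlen R C Y v \<ge> 0"
  by (simp add: sqlen_def sum_nonneg)

lemma bdd_below_sqlen [simp]: "bdd_below (sqlen R C Y ` S)"
  by (rule bdd_belowI2[of _ 0]) simp

lemma vmin_nonempty [simp]: "{v :: 'j \<Rightarrow> real. v j0 = 1} \<noteq> {}"
  by (auto intro!: exI[of _ "\<lambda>_. 1"])

lemma vmin_le: "v j0 = 1 \<Longrightarrow> vmin R C Y j0 \<le> sqlen R C Y v"
  unfolding vmin_def by (rule cINF_lower) auto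

lemma vmin_ge: "(\<And>v. v j0 = 1 \<Longrightarrow> b \<le> sqlen R C Y v) \<Longrightarrow> b \<le> vmin R C Y j0"
  unfolding vmin_def by (rule cINF_greatest) auto

lemma vmin_cong:
  assumes "\<And>i j. i \<in> R \<Longrightarrow> j \<in> C \<Longrightarrow> Y (i, j) = Y' (i, j)"
  shows "vmin R C Y j0 = vmin R C Y' j0"
proof -
  have "sqlen R C Y = sqlen R C Y'" by (auto simp: fun_eq_iff sqlen_def assms intro!: sum.cong)
  then show ?thesis by (simp add: vmin_def)
qed

text \<open>If column \<open>c\<close> has its only nonzero entry in row \<open>r\<close>, then the coefficient of column \<open>c\<close> can be chosen to annihilate row \<open>r\<close> and affects nothing else.\<close>
lemma vmin_eliminate:
  assumes R: "finite R" "r \<in> R" and C: "finite C" "c \<in> C" "c \<noteq> j0"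
    and zero: "\<And>i. i \<in> R \<Longrightarrow> i \<noteq> r \<Longrightarrow> Y (i, c) = 0" and pivot: "Y (r, c) \<noteq> 0"
  shows "vmin R C Y j0 = vmin (R - {r}) (C - {c}) Y j0"
proof (rule antisym)
  have s: "(\<Sum>j\<in>C. Y (i, j) * v j) = Y (i, c) * v c + (\<Sum>j\<in>C - {c}. Y (i, j) * v j)" for i v
    using C by (simp add: sum.remove)
  have rest: "sqlen R C Y v = (\<Sum>j\<in>C. Y (r, j) * v j)\<^sup>2 + sqlen (R - {r}) (C - {c}) Y v" for v
    unfolding sqlen_def using R by (subst sum.remove[OF R]) (simp add: s zero)
  show "vmin R C Y j0 \<le> vmin (R - {r}) (C - {c}) Y j0"
  proof (rule vmin_ge)
    fix v :: "'b \<Rightarrow> real" assume v: "v j0 = 1"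
    define v' where "v' = v(c := - (\<Sum>j\<in>C - {c}. Y (r, j) * v j) / Y (r, c))"
    have e: "(\<Sum>j\<in>C - {c}. Y (i, j) * v' j) = (\<Sum>j\<in>C - {c}. Y (i, j) * v j)" for i
      by (intro sum.cong) (auto simp: v'_def)
    have "(\<Sum>j\<in>C. Y (r, j) * v' j) = 0"
      using pivot by (simp only: s e) (simp add: v'_def)
    moreover have "sqlen (R - {r}) (C - {c}) Y v' = sqlen (R - {r}) (C - {c}) Y v"
      by (simp only: sqlen_def e)
    moreover have "v' j0 = 1" using v C by (simp add: v'_def)
    ultimately show "vmin R C Y j0 \<le> sqlen (R - {r}) (C - {c}) Y v"
      using vmin_le[of v' j0 R C Y] by (simp add: rest)
  qed
  show "vmin (R - {r}) (C - {c}) Y j0 \<le> vmin R C Y j0"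
  proof (rule vmin_ge)
    fix v :: "'b \<Rightarrow> real" assume "v j0 = 1"
    from vmin_le[of v j0 "R - {r}" "C - {c}" Y, OF this]
    show "vmin (R - {r}) (C - {c}) Y j0 \<le> sqlen R C Y v"
      unfolding rest by (rule order_trans) simp
  qed
qed

lemma sqlen_reflect_rows:
  assumes R: "finite R" and C: "finite C"
  shows "sqlen R C (reflect_rows R C u Y) v = sqlen R C Y v"
proof -
  define x where "x i = (\<Sum>j\<in>C. Y (i, j) * v j)" for i
  have "(\<Sum>j\<in>C. reflect_rows R C u Y (i, j) * v j) = reflection R u x i" if i: "i \<in> R" for i
  proof -
    have "(\<Sum>l\<in>R. u l * x l) = (\<Sum>j\<in>C. (\<Sum>l\<in>R. u l * Y (l, j)) * v j)"
      unfolding sum_distrib_left sum_distrib_right x_def by (subst sum.swap) (simp add: mult_ac)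
    then have "reflection R u x i
      = x i - 2 * (\<Sum>j\<in>C. (\<Sum>l\<in>R. u l * Y (l, j)) * v j) / (\<Sum>l\<in>R. (u l)\<^sup>2) * u i"
      using i by (simp add: reflection_def)
    also have "\<dots> = (\<Sum>j\<in>C. Y (i, j) * v j - 2 * ((\<Sum>l\<in>R. u l * Y (l, j)) * v j) / (\<Sum>l\<in>R. (u l)\<^sup>2) * u i)"
      unfolding x_def by (simp only: sum_subtractf sum_distrib_left sum_distrib_right[symmetric] sum_divide_distrib[symmetric])
    also have "\<dots> = (\<Sum>j\<in>C. reflect_rows R C u Y (i, j) * v j)"
      using i by (intro sum.cong) (auto simp: reflection_def reflect_rows_def algebra_simps)
    finally show ?thesis by simp
  qed
  then have "sqlen R C (reflect_rows R C u Y) v = (\<Sum>i\<in>R. reflection R u x i * reflection R u x i)"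
    by (simp add: sqlen_def power2_eq_square)
  also have "\<dots> = sqlen R C Y v"
    by (simp add: reflection_inner[OF R] sqlen_def x_def power2_eq_square)
  finally show ?thesis .
qed

lemma vmin_reflect_rows:
  "finite R \<Longrightarrow> finite C \<Longrightarrow> vmin R C (reflect_rows R C u Y) j0 = vmin R C Y j0"
  by (simp add: vmin_def sqlen_reflect_rows)

text \<open>Strict inequalities for the squared length survive a small change of the coefficients; hence the infimum may be taken over countably many vectors, which gives measurability.\<close>
lemma rational_approximation:
  assumes C: "finite C" and v: "sqlen R C Y v < t" and S: "finite S"
  shows "\<exists>v'. (\<forall>j\<in>S. v' j \<in> \<rat>) \<and> (\<forall>j. j \<notin> S \<longrightarrow> v' j = v j) \<and> sqlen R C Y v' < t"
  using S
proof (induction S rule: finite_induct)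
  case empty
  then show ?case using v by auto
next
  case (insert a S)
  then obtain v' where v': "\<forall>j\<in>S. v' j \<in> \<rat>" "\<forall>j. j \<notin> S \<longrightarrow> v' j = v j" "sqlen R C Y v' < t" by blast
  define f where "f s = sqlen R C Y (v'(a := s))" for s
  have "isCont (\<lambda>s. (v'(a := s)) j) s0" for j s0 by (cases "j = a") auto
  then have "isCont f (v' a)" unfolding f_def sqlen_def by (intro continuous_intros)
  moreover have "f (v' a) < t" using v'(3) by (simp add: f_def)
  ultimately have "eventually (\<lambda>s. f s < t) (nhds (v' a))"
    by (intro order_tendstoD(2)[of f "f (v' a)"]) (simp_all add: isCont_def tendsto_at_iff_tendsto_nhds)
  then obtain d where d: "d > 0" "\<And>s. dist s (v' a) < d \<Longrightarrow> f s < t"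
    by (auto simp: eventually_nhds_metric)
  obtain q where q: "q \<in> \<rat>" "v' a < q" "q < v' a + d"
    using Rats_dense_in_real[of "v' a" "v' a + d"] d by auto
  then have "f q < t" by (intro d) (simp add: dist_real_def)
  then show ?case using v' q insert.hyps
    by (intro exI[of _ "v'(a := q)"]) (auto simp: f_def fun_upd_def)
qed

lemma measurable_vmin [measurable]:
  assumes R: "finite R" and C: "finite C" "j0 \<in> C"
  shows "(\<lambda>Y. vmin R C Y j0) \<in> borel_measurable (\<Pi>\<^sub>M k\<in>R \<times> C. borel)"
proof (rule borel_measurable_iff_less[THEN iffD2], rule allI)
  fix t
  let ?N = "\<Pi>\<^sub>M k\<in>R \<times> C. (borel :: real measure)"
  define W where "W = (\<Pi>\<^sub>E j\<in>C. (\<rat> :: real set))"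
  have "countable W" unfolding W_def using C countable_rat by (intro countable_PiE) auto
  have eq: "{Y \<in> space ?N. vmin R C Y j0 < t} = (\<Union>w\<in>{w \<in> W. w j0 = 1}. {Y \<in> space ?N. sqlen R C Y w < t})"
  proof (intro equalityI subsetI)
    fix Y assume "Y \<in> {Y \<in> space ?N. vmin R C Y j0 < t}"
    then have Y: "Y \<in> space ?N" "vmin R C Y j0 < t" by auto
    then obtain v where v: "v j0 = 1" "sqlen R C Y v < t"
      unfolding vmin_def by (subst (asm) cINF_less_iff) auto
    from rational_approximation[OF C(1) v(2), of "C - {j0}"] C obtain v' where
      v': "\<forall>j\<in>C - {j0}. v' j \<in> \<rat>" "\<forall>j. j \<notin> C - {j0} \<longrightarrow> v' j = v j" "sqlen R C Y v' < t" by blast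
    have "v' j0 = 1" using v' v by auto
    moreover from this v' have "restrict v' C \<in> W" by (auto simp: W_def)
    moreover have "sqlen R C Y (restrict v' C) = sqlen R C Y v'" by (simp add: sqlen_def)
    ultimately show "Y \<in> (\<Union>w\<in>{w \<in> W. w j0 = 1}. {Y \<in> space ?N. sqlen R C Y w < t})"
      using Y v' C by (intro UN_I[of "restrict v' C"]) auto
  next
    fix Y assume "Y \<in> (\<Union>w\<in>{w \<in> W. w j0 = 1}. {Y \<in> space ?N. sqlen R C Y w < t})"
    then obtain w where "w j0 = 1" "sqlen R C Y w < t" "Y \<in> space ?N" by blast
    then show "Y \<in> {Y \<in> space ?N. vmin R C Y j0 < t}"
      using vmin_le[of w j0 R C Y] by simp
  qed
  have "{Y \<in> space ?N. sqlen R C Y w < t} \<in> sets ?N" for w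
    unfolding sqlen_def by measurable
  then show "{Y \<in> space ?N. vmin R C Y j0 < t} \<in> sets ?N"
    unfolding eq using \<open>countable W\<close> by (intro sets.countable_UN') auto
qed

lemma AE_gauss_coordinate_nonzero:
  assumes "k \<in> K"
  shows "AE x in gauss K. x k \<noteq> 0"
proof (rule AE_PiM_component[OF _ assms])
  show "AE x in std_normal_distribution. x \<noteq> 0"
    using AE_lborel_singleton[of "0 :: real"] by (subst AE_density) auto
qed (simp add: prob_space_normal_density)

lemma restrict_gauss:
  assumes "J \<subseteq> K"
  shows "distr (gauss K) (gauss J) (\<lambda>x. restrict x J) = gauss J"
  using distr_PiM_reindex[of K "\<lambda>_. std_normal_distribution" "\<lambda>k. k" J] assms
  by (auto simp: prob_space_normal_density restrict_def[symmetric])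

lemma measurable_reflect_rows [measurable]:
  "reflect_rows R C u \<in> measurable (\<Pi>\<^sub>M k\<in>R \<times> C. borel) (\<Pi>\<^sub>M k\<in>R \<times> C. borel)"
  unfolding reflect_rows_def
proof (rule measurable_restrict)
  fix k assume "k \<in> R \<times> C"
  then obtain i j where k: "k = (i, j)" "i \<in> R" "j \<in> C" by auto
  then have "(\<lambda>Y. case k of (i, j) \<Rightarrow> reflection R u (\<lambda>l. Y (l, j)) i)
    = (\<lambda>Y. Y (i, j) - 2 * (\<Sum>l\<in>R. u l * Y (l, j)) / (\<Sum>l\<in>R. (u l)\<^sup>2) * u i)"
    by (simp add: reflection_def)
  also have "\<dots> \<in> borel_measurable (\<Pi>\<^sub>M k\<in>R \<times> C. borel)"
    using k by (intro borel_measurable_diff borel_measurable_times borel_measurable_divide borel_measurable_sum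
      borel_measurable_const measurable_component_singleton) auto
  finally show "(\<lambda>Y. case k of (i, j) \<Rightarrow> reflection R u (\<lambda>l. Y (l, j)) i) \<in> borel_measurable (\<Pi>\<^sub>M k\<in>R \<times> C. borel)" .
qed

text \<open>Induction on the number of columns. Given a column \<open>c\<close> different from \<open>j0\<close>, reflect the rows so that this column becomes a multiple of a unit vector. The reflection depends on column \<open>c\<close> alone, which is independent of the remaining columns, so these stay standard Gaussian; then the row and the column are eliminated. After all of them one column with \<open>card R + 1 - card C\<close> entries is left.\<close>
theorem distr_vmin:
  fixes R :: "'i set" and C :: "'j set"
  assumes R: "finite R" and C: "finite C" "j0 \<in> C" and card: "card C \<le> card R"
  shows "distr (gauss (R \<times> C)) borel (\<lambda>Y. vmin R C Y j0)
    = distr (gauss {..<card R + 1 - card C}) borel (\<lambda>w. \<Sum>i<card R + 1 - card C. (w i)\<^sup>2)"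
proof -
  have main: "distr (gauss (R \<times> insert j0 S)) borel (\<lambda>Y. vmin R (insert j0 S) Y j0)
    = distr (gauss {..<card R - card S}) borel (\<lambda>w. \<Sum>i<card R - card S. (w i)\<^sup>2)"
    if "finite S" "j0 \<notin> S" "card S < card R" "finite R" for S and R :: "'i set"
    using that
  proof (induction S arbitrary: R rule: finite_induct)
    case (empty R)
    obtain f where f: "bij_betw f {..<card R} R"
      using ex_bij_betw_nat_finite[OF empty(3)] by (auto simp: atLeast0LessThan)
    define g where "g i = (f i, j0)" for i
    have g: "inj_on g {..<card R}" "g \<in> {..<card R} \<rightarrow> R \<times> {j0}"
      using f by (auto simp: g_def inj_on_def bij_betw_def)
    have v: "vmin R {j0} Y j0 = (\<Sum>i<card R. (Y (g i))\<^sup>2)" for Y :: "'i \<times> 'j \<Rightarrow> real"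
    proof -
      have "sqlen R {j0} Y v = (\<Sum>i\<in>R. (Y (i, j0))\<^sup>2)" if "v j0 = 1" for v
        using that by (simp add: sqlen_def)
      then have "vmin R {j0} Y j0 = (\<Sum>i\<in>R. (Y (i, j0))\<^sup>2)"
        by (intro antisym vmin_ge order_trans[OF vmin_le[of "\<lambda>_. 1"]]) auto
      also have "\<dots> = (\<Sum>i<card R. (Y (g i))\<^sup>2)"
        unfolding g_def by (rule sum.reindex_bij_betw[OF f, symmetric])
      finally show ?thesis .
    qed
    have gm: "(\<lambda>\<omega>. \<lambda>n\<in>{..<card R}. \<omega> (g n)) \<in> measurable (gauss (R \<times> {j0})) (gauss {..<card R})"
      using g(2) by (intro measurable_restrict measurable_component_singleton) auto
    have "distr (gauss (R \<times> {j0})) borel (\<lambda>Y. vmin R {j0} Y j0)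
      = distr (distr (gauss (R \<times> {j0})) (gauss {..<card R}) (\<lambda>\<omega>. \<lambda>n\<in>{..<card R}. \<omega> (g n))) borel (\<lambda>w. \<Sum>i<card R. (w i)\<^sup>2)"
      by (subst distr_distr[OF _ gm]) (auto simp: v comp_def)
    also have "distr (gauss (R \<times> {j0})) (gauss {..<card R}) (\<lambda>\<omega>. \<lambda>n\<in>{..<card R}. \<omega> (g n)) = gauss {..<card R}"
      by (rule distr_PiM_reindex[OF _ g]) (simp add: prob_space_normal_density)
    finally show ?case by simp
  next
    case (insert c S R)
    define C where "C = insert j0 S"
    have C: "finite C" "c \<notin> C" "j0 \<in> C" "c \<noteq> j0" using insert by (auto simp: C_def)
    have ins: "insert j0 (insert c S) = insert c C" by (auto simp: C_def)
    from insert have "card R > 0" by simp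
    then obtain r where r: "r \<in> R" by fastforce
    define D where "D = distr (gauss ((R - {r}) \<times> C)) borel (\<lambda>Y. vmin (R - {r}) C Y j0)"
    note [simp] = insert.prems(3)
    have IH: "D = distr (gauss {..<card R - Suc (card S)}) borel (\<lambda>w. \<Sum>i<card R - Suc (card S). (w i)\<^sup>2)"
    proof -
      have "card S < card (R - {r})" "card (R - {r}) - card S = card R - Suc (card S)"
        using insert.prems insert.hyps r by (auto simp: card_Diff_singleton)
      then show ?thesis unfolding D_def C_def
        using insert.IH[of "R - {r}"] insert.prems by simp
    qed
    have split: "R \<times> {c} \<inter> R \<times> C = {}" "R \<times> {c} \<union> R \<times> C = R \<times> insert c C" using C by auto
    have m1[measurable]: "(\<lambda>Y. vmin R (insert c C) Y j0) \<in> borel_measurable (\<Pi>\<^sub>M k\<in>R \<times> insert c C. borel)"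
      by (rule measurable_vmin) (use C in auto)
    have m2: "(\<lambda>Y. vmin (R - {r}) C Y j0) \<in> borel_measurable (\<Pi>\<^sub>M k\<in>(R - {r}) \<times> C. borel)"
      by (rule measurable_vmin) (use C in auto)
    have rest_m: "(\<lambda>Y. restrict Y ((R - {r}) \<times> C)) \<in> measurable (\<Pi>\<^sub>M k\<in>R \<times> C. borel) (\<Pi>\<^sub>M k\<in>(R - {r}) \<times> C. borel)"
      by (rule measurable_restrict_subset) auto
    have m3[measurable]: "(\<lambda>Y. vmin (R - {r}) C Y j0) \<in> borel_measurable (\<Pi>\<^sub>M k\<in>R \<times> C. borel)"
    proof -
      have "(\<lambda>Y. vmin (R - {r}) C (restrict Y ((R - {r}) \<times> C)) j0) \<in> borel_measurable (\<Pi>\<^sub>M k\<in>R \<times> C. borel)"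
        using measurable_compose[OF rest_m m2] .
      moreover have "vmin (R - {r}) C (restrict Y ((R - {r}) \<times> C)) j0 = vmin (R - {r}) C Y j0" for Y
        by (rule vmin_cong) simp
      ultimately show ?thesis by simp
    qed
    have "distr (gauss (R \<times> insert c C)) borel (\<lambda>Y. vmin R (insert c C) Y j0) = D"
    proof (rule measure_eqI)
      fix A assume "A \<in> sets (distr (gauss (R \<times> insert c C)) borel (\<lambda>Y. vmin R (insert c C) Y j0))"
      then have A[measurable]: "A \<in> sets borel" by simp
      let ?I = "indicator A :: real \<Rightarrow> ennreal"
      have "emeasure (distr (gauss (R \<times> insert c C)) borel (\<lambda>Y. vmin R (insert c C) Y j0)) A
        = (\<integral>\<^sup>+s. ?I s \<partial>distr (gauss (R \<times> insert c C)) borel (\<lambda>Y. vmin R (insert c C) Y j0))"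
        by simp
      also have "\<dots> = (\<integral>\<^sup>+Y. ?I (vmin R (insert c C) Y j0) \<partial>gauss (R \<times> insert c C))"
        by (rule nn_integral_distr) (use m1 in \<open>auto cong: measurable_cong_sets\<close>)
      also have "\<dots> = (\<integral>\<^sup>+x. (\<integral>\<^sup>+y. ?I (vmin R (insert c C) (merge (R \<times> {c}) (R \<times> C) (x, y)) j0) \<partial>gauss (R \<times> C)) \<partial>gauss (R \<times> {c}))"
        using product_gauss.product_nn_integral_fold[OF split(1), of "\<lambda>Y. ?I (vmin R (insert c C) Y j0)"] C
        by (simp add: split(2))
      also have "\<dots> = (\<integral>\<^sup>+x. emeasure D A \<partial>gauss (R \<times> {c}))"
      proof (rule nn_integral_cong_AE)
        have "AE x in gauss (R \<times> {c}). x (r, c) \<noteq> 0"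
          by (rule AE_gauss_coordinate_nonzero) (use r in auto)
        then show "AE x in gauss (R \<times> {c}). (\<integral>\<^sup>+y. ?I (vmin R (insert c C) (merge (R \<times> {c}) (R \<times> C) (x, y)) j0) \<partial>gauss (R \<times> C)) = emeasure D A"
        proof eventually_elim
          case (elim x)
          define b where "b = sqrt (\<Sum>i\<in>R. (x (i, c))\<^sup>2)"
          have "(\<Sum>i\<in>R. (x (i, c))\<^sup>2) \<noteq> 0"
            using r elim by (subst sum_nonneg_eq_0_iff) auto
          then have b: "b \<noteq> 0" by (simp add: b_def)
          define e where "e i = (if i = r then b else 0)" for i
          define u where "u i = x (i, c) - e i" for i
          have se: "(\<Sum>i\<in>R. (e i)\<^sup>2) = b\<^sup>2"
          proof -
            have "(\<Sum>i\<in>R. (e i)\<^sup>2) = (\<Sum>i\<in>R. if i = r then b\<^sup>2 else 0)" by (intro sum.cong) (auto simp: e_def)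
            then show ?thesis using r by simp
          qed
          have ref: "reflection R u (\<lambda>i. x (i, c)) i = e i" if "i \<in> R" for i
            unfolding u_def by (rule reflection_maps) (use that se in \<open>auto simp: b_def sum_nonneg\<close>)
          have vv: "vmin R (insert c C) (merge (R \<times> {c}) (R \<times> C) (x, y)) j0 = vmin (R - {r}) C (reflect_rows R C u y) j0" for y
          proof -
            let ?Y = "merge (R \<times> {c}) (R \<times> C) (x, y)"
            have Yc: "?Y (i, c) = x (i, c)" if "i \<in> R" for i using that by (simp add: merge_def)
            have YC: "?Y (i, j) = y (i, j)" if "i \<in> R" "j \<in> C" for i j using that C by (auto simp: merge_def)
            have rc: "reflect_rows R (insert c C) u ?Y (i, c) = e i" if "i \<in> R" for i
            proof -
              have "reflection R u (\<lambda>l. ?Y (l, c)) i = reflection R u (\<lambda>i. x (i, c)) i"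
                using that by (simp add: reflection_def Yc)
              then show ?thesis using that ref by (simp add: reflect_rows_def)
            qed
            have rC: "reflect_rows R (insert c C) u ?Y (i, j) = reflect_rows R C u y (i, j)" if "i \<in> R" "j \<in> C" for i j
              using that by (simp add: reflect_rows_def reflection_def YC)
            have "vmin R (insert c C) ?Y j0 = vmin R (insert c C) (reflect_rows R (insert c C) u ?Y) j0"
              by (rule vmin_reflect_rows[symmetric]) (use C in auto)
            also have "\<dots> = vmin (R - {r}) (insert c C - {c}) (reflect_rows R (insert c C) u ?Y) j0"
              by (rule vmin_eliminate) (use C r b in \<open>auto simp: rc e_def\<close>)
            also have "insert c C - {c} = C" using C by auto
            also have "vmin (R - {r}) C (reflect_rows R (insert c C) u ?Y) j0 = vmin (R - {r}) C (reflect_rows R C u y) j0"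
              by (rule vmin_cong) (simp add: rC)
            finally show ?thesis .
          qed
          have "(\<integral>\<^sup>+y. ?I (vmin R (insert c C) (merge (R \<times> {c}) (R \<times> C) (x, y)) j0) \<partial>gauss (R \<times> C))
            = (\<integral>\<^sup>+y. ?I (vmin (R - {r}) C (reflect_rows R C u y) j0) \<partial>gauss (R \<times> C))"
            by (simp only: vv)
          also have "\<dots> = (\<integral>\<^sup>+y. ?I (vmin (R - {r}) C y j0) \<partial>distr (gauss (R \<times> C)) (\<Pi>\<^sub>M k\<in>R \<times> C. borel) (reflect_rows R C u))"
            by (subst nn_integral_distr) auto
          also have "\<dots> = (\<integral>\<^sup>+y. ?I (vmin (R - {r}) C y j0) \<partial>gauss (R \<times> C))"
            using C by (subst distr_reflect_rows) auto
          also have "\<dots> = (\<integral>\<^sup>+y. ?I (vmin (R - {r}) C (restrict y ((R - {r}) \<times> C)) j0) \<partial>gauss (R \<times> C))"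
            by (intro nn_integral_cong arg_cong[where f="?I"] vmin_cong) auto
          also have "\<dots> = (\<integral>\<^sup>+y. ?I (vmin (R - {r}) C y j0) \<partial>distr (gauss (R \<times> C)) (gauss ((R - {r}) \<times> C)) (\<lambda>y. restrict y ((R - {r}) \<times> C)))"
            using m2 rest_m by (subst nn_integral_distr) (auto cong: measurable_cong_sets)
          also have "\<dots> = (\<integral>\<^sup>+y. ?I (vmin (R - {r}) C y j0) \<partial>gauss ((R - {r}) \<times> C))"
            by (subst restrict_gauss) auto
          also have "\<dots> = (\<integral>\<^sup>+s. ?I s \<partial>D)"
            unfolding D_def by (rule nn_integral_distr[symmetric]) (use m2 in \<open>auto cong: measurable_cong_sets\<close>)
          also have "\<dots> = emeasure D A" by (simp add: D_def)
          finally show ?case .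
        qed
      qed
      also have "\<dots> = emeasure D A"
        by (simp only: nn_integral_const prob_space.emeasure_space_1[OF prob_space_gauss] mult_1_right)
      finally show "emeasure (distr (gauss (R \<times> insert c C)) borel (\<lambda>Y. vmin R (insert c C) Y j0)) A = emeasure D A" .
    qed (simp add: D_def)
    then show ?case using insert.hyps IH by (simp add: ins)
  qed
  have "insert j0 (C - {j0}) = C" "card R - card (C - {j0}) = card R + 1 - card C" "card (C - {j0}) < card R"
    using assms card_gt_0_iff[of C] by (auto simp: card_Diff_singleton)
  then show ?thesis using main[of "C - {j0}" R] assms by simp
qed

text \<open>A sum of at least one squared standard normal variable is almost surely positive.\<close>
lemma AE_vmin_pos:
  assumes R: "finite R" and C: "finite C" "j0 \<in> C" and card: "card C \<le> card R"
  shows "AE Y in gauss (R \<times> C). vmin R C Y j0 > 0"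
proof -
  let ?m = "card R + 1 - card C"
  have m0: "0 < ?m" using card by simp
  have "AE w in gauss {..<?m}. w 0 \<noteq> 0"
    by (rule AE_gauss_coordinate_nonzero) (use m0 in simp)
  then have "AE w in gauss {..<?m}. (\<Sum>i<?m. (w i)\<^sup>2) > 0"
  proof eventually_elim
    fix w :: "nat \<Rightarrow> real" assume "w 0 \<noteq> 0"
    then have "0 < (w 0)\<^sup>2" by simp
    also have "\<dots> \<le> (\<Sum>i<?m. (w i)\<^sup>2)" using m0 by (intro member_le_sum) auto
    finally show "(\<Sum>i<?m. (w i)\<^sup>2) > 0" .
  qed
  then have "AE s in distr (gauss {..<?m}) borel (\<lambda>w. \<Sum>i<?m. (w i)\<^sup>2). s > 0"
    by (subst AE_distr_iff) auto
  then have "AE s in distr (gauss (R \<times> C)) borel (\<lambda>Y. vmin R C Y j0). s > 0"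
    by (simp only: distr_vmin[OF assms])
  then show ?thesis using measurable_vmin[OF R C]
    by (subst (asm) AE_distr_iff) (auto cong: measurable_cong_sets)
qed

text \<open>If every column has positive distance from the span of the others, the columns are linearly independent.\<close>
lemma vmin_pos_imp_injective:
  assumes pos: "\<And>j. j \<in> C \<Longrightarrow> vmin R C Y j > 0" and zero: "\<And>i. i \<in> R \<Longrightarrow> (\<Sum>j\<in>C. Y (i, j) * v j) = 0" and j: "j \<in> C"
  shows "v j = 0"
proof (rule ccontr)
  assume "v j \<noteq> 0"
  define w where "w l = v l / v j" for l
  have "(\<Sum>l\<in>C. Y (i, l) * w l) = 0" if "i \<in> R" for i
    using zero[OF that] by (simp add: w_def sum_divide_distrib[symmetric])
  then have "sqlen R C Y w = 0" by (simp add: sqlen_def)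
  moreover have "vmin R C Y j \<le> sqlen R C Y w" by (rule vmin_le) (simp add: w_def \<open>v j \<noteq> 0\<close>)
  ultimately show False using pos[OF j] by simp
qed

definition elen :: "'j set \<Rightarrow> ('j \<Rightarrow> real) \<Rightarrow> real" where
  "elen C e = sqrt (\<Sum>j\<in>C. (e j)\<^sup>2)"

text \<open>The same minimum for a general direction: the columns are reflected so that \<open>e\<close> becomes a positive multiple of the basis vector \<open>j0\<close>.\<close>
definition vdir :: "'i set \<Rightarrow> 'j set \<Rightarrow> 'j \<Rightarrow> ('i \<times> 'j \<Rightarrow> real) \<Rightarrow> ('j \<Rightarrow> real) \<Rightarrow> real" where
  "vdir R C j0 Y e = vmin R C (reflect_cols R C (\<lambda>j. e j - (if j = j0 then elen C e else 0)) Y) j0"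

lemma reflection_self_adjoint:
  "(\<Sum>k\<in>K. reflection K u x k * y k) = (\<Sum>k\<in>K. x k * reflection K u y k)"
proof -
  define w a b where "w = (\<Sum>l\<in>K. (u l)\<^sup>2)" and "a = (\<Sum>l\<in>K. u l * x l)" and "b = (\<Sum>l\<in>K. u l * y l)"
  have "(\<Sum>k\<in>K. reflection K u x k * y k) = (\<Sum>k\<in>K. x k * y k - 2 * a / w * (u k * y k))"
    by (intro sum.cong) (auto simp: reflection_def w_def a_def algebra_simps)
  also have "\<dots> = (\<Sum>k\<in>K. x k * y k) - 2 * a / w * b"
    by (simp only: sum_subtractf sum_distrib_left[symmetric] b_def)
  also have "\<dots> = (\<Sum>k\<in>K. x k * y k) - 2 * b / w * a" by simp
  also have "\<dots> = (\<Sum>k\<in>K. x k * y k - 2 * b / w * (u k * x k))"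
    by (simp only: sum_subtractf sum_distrib_left[symmetric] a_def)
  also have "\<dots> = (\<Sum>k\<in>K. x k * reflection K u y k)"
    by (intro sum.cong) (auto simp: reflection_def w_def b_def algebra_simps)
  finally show ?thesis .
qed

text \<open>The minimum of \<open>\<bar>Y v\<bar>\<^sup>2\<close> over vectors with \<open>v \<bullet> e = \<bar>e\<bar>\<close> is \<open>\<bar>e\<bar>\<^sup>2\<close> divided by \<open>e' (Y' Y)\<^sup>-\<^sup>1 e\<close>, attained at a multiple of \<open>g = (Y' Y)\<^sup>-\<^sup>1 e\<close>. This turns the inverse in the Hotelling statistic into a quantity whose law is known.\<close>
theorem vdir_inverse_gram:
  assumes R: "finite R" and C: "finite C" "j0 \<in> C"
    and g: "\<And>j. j \<in> C \<Longrightarrow> (\<Sum>l\<in>C. (\<Sum>i\<in>R. Y (i, j) * Y (i, l)) * g l) = e j"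
  shows "vdir R C j0 Y e * (\<Sum>j\<in>C. e j * g j) = (\<Sum>j\<in>C. (e j)\<^sup>2)"
proof -
  define \<epsilon> where "\<epsilon> j = (if j = j0 then elen C e else 0)" for j
  define H where "H = reflection C (\<lambda>j. e j - \<epsilon> j)"
  define eg where "eg = (\<Sum>j\<in>C. e j * g j)"
  define b where "b = elen C e"
  have b0: "b \<ge> 0" and b2: "b\<^sup>2 = (\<Sum>j\<in>C. (e j)\<^sup>2)" by (simp_all add: b_def elen_def sum_nonneg)
  have s\<epsilon>: "(\<Sum>j\<in>C. v j * \<epsilon> j) = b * v j0" for v
  proof -
    have "(\<Sum>j\<in>C. v j * \<epsilon> j) = (\<Sum>j\<in>C. if j = j0 then b * v j else 0)" by (intro sum.cong) (auto simp: \<epsilon>_def b_def)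
    then show ?thesis using C by simp
  qed
  have He: "H e j = \<epsilon> j" if "j \<in> C" for j
    unfolding H_def
    by (rule reflection_maps) (use C that s\<epsilon>[of \<epsilon>] b2 in \<open>auto simp: power2_eq_square \<epsilon>_def b_def\<close>)
  have He2: "(\<Sum>j\<in>C. e j * H v j) = b * v j0" for v
  proof -
    have "(\<Sum>j\<in>C. e j * H v j) = (\<Sum>j\<in>C. H e j * v j)" unfolding H_def by (rule reflection_self_adjoint[symmetric])
    also have "\<dots> = (\<Sum>j\<in>C. v j * \<epsilon> j)" by (intro sum.cong) (auto simp: He)
    finally show ?thesis by (simp only: s\<epsilon>)
  qed
  have sq: "sqlen R C (reflect_cols R C (\<lambda>j. e j - \<epsilon> j) Y) v = sqlen R C Y (H v)" for v
    unfolding sqlen_def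
  proof (rule sum.cong[OF refl])
    fix i assume "i \<in> R"
    then have "(\<Sum>j\<in>C. reflect_cols R C (\<lambda>j. e j - \<epsilon> j) Y (i, j) * v j) = (\<Sum>j\<in>C. H (\<lambda>l. Y (i, l)) j * v j)"
      by (simp add: reflect_cols_def H_def)
    also have "\<dots> = (\<Sum>j\<in>C. Y (i, j) * H v j)"
      unfolding H_def by (rule reflection_self_adjoint)
    finally show "(\<Sum>j\<in>C. reflect_cols R C (\<lambda>j. e j - \<epsilon> j) Y (i, j) * v j)\<^sup>2 = (\<Sum>j\<in>C. Y (i, j) * H v j)\<^sup>2"
      by (rule arg_cong)
  qed
  have vd: "vdir R C j0 Y e = vmin R C (reflect_cols R C (\<lambda>j. e j - \<epsilon> j) Y) j0"
    by (simp add: vdir_def \<epsilon>_def)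
  have bil: "(\<Sum>i\<in>R. (\<Sum>j\<in>C. Y (i, j) * w j) * (\<Sum>l\<in>C. Y (i, l) * g l)) = (\<Sum>j\<in>C. w j * e j)" for w
  proof -
    have "(\<Sum>i\<in>R. (\<Sum>j\<in>C. Y (i, j) * w j) * (\<Sum>l\<in>C. Y (i, l) * g l))
      = (\<Sum>i\<in>R. \<Sum>j\<in>C. \<Sum>l\<in>C. w j * (Y (i, j) * Y (i, l) * g l))"
      unfolding sum_product by (simp add: mult_ac)
    also have "\<dots> = (\<Sum>j\<in>C. \<Sum>l\<in>C. \<Sum>i\<in>R. w j * (Y (i, j) * Y (i, l) * g l))"
      by (subst sum.swap) (intro sum.cong refl sum.swap)
    also have "\<dots> = (\<Sum>j\<in>C. w j * (\<Sum>l\<in>C. (\<Sum>i\<in>R. Y (i, j) * Y (i, l)) * g l))"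
      by (simp add: sum_distrib_left sum_distrib_right)
    also have "\<dots> = (\<Sum>j\<in>C. w j * e j)" by (intro sum.cong) (auto simp: g)
    finally show ?thesis .
  qed
  have sg: "sqlen R C Y g = eg"
    using bil[of g] by (simp add: sqlen_def power2_eq_square eg_def mult.commute)
  have eg0: "eg \<ge> 0" using sqlen_nonneg[of R C Y g] sg by simp
  have low: "b\<^sup>2 \<le> sqlen R C Y w * eg" if "(\<Sum>j\<in>C. e j * w j) = b" for w
  proof -
    have "(\<Sum>i\<in>R. (\<Sum>j\<in>C. Y (i, j) * w j) * (\<Sum>l\<in>C. Y (i, l) * g l))\<^sup>2 \<le> sqlen R C Y w * sqlen R C Y g"
      unfolding sqlen_def by (rule Cauchy_Schwarz_ineq_sum)
    moreover have "(\<Sum>j\<in>C. w j * e j) = b" using that by (simp add: mult.commute)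
    ultimately show ?thesis by (simp add: bil sg)
  qed
  show ?thesis
  proof (cases "eg = 0")
    case True
    have "b = 0"
    proof -
      have "sqlen R C Y g = 0" using sg True by simp
      then have Yg: "\<And>i. i \<in> R \<Longrightarrow> (\<Sum>l\<in>C. Y (i, l) * g l) = 0" using R by (simp add: sqlen_def sum_nonneg_eq_0_iff)
      have "(\<Sum>j\<in>C. e j * e j) = 0" using bil[of e] Yg by simp
      then show ?thesis using b2 by (simp add: power2_eq_square)
    qed
    then show ?thesis using True b2 by (simp add: eg_def)
  next
    case False
    then have egp: "eg > 0" using eg0 by simp
    have "vdir R C j0 Y e = b\<^sup>2 / eg"
    proof (rule antisym)
      show "b\<^sup>2 / eg \<le> vdir R C j0 Y e"
        unfolding vd
      proof (rule vmin_ge)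
        fix v :: "'b \<Rightarrow> real" assume "v j0 = 1"
        then have "b\<^sup>2 \<le> sqlen R C Y (H v) * eg" by (intro low) (simp add: He2)
        then show "b\<^sup>2 / eg \<le> sqlen R C (reflect_cols R C (\<lambda>j. e j - \<epsilon> j) Y) v"
          using egp by (simp add: sq pos_divide_le_eq)
      qed
    next
      show "vdir R C j0 Y e \<le> b\<^sup>2 / eg"
      proof (cases "b = 0")
        case True
        define v where "v j = (if j = j0 then 1 else 0 :: real)" for j
        have e0: "e j = 0" if "j \<in> C" for j using b2 True C that by (simp add: sum_nonneg_eq_0_iff)
        then have "eg = 0" by (simp add: eg_def)
        then show ?thesis using egp by simp
      next
        case False
        then have bp: "b > 0" using b0 by simp
        define w where "w j = (b / eg) * g j" for j
        define v where "v = H w"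
        have Hv: "H v j = w j" if "j \<in> C" for j unfolding v_def H_def by (rule reflection_involution[OF C(1) that])
        have ew: "(\<Sum>j\<in>C. e j * w j) = b"
        proof -
          have "(\<Sum>j\<in>C. e j * w j) = (\<Sum>j\<in>C. (b / eg) * (e j * g j))" by (simp add: w_def mult_ac)
          also have "\<dots> = (b / eg) * eg" by (simp only: sum_distrib_left[symmetric] eg_def)
          finally have "(\<Sum>j\<in>C. e j * w j) = (b / eg) * eg" .
          then show ?thesis using egp by simp
        qed
        have "b * v j0 = (\<Sum>j\<in>C. e j * H v j)" by (rule He2[symmetric])
        also have "\<dots> = b" using ew by (simp add: Hv)
        finally have "v j0 = 1" using bp by simp
        then have "vdir R C j0 Y e \<le> sqlen R C Y (H v)" unfolding vd sq[symmetric] by (rule vmin_le)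
        also have "\<dots> = sqlen R C Y w" by (simp add: sqlen_def Hv)
        also have "\<dots> = (b / eg)\<^sup>2 * sqlen R C Y g"
        proof -
          have "(\<Sum>j\<in>C. Y (i, j) * w j) = (b / eg) * (\<Sum>j\<in>C. Y (i, j) * g j)" for i
            by (simp add: w_def sum_distrib_left mult_ac)
          then have "sqlen R C Y w = (\<Sum>i\<in>R. ((b / eg) * (\<Sum>j\<in>C. Y (i, j) * g j))\<^sup>2)" by (simp only: sqlen_def)
          also have "\<dots> = (\<Sum>i\<in>R. (b / eg)\<^sup>2 * (\<Sum>j\<in>C. Y (i, j) * g j)\<^sup>2)" by (simp only: power_mult_distrib)
          finally show ?thesis by (simp only: sqlen_def sum_distrib_left[symmetric])
        qed
        also have "\<dots> = b\<^sup>2 / eg" using egp by (simp add: sg power2_eq_square)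
        finally show ?thesis .
      qed
    qed
    then show ?thesis using egp by (simp add: eg_def[symmetric] b2)
  qed
qed

section \<open>Triangular maps and the Cholesky factorisation\<close>

definition lower_triangular :: "nat \<Rightarrow> (nat \<Rightarrow> nat \<Rightarrow> real) \<Rightarrow> bool" where
  "lower_triangular p L \<longleftrightarrow> (\<forall>j<p. L j j > 0) \<and> (\<forall>j l. j < l \<longrightarrow> L j l = 0)"

lemma lower_triangular_Suc: "lower_triangular (Suc p) L \<Longrightarrow> lower_triangular p L"
  by (simp add: lower_triangular_def)

lemma forward_substitution:
  assumes "lower_triangular p L"
  shows "\<exists>w. \<forall>j<p. (\<Sum>k<p. L j k * w k) = b j"
  using assms
proof (induction p)
  case (Suc p)
  then obtain w where w: "\<And>j. j < p \<Longrightarrow> (\<Sum>k<p. L j k * w k) = b j" using lower_triangular_Suc by blast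
  define w' where "w' = w(p := (b p - (\<Sum>k<p. L p k * w k)) / L p p)"
  have e: "(\<Sum>k<p. L j k * w' k) = (\<Sum>k<p. L j k * w k)" for j by (intro sum.cong) (auto simp: w'_def)
  have "(\<Sum>k<Suc p. L j k * w' k) = b j" if "j < Suc p" for j
  proof (cases "j = p")
    case True
    have "L p p \<noteq> 0" using Suc.prems by (simp add: lower_triangular_def less_imp_neq[symmetric])
    then show ?thesis using True by (simp add: e) (simp add: w'_def)
  next
    case False
    then have "L j p = 0" "j < p" using Suc.prems that by (auto simp: lower_triangular_def)
    then show ?thesis by (simp add: e w)
  qed
  then show ?case by blast
qed simp

lemma back_substitution:
  assumes "lower_triangular p L"
  shows "\<exists>v. \<forall>k<p. (\<Sum>j<p. L j k * v j) = w k"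
  using assms
proof (induction p arbitrary: w)
  case (Suc p)
  define t where "t = w p / L p p"
  from Suc.IH[OF lower_triangular_Suc[OF Suc.prems], of "\<lambda>k. w k - L p k * t"]
  obtain v where v: "\<And>k. k < p \<Longrightarrow> (\<Sum>j<p. L j k * v j) = w k - L p k * t" by blast
  define v' where "v' = v(p := t)"
  have e: "(\<Sum>j<p. L j k * v' j) = (\<Sum>j<p. L j k * v j)" for k by (intro sum.cong) (auto simp: v'_def)
  have "(\<Sum>j<Suc p. L j k * v' j) = w k" if "k < Suc p" for k
  proof (cases "k = p")
    case True
    have "L p p \<noteq> 0" using Suc.prems by (simp add: lower_triangular_def less_imp_neq[symmetric])
    moreover have "(\<Sum>j<p. L j p * v j) = 0" using Suc.prems by (intro sum.neutral) (auto simp: lower_triangular_def)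
    ultimately show ?thesis using True by (simp add: e) (simp add: v'_def t_def)
  next
    case False
    then show ?thesis using that by (simp add: e v) (simp add: v'_def)
  qed
  then show ?case by blast
qed simp

lemma lower_triangular_mult_inj:
  assumes L: "lower_triangular p L" and eq: "\<And>j. j < p \<Longrightarrow> (\<Sum>k<p. L j k * x k) = (\<Sum>k<p. L j k * y k)" and "k < p"
  shows "x k = y k"
proof -
  define d where "d k = x k - y k" for k
  have 0: "(\<Sum>k<p. L j k * d k) = 0" if "j < p" for j
    using eq[OF that] by (simp add: d_def right_diff_distrib sum_subtractf)
  obtain v where v: "\<And>k. k < p \<Longrightarrow> (\<Sum>j<p. L j k * v j) = d k" using back_substitution[OF L, of d] by blast
  have "(\<Sum>k<p. d k * d k) = (\<Sum>k<p. (\<Sum>j<p. L j k * v j) * d k)" by (simp add: v)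
  also have "\<dots> = (\<Sum>j<p. v j * (\<Sum>k<p. L j k * d k))"
    unfolding sum_distrib_left sum_distrib_right by (subst sum.swap) (simp add: mult_ac)
  also have "\<dots> = 0" by (simp add: 0)
  finally have "d k * d k = 0" using \<open>k < p\<close> by (simp add: sum_nonneg_eq_0_iff)
  then show ?thesis by (simp add: d_def)
qed

lemma transposed_lower_triangular_mult_inj:
  assumes L: "lower_triangular p L" and 0: "\<And>k. k < p \<Longrightarrow> (\<Sum>j<p. L j k * d j) = 0" and "j < p"
  shows "d j = 0"
proof -
  obtain w where w: "\<And>j. j < p \<Longrightarrow> (\<Sum>k<p. L j k * w k) = d j" using forward_substitution[OF L, of d] by blast
  have "(\<Sum>j<p. d j * d j) = (\<Sum>j<p. (\<Sum>k<p. L j k * w k) * d j)" by (simp add: w)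
  also have "\<dots> = (\<Sum>k<p. w k * (\<Sum>j<p. L j k * d j))"
    unfolding sum_distrib_left sum_distrib_right by (subst sum.swap) (simp add: mult_ac)
  also have "\<dots> = 0" by (simp add: 0)
  finally have "d j * d j = 0" using \<open>j < p\<close> by (simp add: sum_nonneg_eq_0_iff)
  then show ?thesis by simp
qed

text \<open>Bordering: with \<open>L w = s\<close> for the new column \<open>s\<close>, the new diagonal entry is the root of the Schur complement, and this is the value of the form at a vector obtained by back substitution, hence positive.\<close>
lemma cholesky_functions:
  assumes "\<And>i j. i < p \<Longrightarrow> j < p \<Longrightarrow> s i j = s j i"
    and "\<And>v. (\<exists>j<p. v j \<noteq> 0) \<Longrightarrow> (\<Sum>i<p. \<Sum>j<p. s i j * v i * v j) > (0 :: real)"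
  shows "\<exists>L. lower_triangular p L \<and> (\<forall>i<p. \<forall>j<p. s i j = (\<Sum>k<p. L i k * L j k))"
  using assms
proof (induction p)
  case 0
  show ?case by (intro exI[of _ "\<lambda>_ _. 0"]) (simp add: lower_triangular_def)
next
  case (Suc p)
  have "\<exists>L. lower_triangular p L \<and> (\<forall>i<p. \<forall>j<p. s i j = (\<Sum>k<p. L i k * L j k))"
  proof (rule Suc.IH)
    fix v :: "nat \<Rightarrow> real" assume "\<exists>j<p. v j \<noteq> 0"
    then have "0 < (\<Sum>i<Suc p. \<Sum>j<Suc p. s i j * (v(p := 0)) i * (v(p := 0)) j)"
      by (intro Suc.prems(2)) (auto simp: less_Suc_eq)
    also have "\<dots> = (\<Sum>i<p. \<Sum>j<p. s i j * (v(p := 0)) i * (v(p := 0)) j)" by simp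
    also have "\<dots> = (\<Sum>i<p. \<Sum>j<p. s i j * v i * v j)" by (intro sum.cong) auto
    finally show "0 < (\<Sum>i<p. \<Sum>j<p. s i j * v i * v j)" .
  qed (use Suc.prems in simp)
  then obtain L where L: "lower_triangular p L" "\<And>i j. i < p \<Longrightarrow> j < p \<Longrightarrow> s i j = (\<Sum>k<p. L i k * L j k)" by blast
  obtain w where w: "\<And>j. j < p \<Longrightarrow> (\<Sum>k<p. L j k * w k) = s j p" using forward_substitution[OF L(1), of "\<lambda>j. s j p"] by blast
  obtain v where v: "\<And>k. k < p \<Longrightarrow> (\<Sum>j<p. L j k * v j) = w k" using back_substitution[OF L(1), of w] by blast
  define W where "W = (\<Sum>k<p. w k * w k)"
  have "0 < (\<Sum>i<Suc p. \<Sum>j<Suc p. s i j * (v(p := -1)) i * (v(p := -1)) j)"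
    by (intro Suc.prems(2)) (auto intro!: exI[of _ p])
  also have "\<dots> = (\<Sum>i<p. \<Sum>j<p. s i j * v i * v j) - (\<Sum>i<p. s i p * v i) - (\<Sum>j<p. s p j * v j) + s p p"
  proof -
    have "(\<Sum>i<p. \<Sum>j<p. s i j * (v(p := -1)) i * (v(p := -1)) j) = (\<Sum>i<p. \<Sum>j<p. s i j * v i * v j)"
      "(\<Sum>i<p. s i p * (v(p := -1)) i) = (\<Sum>i<p. s i p * v i)"
      "(\<Sum>j<p. s p j * (v(p := -1)) j) = (\<Sum>j<p. s p j * v j)"
      by (intro sum.cong refl; simp)+
    then show ?thesis by (simp add: sum.distrib sum_negf del: fun_upd_apply) (simp add: sum_negf)
  qed
  also have "(\<Sum>j<p. s p j * v j) = (\<Sum>i<p. s i p * v i)" by (intro sum.cong) (use Suc.prems(1) in auto)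
  also have "(\<Sum>i<p. s i p * v i) = W"
  proof -
    have "(\<Sum>i<p. s i p * v i) = (\<Sum>i<p. (\<Sum>k<p. L i k * w k) * v i)" by (simp add: w)
    also have "\<dots> = (\<Sum>k<p. w k * (\<Sum>i<p. L i k * v i))"
      unfolding sum_distrib_left sum_distrib_right by (subst sum.swap) (simp add: mult_ac)
    finally show ?thesis by (simp add: v W_def)
  qed
  also have "(\<Sum>i<p. \<Sum>j<p. s i j * v i * v j) = W"
  proof -
    have "(\<Sum>i<p. \<Sum>j<p. s i j * v i * v j) = (\<Sum>i<p. \<Sum>j<p. \<Sum>k<p. (L i k * v i) * (L j k * v j))"
      by (intro sum.cong refl) (simp add: L(2) sum_distrib_left sum_distrib_right mult_ac)
    also have "\<dots> = (\<Sum>i<p. \<Sum>k<p. \<Sum>j<p. (L i k * v i) * (L j k * v j))"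
      by (intro sum.cong refl sum.swap)
    also have "\<dots> = (\<Sum>k<p. \<Sum>i<p. \<Sum>j<p. (L i k * v i) * (L j k * v j))" by (rule sum.swap)
    also have "\<dots> = (\<Sum>k<p. (\<Sum>i<p. L i k * v i) * (\<Sum>j<p. L j k * v j))" by (simp only: sum_product)
    finally show ?thesis by (simp add: v W_def)
  qed
  finally have pos: "0 < s p p - W" by simp
  define L' where "L' i k = (if i = p then (if k < p then w k else if k = p then sqrt (s p p - W) else 0) else L i k)" for i k
  have "lower_triangular (Suc p) L'"
    using L(1) pos by (auto simp: lower_triangular_def L'_def less_Suc_eq)
  moreover have "s i j = (\<Sum>k<Suc p. L' i k * L' j k)" if ij: "i < Suc p" "j < Suc p" for i j
  proof -
    have z: "L i p = 0" if "i < p" for i using that L(1) by (simp add: lower_triangular_def)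
    have sq: "sqrt (s p p - W) * sqrt (s p p - W) = s p p - W" using pos by simp
    consider "i < p" "j < p" | "i < p" "j = p" | "i = p" "j < p" | "i = p" "j = p" using ij by (auto simp: less_Suc_eq)
    then show ?thesis
    proof cases
      case 1 then show ?thesis by (simp add: L'_def L(2) z)
    next
      case 2 then show ?thesis using w[of i] by (simp add: L'_def z)
    next
      case 3 then show ?thesis using w[of j] Suc.prems(1)[of p j] by (simp add: L'_def z mult.commute)
    next
      case 4 then show ?thesis using pos by (simp add: L'_def W_def)
    qed
  qed
  ultimately show ?case by blast
qed

definition tri_affine :: "nat \<Rightarrow> (nat \<Rightarrow> real) \<Rightarrow> (nat \<Rightarrow> nat \<Rightarrow> real) \<Rightarrow> (nat \<Rightarrow> real) \<Rightarrow> nat \<Rightarrow> real" where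
  "tri_affine p m L z = (\<lambda>j\<in>{..<p}. m j + (\<Sum>k<p. L j k * z k))"

lemma measurable_tri_affine [measurable]:
  "tri_affine p m L \<in> measurable (\<Pi>\<^sub>M j\<in>{..<p}. borel) (\<Pi>\<^sub>M j\<in>{..<p}. borel)"
  unfolding tri_affine_def by measurable

text \<open>Triangularity allows the coordinates to be substituted one after the other, each by a one-dimensional affine map; the Jacobian is the product of the diagonal.\<close>
lemma nn_integral_tri_affine:
  assumes L: "lower_triangular p L" and f: "f \<in> borel_measurable (\<Pi>\<^sub>M j\<in>{..<p}. (borel :: real measure))"
  shows "ennreal (\<Prod>j<p. L j j) * (\<integral>\<^sup>+z. f (tri_affine p m L z) \<partial>(\<Pi>\<^sub>M j\<in>{..<p}. lborel))
    = (\<integral>\<^sup>+x. f x \<partial>(\<Pi>\<^sub>M j\<in>{..<p}. lborel))"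
  using assms
proof (induction p arbitrary: f)
  case 0
  show ?case by (simp add: tri_affine_def PiM_empty nn_integral_count_space_finite)
next
  case (Suc p)
  have Lp: "L p p > 0" using Suc.prems(1) by (simp add: lower_triangular_def)
  have lessThan: "{..<Suc p} = insert p {..<p}" by auto
  have f[measurable]: "f \<in> borel_measurable (\<Pi>\<^sub>M j\<in>insert p {..<p}. borel)" using Suc.prems(2) by (simp add: lessThan)
  define F where "F x = (\<integral>\<^sup>+t. f (x(p := t)) \<partial>lborel)" for x
  have Fm0: "(\<lambda>(x, t). f (x(p := t))) \<in> borel_measurable ((\<Pi>\<^sub>M j\<in>{..<p}. borel) \<Otimes>\<^sub>M lborel)"
  proof -
    have "(\<lambda>q. (fst q)(p := snd q)) \<in> measurable ((\<Pi>\<^sub>M j\<in>{..<p}. borel) \<Otimes>\<^sub>M lborel) (\<Pi>\<^sub>M j\<in>insert p {..<p}. (borel :: real measure))"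
      by measurable
    from measurable_compose[OF this f] show ?thesis by (simp add: split_beta')
  qed
  then have F[measurable]: "F \<in> borel_measurable (\<Pi>\<^sub>M j\<in>{..<p}. borel)"
    unfolding F_def by (rule lborel.borel_measurable_nn_integral)
  have upd: "tri_affine (Suc p) m L (z(p := t)) = (tri_affine p m L z)(p := (m p + (\<Sum>k<p. L p k * z k)) + L p p * t)" for z t
  proof
    fix j
    have e: "(\<Sum>k<p. L j k * (z(p := t)) k) = (\<Sum>k<p. L j k * z k)" by (intro sum.cong) auto
    show "tri_affine (Suc p) m L (z(p := t)) j = ((tri_affine p m L z)(p := (m p + (\<Sum>k<p. L p k * z k)) + L p p * t)) j"
      using e Suc.prems(1) by (cases "j = p"; cases "j < p") (auto simp: tri_affine_def lower_triangular_def)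
  qed
  have inner: "ennreal (L p p) * (\<integral>\<^sup>+t. f ((tri_affine p m L z)(p := c + L p p * t)) \<partial>lborel) = F (tri_affine p m L z)" for z c
  proof -
    have sp: "tri_affine p m L z \<in> space (\<Pi>\<^sub>M j\<in>{..<p}. borel)" by (auto simp: space_PiM tri_affine_def)
    from measurable_Pair2[OF Fm0 sp] have "(\<lambda>t. f ((tri_affine p m L z)(p := t))) \<in> borel_measurable borel" by simp
    from nn_integral_real_affine[OF this, of "L p p" c] show ?thesis using Lp by (simp add: F_def)
  qed
  have m2: "(\<lambda>z. \<integral>\<^sup>+t. f ((tri_affine p m L z)(p := (m p + (\<Sum>k<p. L p k * z k)) + L p p * t)) \<partial>lborel) \<in> borel_measurable (\<Pi>\<^sub>M j\<in>{..<p}. lborel)"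
  proof (rule lborel.borel_measurable_nn_integral)
    have "(\<lambda>q. (tri_affine p m L (fst q))(p := (m p + (\<Sum>k<p. L p k * (fst q) k)) + L p p * snd q)) \<in> measurable ((\<Pi>\<^sub>M j\<in>{..<p}. borel) \<Otimes>\<^sub>M lborel) (\<Pi>\<^sub>M j\<in>insert p {..<p}. borel)"
      by measurable
    from measurable_compose[OF this f]
    show "(\<lambda>(z, t). f ((tri_affine p m L z)(p := (m p + (\<Sum>k<p. L p k * z k)) + L p p * t))) \<in> borel_measurable ((\<Pi>\<^sub>M j\<in>{..<p}. lborel) \<Otimes>\<^sub>M lborel)"
      by (simp add: split_beta' cong: measurable_cong_sets sets_pair_measure_cong)
  qed
  have "(\<integral>\<^sup>+z. f (tri_affine (Suc p) m L z) \<partial>(\<Pi>\<^sub>M j\<in>{..<Suc p}. lborel))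
    = (\<integral>\<^sup>+z. \<integral>\<^sup>+t. f ((tri_affine p m L z)(p := (m p + (\<Sum>k<p. L p k * z k)) + L p p * t)) \<partial>lborel \<partial>(\<Pi>\<^sub>M j\<in>{..<p}. lborel))"
    (is "_ = ?I")
  proof -
    have "(\<lambda>z. f (tri_affine (Suc p) m L z)) \<in> borel_measurable (\<Pi>\<^sub>M j\<in>insert p {..<p}. lborel)"
      using measurable_compose[OF measurable_tri_affine Suc.prems(2), of m L] by (simp add: lessThan cong: measurable_cong_sets)
    then show ?thesis
      unfolding lessThan by (subst product_lborel.product_nn_integral_insert) (simp_all only: upd finite_lessThan lessThan_iff less_irrefl not_False_eq_True)
  qed
  then have "ennreal (\<Prod>j<Suc p. L j j) * (\<integral>\<^sup>+z. f (tri_affine (Suc p) m L z) \<partial>(\<Pi>\<^sub>M j\<in>{..<Suc p}. lborel))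
    = ennreal (\<Prod>j<p. L j j) * (ennreal (L p p) * ?I)"
  proof -
    have "(\<Prod>j<p. L j j) \<ge> 0"
      using Suc.prems(1) by (intro prod_nonneg) (auto simp: lower_triangular_def intro: less_imp_le)
    then have "ennreal (\<Prod>j<Suc p. L j j) = ennreal (\<Prod>j<p. L j j) * ennreal (L p p)"
      by (simp add: ennreal_mult')
    moreover assume "(\<integral>\<^sup>+z. f (tri_affine (Suc p) m L z) \<partial>(\<Pi>\<^sub>M j\<in>{..<Suc p}. lborel)) = ?I"
    ultimately show ?thesis by (simp only: mult.assoc)
  qed
  also have "ennreal (L p p) * ?I = (\<integral>\<^sup>+z. F (tri_affine p m L z) \<partial>(\<Pi>\<^sub>M j\<in>{..<p}. lborel))"
    using m2 by (subst nn_integral_cmult[symmetric]) (simp_all only: inner)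
  also have "ennreal (\<Prod>j<p. L j j) * \<dots> = (\<integral>\<^sup>+x. F x \<partial>(\<Pi>\<^sub>M j\<in>{..<p}. lborel))"
    by (rule Suc.IH[OF lower_triangular_Suc[OF Suc.prems(1)] F])
  also have "\<dots> = (\<integral>\<^sup>+x. f x \<partial>(\<Pi>\<^sub>M j\<in>{..<Suc p}. lborel))"
    unfolding lessThan F_def
    using f by (subst product_lborel.product_nn_integral_insert) (auto cong: measurable_cong_sets)
  finally show ?case .
qed

section \<open>Normal samples as affine images of Gaussian matrices\<close>

lemma mult_mat_vec_sum:
  assumes "A \<in> carrier_mat p p" "v \<in> carrier_vec p" "i < p"
  shows "(A *\<^sub>v v) $ i = (\<Sum>j<p. A $$ (i, j) * v $ j)"
  using assms by (auto simp: scalar_prod_def lessThan_atLeast0 intro!: sum.cong)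

lemma scalar_prod_sum: "w \<in> carrier_vec p \<Longrightarrow> v \<bullet> w = (\<Sum>j<p. v $ j * w $ j)"
  by (simp add: scalar_prod_def lessThan_atLeast0)

lemma minverse_inverts:
  assumes A: "A \<in> carrier_mat p p" and det: "Determinant.det A \<noteq> 0"
  shows "minverse A \<in> carrier_mat p p" "A * minverse A = 1\<^sub>m p" "minverse A * A = 1\<^sub>m p"
proof -
  have "A \<in> Units (ring_mat TYPE(real) p ())" by (rule det_non_zero_imp_unit[OF A det])
  then obtain B where B: "mat_inverse A = Some B"
    using mat_inverse(1)[OF A, where b = "()"] by (cases "mat_inverse A") auto
  then show "minverse A \<in> carrier_mat p p" "A * minverse A = 1\<^sub>m p" "minverse A * A = 1\<^sub>m p"
    using mat_inverse(2)[OF A B] by (auto simp: minverse_def)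
qed

lemma quad_form_minverse:
  assumes A: "A \<in> carrier_mat p p" and det: "Determinant.det A \<noteq> 0" and u: "u \<in> carrier_vec p" "A *\<^sub>v u = d"
  shows "quad_form (minverse A) d = d \<bullet> u"
proof -
  have "minverse A *\<^sub>v d = (minverse A * A) *\<^sub>v u"
    unfolding u(2)[symmetric] by (rule assoc_mult_mat_vec[OF minverse_inverts(1)[OF A det] A u(1), symmetric])
  then show ?thesis using minverse_inverts[OF A det] u(1) by (simp add: quad_form_def)
qed

lemma minverse_solves:
  assumes A: "A \<in> carrier_mat p p" and det: "Determinant.det A \<noteq> 0" and d: "d \<in> carrier_vec p"
  shows "A *\<^sub>v (minverse A *\<^sub>v d) = d"
proof -
  have "A *\<^sub>v (minverse A *\<^sub>v d) = (A * minverse A) *\<^sub>v d"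
    by (rule assoc_mult_mat_vec[OF A minverse_inverts(1)[OF A det] d, symmetric])
  then show ?thesis using minverse_inverts[OF A det] d by simp
qed

definition factorizes :: "nat \<Rightarrow> (nat \<Rightarrow> nat \<Rightarrow> real) \<Rightarrow> real mat \<Rightarrow> bool" where
  "factorizes p L S \<longleftrightarrow> S \<in> carrier_mat p p \<and> lower_triangular p L \<and>
     (\<forall>i<p. \<forall>j<p. S $$ (i, j) = (\<Sum>k<p. L i k * L j k))"

lemma cholesky:
  assumes "pos_def_mat p S"
  shows "\<exists>L. factorizes p L S"
proof -
  from assms have S: "S \<in> carrier_mat p p" "transpose_mat S = S"
    and pos: "\<And>v. v \<in> carrier_vec p \<Longrightarrow> v \<noteq> 0\<^sub>v p \<Longrightarrow> quad_form S v > 0"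
    by (auto simp: pos_def_mat_def)
  have "\<exists>L. lower_triangular p L \<and> (\<forall>i<p. \<forall>j<p. S $$ (i, j) = (\<Sum>k<p. L i k * L j k))"
  proof (rule cholesky_functions)
    fix i j assume "i < p" "j < p"
    then have "transpose_mat S $$ (i, j) = S $$ (j, i)" using S(1) by simp
    then show "S $$ (i, j) = S $$ (j, i)" by (simp only: S(2))
  next
    fix v :: "nat \<Rightarrow> real" assume "\<exists>j<p. v j \<noteq> 0"
    then obtain j where j: "j < p" "v j \<noteq> 0" by blast
    have "Matrix.vec p v \<noteq> 0\<^sub>v p"
    proof
      assume "Matrix.vec p v = 0\<^sub>v p"
      then have "Matrix.vec p v $ j = 0\<^sub>v p $ j" by simp
      then show False using j by simp
    qed
    then have "0 < quad_form S (Matrix.vec p v)" by (intro pos) auto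
    also have "\<dots> = (\<Sum>i<p. v i * (\<Sum>j<p. S $$ (i, j) * v j))"
      unfolding quad_form_def
      by (subst scalar_prod_sum[of _ p])
        (use S(1) in \<open>auto simp: mult_mat_vec_sum simp del: index_mult_mat_vec intro!: sum.cong\<close>)
    also have "\<dots> = (\<Sum>i<p. \<Sum>j<p. S $$ (i, j) * v i * v j)" by (simp add: sum_distrib_left mult_ac)
    finally show "0 < (\<Sum>i<p. \<Sum>j<p. S $$ (i, j) * v i * v j)" .
  qed
  then show ?thesis using S(1) by (auto simp: factorizes_def)
qed

lemma det_factorizes:
  assumes "factorizes p L S"
  shows "Determinant.det S = (\<Prod>j<p. L j j)\<^sup>2" "(\<Prod>j<p. L j j) > 0"
proof -
  have L: "lower_triangular p L" and S: "S \<in> carrier_mat p p"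
    "\<And>i j. i < p \<Longrightarrow> j < p \<Longrightarrow> S $$ (i, j) = (\<Sum>k<p. L i k * L j k)"
    using assms by (auto simp: factorizes_def)
  define A where "A = Matrix.mat p p (\<lambda>(i, j). L i j)"
  have A: "A \<in> carrier_mat p p" by (simp add: A_def)
  have "S = A * transpose_mat A"
    by (rule eq_matI) (use S in \<open>auto simp: A_def scalar_prod_def lessThan_atLeast0 intro!: sum.cong\<close>)
  moreover have "Determinant.det A = (\<Prod>j<p. L j j)"
  proof -
    have "Determinant.det A = prod_list (diag_mat A)"
      by (rule det_lower_triangular[OF _ A]) (use L in \<open>auto simp: A_def lower_triangular_def\<close>)
    also have "\<dots> = (\<Prod>j<p. L j j)"
      by (simp add: diag_mat_def A_def prod.list_conv_set_nth lessThan_atLeast0)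
    finally show ?thesis .
  qed
  ultimately show "Determinant.det S = (\<Prod>j<p. L j j)\<^sup>2"
    using A by (simp add: det_mult[of _ p] det_transpose power2_eq_square)
  show "(\<Prod>j<p. L j j) > 0" using L by (intro prod_pos) (auto simp: lower_triangular_def)
qed

lemma factorizes_mult:
  assumes F: "factorizes p L S" and u: "u \<in> carrier_vec p" and i: "i < p"
  shows "(S *\<^sub>v u) $ i = (\<Sum>k<p. L i k * (\<Sum>j<p. L j k * u $ j))"
proof -
  have "(S *\<^sub>v u) $ i = (\<Sum>j<p. \<Sum>k<p. L i k * (L j k * u $ j))"
    using F u i by (subst mult_mat_vec_sum[of _ p]) (auto simp: factorizes_def sum_distrib_right sum_distrib_left mult_ac intro!: sum.cong)
  also have "\<dots> = (\<Sum>k<p. L i k * (\<Sum>j<p. L j k * u $ j))" by (subst sum.swap) (simp add: sum_distrib_left)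
  finally show ?thesis .
qed

lemma quad_form_minverse_factorizes:
  assumes F: "factorizes p L S" and d: "d \<in> carrier_vec p" "\<And>j. j < p \<Longrightarrow> d $ j = (\<Sum>k<p. L j k * z k)"
  shows "quad_form (minverse S) d = (\<Sum>k<p. (z k)\<^sup>2)"
proof -
  have L: "lower_triangular p L" and S: "S \<in> carrier_mat p p" using F by (auto simp: factorizes_def)
  obtain v where v: "\<And>k. k < p \<Longrightarrow> (\<Sum>j<p. L j k * v j) = z k" using back_substitution[OF L, of z] by blast
  define u where "u = Matrix.vec p v"
  have u: "u \<in> carrier_vec p" "\<And>k. k < p \<Longrightarrow> (\<Sum>j<p. L j k * u $ j) = z k" using v by (auto simp: u_def)
  have "S *\<^sub>v u = d"
    by (rule eq_vecI) (use S d u in \<open>auto simp: factorizes_mult[OF F] simp del: index_mult_mat_vec\<close>)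
  then have "quad_form (minverse S) d = d \<bullet> u"
    using zero_less_power[OF det_factorizes(2)[OF F], of 2]
    by (intro quad_form_minverse[OF S _ u(1)]) (simp_all only: det_factorizes(1)[OF F])
  also have "\<dots> = (\<Sum>j<p. (\<Sum>k<p. L j k * z k) * u $ j)" using d u by (simp add: scalar_prod_sum[of _ p])
  also have "\<dots> = (\<Sum>k<p. z k * (\<Sum>j<p. L j k * u $ j))"
    unfolding sum_distrib_left sum_distrib_right by (subst sum.swap) (simp add: mult_ac)
  also have "\<dots> = (\<Sum>k<p. (z k)\<^sup>2)" by (simp add: u power2_eq_square)
  finally show ?thesis .
qed

lemma inj_on_vec: "inj_on (Matrix.vec p) (space (\<Pi>\<^sub>M j\<in>{..<p}. (lborel :: real measure)))"
proof (rule inj_onI)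
  fix x y :: "nat \<Rightarrow> real" assume xy: "x \<in> space (\<Pi>\<^sub>M j\<in>{..<p}. lborel)" "y \<in> space (\<Pi>\<^sub>M j\<in>{..<p}. lborel)"
    and eq: "Matrix.vec p x = Matrix.vec p y"
  show "x = y"
  proof
    fix j
    have "Matrix.vec p x $ j = Matrix.vec p y $ j" using eq by simp
    then show "x j = y j" using xy by (cases "j < p") (auto simp: space_PiM PiE_def extensional_def)
  qed
qed

lemma measurable_vec: "Matrix.vec p \<in> measurable (\<Pi>\<^sub>M j\<in>{..<p}. borel) (lborel_vec p)"
  using measurable_embed_measure2'[OF inj_on_vec, of p]
  unfolding lborel_vec_def measurable_cong_sets[OF sets_PiM_lborel refl] .

lemma measurable_vec_index [measurable]:
  assumes "j < p" shows "(\<lambda>v. v $ j) \<in> borel_measurable (lborel_vec p)"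
  unfolding lborel_vec_def by (rule measurable_embed_measure1) (use assms in simp)

text \<open>With \<open>S = L L'\<close> the exponent of the density is \<open>- \<bar>z\<bar>\<^sup>2 / 2\<close> at \<open>x = \<mu> + L z\<close> and the normalising constant contains the Jacobian of this map.\<close>
theorem mvn_eq_distr_gauss:
  assumes F: "factorizes p L S" and \<mu>: "\<mu> \<in> carrier_vec p"
    and dens: "(\<lambda>x. ennreal (mvn_density p \<mu> S x)) \<in> borel_measurable (lborel_vec p)"
  shows "density (lborel_vec p) (\<lambda>x. ennreal (mvn_density p \<mu> S x))
    = distr (gauss {..<p}) (lborel_vec p) (\<lambda>z. Matrix.vec p (tri_affine p (\<lambda>j. \<mu> $ j) L z))"
    (is "?D = distr _ _ ?t")
proof (rule measure_eqI)
  fix A assume "A \<in> sets ?D"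
  then have A: "A \<in> sets (lborel_vec p)" by simp
  have L: "lower_triangular p L" using F by (simp add: factorizes_def)
  let ?P = "\<Prod>j<p. L j j"
  note P = det_factorizes[OF F]
  have t: "?t \<in> measurable (\<Pi>\<^sub>M j\<in>{..<p}. borel) (lborel_vec p)"
    by (rule measurable_compose[OF measurable_tri_affine measurable_vec])
  have key: "ennreal ?P * ennreal (mvn_density p \<mu> S (?t z)) = ennreal (\<Prod>j<p. std_normal_density (z j))" for z
  proof -
    have "quad_form (minverse S) (?t z - \<mu>) = (\<Sum>k<p. (z k)\<^sup>2)"
      by (rule quad_form_minverse_factorizes[OF F]) (use \<mu> in \<open>auto simp: tri_affine_def\<close>)
    moreover have sq: "sqrt ((2 * pi) ^ p * Determinant.det S) = sqrt (2 * pi) ^ p * ?P"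
    proof -
      have "sqrt (?P\<^sup>2) = ?P" using P(2) by (simp only: real_sqrt_abs abs_of_pos)
      then show ?thesis by (simp only: P(1) real_sqrt_mult real_sqrt_power)
    qed
    moreover have "x > 0 \<Longrightarrow> y = s ^ p * x \<Longrightarrow> x * (e / y) = (1 / s) ^ p * e" for x y s e :: real
      by (simp add: power_one_over field_simps)
    from this[OF P(2) sq] have "?P * (e / sqrt ((2 * pi) ^ p * Determinant.det S)) = (1 / sqrt (2 * pi)) ^ p * e" for e .
    ultimately have "?P * mvn_density p \<mu> S (?t z) = (\<Prod>j<p. std_normal_density (z j))"
      by (simp only: mvn_density_def prod_std_normal_density card_lessThan)
    moreover have "ennreal ?P * ennreal (mvn_density p \<mu> S (?t z)) = ennreal (?P * mvn_density p \<mu> S (?t z))"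
      using P(2) by (simp add: ennreal_mult')
    ultimately show ?thesis by simp
  qed
  have m1: "(\<lambda>x. ennreal (mvn_density p \<mu> S x) * indicator A x) \<in> borel_measurable (lborel_vec p)"
    using dens A by measurable
  have m2: "(\<lambda>x. ennreal (mvn_density p \<mu> S (Matrix.vec p x)) * indicator A (Matrix.vec p x)) \<in> borel_measurable (\<Pi>\<^sub>M j\<in>{..<p}. borel)"
    by (rule measurable_compose[OF measurable_vec m1])
  have "emeasure ?D A = (\<integral>\<^sup>+x. ennreal (mvn_density p \<mu> S x) * indicator A x \<partial>lborel_vec p)"
    by (rule emeasure_density[OF dens A])
  also have "\<dots> = (\<integral>\<^sup>+x. ennreal (mvn_density p \<mu> S (Matrix.vec p x)) * indicator A (Matrix.vec p x) \<partial>(\<Pi>\<^sub>M j\<in>{..<p}. lborel))"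
    using m1 unfolding lborel_vec_def by (rule nn_integral_embed_measure'[OF inj_on_vec])
  also have "\<dots> = ennreal ?P * (\<integral>\<^sup>+z. ennreal (mvn_density p \<mu> S (?t z)) * indicator A (?t z) \<partial>(\<Pi>\<^sub>M j\<in>{..<p}. lborel))"
    by (rule nn_integral_tri_affine[OF L m2, symmetric])
  also have "\<dots> = (\<integral>\<^sup>+z. ennreal ?P * (ennreal (mvn_density p \<mu> S (?t z)) * indicator A (?t z)) \<partial>(\<Pi>\<^sub>M j\<in>{..<p}. lborel))"
  proof (rule nn_integral_cmult[symmetric])
    show "(\<lambda>z. ennreal (mvn_density p \<mu> S (?t z)) * indicator A (?t z)) \<in> borel_measurable (\<Pi>\<^sub>M j\<in>{..<p}. lborel)"
      using measurable_compose[OF t m1] by (simp cong: measurable_cong_sets)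
  qed
  also have "\<dots> = (\<integral>\<^sup>+z. ennreal (\<Prod>j<p. std_normal_density (z j)) * indicator A (?t z) \<partial>(\<Pi>\<^sub>M j\<in>{..<p}. lborel))"
    by (simp only: mult.assoc[symmetric] key)
  also have "\<dots> = (\<integral>\<^sup>+z. indicator A (?t z) \<partial>gauss {..<p})"
    by (rule nn_integral_gauss[symmetric]) (use t A in measurable)
  also have "\<dots> = (\<integral>\<^sup>+x. indicator A x \<partial>distr (gauss {..<p}) (lborel_vec p) ?t)"
    by (rule nn_integral_distr[symmetric]) (use t A in \<open>auto cong: measurable_cong_sets\<close>)
  also have "\<dots> = emeasure (distr (gauss {..<p}) (lborel_vec p) ?t) A" using A by simp
  finally show "emeasure ?D A = emeasure (distr (gauss {..<p}) (lborel_vec p) ?t) A" .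
qed simp

definition gauss_sample :: "nat \<Rightarrow> real Matrix.vec \<Rightarrow> (nat \<Rightarrow> nat \<Rightarrow> real) \<Rightarrow> (nat \<times> nat \<Rightarrow> real) \<Rightarrow> nat \<Rightarrow> real Matrix.vec" where
  "gauss_sample p \<mu> L z i = Matrix.vec p (tri_affine p (\<lambda>j. \<mu> $ j) L (\<lambda>j. z (i, j)))"

text \<open>Independent vectors are determined by their marginal laws, so the sample may be replaced by \<open>\<mu> + L z\<^sub>i\<close> with the rows \<open>z\<^sub>i\<close> of a Gaussian matrix.\<close>
theorem normal_sample_law:
  assumes sample: "normal_sample M N p \<mu> S X" and F: "factorizes p L S" and \<mu>: "\<mu> \<in> carrier_vec p" and N: "N > 0" and p: "p > 0"
    and A: "A \<in> sets (\<Pi>\<^sub>M i\<in>{..<N}. lborel_vec p)"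
  shows "measure M {\<omega> \<in> space M. (\<lambda>i\<in>{..<N}. X i \<omega>) \<in> A}
    = measure (gauss ({..<N} \<times> {..<p})) {z \<in> space (gauss ({..<N} \<times> {..<p})). (\<lambda>i\<in>{..<N}. gauss_sample p \<mu> L z i) \<in> A}"
proof -
  let ?K = "{..<N} \<times> {..<p}" and ?V = "\<lambda>_::nat. lborel_vec p"
  let ?t = "\<lambda>z. Matrix.vec p (tri_affine p (\<lambda>j. \<mu> $ j) L z)"
  define \<nu> where "\<nu> = distr (gauss {..<p}) (lborel_vec p) ?t"
  interpret M: prob_space M using sample by (simp add: normal_sample_def)
  have ind: "M.indep_vars ?V X {..<N}" using sample by (simp add: normal_sample_def)
  have dist: "distributed M (lborel_vec p) (X i) (\<lambda>x. ennreal (mvn_density p \<mu> S x))" if "i < N" for i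
    using sample that by (simp add: normal_sample_def)
  have rv: "X i \<in> measurable M (lborel_vec p)" if "i < N" for i
    using distributed_measurable[OF dist[OF that]] .
  have law: "distr M (lborel_vec p) (X i) = \<nu>" if "i < N" for i
    unfolding \<nu>_def distributed_distr_eq_density[OF dist[OF that]]
    by (rule mvn_eq_distr_gauss[OF F \<mu>]) (rule distributed_borel_measurable[OF dist[OF that]])
  have "distr M (\<Pi>\<^sub>M i\<in>{..<N}. lborel_vec p) (\<lambda>\<omega>. \<lambda>i\<in>{..<N}. X i \<omega>) = (\<Pi>\<^sub>M i\<in>{..<N}. distr M (lborel_vec p) (X i))"
    using ind N rv by (subst M.indep_vars_iff_distr_eq_PiM'[symmetric]) auto
  also have "\<dots> = (\<Pi>\<^sub>M i\<in>{..<N}. \<nu>)" by (rule PiM_cong) (auto simp: law)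
  finally have DX: "distr M (\<Pi>\<^sub>M i\<in>{..<N}. lborel_vec p) (\<lambda>\<omega>. \<lambda>i\<in>{..<N}. X i \<omega>) = (\<Pi>\<^sub>M i\<in>{..<N}. \<nu>)" .
  interpret G: prob_space "gauss ?K" by (rule prob_space_gauss)
  let ?Y = "\<lambda>i z. gauss_sample p \<mu> L z i"
  have Ym: "?Y i \<in> measurable (gauss ?K) (lborel_vec p)" if "i < N" for i
  proof -
    have "(\<lambda>z. tri_affine p (\<lambda>j. \<mu> $ j) L (\<lambda>j. z (i, j))) \<in> measurable (gauss ?K) (\<Pi>\<^sub>M j\<in>{..<p}. borel)"
      unfolding tri_affine_def
      using that by (intro measurable_restrict borel_measurable_add borel_measurable_sum borel_measurable_times
        borel_measurable_const measurable_compose[OF measurable_component_singleton]) auto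
    from measurable_compose[OF this measurable_vec] show ?thesis by (simp add: gauss_sample_def)
  qed
  have coords: "G.indep_vars (\<lambda>_. std_normal_distribution) (\<lambda>k z. z k) ?K" if "?K \<noteq> {}"
  proof (subst G.indep_vars_iff_distr_eq_PiM'[OF that])
    show "distr (gauss ?K) (gauss ?K) (\<lambda>x. \<lambda>i\<in>?K. x i) = (\<Pi>\<^sub>M i\<in>?K. distr (gauss ?K) std_normal_distribution (\<lambda>z. z i))"
    proof -
      have "distr (gauss ?K) (gauss ?K) (\<lambda>x. \<lambda>i\<in>?K. x i) = distr (gauss ?K) (gauss ?K) (\<lambda>x. x)"
        by (rule distr_cong) (auto simp: space_gauss)
      also have "\<dots> = gauss ?K" by (rule distr_id)
      also have "\<dots> = (\<Pi>\<^sub>M i\<in>?K. distr (gauss ?K) std_normal_distribution (\<lambda>z. z i))"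
        by (rule PiM_cong[OF refl], rule distr_PiM_component[symmetric]) (auto simp: prob_space_normal_density)
      finally show ?thesis .
    qed
  qed simp
  have rows: "G.indep_vars ?V ?Y {..<N}"
  proof -
    have K0: "?K \<noteq> {}" using N p by (auto simp: lessThan_empty_iff)
    define Z where "Z i = (\<lambda>y :: nat \<times> nat \<Rightarrow> real. ?t (\<lambda>j. y (i, j)))" for i
    have "G.indep_vars (\<lambda>i. \<Pi>\<^sub>M k\<in>{i} \<times> {..<p}. std_normal_distribution) (\<lambda>i z. restrict (\<lambda>k. z k) ({i} \<times> {..<p})) {..<N}"
      by (rule G.indep_vars_restrict[OF coords[OF K0]]) (auto simp: disjoint_family_on_def)
    then have "G.indep_vars ?V (\<lambda>i z. Z i (restrict (\<lambda>k. z k) ({i} \<times> {..<p}))) {..<N}"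
    proof (rule G.indep_vars_compose2)
      fix i assume "i \<in> {..<N}"
      have "(\<lambda>z. tri_affine p (\<lambda>j. \<mu> $ j) L (\<lambda>j. z (i, j))) \<in> measurable (gauss ({i} \<times> {..<p})) (\<Pi>\<^sub>M j\<in>{..<p}. borel)"
        unfolding tri_affine_def
        by (intro measurable_restrict borel_measurable_add borel_measurable_sum borel_measurable_times
          borel_measurable_const measurable_compose[OF measurable_component_singleton]) auto
      from measurable_compose[OF this measurable_vec] show "Z i \<in> measurable (gauss ({i} \<times> {..<p})) (lborel_vec p)"
        by (simp add: Z_def)
    qed
    moreover have "Z i (restrict (\<lambda>k. z k) ({i} \<times> {..<p})) = ?Y i z" for i z
      by (auto simp: Z_def gauss_sample_def tri_affine_def intro!: arg_cong[where f = "Matrix.vec p"] restrict_ext sum.cong)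
    ultimately show ?thesis by simp
  qed
  have lawY: "distr (gauss ?K) (lborel_vec p) (?Y i) = \<nu>" if "i < N" for i
  proof -
    have r: "distr (gauss ?K) (gauss {..<p}) (\<lambda>z. \<lambda>j\<in>{..<p}. z (i, j)) = gauss {..<p}"
      by (rule distr_PiM_reindex) (use that in \<open>auto simp: prob_space_normal_density inj_on_def\<close>)
    have rm: "(\<lambda>z. \<lambda>j\<in>{..<p}. z (i, j)) \<in> measurable (gauss ?K) (gauss {..<p})"
      using that by (intro measurable_restrict measurable_component_singleton) auto
    have tm: "?t \<in> measurable (gauss {..<p}) (lborel_vec p)"
      using measurable_compose[OF measurable_tri_affine measurable_vec] by (simp cong: measurable_cong_sets)
    have "\<nu> = distr (distr (gauss ?K) (gauss {..<p}) (\<lambda>z. \<lambda>j\<in>{..<p}. z (i, j))) (lborel_vec p) ?t"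
      by (simp add: r \<nu>_def)
    also have "\<dots> = distr (gauss ?K) (lborel_vec p) (?t \<circ> (\<lambda>z. \<lambda>j\<in>{..<p}. z (i, j)))"
      by (rule distr_distr[OF tm rm])
    also have "?t \<circ> (\<lambda>z. \<lambda>j\<in>{..<p}. z (i, j)) = ?Y i"
      by (auto simp: fun_eq_iff gauss_sample_def tri_affine_def intro!: arg_cong[where f = "Matrix.vec p"] restrict_ext sum.cong)
    finally show ?thesis by simp
  qed
  have "distr (gauss ?K) (\<Pi>\<^sub>M i\<in>{..<N}. lborel_vec p) (\<lambda>z. \<lambda>i\<in>{..<N}. ?Y i z) = (\<Pi>\<^sub>M i\<in>{..<N}. distr (gauss ?K) (lborel_vec p) (?Y i))"
    using rows N Ym by (subst G.indep_vars_iff_distr_eq_PiM'[symmetric]) auto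
  also have "\<dots> = (\<Pi>\<^sub>M i\<in>{..<N}. \<nu>)" by (rule PiM_cong) (auto simp: lawY)
  finally have DY: "distr (gauss ?K) (\<Pi>\<^sub>M i\<in>{..<N}. lborel_vec p) (\<lambda>z. \<lambda>i\<in>{..<N}. ?Y i z) = (\<Pi>\<^sub>M i\<in>{..<N}. \<nu>)" .
  have "measure M {\<omega> \<in> space M. (\<lambda>i\<in>{..<N}. X i \<omega>) \<in> A} = measure (distr M (\<Pi>\<^sub>M i\<in>{..<N}. lborel_vec p) (\<lambda>\<omega>. \<lambda>i\<in>{..<N}. X i \<omega>)) A"
    using rv A by (subst measure_distr) (auto intro!: measurable_restrict arg_cong[where f = "measure M"])
  also have "\<dots> = measure (distr (gauss ?K) (\<Pi>\<^sub>M i\<in>{..<N}. lborel_vec p) (\<lambda>z. \<lambda>i\<in>{..<N}. ?Y i z)) A"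
    by (simp only: DX DY)
  also have "\<dots> = measure (gauss ?K) {z \<in> space (gauss ?K). (\<lambda>i\<in>{..<N}. ?Y i z) \<in> A}"
    using Ym A by (subst measure_distr) (auto intro!: measurable_restrict arg_cong[where f = "measure (gauss ?K)"])
  finally show ?thesis .
qed

section \<open>Measurability of the test statistic and the rotated sample\<close>

lemma borel_measurable_det:
  assumes A: "\<And>\<omega>. A \<omega> \<in> carrier_mat n n"
    and m: "\<And>i j. i < n \<Longrightarrow> j < n \<Longrightarrow> (\<lambda>\<omega>. A \<omega> $$ (i, j)) \<in> borel_measurable M"
  shows "(\<lambda>\<omega>. Determinant.det (A \<omega>) :: real) \<in> borel_measurable M"
proof -
  have "(\<lambda>\<omega>. Determinant.det (A \<omega>)) = (\<lambda>\<omega>. \<Sum>p\<in>{p. p permutes {0..<n}}. signof p * (\<Prod>i = 0..<n. A \<omega> $$ (i, p i)))"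
    by (rule ext) (rule det_def'[OF A])
  moreover have "(\<lambda>\<omega>. A \<omega> $$ (i, p i)) \<in> borel_measurable M" if "p permutes {0..<n}" "i \<in> {0..<n}" for p i
    using that permutes_in_image[OF that(1), of i] by (intro m) auto
  ultimately show ?thesis
    by (auto intro!: borel_measurable_sum borel_measurable_times borel_measurable_prod)
qed

text \<open>Cramer's rule, with the zero matrix for singular arguments; it expresses the entries as rational functions and so makes them measurable.\<close>
lemma minverse_eq_adj_mat:
  assumes A: "A \<in> carrier_mat n n" and ij: "i < n" "j < n"
  shows "minverse A $$ (i, j) = (if Determinant.det A = 0 then 0 else adj_mat A $$ (i, j) / Determinant.det A)"
proof (cases "Determinant.det A = 0")
  case True
  have "mat_inverse A = None"
  proof (cases "mat_inverse A")
    case (Some B)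
    from mat_inverse(2)[OF A Some] have "A * B = 1\<^sub>m n" "B \<in> carrier_mat n n" by auto
    then have "Determinant.det A * Determinant.det B = 1" using A det_mult[of A n B] by simp
    then show ?thesis using True by simp
  qed
  then show ?thesis using True A ij by (simp add: minverse_def)
next
  case False
  note mi = minverse_inverts[OF A False]
  note adj = adj_mat[OF A]
  have "minverse A * (A * adj_mat A) = (minverse A * A) * adj_mat A"
    using assoc_mult_mat[OF mi(1) A adj(1)] by simp
  then have "minverse A * (Determinant.det A \<cdot>\<^sub>m 1\<^sub>m n) = adj_mat A" using mi adj by simp
  moreover have "minverse A * (Determinant.det A \<cdot>\<^sub>m 1\<^sub>m n) = Determinant.det A \<cdot>\<^sub>m minverse A"
    by (subst mult_smult_distrib[OF mi(1) one_carrier_mat]) (simp only: right_mult_one_mat[OF mi(1)])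
  ultimately have "adj_mat A $$ (i, j) = Determinant.det A * minverse A $$ (i, j)"
    using mi(1) ij by (metis carrier_matD index_smult_mat(1))
  then show ?thesis using False by simp
qed

lemma borel_measurable_minverse:
  assumes A: "\<And>\<omega>. A \<omega> \<in> carrier_mat n n"
    and m: "\<And>i j. i < n \<Longrightarrow> j < n \<Longrightarrow> (\<lambda>\<omega>. A \<omega> $$ (i, j)) \<in> borel_measurable M"
    and ij: "i < n" "j < n"
  shows "(\<lambda>\<omega>. minverse (A \<omega>) $$ (i, j)) \<in> borel_measurable M"
proof -
  have det[measurable]: "(\<lambda>\<omega>. Determinant.det (A \<omega>)) \<in> borel_measurable M" by (rule borel_measurable_det[OF A m])
  have "(\<lambda>\<omega>. Determinant.det (mat_delete (A \<omega>) j i)) \<in> borel_measurable M"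
  proof (rule borel_measurable_det)
    show "mat_delete (A \<omega>) j i \<in> carrier_mat (n - 1) (n - 1)" for \<omega>
      using A[of \<omega>] by (auto simp: mat_delete_def)
    fix k l assume kl: "k < n - 1" "l < n - 1"
    have "(\<lambda>\<omega>. mat_delete (A \<omega>) j i $$ (k, l)) = (\<lambda>\<omega>. A \<omega> $$ (if k < j then k else Suc k, if l < i then l else Suc l))"
      using A kl by (auto simp: mat_delete_def fun_eq_iff carrier_matD[OF A])
    then show "(\<lambda>\<omega>. mat_delete (A \<omega>) j i $$ (k, l)) \<in> borel_measurable M" using kl by (auto intro!: m)
  qed
  then have [measurable]: "(\<lambda>\<omega>. adj_mat (A \<omega>) $$ (i, j)) \<in> borel_measurable M"
    using ij by (simp add: adj_mat_def cofactor_def carrier_matD[OF A])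
  have "(\<lambda>\<omega>. minverse (A \<omega>) $$ (i, j)) = (\<lambda>\<omega>. if Determinant.det (A \<omega>) = 0 then 0 else adj_mat (A \<omega>) $$ (i, j) / Determinant.det (A \<omega>))"
    using minverse_eq_adj_mat[OF A ij] by auto
  then show ?thesis by simp
qed

lemma minverse_carrier:
  assumes A: "A \<in> carrier_mat n n" shows "minverse A \<in> carrier_mat n n"
proof (cases "mat_inverse A")
  case None
  then show ?thesis using A by (simp add: minverse_def)
next
  case (Some B)
  then show ?thesis using mat_inverse(2)[OF A Some] by (simp add: minverse_def)
qed

lemma quad_form_sum:
  assumes "A \<in> carrier_mat p p" "v \<in> carrier_vec p"
  shows "quad_form A v = (\<Sum>i<p. v $ i * (\<Sum>j<p. A $$ (i, j) * v $ j))"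
  unfolding quad_form_def using assms
  by (subst scalar_prod_sum[of _ p]) (auto simp: mult_mat_vec_sum[of A p] simp del: index_mult_mat_vec intro!: sum.cong)

lemma sample_cov_carrier [simp]: "sample_cov N p x \<in> carrier_mat p p"
  by (simp add: sample_cov_def)

lemma mtrace_square:
  assumes "S \<in> carrier_mat p p" "\<And>i j. i < p \<Longrightarrow> j < p \<Longrightarrow> S $$ (i, j) = S $$ (j, i)"
  shows "mtrace (S ^\<^sub>m 2) = (\<Sum>i<p. \<Sum>j<p. (S $$ (i, j))\<^sup>2)"
proof -
  have "S ^\<^sub>m 2 = S * S" using assms(1) by (simp add: numeral_2_eq_2)
  then have "mtrace (S ^\<^sub>m 2) = (\<Sum>i<p. (S * S) $$ (i, i))" using assms(1) by (simp add: mtrace_def)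
  also have "\<dots> = (\<Sum>i<p. \<Sum>j<p. S $$ (i, j) * S $$ (j, i))"
    using assms(1) by (auto simp: scalar_prod_def lessThan_atLeast0 intro!: sum.cong)
  also have "\<dots> = (\<Sum>i<p. \<Sum>j<p. (S $$ (i, j))\<^sup>2)"
    using assms(2) by (auto simp: power2_eq_square intro!: sum.cong)
  finally show ?thesis .
qed

lemma sample_cov_sym: "i < p \<Longrightarrow> j < p \<Longrightarrow> sample_cov N p x $$ (i, j) = sample_cov N p x $$ (j, i)"
  by (simp add: sample_cov_def mult.commute)

definition test_statistic :: "nat \<Rightarrow> nat \<Rightarrow> real Matrix.vec \<Rightarrow> real \<Rightarrow> (nat \<Rightarrow> real Matrix.vec) \<Rightarrow> real" where
  "test_statistic N p \<mu>0 \<rho> x = T_stat N p \<mu>0 \<rho> x / sigma_fun \<rho> (real p / real (N - 1)) (a1_hat N p x) (a2_hat N p x)"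

lemma test_statistic_restrict: "test_statistic N p \<mu>0 \<rho> (\<lambda>i\<in>{..<N}. x i) = test_statistic N p \<mu>0 \<rho> x"
proof -
  have "sample_mean N p (\<lambda>i\<in>{..<N}. x i) = sample_mean N p x" by (simp add: sample_mean_def)
  moreover from this have "sample_cov N p (\<lambda>i\<in>{..<N}. x i) = sample_cov N p x"
    unfolding sample_cov_def by (intro arg_cong[where f = "Matrix.mat p p"] ext) (auto intro!: sum.cong)
  ultimately show ?thesis
    by (simp add: test_statistic_def T_stat_def hotelling_T2_def dempster_D_def a1_hat_def a2_hat_def)
qed

lemma borel_measurable_test_statistic:
  assumes \<mu>0: "\<mu>0 \<in> carrier_vec p"
  shows "test_statistic N p \<mu>0 \<rho> \<in> borel_measurable (\<Pi>\<^sub>M i\<in>{..<N}. lborel_vec p)"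
proof -
  let ?M = "\<Pi>\<^sub>M i\<in>{..<N}. lborel_vec p"
  have x[measurable]: "(\<lambda>x. x i $ j) \<in> borel_measurable ?M" if "i < N" "j < p" for i j
  proof -
    have "(\<lambda>x. x i) \<in> measurable ?M (lborel_vec p)"
      using that by (intro measurable_component_singleton) simp
    from measurable_compose[OF this measurable_vec_index[OF that(2)]] show ?thesis .
  qed
  have mean: "(\<lambda>x. sample_mean N p x $ j) \<in> borel_measurable ?M" if "j < p" for j
    using that by (simp add: sample_mean_def)
  have diff: "(\<lambda>x. (sample_mean N p x - \<mu>0) $ j) \<in> borel_measurable ?M" if "j < p" for j
    using that \<mu>0 mean[OF that] by simp
  have cov: "(\<lambda>x. sample_cov N p x $$ (j, l)) \<in> borel_measurable ?M" if jl: "j < p" "l < p" for j l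
  proof -
    have "sample_cov N p x $$ (j, l) = (\<Sum>i<N. (x i $ j - sample_mean N p x $ j) * (x i $ l - sample_mean N p x $ l)) / real (N - 1)"
      if "x \<in> space ?M" for x
    proof -
      have sm: "sample_mean N p x \<in> carrier_vec p" by (simp add: sample_mean_def)
      have "(\<Sum>i<N. (x i - sample_mean N p x) $ j * (x i - sample_mean N p x) $ l)
          = (\<Sum>i<N. (x i $ j - sample_mean N p x $ j) * (x i $ l - sample_mean N p x $ l))"
        using jl sm by (intro sum.cong refl) simp
      then show ?thesis using jl by (simp add: sample_cov_def)
    qed
    then show ?thesis
      by (subst measurable_cong)
         (use jl in \<open>auto intro!: borel_measurable_divide borel_measurable_sum borel_measurable_times borel_measurable_diff x mean\<close>)
  qed
  have tr: "(\<lambda>x. mtrace (sample_cov N p x)) \<in> borel_measurable ?M"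
  proof -
    have "(\<lambda>x. mtrace (sample_cov N p x)) = (\<lambda>x. \<Sum>j<p. sample_cov N p x $$ (j, j))"
      by (simp add: mtrace_def carrier_matD[OF sample_cov_carrier])
    then show ?thesis by (auto intro!: borel_measurable_sum cov)
  qed
  have tr2: "(\<lambda>x. mtrace (sample_cov N p x ^\<^sub>m 2)) \<in> borel_measurable ?M"
  proof -
    have "(\<lambda>x. mtrace (sample_cov N p x ^\<^sub>m 2)) = (\<lambda>x. \<Sum>i<p. \<Sum>j<p. (sample_cov N p x $$ (i, j))\<^sup>2)"
      by (rule ext, rule mtrace_square[OF sample_cov_carrier sample_cov_sym])
    then show ?thesis by (auto intro!: borel_measurable_sum borel_measurable_power cov)
  qed
  have dimc: "sample_mean N p x - \<mu>0 \<in> carrier_vec p" for x using \<mu>0 by (simp add: sample_mean_def)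
  have hot: "(\<lambda>x. hotelling_T2 N p \<mu>0 x) \<in> borel_measurable ?M"
    unfolding hotelling_T2_def quad_form_sum[OF minverse_carrier[OF sample_cov_carrier] dimc]
    by (auto intro!: borel_measurable_times borel_measurable_sum diff borel_measurable_minverse[OF sample_cov_carrier] cov simp del: index_minus_vec)
  have dem: "(\<lambda>x. dempster_D N p \<mu>0 x) \<in> borel_measurable ?M"
    unfolding dempster_D_def scalar_prod_sum[OF dimc]
    by (auto intro!: borel_measurable_times borel_measurable_divide borel_measurable_sum diff tr simp del: index_minus_vec)
  have a1: "(\<lambda>x. a1_hat N p x) \<in> borel_measurable ?M" unfolding a1_hat_def using tr by simp
  have a2: "(\<lambda>x. a2_hat N p x) \<in> borel_measurable ?M" unfolding a2_hat_def Let_def using tr tr2 by simp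
  have "(\<lambda>x. T_stat N p \<mu>0 \<rho> x) \<in> borel_measurable ?M" unfolding T_stat_def Let_def using hot dem by measurable
  moreover have "(\<lambda>x. sigma_fun \<rho> (real p / real (N - 1)) (a1_hat N p x) (a2_hat N p x)) \<in> borel_measurable ?M"
    unfolding sigma_fun_def using a1 a2 by measurable
  ultimately have "(\<lambda>x. test_statistic N p \<mu>0 \<rho> x) \<in> borel_measurable ?M"
    unfolding test_statistic_def by measurable
  then show ?thesis by simp
qed

text \<open>The reflection of the row space that exchanges the first basis vector with the normalised vector of ones. It plays the part of the Helmert matrix: afterwards row \<open>0\<close> carries the sample mean and the other rows carry the sample covariance.\<close>
definition helmert :: "nat \<Rightarrow> nat \<Rightarrow> (nat \<times> nat \<Rightarrow> real) \<Rightarrow> nat \<times> nat \<Rightarrow> real" where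
  "helmert N p = reflect_rows {..<N} {..<p} (\<lambda>i. (if i = 0 then 1 else 0) - 1 / sqrt (real N))"

definition canonical_sample :: "nat \<Rightarrow> nat \<Rightarrow> real Matrix.vec \<Rightarrow> (nat \<Rightarrow> nat \<Rightarrow> real) \<Rightarrow> (nat \<times> nat \<Rightarrow> real) \<Rightarrow> nat \<Rightarrow> real Matrix.vec" where
  "canonical_sample N p \<mu> L z = gauss_sample p \<mu> L (helmert N p z)"

lemma measurable_gauss_sample:
  assumes "i < N"
  shows "(\<lambda>z. gauss_sample p \<mu> L z i) \<in> measurable (\<Pi>\<^sub>M k\<in>{..<N} \<times> {..<p}. borel) (lborel_vec p)"
proof -
  have "(\<lambda>z. tri_affine p (\<lambda>j. \<mu> $ j) L (\<lambda>j. z (i, j))) \<in> measurable (\<Pi>\<^sub>M k\<in>{..<N} \<times> {..<p}. borel) (\<Pi>\<^sub>M j\<in>{..<p}. borel)"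
    unfolding tri_affine_def
    using assms by (intro measurable_restrict borel_measurable_add borel_measurable_sum borel_measurable_times
      borel_measurable_const measurable_component_singleton) auto
  from measurable_compose[OF this measurable_vec] show ?thesis by (simp add: gauss_sample_def)
qed

text \<open>The Gaussian matrix may be rotated without changing its law, so the probability is computed for the rotated sample.\<close>
theorem reject_prob_canonical:
  assumes sample: "normal_sample M N p \<mu> S X" and F: "factorizes p L S"
    and \<mu>: "\<mu> \<in> carrier_vec p" and \<mu>0: "\<mu>0 \<in> carrier_vec p" and N: "N > 0" and p: "p > 0"
  shows "reject_prob M N p \<mu>0 X \<alpha> \<rho> = measure (gauss ({..<N} \<times> {..<p}))
      {z \<in> space (gauss ({..<N} \<times> {..<p})). test_statistic N p \<mu>0 \<rho> (canonical_sample N p \<mu> L z) \<ge> upper_percentile \<alpha>}"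
    and "{z \<in> space (gauss ({..<N} \<times> {..<p})). test_statistic N p \<mu>0 \<rho> (canonical_sample N p \<mu> L z) \<ge> t} \<in> sets (gauss ({..<N} \<times> {..<p}))"
proof -
  let ?G = "gauss ({..<N} \<times> {..<p})" and ?P = "\<Pi>\<^sub>M i\<in>{..<N}. lborel_vec p" and ?B = "\<Pi>\<^sub>M k\<in>{..<N} \<times> {..<p}. (borel :: real measure)"
  define A where "A t = {x \<in> space ?P. test_statistic N p \<mu>0 \<rho> x \<ge> t}" for t
  have A: "A t \<in> sets ?P" for t unfolding A_def using borel_measurable_test_statistic[OF \<mu>0] by measurable
  have gm: "(\<lambda>z. \<lambda>i\<in>{..<N}. gauss_sample p \<mu> L z i) \<in> measurable ?B ?P"
    by (intro measurable_restrict measurable_gauss_sample) auto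
  have sp: "(\<lambda>i\<in>{..<N}. gauss_sample p \<mu> L z i) \<in> space ?P" if "z \<in> space ?B" for z
    using measurable_space[OF gm that] .
  have ev: "(\<lambda>i\<in>{..<N}. gauss_sample p \<mu> L z i) \<in> A t \<longleftrightarrow> test_statistic N p \<mu>0 \<rho> (gauss_sample p \<mu> L z) \<ge> t" if "z \<in> space ?B" for z t
    using sp[OF that] by (simp add: A_def test_statistic_restrict)
  have spB: "space ?G = space ?B" by (simp add: space_PiM)
  define E where "E t = {z \<in> space ?B. test_statistic N p \<mu>0 \<rho> (gauss_sample p \<mu> L z) \<ge> t}" for t
  have "E t = (\<lambda>z. \<lambda>i\<in>{..<N}. gauss_sample p \<mu> L z i) -` A t \<inter> space ?B" for t using ev by (auto simp: E_def)
  then have E: "E t \<in> sets ?B" for t using measurable_sets[OF gm A] by simp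
  have hm: "helmert N p \<in> measurable ?G ?B" unfolding helmert_def by measurable
  have pre: "{z \<in> space ?G. test_statistic N p \<mu>0 \<rho> (canonical_sample N p \<mu> L z) \<ge> t} = helmert N p -` E t \<inter> space ?G" for t
    using measurable_space[OF hm] by (auto simp: E_def canonical_sample_def)
  show "{z \<in> space ?G. test_statistic N p \<mu>0 \<rho> (canonical_sample N p \<mu> L z) \<ge> t} \<in> sets ?G"
    unfolding pre by (rule measurable_sets[OF hm E])
  have rvX: "X i \<in> measurable M (lborel_vec p)" if "i < N" for i
    using sample that by (auto simp: normal_sample_def dest: distributed_measurable)
  let ?a = "upper_percentile \<alpha>"
  have "reject_prob M N p \<mu>0 X \<alpha> \<rho> = measure M {\<omega> \<in> space M. test_statistic N p \<mu>0 \<rho> (\<lambda>i. X i \<omega>) \<ge> ?a}"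
    by (simp add: reject_prob_def test_statistic_def Let_def)
  also have "{\<omega> \<in> space M. test_statistic N p \<mu>0 \<rho> (\<lambda>i. X i \<omega>) \<ge> ?a} = {\<omega> \<in> space M. (\<lambda>i\<in>{..<N}. X i \<omega>) \<in> A ?a}"
    using measurable_space[OF rvX] test_statistic_restrict[of N p \<mu>0 \<rho>]
    by (auto simp: A_def space_PiM)
  also have "measure M \<dots> = measure ?G {z \<in> space ?G. (\<lambda>i\<in>{..<N}. gauss_sample p \<mu> L z i) \<in> A ?a}"
    by (rule normal_sample_law[OF sample F \<mu> N p A])
  also have "{z \<in> space ?G. (\<lambda>i\<in>{..<N}. gauss_sample p \<mu> L z i) \<in> A ?a} = E ?a" using ev by (auto simp: E_def spB)
  also have "measure ?G (E ?a) = measure (distr ?G ?B (helmert N p)) (E ?a)"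
    unfolding helmert_def by (subst distr_reflect_rows) auto
  also have "\<dots> = measure ?G (helmert N p -` E ?a \<inter> space ?G)" by (rule measure_distr[OF hm E])
  finally show "reject_prob M N p \<mu>0 X \<alpha> \<rho> = measure ?G {z \<in> space ?G. test_statistic N p \<mu>0 \<rho> (canonical_sample N p \<mu> L z) \<ge> ?a}"
    by (simp only: pre)
qed

lemma helmert_sum:
  assumes N: "N > 0" and j: "j < p"
  shows "(\<Sum>i<N. helmert N p z (i, j)) = sqrt (real N) * z (0, j)"
proof -
  let ?s = "sqrt (real N)"
  define u where "u i = (if i = 0 then 1 else 0) - 1 / ?s" for i :: nat
  have s: "?s > 0" using N by simp
  have e0: "(\<Sum>i<N. f i * (if i = 0 then 1 else 0)) = f 0" for f :: "nat \<Rightarrow> real"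
  proof -
    have "(\<Sum>i<N. f i * (if i = 0 then 1 else 0)) = (\<Sum>i<N. if i = 0 then f i else 0)" by (intro sum.cong) auto
    then show ?thesis using N by simp
  qed
  have ref: "reflection {..<N} u (\<lambda>i. if i = 0 then 1 else 0) i = 1 / ?s" if "i < N" for i
    unfolding u_def
  proof (rule reflection_maps)
    show "(\<Sum>k<N. (if k = 0 then 1 else 0 :: real)\<^sup>2) = (\<Sum>k<N. (1 / ?s)\<^sup>2)"
      using e0[of "\<lambda>i. if i = 0 then 1 else 0"] s by (simp add: power2_eq_square)
  qed (use that in auto)
  have "(\<Sum>i<N. helmert N p z (i, j)) = (\<Sum>i<N. ?s * (reflection {..<N} u (\<lambda>l. z (l, j)) i * (1 / ?s)))"
    using j s by (intro sum.cong) (auto simp: helmert_def reflect_rows_def u_def[abs_def])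
  also have "\<dots> = ?s * (\<Sum>i<N. reflection {..<N} u (\<lambda>l. z (l, j)) i * reflection {..<N} u (\<lambda>i. if i = 0 then 1 else 0) i)"
    by (simp add: sum_distrib_left ref)
  also have "\<dots> = ?s * (\<Sum>i<N. z (i, j) * (if i = 0 then 1 else 0))"
    by (subst reflection_inner) auto
  also have "\<dots> = ?s * z (0, j)" by (simp only: e0)
  finally show ?thesis .
qed

lemma helmert_gram:
  assumes "j < p" "l < p"
  shows "(\<Sum>i<N. helmert N p z (i, j) * helmert N p z (i, l)) = (\<Sum>i<N. z (i, j) * z (i, l))"
  using assms by (simp add: helmert_def reflect_rows_def reflection_inner)

definition colored :: "nat \<Rightarrow> (nat \<Rightarrow> nat \<Rightarrow> real) \<Rightarrow> (nat \<times> nat \<Rightarrow> real) \<Rightarrow> nat \<Rightarrow> nat \<Rightarrow> real" where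
  "colored p L z i j = (\<Sum>k<p. L j k * z (i, k))"

lemma canonical_index: "j < p \<Longrightarrow> canonical_sample N p \<mu> L z i $ j = \<mu> $ j + colored p L (helmert N p z) i j"
  by (simp add: canonical_sample_def gauss_sample_def tri_affine_def colored_def)

lemma sample_mean_canonical:
  assumes N: "N > 0" and j: "j < p"
  shows "sample_mean N p (canonical_sample N p \<mu> L z) $ j = \<mu> $ j + colored p L z 0 j / sqrt (real N)"
proof -
  have "(\<Sum>i<N. colored p L (helmert N p z) i j) = (\<Sum>k<p. L j k * (\<Sum>i<N. helmert N p z (i, k)))"
    unfolding colored_def sum_distrib_left by (rule sum.swap)
  also have "\<dots> = (\<Sum>k<p. L j k * (sqrt (real N) * z (0, k)))" by (intro sum.cong refl) (simp add: helmert_sum[OF N])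
  also have "\<dots> = sqrt (real N) * colored p L z 0 j" by (simp add: colored_def sum_distrib_left mult_ac)
  finally have "(\<Sum>i<N. canonical_sample N p \<mu> L z i $ j) = real N * \<mu> $ j + sqrt (real N) * colored p L z 0 j"
    using j by (simp add: canonical_index sum.distrib)
  moreover have "sqrt (real N) / real N = 1 / sqrt (real N)" using N by (simp add: field_simps)
  ultimately show ?thesis using N j by (simp add: sample_mean_def add_divide_distrib) (simp add: field_simps)
qed

text \<open>The Gram matrix of the rows is invariant under the rotation, and subtracting the mean removes exactly the contribution of row \<open>0\<close>.\<close>
lemma sample_cov_canonical:
  assumes N: "N > 0" and j: "j < p" "l < p"
  shows "sample_cov N p (canonical_sample N p \<mu> L z) $$ (j, l)
    = (\<Sum>i\<in>{1..<N}. colored p L z i j * colored p L z i l) / real (N - 1)"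
proof -
  let ?x = "canonical_sample N p \<mu> L z" and ?s = "sqrt (real N)" and ?h = "helmert N p z"
  have s: "?s * ?s = real N" "?s > 0" using N by auto
  have dev: "(?x i - sample_mean N p ?x) $ j = (\<Sum>k<p. L j k * (?h (i, k) - z (0, k) / ?s))" if "j < p" for i j
  proof -
    have "(?x i - sample_mean N p ?x) $ j = colored p L ?h i j - colored p L z 0 j / ?s"
      using that sample_mean_canonical[OF N that, of \<mu> L z] by (simp add: canonical_index sample_mean_def)
    also have "\<dots> = (\<Sum>k<p. L j k * (?h (i, k) - z (0, k) / ?s))"
      by (simp add: colored_def right_diff_distrib sum_subtractf sum_divide_distrib)
    finally show ?thesis .
  qed
  have cen: "(\<Sum>i<N. (?h (i, k) - z (0, k) / ?s) * (?h (i, m) - z (0, m) / ?s)) = (\<Sum>i\<in>{1..<N}. z (i, k) * z (i, m))"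
    if "k < p" "m < p" for k m
  proof -
    have "(\<Sum>i<N. (?h (i, k) - z (0, k) / ?s) * (?h (i, m) - z (0, m) / ?s))
      = (\<Sum>i<N. ?h (i, k) * ?h (i, m)) - (z (0, m) / ?s) * (\<Sum>i<N. ?h (i, k)) - (z (0, k) / ?s) * (\<Sum>i<N. ?h (i, m)) + real N * ((z (0, k) / ?s) * (z (0, m) / ?s))"
      by (simp add: algebra_simps sum.distrib sum_subtractf sum_distrib_left)
    also have "\<dots> = (\<Sum>i<N. z (i, k) * z (i, m)) - z (0, k) * z (0, m)"
    proof -
      have gen: "t \<noteq> 0 \<Longrightarrow> q - (b / t) * (t * a) - (a / t) * (t * b) + (t * t) * ((a / t) * (b / t)) = q - a * b"
        for q a b t :: real by (simp add: field_simps)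
      have "?s \<noteq> 0" using s(2) by linarith
      from gen[OF this, of _ "z (0, m)" "z (0, k)", unfolded s(1)]
      show ?thesis unfolding helmert_gram[OF that] helmert_sum[OF N that(1)] helmert_sum[OF N that(2)] .
    qed
    also have "(\<Sum>i<N. z (i, k) * z (i, m)) = z (0, k) * z (0, m) + (\<Sum>i\<in>{1..<N}. z (i, k) * z (i, m))"
      using N by (simp add: lessThan_atLeast0 sum.atLeast_Suc_lessThan)
    finally show ?thesis by simp
  qed
  have "(\<Sum>i<N. (?x i - sample_mean N p ?x) $ j * (?x i - sample_mean N p ?x) $ l)
    = (\<Sum>i<N. \<Sum>k<p. \<Sum>m<p. L j k * L l m * ((?h (i, k) - z (0, k) / ?s) * (?h (i, m) - z (0, m) / ?s)))"
    unfolding dev[OF j(1)] dev[OF j(2)] sum_product by (simp only: mult_ac)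
  also have "\<dots> = (\<Sum>k<p. \<Sum>m<p. \<Sum>i<N. L j k * L l m * ((?h (i, k) - z (0, k) / ?s) * (?h (i, m) - z (0, m) / ?s)))"
    by (subst sum.swap) (intro sum.cong refl sum.swap)
  also have "\<dots> = (\<Sum>k<p. \<Sum>m<p. L j k * L l m * (\<Sum>i\<in>{1..<N}. z (i, k) * z (i, m)))"
    by (intro sum.cong refl) (simp only: sum_distrib_left[symmetric] cen lessThan_iff)
  also have "\<dots> = (\<Sum>i\<in>{1..<N}. \<Sum>k<p. \<Sum>m<p. L j k * L l m * (z (i, k) * z (i, m)))"
    unfolding sum_distrib_left by (subst (2) sum.swap) (intro sum.cong refl sum.swap)
  also have "\<dots> = (\<Sum>i\<in>{1..<N}. colored p L z i j * colored p L z i l)"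
    unfolding colored_def sum_product by (simp only: mult_ac)
  finally show ?thesis using j by (simp add: sample_cov_def)
qed

section \<open>Sample mean, traces and Hotelling statistic in rotated coordinates\<close>

lemma AE_gram_injective:
  fixes N p :: nat
  assumes "p < N"
  shows "AE z in gauss ({..<N} \<times> {..<p}). \<forall>v. (\<forall>i\<in>{1..<N}. (\<Sum>j<p. z (i, j) * v j) = 0) \<longrightarrow> (\<forall>j<p. v j = (0::real))"
proof -
  have sub: "{1..<N} \<times> {..<p} \<subseteq> {..<N} \<times> {..<p}" by auto
  let ?r = "\<lambda>z. restrict z ({1..<N} \<times> {..<p})"
  have "AE Y in gauss ({1..<N} \<times> {..<p}). vmin {1..<N} {..<p} Y j > 0" if "j < p" for j
  proof -
    have "card {..<p} \<le> card {1..<N}" using assms by simp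
    then show ?thesis using that by (intro AE_vmin_pos) simp_all
  qed
  then have "AE Y in gauss ({1..<N} \<times> {..<p}). \<forall>j\<in>{..<p}. vmin {1..<N} {..<p} Y j > 0"
    by (intro AE_finite_allI) auto
  then have "AE Y in distr (gauss ({..<N} \<times> {..<p})) (gauss ({1..<N} \<times> {..<p})) ?r. \<forall>j\<in>{..<p}. vmin {1..<N} {..<p} Y j > 0"
    by (simp only: restrict_gauss[OF sub])
  then have "AE z in gauss ({..<N} \<times> {..<p}). \<forall>j\<in>{..<p}. vmin {1..<N} {..<p} (?r z) j > 0"
    by (rule AE_distrD[rotated]) (rule measurable_restrict_subset[OF sub])
  then show ?thesis
  proof eventually_elim
    case (elim z)
    show ?case
    proof (intro allI impI)
      fix v j assume 0: "\<forall>i\<in>{1..<N}. (\<Sum>j<p. z (i, j) * v j) = 0" and j: "j < p"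
      show "v j = 0"
      proof (rule vmin_pos_imp_injective[of "{..<p}" "{1..<N}" "?r z"])
        fix i assume i: "i \<in> {1..<N}"
        then have "(\<Sum>j<p. ?r z (i, j) * v j) = (\<Sum>j<p. z (i, j) * v j)" by (intro sum.cong) auto
        then show "(\<Sum>j<p. ?r z (i, j) * v j) = 0" using 0 i by simp
      qed (use elim j in auto)
    qed
  qed
qed

text \<open>The first row shifted by \<open>L\<^sup>-\<^sup>1 \<delta>\<close>, where \<open>\<delta>\<close> is the scaled difference of the means.\<close>
definition noncentral :: "(nat \<Rightarrow> real) \<Rightarrow> (nat \<times> nat \<Rightarrow> real) \<Rightarrow> nat \<Rightarrow> real" where
  "noncentral e0 z j = z (0, j) + e0 j"

definition row_inner :: "nat \<Rightarrow> (nat \<Rightarrow> nat \<Rightarrow> real) \<Rightarrow> (nat \<times> nat \<Rightarrow> real) \<Rightarrow> nat \<Rightarrow> nat \<Rightarrow> real" where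
  "row_inner p L z i l = (\<Sum>j<p. colored p L z i j * colored p L z l j)"

lemma colored_inner: "(\<Sum>j<p. colored p L z i j * v j) = (\<Sum>k<p. z (i, k) * (\<Sum>j<p. L j k * v j))"
  unfolding colored_def sum_distrib_left sum_distrib_right by (subst sum.swap) (simp add: mult_ac)

context
  fixes N p :: nat and \<mu> \<mu>0 :: "real Matrix.vec" and L :: "nat \<Rightarrow> nat \<Rightarrow> real" and e0 :: "nat \<Rightarrow> real"
    and z :: "nat \<times> nat \<Rightarrow> real"
  assumes p: "0 < p" and N: "p < N" and \<mu>: "\<mu> \<in> carrier_vec p" and \<mu>0: "\<mu>0 \<in> carrier_vec p"
    and L: "lower_triangular p L"
    and e0: "\<And>j. j < p \<Longrightarrow> sqrt (real N) * (\<mu> $ j - \<mu>0 $ j) = (\<Sum>k<p. L j k * e0 k)"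
begin

abbreviation (input) "xs \<equiv> canonical_sample N p \<mu> L z"

lemma scaled_mean_canonical:
  assumes "j < p"
  shows "sqrt (real N) * (sample_mean N p xs - \<mu>0) $ j = (\<Sum>k<p. L j k * noncentral e0 z k)"
proof -
  have s: "sqrt (real N) > 0" using N by simp
  have "sqrt (real N) * (sample_mean N p xs - \<mu>0) $ j = sqrt (real N) * (\<mu> $ j - \<mu>0 $ j) + colored p L z 0 j"
    using assms \<mu>0 s N by (simp add: sample_mean_canonical field_simps)
  also have "\<dots> = (\<Sum>k<p. L j k * noncentral e0 z k)"
    unfolding e0[OF assms] colored_def noncentral_def by (simp add: sum.distrib distrib_left)
  finally show ?thesis .
qed

lemma dempster_canonical:
  "real N * ((sample_mean N p xs - \<mu>0) \<bullet> (sample_mean N p xs - \<mu>0)) = (\<Sum>j<p. (\<Sum>k<p. L j k * noncentral e0 z k)\<^sup>2)"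
proof -
  have d: "sample_mean N p xs - \<mu>0 \<in> carrier_vec p" using \<mu>0 by (simp add: sample_mean_def)
  have "real N * ((sample_mean N p xs - \<mu>0) \<bullet> (sample_mean N p xs - \<mu>0)) = (\<Sum>j<p. (sqrt (real N) * (sample_mean N p xs - \<mu>0) $ j)\<^sup>2)"
    unfolding scalar_prod_sum[OF d] by (simp add: power_mult_distrib sum_distrib_left power2_eq_square[of "_ $ _"] del: index_minus_vec)
  also have "\<dots> = (\<Sum>j<p. (\<Sum>k<p. L j k * noncentral e0 z k)\<^sup>2)"
    by (intro sum.cong refl) (simp only: scaled_mean_canonical lessThan_iff)
  finally show ?thesis .
qed

lemma trace_canonical: "mtrace (sample_cov N p xs) = (\<Sum>i\<in>{1..<N}. row_inner p L z i i) / real (N - 1)"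
proof -
  have "mtrace (sample_cov N p xs) = (\<Sum>j<p. sample_cov N p xs $$ (j, j))"
    by (simp add: mtrace_def carrier_matD[OF sample_cov_carrier])
  also have "\<dots> = (\<Sum>j<p. (\<Sum>i\<in>{1..<N}. colored p L z i j * colored p L z i j) / real (N - 1))"
    using N by (intro sum.cong refl) (simp add: sample_cov_canonical)
  also have "\<dots> = (\<Sum>i\<in>{1..<N}. row_inner p L z i i) / real (N - 1)"
    unfolding sum_divide_distrib[symmetric] row_inner_def by (subst sum.swap) simp
  finally show ?thesis .
qed

lemma trace_square_canonical:
  "mtrace (sample_cov N p xs ^\<^sub>m 2) = (\<Sum>i\<in>{1..<N}. \<Sum>l\<in>{1..<N}. (row_inner p L z i l)\<^sup>2) / (real (N - 1))\<^sup>2"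
proof -
  let ?c = "colored p L z" and ?R = "{1..<N}"
  have "mtrace (sample_cov N p xs ^\<^sub>m 2) = (\<Sum>j<p. \<Sum>k<p. (sample_cov N p xs $$ (j, k))\<^sup>2)"
    by (rule mtrace_square[OF sample_cov_carrier sample_cov_sym])
  also have "\<dots> = (\<Sum>j<p. \<Sum>k<p. ((\<Sum>i\<in>?R. ?c i j * ?c i k) / real (N - 1))\<^sup>2)"
    using N by (intro sum.cong refl) (simp add: sample_cov_canonical)
  also have "\<dots> = (\<Sum>j<p. \<Sum>k<p. \<Sum>i\<in>?R. \<Sum>l\<in>?R. (?c i j * ?c l j) * (?c i k * ?c l k)) / (real (N - 1))\<^sup>2"
  proof -
    have "(\<Sum>i\<in>?R. ?c i j * ?c i k)\<^sup>2 = (\<Sum>i\<in>?R. \<Sum>l\<in>?R. (?c i j * ?c l j) * (?c i k * ?c l k))" for j k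
      unfolding power2_eq_square sum_product by (simp only: mult_ac)
    then show ?thesis by (simp only: power_divide sum_divide_distrib[symmetric])
  qed
  also have "(\<Sum>j<p. \<Sum>k<p. \<Sum>i\<in>?R. \<Sum>l\<in>?R. (?c i j * ?c l j) * (?c i k * ?c l k))
    = (\<Sum>i\<in>?R. \<Sum>l\<in>?R. \<Sum>j<p. \<Sum>k<p. (?c i j * ?c l j) * (?c i k * ?c l k))"
  proof -
    let ?f = "\<lambda>i l j k. (?c i j * ?c l j) * (?c i k * ?c l k)"
    have "(\<Sum>j<p. \<Sum>k<p. \<Sum>i\<in>?R. \<Sum>l\<in>?R. ?f i l j k) = (\<Sum>j<p. \<Sum>i\<in>?R. \<Sum>k<p. \<Sum>l\<in>?R. ?f i l j k)"
      by (rule sum.cong[OF refl], rule sum.swap)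
    also have "\<dots> = (\<Sum>i\<in>?R. \<Sum>j<p. \<Sum>k<p. \<Sum>l\<in>?R. ?f i l j k)" by (rule sum.swap)
    also have "\<dots> = (\<Sum>i\<in>?R. \<Sum>j<p. \<Sum>l\<in>?R. \<Sum>k<p. ?f i l j k)"
      by (rule sum.cong[OF refl], rule sum.cong[OF refl], rule sum.swap)
    also have "\<dots> = (\<Sum>i\<in>?R. \<Sum>l\<in>?R. \<Sum>j<p. \<Sum>k<p. ?f i l j k)"
      by (rule sum.cong[OF refl], rule sum.swap)
    finally show ?thesis .
  qed
  also have "\<dots> = (\<Sum>i\<in>?R. \<Sum>l\<in>?R. (row_inner p L z i l)\<^sup>2)"
    unfolding row_inner_def power2_eq_square sum_product ..
  finally show ?thesis .
qed

text \<open>In rotated coordinates \<open>n S = L Y' Y L'\<close> and the scaled deviation of the mean is \<open>L e\<close>. The factors \<open>L\<close> cancel, leaving \<open>e' (Y' Y)\<^sup>-\<^sup>1 e\<close>.\<close>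
lemma hotelling_canonical:
  assumes inj: "\<And>v. (\<forall>i\<in>{1..<N}. (\<Sum>j<p. z (i, j) * v j) = 0) \<Longrightarrow> (\<forall>j<p. v j = (0::real))"
  shows "hotelling_T2 N p \<mu>0 xs / real (N - 1)
    = (\<Sum>j<p. (noncentral e0 z j)\<^sup>2) / vdir {1..<N} {..<p} 0 z (noncentral e0 z)"
proof -
  let ?R = "{1..<N}" and ?n = "real (N - 1)" and ?e = "noncentral e0 z" and ?s = "sqrt (real N)"
  define S where "S = sample_cov N p xs"
  define w where "w = sample_mean N p xs - \<mu>0"
  have n: "?n > 0" and s: "?s > 0" "?s * ?s = real N" using N p by auto
  have S: "S \<in> carrier_mat p p" by (simp add: S_def)
  have w: "w \<in> carrier_vec p" using \<mu>0 by (simp add: w_def sample_mean_def)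
  have Sv: "(S *\<^sub>v v) $ j = (\<Sum>k<p. L j k * (\<Sum>l<p. (\<Sum>i\<in>?R. z (i, k) * z (i, l)) * (\<Sum>m<p. L m l * v $ m))) / ?n"
    if v: "v \<in> carrier_vec p" and j: "j < p" for v j
  proof -
    have "(S *\<^sub>v v) $ j = (\<Sum>m<p. (\<Sum>i\<in>?R. colored p L z i j * colored p L z i m) / ?n * v $ m)"
      using N j unfolding S_def by (subst mult_mat_vec_sum[OF sample_cov_carrier v j]) (simp add: sample_cov_canonical)
    also have "\<dots> = (\<Sum>m<p. \<Sum>i\<in>?R. colored p L z i j * (colored p L z i m * v $ m)) / ?n"
    proof -
      have "(\<Sum>i\<in>?R. colored p L z i j * colored p L z i m) / ?n * v $ m = (\<Sum>i\<in>?R. colored p L z i j * (colored p L z i m * v $ m)) / ?n" for m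
        by (simp add: sum_distrib_right mult.assoc)
      then show ?thesis by (simp only: sum_divide_distrib[symmetric])
    qed
    also have "(\<Sum>m<p. \<Sum>i\<in>?R. colored p L z i j * (colored p L z i m * v $ m)) = (\<Sum>i\<in>?R. colored p L z i j * (\<Sum>m<p. colored p L z i m * v $ m))"
      by (subst sum.swap) (simp add: sum_distrib_left)
    also have "\<dots> = (\<Sum>i\<in>?R. (\<Sum>k<p. L j k * z (i, k)) * (\<Sum>l<p. z (i, l) * (\<Sum>m<p. L m l * v $ m)))"
      by (simp only: colored_inner) (simp only: colored_def)
    also have "\<dots> = (\<Sum>i\<in>?R. \<Sum>k<p. L j k * (\<Sum>l<p. z (i, k) * z (i, l) * (\<Sum>m<p. L m l * v $ m)))"
    proof -
      have "(\<Sum>k<p. a k * x k) * (\<Sum>l<p. x l * y l) = (\<Sum>k<p. a k * (\<Sum>l<p. x k * x l * y l))" for a x y :: "nat \<Rightarrow> real"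
        by (subst sum_product) (simp only: sum_distrib_left mult.assoc)
      then show ?thesis by (rule sum.cong[OF refl])
    qed
    also have "\<dots> = (\<Sum>k<p. L j k * (\<Sum>i\<in>?R. \<Sum>l<p. z (i, k) * z (i, l) * (\<Sum>m<p. L m l * v $ m)))"
      unfolding sum_distrib_left[of "L j _" _ ?R] by (rule sum.swap)
    also have "\<dots> = (\<Sum>k<p. L j k * (\<Sum>l<p. (\<Sum>i\<in>?R. z (i, k) * z (i, l)) * (\<Sum>m<p. L m l * v $ m)))"
      unfolding sum_distrib_right by (intro sum.cong refl arg_cong2[where f="(*)"] sum.swap)
    finally show ?thesis .
  qed
  have det: "Determinant.det S \<noteq> 0"
  proof
    assume "Determinant.det S = 0"
    then obtain v where v: "v \<in> carrier_vec p" "v \<noteq> 0\<^sub>v p" "S *\<^sub>v v = 0\<^sub>v p"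
      using det_0_iff_vec_prod_zero_field[OF S] by blast
    define y where "y l = (\<Sum>m<p. L m l * v $ m)" for l
    have 0: "(\<Sum>k<p. L j k * (\<Sum>l<p. (\<Sum>i\<in>?R. z (i, k) * z (i, l)) * y l)) = (\<Sum>k<p. L j k * 0)" if "j < p" for j
      using Sv[OF v(1) that] n v(3) that by (simp add: y_def)
    have G0: "(\<Sum>l<p. (\<Sum>i\<in>?R. z (i, k) * z (i, l)) * y l) = 0" if "k < p" for k
      using lower_triangular_mult_inj[OF L, of "\<lambda>k. \<Sum>l<p. (\<Sum>i\<in>?R. z (i, k) * z (i, l)) * y l" "\<lambda>_. 0", OF 0 that] .
    have "(\<Sum>i\<in>?R. (\<Sum>l<p. z (i, l) * y l) * (\<Sum>l<p. z (i, l) * y l)) = (\<Sum>i\<in>?R. \<Sum>k<p. y k * (\<Sum>l<p. z (i, k) * z (i, l) * y l))"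
      by (intro sum.cong refl) (subst sum_product, simp only: sum_distrib_left mult_ac)
    also have "\<dots> = (\<Sum>k<p. y k * (\<Sum>i\<in>?R. \<Sum>l<p. z (i, k) * z (i, l) * y l))"
      unfolding sum_distrib_left[of "y _" _ ?R] by (rule sum.swap)
    also have "\<dots> = (\<Sum>k<p. y k * (\<Sum>l<p. (\<Sum>i\<in>?R. z (i, k) * z (i, l)) * y l))"
      unfolding sum_distrib_right by (intro sum.cong refl arg_cong2[where f="(*)"] sum.swap)
    also have "\<dots> = 0"
    proof (rule sum.neutral, rule ballI)
      fix k assume "k \<in> {..<p}"
      then show "y k * (\<Sum>l<p. (\<Sum>i\<in>?R. z (i, k) * z (i, l)) * y l) = 0"
        by (simp only: lessThan_iff G0 mult_zero_right)
    qed
    finally have "\<forall>i\<in>?R. (\<Sum>l<p. z (i, l) * y l) = 0" by (simp add: sum_nonneg_eq_0_iff)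
    then have "\<forall>l<p. y l = 0" by (rule inj)
    then have "v $ j = 0" if "j < p" for j
      using transposed_lower_triangular_mult_inj[OF L _ that, of "\<lambda>m. v $ m"] by (simp add: y_def)
    then have "v = 0\<^sub>v p" using v(1) by (intro eq_vecI) auto
    then show False using v(2) by simp
  qed
  define u where "u = minverse S *\<^sub>v w"
  have u: "u \<in> carrier_vec p" "S *\<^sub>v u = w"
    using minverse_solves[OF S det w] minverse_inverts(1)[OF S det] w by (auto simp: u_def)
  have hot: "hotelling_T2 N p \<mu>0 xs / ?n = real N / ?n * (w \<bullet> u)"
    using quad_form_minverse[OF S det u] by (simp add: hotelling_T2_def S_def w_def)
  define g where "g l = ?s / ?n * (\<Sum>m<p. L m l * u $ m)" for l
  have sw: "?s * w $ j = (\<Sum>k<p. L j k * ?e k)" if "j < p" for j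
    unfolding w_def by (rule scaled_mean_canonical[OF that])
  have g: "(\<Sum>l<p. (\<Sum>i\<in>?R. z (i, k) * z (i, l)) * g l) = ?e k" if k: "k < p" for k
  proof (rule lower_triangular_mult_inj[OF L _ k])
    fix j assume j: "j < p"
    have "(\<Sum>k<p. L j k * (\<Sum>l<p. (\<Sum>i\<in>?R. z (i, k) * z (i, l)) * g l))
      = ?s * ((\<Sum>k<p. L j k * (\<Sum>l<p. (\<Sum>i\<in>?R. z (i, k) * z (i, l)) * (\<Sum>m<p. L m l * u $ m))) / ?n)"
    proof -
      have "(\<Sum>k<p. a k * (\<Sum>l<p. b k l * (c * y l))) = c * (\<Sum>k<p. a k * (\<Sum>l<p. b k l * y l))"
        for a y :: "nat \<Rightarrow> real" and b c by (simp add: sum_distrib_left mult_ac)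
      then show ?thesis by (simp only: g_def) simp
    qed
    also have "\<dots> = ?s * w $ j" using Sv[OF u(1) j] by (simp add: u(2))
    finally show "(\<Sum>k<p. L j k * (\<Sum>l<p. (\<Sum>i\<in>?R. z (i, k) * z (i, l)) * g l)) = (\<Sum>k<p. L j k * ?e k)"
      by (simp only: sw[OF j])
  qed
  have eg: "(\<Sum>k<p. ?e k * g k) = hotelling_T2 N p \<mu>0 xs / ?n"
  proof -
    have "(\<Sum>k<p. ?e k * g k) = ?s / ?n * (\<Sum>k<p. ?e k * (\<Sum>m<p. L m k * u $ m))"
      by (simp add: g_def sum_distrib_left mult_ac)
    also have "(\<Sum>k<p. ?e k * (\<Sum>m<p. L m k * u $ m)) = (\<Sum>m<p. (\<Sum>k<p. L m k * ?e k) * u $ m)"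
      unfolding sum_distrib_left sum_distrib_right by (subst sum.swap) (simp add: mult_ac)
    also have "\<dots> = (\<Sum>m<p. ?s * w $ m * u $ m)" by (intro sum.cong refl) (simp add: sw)
    also have "\<dots> = ?s * (w \<bullet> u)" unfolding scalar_prod_sum[OF u(1)] by (simp add: sum_distrib_left mult_ac)
    also have "?s / ?n * (?s * (w \<bullet> u)) = real N / ?n * (w \<bullet> u)" using s(2) by (simp add: field_simps)
    finally show ?thesis by (simp only: hot)
  qed
  have main: "vdir ?R {..<p} 0 z ?e * (hotelling_T2 N p \<mu>0 xs / ?n) = (\<Sum>j<p. (?e j)\<^sup>2)"
    unfolding eg[symmetric]
  proof (rule vdir_inverse_gram)
    show "(\<Sum>l<p. (\<Sum>i\<in>?R. z (i, j) * z (i, l)) * g l) = ?e j" if "j \<in> {..<p}" for j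
      using that by (simp only: lessThan_iff g)
  qed (use p in simp_all)
  show ?thesis
  proof (cases "vdir ?R {..<p} 0 z ?e = 0")
    case True
    then have "(\<Sum>j<p. (?e j)\<^sup>2) = 0" using main by simp
    then have "?e k = 0" if "k < p" for k using that by (simp add: sum_nonneg_eq_0_iff)
    then have "hotelling_T2 N p \<mu>0 xs / ?n = 0" using eg by simp
    then show ?thesis using True by simp
  next
    case False
    then show ?thesis using main by (simp add: field_simps)
  qed
qed

end

section \<open>Parameters of the model through the Gram matrix\<close>

definition transposed :: "(nat \<Rightarrow> nat \<Rightarrow> real) \<Rightarrow> nat \<Rightarrow> nat \<Rightarrow> real" where
  "transposed L i j = L j i"

text \<open>The matrix \<open>L' L\<close>. It has the same spectral moments as \<open>S = L L'\<close> and is the matrix of the quadratic form \<open>\<bar>L z\<bar>\<^sup>2\<close>.\<close>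
definition gramian :: "nat \<Rightarrow> (nat \<Rightarrow> nat \<Rightarrow> real) \<Rightarrow> nat \<Rightarrow> nat \<Rightarrow> real" where
  "gramian p L = mmult {..<p} (transposed L) L"

lemma mmult_assoc: "mmult K (mmult K A B) C = mmult K A (mmult K B C)"
proof (intro ext)
  fix i j
  show "mmult K (mmult K A B) C i j = mmult K A (mmult K B C) i j"
    unfolding mmult_def sum_distrib_left sum_distrib_right by (subst sum.swap) (simp add: mult.assoc)
qed

lemma tr_on_mmult_commute: "tr_on K (mmult K A B) = tr_on K (mmult K B A)"
  unfolding tr_on_def mmult_def by (subst sum.swap) (simp add: mult.commute)

lemma sym_on_gramian: "sym_on K (gramian p L)"
  by (simp add: sym_on_def gramian_def mmult_def transposed_def mult.commute)

lemma a_coef_gramian: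
  assumes F: "factorizes p L S"
  shows "a_coef 1 p S = tr_on {..<p} (gramian p L) / real p"
    "a_coef 2 p S = frob2 {..<p} (gramian p L) / real p"
    "a_coef 4 p S = frob2 {..<p} (mmult {..<p} (gramian p L) (gramian p L)) / real p"
proof -
  let ?K = "{..<p}"
  let ?B = "gramian p L"
  define s where "s = mmult ?K L (transposed L)"
  have S: "S \<in> carrier_mat p p" using F by (simp add: factorizes_def)
  have ent: "S $$ (i, j) = s i j" if "i < p" "j < p" for i j
    using F that by (simp add: factorizes_def s_def mmult_def transposed_def)
  have tr: "mtrace A = tr_on ?K a" if "A \<in> carrier_mat p p" "\<And>i j. i < p \<Longrightarrow> j < p \<Longrightarrow> A $$ (i, j) = a i j" for A a
    using that by (auto simp: mtrace_def tr_on_def)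
  have mul: "(A * C) $$ (i, j) = mmult ?K a c i j"
    if "A \<in> carrier_mat p p" "C \<in> carrier_mat p p" "\<And>i j. i < p \<Longrightarrow> j < p \<Longrightarrow> A $$ (i, j) = a i j"
      "\<And>i j. i < p \<Longrightarrow> j < p \<Longrightarrow> C $$ (i, j) = c i j" "i < p" "j < p" for A C a c i j
    using that by (auto simp: mmult_def scalar_prod_def lessThan_atLeast0 intro!: sum.cong)
  have S1: "S ^\<^sub>m 1 = S" using S by simp
  have S2: "S ^\<^sub>m 2 = S * S" using S by (simp add: numeral_2_eq_2)
  have S4: "S ^\<^sub>m 4 = S * S * S * S" using S by (simp add: eval_nat_numeral)
  have e2: "(S * S) $$ (i, j) = mmult ?K s s i j" if "i < p" "j < p" for i j
    by (rule mul[OF S S ent ent that])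
  have e3: "(S * S * S) $$ (i, j) = mmult ?K (mmult ?K s s) s i j" if "i < p" "j < p" for i j
    by (rule mul[OF _ S e2 ent that]) (use S in auto)
  have e4: "(S * S * S * S) $$ (i, j) = mmult ?K (mmult ?K (mmult ?K s s) s) s i j" if "i < p" "j < p" for i j
    by (rule mul[OF _ S e3 ent that]) (use S in auto)
  have "tr_on ?K s = tr_on ?K ?B" unfolding s_def gramian_def by (rule tr_on_mmult_commute)
  then show "a_coef 1 p S = tr_on ?K ?B / real p"
    using tr[OF S ent] by (simp only: a_coef_def S1)
  have "tr_on ?K (mmult ?K s s) = tr_on ?K (mmult ?K L (mmult ?K ?B (transposed L)))"
    by (simp only: s_def gramian_def mmult_assoc)
  also have "\<dots> = tr_on ?K (mmult ?K ?B ?B)"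
    by (subst tr_on_mmult_commute) (simp only: gramian_def mmult_assoc)
  also have "\<dots> = frob2 ?K ?B" by (rule tr_on_mmult[OF sym_on_gramian])
  finally show "a_coef 2 p S = frob2 ?K ?B / real p"
    using tr[OF mult_carrier_mat[OF S S] e2] by (simp only: a_coef_def S2)
  have "tr_on ?K (mmult ?K (mmult ?K (mmult ?K s s) s) s) = tr_on ?K (mmult ?K L (mmult ?K ?B (mmult ?K ?B (mmult ?K ?B (transposed L)))))"
    by (simp only: s_def gramian_def mmult_assoc)
  also have "\<dots> = tr_on ?K (mmult ?K (mmult ?K ?B ?B) (mmult ?K ?B ?B))"
    by (subst tr_on_mmult_commute) (simp only: gramian_def mmult_assoc)
  also have "\<dots> = frob2 ?K (mmult ?K ?B ?B)" by (rule tr_on_mmult[OF sym_on_mmult[OF sym_on_gramian]])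
  finally show "a_coef 4 p S = frob2 ?K (mmult ?K ?B ?B) / real p"
    using tr[OF mult_carrier_mat[OF mult_carrier_mat[OF mult_carrier_mat[OF S S] S] S] e4]
    by (simp only: a_coef_def S4)
qed

lemma Delta_factorizes:
  assumes F: "factorizes p L S" and \<mu>: "\<mu> \<in> carrier_vec p" and \<mu>0: "\<mu>0 \<in> carrier_vec p" and N: "0 < N"
    and e0: "\<And>j. j < p \<Longrightarrow> sqrt (real N) * (\<mu> $ j - \<mu>0 $ j) = (\<Sum>k<p. L j k * e0 k)"
  shows "(\<Sum>k<p. (e0 k)\<^sup>2) = real N * Delta2 \<mu> \<mu>0 S"
    "(\<Sum>j<p. (\<Sum>k<p. L j k * e0 k)\<^sup>2) = real N * DeltaI2 \<mu> \<mu>0"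
    "(\<Sum>k<p. (\<Sum>j<p. L j k * (\<Sum>l<p. L j l * e0 l))\<^sup>2) = real N * DeltaS2 \<mu> \<mu>0 S"
proof -
  let ?s = "sqrt (real N)" and ?d = "\<mu> - \<mu>0"
  have s: "?s > 0" "?s\<^sup>2 = real N" using N by auto
  have d: "?d \<in> carrier_vec p" "\<And>j. j < p \<Longrightarrow> ?s * ?d $ j = (\<Sum>k<p. L j k * e0 k)"
    using \<mu> \<mu>0 e0 by auto
  have "?d $ j = (\<Sum>k<p. L j k * (e0 k / ?s))" if "j < p" for j
    using d(2)[OF that] s(1) by (simp add: sum_divide_distrib[symmetric] field_simps)
  from quad_form_minverse_factorizes[OF F d(1) this]
  have "Delta2 \<mu> \<mu>0 S = (\<Sum>k<p. (e0 k)\<^sup>2) / real N"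
    by (simp add: Delta2_def power_divide sum_divide_distrib[symmetric] s(2))
  then show "(\<Sum>k<p. (e0 k)\<^sup>2) = real N * Delta2 \<mu> \<mu>0 S" using N by simp
  have "(\<Sum>j<p. (\<Sum>k<p. L j k * e0 k)\<^sup>2) = (\<Sum>j<p. (?s * ?d $ j)\<^sup>2)" by (intro sum.cong refl) (simp only: d(2) lessThan_iff)
  also have "\<dots> = real N * DeltaI2 \<mu> \<mu>0"
    unfolding DeltaI2_def scalar_prod_sum[OF d(1)] power_mult_distrib s(2) sum_distrib_left power2_eq_square[of "_ $ _"] ..
  finally show "(\<Sum>j<p. (\<Sum>k<p. L j k * e0 k)\<^sup>2) = real N * DeltaI2 \<mu> \<mu>0" .
  have S: "S \<in> carrier_mat p p" using F by (simp add: factorizes_def)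
  have "DeltaS2 \<mu> \<mu>0 S = (\<Sum>i<p. ?d $ i * (S *\<^sub>v ?d) $ i)"
    unfolding DeltaS2_def quad_form_def by (rule scalar_prod_sum[OF mult_mat_vec_carrier[OF S d(1)]])
  also have "\<dots> = (\<Sum>i<p. ?d $ i * (\<Sum>k<p. L i k * (\<Sum>j<p. L j k * ?d $ j)))"
    by (intro sum.cong refl) (simp only: factorizes_mult[OF F d(1)] lessThan_iff)
  also have "\<dots> = (\<Sum>k<p. (\<Sum>i<p. L i k * ?d $ i) * (\<Sum>j<p. L j k * ?d $ j))"
    unfolding sum_distrib_left[of "?d $ _"] sum_distrib_right[of _ _ "\<Sum>j<p. L j _ * ?d $ j"]
    by (subst sum.swap) (simp only: mult_ac)
  finally have q: "DeltaS2 \<mu> \<mu>0 S = (\<Sum>k<p. (\<Sum>j<p. L j k * ?d $ j)\<^sup>2)" by (simp only: power2_eq_square)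
  have "(\<Sum>j<p. L j k * (\<Sum>l<p. L j l * e0 l)) = ?s * (\<Sum>j<p. L j k * ?d $ j)" for k
    unfolding sum_distrib_left[of ?s] by (intro sum.cong refl) (simp add: d(2)[symmetric] del: index_minus_vec)
  then show "(\<Sum>k<p. (\<Sum>j<p. L j k * (\<Sum>l<p. L j l * e0 l))\<^sup>2) = real N * DeltaS2 \<mu> \<mu>0 S"
    by (simp only: q power_mult_distrib s(2) sum_distrib_left[symmetric])
qed

section \<open>Rows of a Gaussian matrix\<close>

lemma centered_cong: "(\<And>k. k \<in> K \<Longrightarrow> x k = y k) \<Longrightarrow> centered K C x = centered K C y"
  by (simp add: centered_def quadratic_def)

lemma distr_row:
  assumes "i \<in> R"
  shows "distr (gauss (R \<times> {..<p})) (gauss {..<p}) (\<lambda>z. \<lambda>j\<in>{..<p::nat}. z (i, j)) = gauss {..<p}"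
  by (rule distr_PiM_reindex) (use assms in \<open>auto simp: prob_space_normal_density inj_on_def\<close>)

lemma measurable_row:
  assumes "i \<in> R"
  shows "(\<lambda>z. \<lambda>j\<in>{..<p::nat}. z (i, j)) \<in> measurable (gauss (R \<times> {..<p})) (gauss {..<p})"
  using assms by (intro measurable_restrict measurable_component_singleton) auto

lemma integral_row:
  fixes f :: "(nat \<Rightarrow> real) \<Rightarrow> 'b::{banach, second_countable_topology}"
  assumes "i \<in> R" and f: "f \<in> borel_measurable (gauss {..<p})" and c: "\<And>x. f (\<lambda>j\<in>{..<p}. x j) = f x"
  shows "(LINT z|gauss (R \<times> {..<p}). f (\<lambda>j. z (i, j))) = (LINT x|gauss {..<p}. f x)"
proof -
  have "(LINT x|gauss {..<p}. f x) = (LINT x|distr (gauss (R \<times> {..<p})) (gauss {..<p}) (\<lambda>z. \<lambda>j\<in>{..<p}. z (i, j)). f x)"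
    by (simp only: distr_row[OF assms(1)])
  also have "\<dots> = (LINT z|gauss (R \<times> {..<p}). f (\<lambda>j\<in>{..<p}. z (i, j)))"
    by (rule integral_distr[OF measurable_row[OF assms(1)] f])
  finally show ?thesis by (simp only: c)
qed

text \<open>Row \<open>i\<close> is integrated first; the merge map puts it back into the matrix.\<close>
lemma integral_out_row:
  fixes F :: "(nat \<times> nat \<Rightarrow> real) \<Rightarrow> real"
  assumes i: "i < N" and F: "integrable (gauss ({..<N} \<times> {..<p})) F"
  shows "(LINT z|gauss ({..<N} \<times> {..<p}). F z)
    = (LINT x|gauss (({..<N} - {i}) \<times> {..<p}). LINT y|gauss {..<p}.
         F (merge (({..<N} - {i}) \<times> {..<p}) ({i} \<times> {..<p}) (x, \<lambda>k\<in>{i} \<times> {..<p}. y (snd k))))"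
proof -
  let ?I = "({..<N} - {i}) \<times> {..<p}" and ?J = "{i} \<times> {..<p}"
  have IJ: "?I \<inter> ?J = {}" "?I \<union> ?J = {..<N} \<times> {..<p}" using i by auto
  have "(LINT z|gauss (?I \<union> ?J). F z) = (LINT x|gauss ?I. LINT w|gauss ?J. F (merge ?I ?J (x, w)))"
    by (rule product_gauss.product_integral_fold) (use IJ F in auto)
  also have "\<dots> = (LINT x|gauss ?I. LINT y|gauss {..<p}. F (merge ?I ?J (x, \<lambda>k\<in>?J. y (snd k))))"
  proof (rule Bochner_Integration.integral_cong[OF refl])
    fix x assume x: "x \<in> space (gauss ?I)"
    have D: "distr (gauss {..<p}) (gauss ?J) (\<lambda>y. \<lambda>k\<in>?J. y (snd k)) = gauss ?J"
      by (rule distr_PiM_reindex) (auto simp: prob_space_normal_density inj_on_def)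
    have m: "(\<lambda>y. \<lambda>k\<in>?J. y (snd k)) \<in> measurable (gauss {..<p}) (gauss ?J)"
      by (intro measurable_restrict measurable_component_singleton) auto
    have Fm: "F \<in> borel_measurable (gauss (?I \<union> ?J))" using F IJ(2) by auto
    have "(\<lambda>w. F (merge ?I ?J (x, w))) \<in> borel_measurable (gauss ?J)"
      using measurable_compose[OF measurable_compose[OF measurable_Pair1'[OF x] measurable_merge] Fm] .
    from integral_distr[OF m this] show "(LINT w|gauss ?J. F (merge ?I ?J (x, w))) = (LINT y|gauss {..<p}. F (merge ?I ?J (x, \<lambda>k\<in>?J. y (snd k))))"
      by (simp only: D)
  qed
  finally show ?thesis by (simp only: IJ(2))
qed

lemma linear_form_square:
  assumes "finite K"
  shows "(LINT x|gauss K. (\<Sum>k\<in>K. h k * x k)\<^sup>2) = (\<Sum>k\<in>K. (h k)\<^sup>2)"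
proof -
  have "(\<Sum>k\<in>K. h k * x k)\<^sup>2 = quadratic K (\<lambda>a b. h a * h b) x" for x
    by (simp add: quadratic_def power2_eq_square sum_product mult_ac)
  then have "(LINT x|gauss K. (\<Sum>k\<in>K. h k * x k)\<^sup>2) = tr_on K (\<lambda>a b. h a * h b)"
    using expectation_quadratic[OF assms, of "\<lambda>a b. h a * h b"] by (simp add: sym_on_def mult.commute)
  then show ?thesis by (simp add: tr_on_def power2_eq_square)
qed

text \<open>The multiple \<open>\<gamma>\<close> of the identity, for which the centred quadratic form is a centred chi-square variable.\<close>
definition scaled_id :: "real \<Rightarrow> 'i \<Rightarrow> 'i \<Rightarrow> real" where
  "scaled_id \<gamma> a b = (if a = b then \<gamma> else 0)"

lemma scaled_id_facts:
  assumes "finite K"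
  shows "sym_on K (scaled_id \<gamma>)" "centered K (scaled_id \<gamma>) x = \<gamma> * ((\<Sum>k\<in>K. (x k)\<^sup>2) - real (card K))"
    "frob2 K (scaled_id \<gamma>) = \<gamma>\<^sup>2 * real (card K)"
    "frob2 K (mmult K (scaled_id \<gamma>) (scaled_id \<gamma>)) = \<gamma> ^ 4 * real (card K)"
proof -
  have d: "(\<Sum>b\<in>K. (if a = b then f b else 0)) = f a" if "a \<in> K" for a and f :: "'a \<Rightarrow> real"
    using that assms by simp
  show "sym_on K (scaled_id \<gamma>)" by (simp add: sym_on_def scaled_id_def)
  have "quadratic K (scaled_id \<gamma>) x = (\<Sum>a\<in>K. \<Sum>b\<in>K. if a = b then \<gamma> * x a * x b else 0)"
    unfolding quadratic_def by (intro sum.cong refl) (simp add: scaled_id_def)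
  also have "\<dots> = \<gamma> * (\<Sum>k\<in>K. (x k)\<^sup>2)" by (simp add: d power2_eq_square sum_distrib_left mult.assoc)
  finally show "centered K (scaled_id \<gamma>) x = \<gamma> * ((\<Sum>k\<in>K. (x k)\<^sup>2) - real (card K))"
    by (simp add: centered_def tr_on_def scaled_id_def algebra_simps)
  have fr: "frob2 K (scaled_id g) = g\<^sup>2 * real (card K)" for g
  proof -
    have "frob2 K (scaled_id g) = (\<Sum>a\<in>K. \<Sum>b\<in>K. if a = b then g\<^sup>2 else 0)"
      unfolding frob2_def by (intro sum.cong refl) (simp add: scaled_id_def)
    then show ?thesis by (simp add: d)
  qed
  show "frob2 K (scaled_id \<gamma>) = \<gamma>\<^sup>2 * real (card K)" by (rule fr)
  have "mmult K (scaled_id \<gamma>) (scaled_id \<gamma>) a b = scaled_id (\<gamma>\<^sup>2) a b" if "a \<in> K" for a b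
  proof -
    have "mmult K (scaled_id \<gamma>) (scaled_id \<gamma>) a b = (\<Sum>c\<in>K. if a = c then \<gamma> * scaled_id \<gamma> c b else 0)"
      unfolding mmult_def by (intro sum.cong refl) (simp add: scaled_id_def)
    then show ?thesis using that by (simp add: d) (simp add: scaled_id_def power2_eq_square)
  qed
  then have "frob2 K (mmult K (scaled_id \<gamma>) (scaled_id \<gamma>)) = frob2 K (scaled_id (\<gamma>\<^sup>2))"
    unfolding frob2_def by (intro sum.cong refl) simp
  then show "frob2 K (mmult K (scaled_id \<gamma>) (scaled_id \<gamma>)) = \<gamma> ^ 4 * real (card K)"
    by (simp add: fr)
qed

lemma reflection_cong:
  assumes "\<And>k. k \<in> K \<Longrightarrow> u k = u' k" "\<And>k. k \<in> K \<Longrightarrow> x k = x' k" "j \<in> K"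
  shows "reflection K u x j = reflection K u' x' j"
  using assms by (simp add: reflection_def)

section \<open>Independence of the first row and the residual\<close>

text \<open>The residual \<open>V\<close>, the denominator of the Hotelling statistic.\<close>
definition Vstat :: "nat \<Rightarrow> nat \<Rightarrow> (nat \<Rightarrow> real) \<Rightarrow> (nat \<times> nat \<Rightarrow> real) \<Rightarrow> real" where
  "Vstat N p e0 z = vdir {1..<N} {..<p} 0 z (noncentral e0 z)"

definition chisq :: "nat \<Rightarrow> real measure" where
  "chisq m = distr (gauss {..<m}) borel (\<lambda>w. \<Sum>i<m. (w i)\<^sup>2)"

lemma prob_space_chisq: "prob_space (chisq m)"
  unfolding chisq_def by (rule prob_space.prob_space_distr[OF prob_space_gauss]) measurable

lemma sets_chisq [simp, measurable_cong]: "sets (chisq m) = sets borel" by (simp add: chisq_def)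

lemma borel_measurable_Vstat [measurable]:
  assumes "0 < p"
  shows "Vstat N p e0 \<in> borel_measurable (gauss ({..<N} \<times> {..<p}))"
proof -
  let ?G = "gauss ({..<N} \<times> {..<p})" and ?C = "{..<p}" and ?R = "{1..<N}"
  have co: "(\<lambda>z. z (i, j)) \<in> borel_measurable ?G" if "i < N" "j < p" for i j
    using that by (intro all_moments_measurable all_moments_coordinate) simp
  have vm: "(\<lambda>Y. vmin ?R ?C Y 0) \<in> borel_measurable (\<Pi>\<^sub>M k\<in>?R \<times> ?C. borel)"
    by (rule measurable_vmin) (use assms in auto)
  show ?thesis
  proof (cases "N = 0")
    case True
    have R: "?R = {}" using True by simp
    have "Vstat N p e0 z = vmin {} ?C (\<lambda>_. 0) 0" for z
      unfolding Vstat_def vdir_def R by (simp add: vmin_def sqlen_def[abs_def])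
    then have "Vstat N p e0 = (\<lambda>_. vmin {} ?C (\<lambda>_. 0) 0)" by (rule ext)
    then show ?thesis by (rule ssubst) (rule borel_measurable_const)
  next
    case False
    have ne: "(\<lambda>z. noncentral e0 z j) \<in> borel_measurable ?G" if "j < p" for j
      unfolding noncentral_def using that False by (intro borel_measurable_add co borel_measurable_const) auto
    have el: "(\<lambda>z. elen ?C (noncentral e0 z)) \<in> borel_measurable ?G"
      unfolding elen_def by (intro measurable_compose[OF _ borel_measurable_sqrt] borel_measurable_sum borel_measurable_power ne) simp
    define u where "u z j = noncentral e0 z j - (if j = 0 then elen ?C (noncentral e0 z) else 0)" for z j
    have u: "(\<lambda>z. u z j) \<in> borel_measurable ?G" if "j < p" for j
      unfolding u_def using ne[OF that] el by simp
    have "(\<lambda>z. reflect_cols ?R ?C (u z) z) \<in> measurable ?G (\<Pi>\<^sub>M k\<in>?R \<times> ?C. borel)"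
      unfolding reflect_cols_def
    proof (rule measurable_restrict)
      fix k assume "k \<in> ?R \<times> ?C"
      then obtain i j where k: "k = (i, j)" "i \<in> ?R" "i < N" "j < p" by auto
      then have "(\<lambda>z. case k of (i, j) \<Rightarrow> reflection ?C (u z) (\<lambda>l. z (i, l)) j)
        = (\<lambda>z. z (i, j) - 2 * (\<Sum>l<p. u z l * z (i, l)) / (\<Sum>l<p. (u z l)\<^sup>2) * u z j)"
        by (simp add: reflection_def)
      also have "\<dots> \<in> borel_measurable ?G"
        using k by (intro borel_measurable_diff borel_measurable_times borel_measurable_divide borel_measurable_sum
          borel_measurable_const borel_measurable_power co u) auto
      finally show "(\<lambda>z. case k of (i, j) \<Rightarrow> reflection ?C (u z) (\<lambda>l. z (i, l)) j) \<in> borel_measurable ?G" .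
    qed
    from measurable_compose[OF this vm] show ?thesis
      unfolding Vstat_def[abs_def] vdir_def u_def[abs_def] .
  qed
qed

text \<open>For every fixed direction \<open>e\<close> the law of \<open>vdir\<close> is the same chi-square law, because a column reflection preserves the Gaussian matrix. Conditioning on the first row, which determines the direction, therefore shows that \<open>V\<close> is independent of it.\<close>
theorem distr_row_Vstat:
  assumes p: "0 < p" and N: "p < N"
  shows "distr (gauss ({..<N} \<times> {..<p})) (gauss {..<p} \<Otimes>\<^sub>M chisq (N - p)) (\<lambda>z. (\<lambda>j\<in>{..<p}. z (0, j), Vstat N p e0 z))
    = gauss {..<p} \<Otimes>\<^sub>M chisq (N - p)"
proof (rule pair_measure_eqI[symmetric])
  let ?G = "gauss ({..<N} \<times> {..<p})" and ?C = "{..<p}" and ?R = "{1..<N}" and ?m = "N - p"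
  let ?f = "\<lambda>z. (\<lambda>j\<in>{..<p}. z (0, j), Vstat N p e0 z)"
  show "sigma_finite_measure (gauss ?C)" "sigma_finite_measure (chisq ?m)"
    by (auto intro: prob_space_imp_sigma_finite prob_space_gauss prob_space_chisq)
  have f: "?f \<in> measurable ?G (gauss ?C \<Otimes>\<^sub>M chisq ?m)"
  proof (rule measurable_Pair)
    show "(\<lambda>z. \<lambda>j\<in>{..<p}. z (0, j)) \<in> measurable ?G (gauss ?C)" by (rule measurable_row) (use N in simp)
    show "Vstat N p e0 \<in> measurable ?G (chisq ?m)"
      using borel_measurable_Vstat[OF p, of N e0] by (simp cong: measurable_cong_sets)
  qed
  fix A B assume A: "A \<in> sets (gauss ?C)" and B: "B \<in> sets (chisq ?m)"
  have B': "B \<in> sets borel" using B by simp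
  let ?IA = "indicator A :: _ \<Rightarrow> ennreal" and ?IB = "indicator B :: _ \<Rightarrow> ennreal"
  let ?r = "\<lambda>x. \<lambda>j\<in>{..<p}. x (0::nat, j)"
  have split: "{0::nat} \<times> ?C \<inter> ?R \<times> ?C = {}" "{0::nat} \<times> ?C \<union> ?R \<times> ?C = {..<N} \<times> ?C" using N by auto
  have vlaw: "(\<integral>\<^sup>+Y. ?IB (vdir ?R ?C 0 Y e) \<partial>gauss (?R \<times> ?C)) = emeasure (chisq ?m) B" for e
  proof -
    have vm: "(\<lambda>Y. vmin ?R ?C Y 0) \<in> borel_measurable (\<Pi>\<^sub>M k\<in>?R \<times> ?C. borel)"
      by (rule measurable_vmin) (use p in auto)
    define u where "u j = e j - (if j = 0 then elen ?C e else 0)" for j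
    have rm: "reflect_cols ?R ?C u \<in> measurable (gauss (?R \<times> ?C)) (\<Pi>\<^sub>M k\<in>?R \<times> ?C. borel)"
      unfolding reflect_cols_def
    proof (rule measurable_restrict)
      fix k assume "k \<in> ?R \<times> ?C"
      then obtain i j where k: "k = (i, j)" "i \<in> ?R" "j < p" by auto
      then have "(\<lambda>z. case k of (i, j) \<Rightarrow> reflection ?C u (\<lambda>l. z (i, l)) j)
        = (\<lambda>z. z (i, j) - 2 * (\<Sum>l<p. u l * z (i, l)) / (\<Sum>l<p. (u l)\<^sup>2) * u j)"
        by (simp add: reflection_def)
      also have "\<dots> \<in> borel_measurable (gauss (?R \<times> ?C))"
        using k by (intro borel_measurable_diff borel_measurable_times borel_measurable_divide borel_measurable_sum
          borel_measurable_const all_moments_measurable[OF all_moments_coordinate]) auto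
      finally show "(\<lambda>z. case k of (i, j) \<Rightarrow> reflection ?C u (\<lambda>l. z (i, l)) j) \<in> borel_measurable (gauss (?R \<times> ?C))" .
    qed
    have card: "card ?C \<le> card ?R" "card ?R + 1 - card ?C = ?m" using N by auto
    have "(\<integral>\<^sup>+Y. ?IB (vdir ?R ?C 0 Y e) \<partial>gauss (?R \<times> ?C)) = (\<integral>\<^sup>+Y. ?IB (vmin ?R ?C (reflect_cols ?R ?C u Y) 0) \<partial>gauss (?R \<times> ?C))"
      unfolding vdir_def u_def[abs_def] ..
    also have "\<dots> = (\<integral>\<^sup>+Y. ?IB (vmin ?R ?C Y 0) \<partial>distr (gauss (?R \<times> ?C)) (\<Pi>\<^sub>M k\<in>?R \<times> ?C. borel) (reflect_cols ?R ?C u))"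
      by (rule nn_integral_distr[OF rm, symmetric]) (use vm B' in measurable)
    also have "\<dots> = (\<integral>\<^sup>+Y. ?IB (vmin ?R ?C Y 0) \<partial>gauss (?R \<times> ?C))" by (subst distr_reflect_cols) auto
    also have "\<dots> = (\<integral>\<^sup>+s. ?IB s \<partial>distr (gauss (?R \<times> ?C)) borel (\<lambda>Y. vmin ?R ?C Y 0))"
      by (rule nn_integral_distr[symmetric]) (use vm B' in \<open>auto cong: measurable_cong_sets\<close>)
    also have "distr (gauss (?R \<times> ?C)) borel (\<lambda>Y. vmin ?R ?C Y 0) = chisq ?m"
      using distr_vmin[of ?R ?C 0] p card by (simp add: chisq_def)
    also have "(\<integral>\<^sup>+s. ?IB s \<partial>chisq ?m) = emeasure (chisq ?m) B" using B by simp
    finally show ?thesis .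
  qed
  have fm: "(\<lambda>z. ?IA (?r z) * ?IB (Vstat N p e0 z)) \<in> borel_measurable ?G"
    using measurable_compose[OF measurable_row[of 0 "{..<N}" p], of ?IA borel] A B' p N
    by (intro borel_measurable_times_ennreal measurable_compose[OF borel_measurable_Vstat]) auto
  have "emeasure (distr ?G (gauss ?C \<Otimes>\<^sub>M chisq ?m) ?f) (A \<times> B) = (\<integral>\<^sup>+q. indicator (A \<times> B) q \<partial>distr ?G (gauss ?C \<Otimes>\<^sub>M chisq ?m) ?f)"
    using A B by simp
  also have "\<dots> = (\<integral>\<^sup>+z. indicator (A \<times> B) (?f z) \<partial>?G)"
    by (rule nn_integral_distr[OF f]) (use A B in auto)
  also have "\<dots> = (\<integral>\<^sup>+z. ?IA (?r z) * ?IB (Vstat N p e0 z) \<partial>gauss ({0::nat} \<times> ?C \<union> ?R \<times> ?C))"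
    by (simp only: split(2)) (simp only: indicator_times fst_conv snd_conv)
  also have "\<dots> = (\<integral>\<^sup>+x. (\<integral>\<^sup>+Y. ?IA (?r (merge ({0::nat} \<times> ?C) (?R \<times> ?C) (x, Y))) * ?IB (Vstat N p e0 (merge ({0::nat} \<times> ?C) (?R \<times> ?C) (x, Y))) \<partial>gauss (?R \<times> ?C)) \<partial>gauss ({0::nat} \<times> ?C))"
    by (rule product_gauss.product_nn_integral_fold) (use fm split in auto)
  also have "\<dots> = (\<integral>\<^sup>+x. ?IA (?r x) * emeasure (chisq ?m) B \<partial>gauss ({0::nat} \<times> ?C))"
  proof (rule nn_integral_cong)
    fix x assume x: "x \<in> space (gauss ({0::nat} \<times> ?C))"
    have r: "?r (merge ({0::nat} \<times> ?C) (?R \<times> ?C) (x, Y)) = ?r x" for Y by (auto simp: fun_eq_iff merge_def)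
    have V: "Vstat N p e0 (merge ({0::nat} \<times> ?C) (?R \<times> ?C) (x, Y)) = vdir ?R ?C 0 Y (noncentral e0 x)" for Y
    proof -
      let ?z = "merge ({0::nat} \<times> ?C) (?R \<times> ?C) (x, Y)"
      have n: "noncentral e0 ?z j = noncentral e0 x j" if "j < p" for j using that by (simp add: noncentral_def merge_def)
      then have el: "elen ?C (noncentral e0 ?z) = elen ?C (noncentral e0 x)" by (simp add: elen_def)
      have Y: "?z (i, j) = Y (i, j)" if "i \<in> ?R" "j < p" for i j using that by (auto simp: merge_def)
      show ?thesis unfolding Vstat_def vdir_def
      proof (rule vmin_cong)
        fix i j assume ij: "i \<in> ?R" "j \<in> ?C"
        have "reflection ?C (\<lambda>l. noncentral e0 ?z l - (if l = 0 then elen ?C (noncentral e0 ?z) else 0)) (\<lambda>l. ?z (i, l)) j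
          = reflection ?C (\<lambda>l. noncentral e0 x l - (if l = 0 then elen ?C (noncentral e0 x) else 0)) (\<lambda>l. Y (i, l)) j"
          by (rule reflection_cong) (use ij n Y in \<open>simp_all only: el lessThan_iff\<close>)
        then show "reflect_cols ?R ?C (\<lambda>l. noncentral e0 ?z l - (if l = 0 then elen ?C (noncentral e0 ?z) else 0)) ?z (i, j)
          = reflect_cols ?R ?C (\<lambda>l. noncentral e0 x l - (if l = 0 then elen ?C (noncentral e0 x) else 0)) Y (i, j)"
          unfolding reflect_cols_def using ij by simp
      qed
    qed
    have vm2: "(\<lambda>Y. ?IB (vdir ?R ?C 0 Y (noncentral e0 x))) \<in> borel_measurable (gauss (?R \<times> ?C))"
    proof -
      have "(\<lambda>Y. merge ({0::nat} \<times> ?C) (?R \<times> ?C) (x, Y)) \<in> measurable (gauss (?R \<times> ?C)) (gauss ({0::nat} \<times> ?C \<union> ?R \<times> ?C))"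
        using measurable_compose[OF measurable_Pair1'[OF x] measurable_merge] .
      from measurable_compose[OF this, of "Vstat N p e0" borel] have "(\<lambda>Y. vdir ?R ?C 0 Y (noncentral e0 x)) \<in> borel_measurable (gauss (?R \<times> ?C))"
        using borel_measurable_Vstat[OF p, of N e0] by (simp only: V split(2))
      then show ?thesis using B' by measurable
    qed
    show "(\<integral>\<^sup>+Y. ?IA (?r (merge ({0::nat} \<times> ?C) (?R \<times> ?C) (x, Y))) * ?IB (Vstat N p e0 (merge ({0::nat} \<times> ?C) (?R \<times> ?C) (x, Y))) \<partial>gauss (?R \<times> ?C))
      = ?IA (?r x) * emeasure (chisq ?m) B"
      unfolding r V using vm2 by (subst nn_integral_cmult) (simp_all only: vlaw)
  qed
  also have "\<dots> = (\<integral>\<^sup>+x. ?IA (?r x) \<partial>gauss ({0::nat} \<times> ?C)) * emeasure (chisq ?m) B"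
  proof (rule nn_integral_multc)
    have "?r \<in> measurable (gauss ({0::nat} \<times> ?C)) (gauss ?C)" by (intro measurable_restrict measurable_component_singleton) auto
    then show "(\<lambda>x. ?IA (?r x)) \<in> borel_measurable (gauss ({0::nat} \<times> ?C))" using A by measurable
  qed
  also have "(\<integral>\<^sup>+x. ?IA (?r x) \<partial>gauss ({0::nat} \<times> ?C)) = emeasure (gauss ?C) A"
  proof -
    have rm: "?r \<in> measurable (gauss ({0::nat} \<times> ?C)) (gauss ?C)" by (intro measurable_restrict measurable_component_singleton) auto
    have D: "distr (gauss ({0::nat} \<times> ?C)) (gauss ?C) ?r = gauss ?C"
      by (rule distr_PiM_reindex) (auto simp: prob_space_normal_density inj_on_def)
    have "(\<integral>\<^sup>+x. ?IA (?r x) \<partial>gauss ({0::nat} \<times> ?C)) = (\<integral>\<^sup>+y. ?IA y \<partial>distr (gauss ({0::nat} \<times> ?C)) (gauss ?C) ?r)"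
      by (rule nn_integral_distr[OF rm, symmetric]) (use A in auto)
    then show ?thesis using A by (simp only: D nn_integral_indicator)
  qed
  finally show "emeasure (gauss ?C) A * emeasure (chisq ?m) B = emeasure (distr ?G (gauss ?C \<Otimes>\<^sub>M chisq ?m) ?f) (A \<times> B)" by (rule sym)
qed simp

section \<open>Sums over independent rows\<close>

lemma integral_row_zero:
  fixes N p :: nat
  assumes i: "i < N" and F: "integrable (gauss ({..<N} \<times> {..<p})) F"
    and 0: "\<And>x. (LINT y|gauss {..<p}. F (merge (({..<N} - {i}) \<times> {..<p}) ({i} \<times> {..<p}) (x, \<lambda>k\<in>{i} \<times> {..<p}. y (snd k)))) = (0::real)"
  shows "(LINT z|gauss ({..<N} \<times> {..<p}). F z) = 0"
  unfolding integral_out_row[OF i F] 0 by simp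

lemma all_moments_row:
  fixes p :: nat
  assumes "i \<in> R"
  shows "all_moments (gauss (R \<times> {..<p})) (\<lambda>z. quadratic {..<p} C (\<lambda>j. z (i, j)))"
    "all_moments (gauss (R \<times> {..<p})) (\<lambda>z. centered {..<p} C (\<lambda>j. z (i, j)))"
    "all_moments (gauss (R \<times> {..<p})) (\<lambda>z. mvec {..<p} C (\<lambda>j. z (i, j)) k)"
proof -
  have c: "all_moments (gauss (R \<times> {..<p})) (\<lambda>z. z (i, j))" if "j \<in> {..<p}" for j
    using that assms by (intro all_moments_coordinate) simp
  show q: "all_moments (gauss (R \<times> {..<p})) (\<lambda>z. quadratic {..<p} C (\<lambda>j. z (i, j)))"
    unfolding quadratic_def by (intro gauss_moments c)
  show "all_moments (gauss (R \<times> {..<p})) (\<lambda>z. centered {..<p} C (\<lambda>j. z (i, j)))"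
    unfolding centered_def by (intro gauss_moments q)
  show "all_moments (gauss (R \<times> {..<p})) (\<lambda>z. mvec {..<p} C (\<lambda>j. z (i, j)) k)"
    unfolding mvec_def by (intro gauss_moments c)
qed

lemma centered_row_square:
  fixes p :: nat
  assumes "i \<in> R" "sym_on {..<p} C"
  shows "(LINT z|gauss (R \<times> {..<p}). (centered {..<p} C (\<lambda>j. z (i, j)))\<^sup>2) = 2 * frob2 {..<p} C"
proof -
  have "(LINT z|gauss (R \<times> {..<p}). (centered {..<p} C (\<lambda>j. z (i, j)))\<^sup>2) = (LINT x|gauss {..<p}. (centered {..<p} C x)\<^sup>2)"
  proof (rule integral_row[OF assms(1)])
    show "(\<lambda>x. (centered {..<p} C x)\<^sup>2) \<in> borel_measurable (gauss {..<p})"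
      by (intro all_moments_measurable gauss_moments all_moments_centered)
    show "(centered {..<p} C (\<lambda>j\<in>{..<p}. x j))\<^sup>2 = (centered {..<p} C x)\<^sup>2" for x
      by (rule arg_cong[where f="\<lambda>s. s\<^sup>2"], rule centered_cong) simp
  qed
  then show ?thesis by (simp only: expectation_centered_square[OF finite_lessThan assms(2)])
qed

lemma merge_row_fun:
  fixes N p :: nat
  assumes "l < N" "l \<noteq> i"
  shows "centered {..<p} C (\<lambda>j. merge (({..<N} - {i}) \<times> {..<p}) ({i} \<times> {..<p}) (x, \<lambda>k\<in>{i} \<times> {..<p}. y (snd k)) (i, j)) = centered {..<p} C y"
    "centered {..<p} C (\<lambda>j. merge (({..<N} - {i}) \<times> {..<p}) ({i} \<times> {..<p}) (x, \<lambda>k\<in>{i} \<times> {..<p}. y (snd k)) (l, j)) = centered {..<p} C (\<lambda>j. x (l, j))"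
  by (rule centered_cong, use assms in \<open>simp add: merge_def\<close>)+

text \<open>Mixed terms vanish because each summand has mean zero given the other rows.\<close>
theorem sum_centered_rows_square:
  fixes R :: "nat set" and p :: nat
  assumes R: "R \<subseteq> {..<N}" and C: "sym_on {..<p} C"
  shows "(LINT z|gauss ({..<N} \<times> {..<p}). (\<Sum>i\<in>R. centered {..<p} C (\<lambda>j. z (i, j)))\<^sup>2) = real (card R) * (2 * frob2 {..<p} C)"
proof -
  let ?G = "gauss ({..<N} \<times> {..<p})"
  define f where "f i z = centered {..<p} C (\<lambda>j. z (i, j))" for i :: nat and z
  have f: "all_moments ?G (f i)" if "i \<in> R" for i
    unfolding f_def using that R by (intro all_moments_row) auto
  have cross: "(LINT z|?G. f i z * f l z) = (if i = l then 2 * frob2 {..<p} C else 0)" if il: "i \<in> R" "l \<in> R" for i l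
  proof (cases "i = l")
    case True
    then show ?thesis using centered_row_square[of i "{..<N}" p C] that R C
      by (simp add: f_def power2_eq_square subset_iff)
  next
    case False
    have iN: "i < N" "l < N" using il R by auto
    have "(LINT z|?G. f i z * f l z) = 0"
    proof (rule integral_row_zero[OF iN(1)])
      show "integrable ?G (\<lambda>z. f i z * f l z)" by (intro all_moments_integrable gauss_moments f il)
      fix x
      show "(LINT y|gauss {..<p}. f i (merge (({..<N} - {i}) \<times> {..<p}) ({i} \<times> {..<p}) (x, \<lambda>k\<in>{i} \<times> {..<p}. y (snd k)))
          * f l (merge (({..<N} - {i}) \<times> {..<p}) ({i} \<times> {..<p}) (x, \<lambda>k\<in>{i} \<times> {..<p}. y (snd k)))) = 0"
        unfolding f_def merge_row_fun[OF iN(2) False[symmetric]]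
        by (simp add: expectation_centered[OF finite_lessThan C])
    qed
    then show ?thesis using False by simp
  qed
  have "(LINT z|?G. (\<Sum>i\<in>R. f i z)\<^sup>2) = (LINT z|?G. (\<Sum>i\<in>R. \<Sum>l\<in>R. f i z * f l z))"
    by (simp only: power2_eq_square sum_product)
  also have "\<dots> = (\<Sum>i\<in>R. \<Sum>l\<in>R. LINT z|?G. f i z * f l z)"
    by (subst Bochner_Integration.integral_sum, intro all_moments_integrable gauss_moments f, assumption+,
        intro sum.cong refl Bochner_Integration.integral_sum all_moments_integrable gauss_moments f)
  also have "\<dots> = (\<Sum>i\<in>R. \<Sum>l\<in>R. if i = l then 2 * frob2 {..<p} C else 0)"
    by (intro sum.cong refl cross)
  also have "\<dots> = real (card R) * (2 * frob2 {..<p} C)"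
    using finite_subset[OF R] by simp
  finally show ?thesis by (simp add: f_def)
qed

section \<open>A degenerate kernel for squared inner products of rows\<close>

text \<open>The square of the inner product of two rows, minus its projections on functions of a single row (the second-order part of the Hoeffding decomposition).\<close>
definition kern :: "nat \<Rightarrow> (nat \<Rightarrow> nat \<Rightarrow> real) \<Rightarrow> (nat \<Rightarrow> real) \<Rightarrow> (nat \<Rightarrow> real) \<Rightarrow> real" where
  "kern p B x y = (\<Sum>k<p. x k * mvec {..<p} B y k)\<^sup>2 - quadratic {..<p} (mmult {..<p} B B) x
     - quadratic {..<p} (mmult {..<p} B B) y + frob2 {..<p} B"

lemma kern_cong:
  assumes "\<And>j. j < p \<Longrightarrow> x j = x' j" "\<And>j. j < p \<Longrightarrow> y j = y' j"
  shows "kern p B x y = kern p B x' y'"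
  using assms by (simp add: kern_def quadratic_def mvec_def)

lemma kern_commute:
  assumes "sym_on {..<p} B"
  shows "kern p B x y = kern p B y x"
proof -
  have "(\<Sum>k<p. x k * mvec {..<p} B y k) = (\<Sum>k<p. \<Sum>l<p. x k * (B k l * y l))" by (simp add: mvec_def sum_distrib_left)
  also have "\<dots> = (\<Sum>l<p. \<Sum>k<p. x k * (B k l * y l))" by (rule sum.swap)
  also have "\<dots> = (\<Sum>l<p. y l * mvec {..<p} B x l)"
    unfolding mvec_def sum_distrib_left using assms by (intro sum.cong refl) (auto simp: sym_on_def)
  finally show ?thesis by (simp add: kern_def)
qed

text \<open>For fixed \<open>x\<close> the kernel is a centred quadratic form in \<open>y\<close>, with this matrix.\<close>
definition kern_matrix :: "nat \<Rightarrow> (nat \<Rightarrow> nat \<Rightarrow> real) \<Rightarrow> (nat \<Rightarrow> real) \<Rightarrow> nat \<Rightarrow> nat \<Rightarrow> real" where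
  "kern_matrix p B x a b = mvec {..<p} B x a * mvec {..<p} B x b - mmult {..<p} B B a b"

lemma kern_centered:
  assumes B: "sym_on {..<p} B"
  shows "kern p B y x = centered {..<p} (kern_matrix p B x) y" "sym_on {..<p} (kern_matrix p B x)"
    "frob2 {..<p} (kern_matrix p B x) \<le> 2 * ((quadratic {..<p} (mmult {..<p} B B) x)\<^sup>2 + frob2 {..<p} (mmult {..<p} B B))"
proof -
  let ?h = "mvec {..<p} B x" and ?BB = "mmult {..<p} B B"
  have hh: "(\<Sum>a<p. (?h a)\<^sup>2) = quadratic {..<p} ?BB x" by (rule sum_mvec_square[OF finite_lessThan B])
  have "quadratic {..<p} (kern_matrix p B x) y = (\<Sum>a<p. \<Sum>b<p. (y a * ?h a) * (y b * ?h b)) - quadratic {..<p} ?BB y"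
    by (simp add: quadratic_def kern_matrix_def left_diff_distrib right_diff_distrib sum_subtractf mult_ac)
  also have "(\<Sum>a<p. \<Sum>b<p. (y a * ?h a) * (y b * ?h b)) = (\<Sum>k<p. y k * ?h k)\<^sup>2"
    by (simp only: power2_eq_square sum_product)
  finally have q: "quadratic {..<p} (kern_matrix p B x) y = (\<Sum>k<p. y k * ?h k)\<^sup>2 - quadratic {..<p} ?BB y" .
  have "tr_on {..<p} (kern_matrix p B x) = (\<Sum>a<p. (?h a)\<^sup>2) - tr_on {..<p} ?BB"
    by (simp add: tr_on_def kern_matrix_def sum_subtractf power2_eq_square)
  then have "tr_on {..<p} (kern_matrix p B x) = quadratic {..<p} ?BB x - frob2 {..<p} B"
    by (simp add: hh tr_on_mmult[OF B])
  then show "kern p B y x = centered {..<p} (kern_matrix p B x) y"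
    by (simp add: kern_def centered_def q)
  show "sym_on {..<p} (kern_matrix p B x)"
    using sym_on_mmult[OF B] by (auto simp: sym_on_def kern_matrix_def mult.commute)
  have sq: "(a - b)\<^sup>2 \<le> 2 * (a\<^sup>2 + b\<^sup>2)" for a b :: real
    using zero_le_power2[of "a + b"] by (simp add: power2_eq_square algebra_simps)
  have "frob2 {..<p} (kern_matrix p B x) \<le> (\<Sum>a<p. \<Sum>b<p. 2 * ((?h a * ?h b)\<^sup>2 + (?BB a b)\<^sup>2))"
    unfolding frob2_def kern_matrix_def by (intro sum_mono sq)
  also have "\<dots> = 2 * ((\<Sum>a<p. \<Sum>b<p. (?h a)\<^sup>2 * (?h b)\<^sup>2) + frob2 {..<p} ?BB)"
    by (simp add: frob2_def sum.distrib sum_distrib_left power_mult_distrib)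
  also have "(\<Sum>a<p. \<Sum>b<p. (?h a)\<^sup>2 * (?h b)\<^sup>2) = (quadratic {..<p} ?BB x)\<^sup>2"
    by (simp only: hh[symmetric] power2_eq_square[of "\<Sum>a<p. _ a"] sum_product)
  finally show "frob2 {..<p} (kern_matrix p B x) \<le> 2 * ((quadratic {..<p} ?BB x)\<^sup>2 + frob2 {..<p} ?BB)" .
qed

lemma kern_mean: "sym_on {..<p} B \<Longrightarrow> (LINT y|gauss {..<p}. kern p B y x) = 0"
  by (simp add: kern_centered expectation_centered)

lemma kern_mean_square:
  assumes "sym_on {..<p} B"
  shows "(LINT y|gauss {..<p}. (kern p B y x)\<^sup>2) \<le> 4 * ((quadratic {..<p} (mmult {..<p} B B) x)\<^sup>2 + frob2 {..<p} (mmult {..<p} B B))"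
  using kern_centered(3)[OF assms, of x]
  by (simp add: kern_centered(1)[OF assms] expectation_centered_square[OF finite_lessThan kern_centered(2)[OF assms]])

lemma all_moments_kern:
  assumes "i \<in> R" "l \<in> R"
  shows "all_moments (gauss (R \<times> {..<p})) (\<lambda>z. kern p B (\<lambda>j. z (i, j)) (\<lambda>j. z (l, j)))"
proof -
  have c: "all_moments (gauss (R \<times> {..<p})) (\<lambda>z. z (i, j))" if "j \<in> {..<p}" for j
    using that assms by (intro all_moments_coordinate) simp
  show ?thesis
    unfolding kern_def using assms by (intro gauss_moments all_moments_row c)
qed

definition kern_bound :: "nat \<Rightarrow> (nat \<Rightarrow> nat \<Rightarrow> real) \<Rightarrow> real" where
  "kern_bound p B = 4 * ((frob2 {..<p} B)\<^sup>2 + 3 * frob2 {..<p} (mmult {..<p} B B))"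

lemma kern_bound_nonneg: "kern_bound p B \<ge> 0" by (simp add: kern_bound_def)

lemma quadratic_row_square:
  fixes p :: nat
  assumes "l \<in> R" and B: "sym_on {..<p} B"
  shows "(LINT z|gauss (R \<times> {..<p}). (quadratic {..<p} (mmult {..<p} B B) (\<lambda>j. z (l, j)))\<^sup>2)
    = 2 * frob2 {..<p} (mmult {..<p} B B) + (frob2 {..<p} B)\<^sup>2"
proof -
  let ?BB = "mmult {..<p} B B" and ?G = "gauss (R \<times> {..<p})"
  let ?c = "\<lambda>z. centered {..<p} ?BB (\<lambda>j. z (l, j))" and ?t = "frob2 {..<p} B"
  have s: "sym_on {..<p} ?BB" by (rule sym_on_mmult[OF B])
  have c: "all_moments ?G ?c" by (rule all_moments_row(2)[OF assms(1)])
  have mean: "(LINT z|?G. ?c z) = 0"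
  proof -
    have "(LINT z|?G. ?c z) = (LINT x|gauss {..<p}. centered {..<p} ?BB x)"
      by (rule integral_row[OF assms(1)]) (auto intro!: all_moments_measurable all_moments_centered centered_cong)
    then show ?thesis by (simp add: expectation_centered[OF finite_lessThan s])
  qed
  have "(LINT z|?G. (quadratic {..<p} ?BB (\<lambda>j. z (l, j)))\<^sup>2) = (LINT z|?G. (?c z)\<^sup>2 + (2 * ?t * ?c z + ?t\<^sup>2))"
    by (intro Bochner_Integration.integral_cong refl)
       (simp add: centered_def tr_on_mmult[OF B] power2_eq_square algebra_simps)
  also have "\<dots> = (LINT z|?G. (?c z)\<^sup>2) + (LINT z|?G. 2 * ?t * ?c z + ?t\<^sup>2)"
    by (rule Bochner_Integration.integral_add) (intro all_moments_integrable gauss_moments c)+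
  also have "(LINT z|?G. 2 * ?t * ?c z + ?t\<^sup>2) = (LINT z|?G. 2 * ?t * ?c z) + (LINT z|?G. ?t\<^sup>2)"
    by (rule Bochner_Integration.integral_add) (intro all_moments_integrable gauss_moments c)+
  also have "(LINT z|?G. ?t\<^sup>2) = ?t\<^sup>2" by (simp add: prob_space.prob_space[OF prob_space_gauss])
  finally show ?thesis
    by (simp add: centered_row_square[OF assms(1) s] mean)
qed

lemma merge_kern:
  fixes N p :: nat
  assumes "l < N" "l \<noteq> i"
  shows "kern p B (\<lambda>j. merge (({..<N} - {i}) \<times> {..<p}) ({i} \<times> {..<p}) (x, \<lambda>k\<in>{i} \<times> {..<p}. y (snd k)) (i, j))
      (\<lambda>j. merge (({..<N} - {i}) \<times> {..<p}) ({i} \<times> {..<p}) (x, \<lambda>k\<in>{i} \<times> {..<p}. y (snd k)) (l, j)) = kern p B y (\<lambda>j. x (l, j))"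
    "l' < N \<Longrightarrow> l' \<noteq> i \<Longrightarrow> kern p B (\<lambda>j. merge (({..<N} - {i}) \<times> {..<p}) ({i} \<times> {..<p}) (x, \<lambda>k\<in>{i} \<times> {..<p}. y (snd k)) (l, j))
      (\<lambda>j. merge (({..<N} - {i}) \<times> {..<p}) ({i} \<times> {..<p}) (x, \<lambda>k\<in>{i} \<times> {..<p}. y (snd k)) (l', j)) = kern p B (\<lambda>j. x (l, j)) (\<lambda>j. x (l', j))"
  by (rule kern_cong; use assms in \<open>simp add: merge_def\<close>)+

lemma kern_rows_square:
  fixes N p :: nat
  assumes il: "i < N" "l < N" "i \<noteq> l" and B: "sym_on {..<p} B"
  shows "(LINT z|gauss ({..<N} \<times> {..<p}). (kern p B (\<lambda>j. z (i, j)) (\<lambda>j. z (l, j)))\<^sup>2) \<le> kern_bound p B"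
proof -
  let ?G = "gauss ({..<N} \<times> {..<p})" and ?H = "gauss (({..<N} - {i}) \<times> {..<p})" and ?BB = "mmult {..<p} B B"
  have l: "l \<in> {..<N} - {i}" using il by auto
  have F: "integrable ?G (\<lambda>z. (kern p B (\<lambda>j. z (i, j)) (\<lambda>j. z (l, j)))\<^sup>2)"
    by (intro all_moments_integrable gauss_moments all_moments_kern) (use il in auto)
  have q: "all_moments ?H (\<lambda>x. (quadratic {..<p} ?BB (\<lambda>j. x (l, j)))\<^sup>2)"
    by (intro gauss_moments all_moments_row l)
  have bnd: "integrable ?H (\<lambda>x. 4 * ((quadratic {..<p} ?BB (\<lambda>j. x (l, j)))\<^sup>2 + frob2 {..<p} ?BB))"
    by (intro all_moments_integrable gauss_moments all_moments_row l)
  have "(LINT z|?G. (kern p B (\<lambda>j. z (i, j)) (\<lambda>j. z (l, j)))\<^sup>2)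
     = (LINT x|?H. LINT y|gauss {..<p}. (kern p B y (\<lambda>j. x (l, j)))\<^sup>2)"
    by (subst integral_out_row[OF il(1) F]) (simp only: merge_kern(1)[OF il(2) il(3)[symmetric]])
  also have "\<dots> \<le> (LINT x|?H. 4 * ((quadratic {..<p} ?BB (\<lambda>j. x (l, j)))\<^sup>2 + frob2 {..<p} ?BB))"
    by (rule integral_mono'[OF bnd kern_mean_square[OF B]]) simp
  also have "\<dots> = 4 * ((LINT x|?H. (quadratic {..<p} ?BB (\<lambda>j. x (l, j)))\<^sup>2) + (LINT x|?H. frob2 {..<p} ?BB))"
    by (subst integral_mult_right_zero, subst Bochner_Integration.integral_add)
       (auto intro: all_moments_integrable q gauss_moments)
  also have "\<dots> = kern_bound p B"
    by (simp add: quadratic_row_square[OF l B] kern_bound_def prob_space.prob_space[OF prob_space_gauss])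
  finally show ?thesis .
qed

text \<open>The kernel has mean zero in each argument. Hence two terms are uncorrelated unless they involve the same pair of rows, and the second moment of the sum is of the order of the number of pairs rather than its square.\<close>
theorem sum_kern_square:
  fixes N p :: nat
  assumes R: "R \<subseteq> {..<N}" and B: "sym_on {..<p} B"
  shows "(LINT z|gauss ({..<N} \<times> {..<p}). (\<Sum>i\<in>R. \<Sum>l\<in>R - {i}. kern p B (\<lambda>j. z (i, j)) (\<lambda>j. z (l, j)))\<^sup>2)
    \<le> 2 * (real (card R))\<^sup>2 * kern_bound p B"
proof -
  let ?G = "gauss ({..<N} \<times> {..<p})"
  define P where "P = Sigma R (\<lambda>i. R - {i})"
  define f where "f q z = kern p B (\<lambda>j. z (fst q, j)) (\<lambda>j. z (snd q, j))" for q :: "nat \<times> nat" and z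
  have fin: "finite R" using R by (rule finite_subset) simp
  then have finP: "finite P" by (simp add: P_def)
  have f: "all_moments ?G (f q)" if "q \<in> P" for q
    unfolding f_def using that R by (intro all_moments_kern) (auto simp: P_def)
  have PN: "fst q < N" "snd q < N" "fst q \<noteq> snd q" if "q \<in> P" for q using that R by (auto simp: P_def)
  have swap: "f q = f (snd q, fst q)" for q unfolding f_def by (rule ext) (simp add: kern_commute[OF B])
  have zero1: "(LINT z|?G. f q z * f q' z) = 0" if q: "q \<in> P" "q' \<in> P" and ne: "fst q \<noteq> fst q'" "fst q \<noteq> snd q'" for q q'
  proof (rule integral_row_zero[OF PN(1)[OF q(1)]])
    show "integrable ?G (\<lambda>z. f q z * f q' z)" by (intro all_moments_integrable gauss_moments f q)
    fix x
    show "(LINT y|gauss {..<p}. f q (merge (({..<N} - {fst q}) \<times> {..<p}) ({fst q} \<times> {..<p}) (x, \<lambda>k\<in>{fst q} \<times> {..<p}. y (snd k)))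
        * f q' (merge (({..<N} - {fst q}) \<times> {..<p}) ({fst q} \<times> {..<p}) (x, \<lambda>k\<in>{fst q} \<times> {..<p}. y (snd k)))) = 0"
      unfolding f_def merge_kern(1)[OF PN(2)[OF q(1)] PN(3)[OF q(1), symmetric]]
        merge_kern(2)[OF PN(1)[OF q(2)] ne(1)[symmetric] PN(2)[OF q(2)] ne(2)[symmetric]]
      by (simp add: kern_mean[OF B])
  qed
  have bound: "(LINT z|?G. f q z * f q' z) \<le> (if q' = q then kern_bound p B else 0) + (if q' = (snd q, fst q) then kern_bound p B else 0)"
    if q: "q \<in> P" "q' \<in> P" for q q'
  proof -
    have sq: "(LINT z|?G. f q z * f q z) \<le> kern_bound p B"
      using kern_rows_square[OF PN[OF q(1)] B] by (simp add: f_def power2_eq_square)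
    have nn: "0 \<le> kern_bound p B" by (rule kern_bound_nonneg)
    have neq: "q \<noteq> (snd q, fst q)" using PN(3)[OF q(1)] by (metis fst_conv)
    consider "q' = q" | "q' = (snd q, fst q)" | "fst q \<noteq> fst q' \<and> fst q \<noteq> snd q'" | "snd q \<noteq> fst q' \<and> snd q \<noteq> snd q'"
      using PN(3)[OF q(1)] PN(3)[OF q(2)] by (metis prod.collapse)
    then show ?thesis
    proof cases
      case 1 then show ?thesis using sq neq by simp
    next
      case 2 then show ?thesis using sq neq swap[of q] by simp
    next
      case 3 then show ?thesis using zero1[OF q] nn by simp
    next
      case 4
      have "(snd q, fst q) \<in> P" using q(1) by (auto simp: P_def)
      from zero1[OF this q(2)] 4 have "(LINT z|?G. f q z * f q' z) = 0" using swap[of q] by simp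
      then show ?thesis using nn by simp
    qed
  qed
  have "(LINT z|?G. (\<Sum>q\<in>P. f q z)\<^sup>2) = (LINT z|?G. (\<Sum>q\<in>P. \<Sum>q'\<in>P. f q z * f q' z))"
    by (simp only: power2_eq_square sum_product)
  also have "\<dots> = (\<Sum>q\<in>P. \<Sum>q'\<in>P. LINT z|?G. f q z * f q' z)"
    by (subst Bochner_Integration.integral_sum, intro all_moments_integrable gauss_moments f, assumption+,
        intro sum.cong refl Bochner_Integration.integral_sum all_moments_integrable gauss_moments f)
  also have "\<dots> \<le> (\<Sum>q\<in>P. \<Sum>q'\<in>P. (if q' = q then kern_bound p B else 0) + (if q' = (snd q, fst q) then kern_bound p B else 0))"
    by (intro sum_mono bound)
  also have "\<dots> \<le> (\<Sum>q\<in>P. 2 * kern_bound p B)"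
  proof (rule sum_mono)
    fix q assume "q \<in> P"
    then show "(\<Sum>q'\<in>P. (if q' = q then kern_bound p B else 0) + (if q' = (snd q, fst q) then kern_bound p B else 0)) \<le> 2 * kern_bound p B"
      using finP kern_bound_nonneg[of p B] by (simp add: sum.distrib)
  qed
  also have "\<dots> = real (card P) * (2 * kern_bound p B)" by simp
  also have "\<dots> \<le> (real (card R))\<^sup>2 * (2 * kern_bound p B)"
  proof (rule mult_right_mono)
    have "card P \<le> card (R \<times> R)" using fin by (intro card_mono) (auto simp: P_def)
    then have "card P \<le> card R * card R" by (simp add: card_cartesian_product)
    then have "real (card P) \<le> real (card R * card R)" by (rule of_nat_mono)
    then show "real (card P) \<le> (real (card R))\<^sup>2" by (simp add: power2_eq_square)
  qed (use kern_bound_nonneg[of p B] in simp)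
  finally have "(LINT z|?G. (\<Sum>q\<in>P. f q z)\<^sup>2) \<le> 2 * (real (card R))\<^sup>2 * kern_bound p B" by (simp add: mult_ac)
  moreover have "(\<Sum>q\<in>P. f q z) = (\<Sum>i\<in>R. \<Sum>l\<in>R - {i}. kern p B (\<lambda>j. z (i, j)) (\<lambda>j. z (l, j)))" for z
    unfolding P_def f_def using fin by (subst sum.Sigma) (auto simp: split_beta')
  ultimately show ?thesis by simp
qed

lemma row_inner_gramian:
  "row_inner p L z i l = (\<Sum>k<p. z (i, k) * mvec {..<p} (gramian p L) (\<lambda>j. z (l, j)) k)"
proof -
  have "(\<Sum>j<p. L j k * colored p L z l j) = mvec {..<p} (gramian p L) (\<lambda>j. z (l, j)) k" for k
  proof -
    have "(\<Sum>j<p. L j k * colored p L z l j) = (\<Sum>j<p. \<Sum>m<p. L j k * (L j m * z (l, m)))"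
      by (simp add: colored_def sum_distrib_left)
    also have "\<dots> = (\<Sum>m<p. \<Sum>j<p. L j k * (L j m * z (l, m)))" by (rule sum.swap)
    also have "\<dots> = mvec {..<p} (gramian p L) (\<lambda>j. z (l, j)) k"
      by (simp add: mvec_def gramian_def mmult_def transposed_def sum_distrib_right mult.assoc)
    finally show ?thesis .
  qed
  then show ?thesis unfolding row_inner_def by (simp only: colored_inner)
qed

section \<open>Joint law of the first row and the residual\<close>

lemma distr_Vstat:
  assumes "0 < p" "p < N"
  shows "distr (gauss ({..<N} \<times> {..<p})) (chisq (N - p)) (Vstat N p e0) = chisq (N - p)"
proof -
  let ?G = "gauss ({..<N} \<times> {..<p})" and ?P = "gauss {..<p} \<Otimes>\<^sub>M chisq (N - p)"
  interpret C: prob_space "chisq (N - p)" by (rule prob_space_chisq)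
  interpret R: prob_space "gauss {..<p}" by (rule prob_space_gauss)
  interpret P: pair_prob_space "gauss {..<p}" "chisq (N - p)" ..
  have f: "(\<lambda>z. (\<lambda>j\<in>{..<p}. z (0, j), Vstat N p e0 z)) \<in> measurable ?G ?P"
  proof (rule measurable_Pair)
    show "(\<lambda>z. \<lambda>j\<in>{..<p}. z (0, j)) \<in> measurable ?G (gauss {..<p})" by (rule measurable_row) (use assms in simp)
    show "Vstat N p e0 \<in> measurable ?G (chisq (N - p))"
      using borel_measurable_Vstat[OF assms(1), of N e0] by (simp cong: measurable_cong_sets)
  qed
  have "chisq (N - p) = distr ?P (chisq (N - p)) snd"
  proof (rule measure_eqI)
    fix A assume A: "A \<in> sets (chisq (N - p))"
    then have "snd -` A \<inter> space ?P = space (gauss {..<p}) \<times> A"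
      using sets.sets_into_space[OF A] by (auto simp: space_pair_measure)
    then have "emeasure (distr ?P (chisq (N - p)) snd) A = emeasure (gauss {..<p}) (space (gauss {..<p})) * emeasure (chisq (N - p)) A"
      using A by (subst emeasure_distr) (simp_all only: measurable_snd C.emeasure_pair_measure_Times sets.top)
    then show "emeasure (chisq (N - p)) A = emeasure (distr ?P (chisq (N - p)) snd) A"
      by (simp only: R.emeasure_space_1 mult_1_left)
  qed simp
  also have "\<dots> = distr (distr ?G ?P (\<lambda>z. (\<lambda>j\<in>{..<p}. z (0, j), Vstat N p e0 z))) (chisq (N - p)) snd"
    by (simp only: distr_row_Vstat[OF assms])
  also have "\<dots> = distr ?G (chisq (N - p)) (snd \<circ> (\<lambda>z. (\<lambda>j\<in>{..<p}. z (0, j), Vstat N p e0 z)))"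
    by (rule distr_distr[OF measurable_snd f])
  finally show ?thesis by (simp add: comp_def)
qed

lemma integral_chisq:
  fixes f :: "real \<Rightarrow> 'b::{banach, second_countable_topology}"
  assumes [measurable]: "f \<in> borel_measurable borel"
  shows "(LINT v|chisq m. f v) = (LINT w|gauss {..<m}. f (\<Sum>i<m. (w i)\<^sup>2))"
  unfolding chisq_def by (rule integral_distr) measurable

lemma Vstat_variance:
  assumes "0 < p" "p < N"
  shows "integrable (gauss ({..<N} \<times> {..<p})) (\<lambda>z. (Vstat N p e0 z - real (N - p))\<^sup>2)"
    "(LINT z|gauss ({..<N} \<times> {..<p}). (Vstat N p e0 z - real (N - p))\<^sup>2) = 2 * real (N - p)"
proof -
  let ?G = "gauss ({..<N} \<times> {..<p})" and ?m = "N - p"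
  have V: "Vstat N p e0 \<in> measurable ?G (chisq ?m)"
    using borel_measurable_Vstat[OF assms(1), of N e0] by (simp cong: measurable_cong_sets)
  have b: "(\<lambda>v. (v - real ?m)\<^sup>2) \<in> borel_measurable borel" by measurable
  have c: "(\<Sum>i<?m. (w i)\<^sup>2) - real ?m = centered {..<?m} (scaled_id 1) w" for w
    by (simp add: scaled_id_facts)
  have i: "integrable (chisq ?m) (\<lambda>v. (v - real ?m)\<^sup>2)"
    unfolding chisq_def
  proof (subst integrable_distr_eq)
    show "integrable (gauss {..<?m}) (\<lambda>w. ((\<Sum>i<?m. (w i)\<^sup>2) - real ?m)\<^sup>2)"
      unfolding c by (intro all_moments_integrable gauss_moments all_moments_centered)
  qed measurable
  have "(LINT v|chisq ?m. (v - real ?m)\<^sup>2) = (LINT w|gauss {..<?m}. (centered {..<?m} (scaled_id 1) w)\<^sup>2)"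
    by (subst integral_chisq[OF b]) (simp only: c)
  also have "\<dots> = 2 * real ?m"
    by (subst expectation_centered_square) (simp_all add: scaled_id_facts)
  finally have e: "(LINT v|chisq ?m. (v - real ?m)\<^sup>2) = 2 * real ?m" .
  have i': "integrable (distr ?G (chisq ?m) (Vstat N p e0)) (\<lambda>v. (v - real ?m)\<^sup>2)"
    unfolding distr_Vstat[OF assms] by (rule i)
  have b': "(\<lambda>v. (v - real ?m)\<^sup>2) \<in> borel_measurable (chisq ?m)" using b by (simp cong: measurable_cong_sets)
  show "integrable ?G (\<lambda>z. (Vstat N p e0 z - real ?m)\<^sup>2)"
    using i' unfolding integrable_distr_eq[OF V b'] .
  show "(LINT z|?G. (Vstat N p e0 z - real ?m)\<^sup>2) = 2 * real ?m"
    using integral_distr[OF V b'] unfolding distr_Vstat[OF assms] e by (rule sym)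
qed

lemma integral_pair_times:
  fixes f :: "'a \<Rightarrow> complex" and g :: "'b \<Rightarrow> complex"
  assumes "prob_space M1" "prob_space M2"
    and [measurable]: "f \<in> borel_measurable M1" "g \<in> borel_measurable M2" and b: "\<And>x. norm (f x) \<le> 1" "\<And>y. norm (g y) \<le> 1"
  shows "(LINT q|(M1 \<Otimes>\<^sub>M M2). f (fst q) * g (snd q)) = (LINT x|M1. f x) * (LINT y|M2. g y)"
proof -
  interpret A: prob_space M1 by fact
  interpret B: prob_space M2 by fact
  interpret P: pair_prob_space M1 M2 ..
  have "integrable (M1 \<Otimes>\<^sub>M M2) (\<lambda>q. f (fst q) * g (snd q))"
    by (rule P.P.integrable_const_bound[of _ 1]) (use b in \<open>auto simp: norm_mult intro!: mult_le_one\<close>)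
  from P.integral_fst'[OF this] have "(LINT q|(M1 \<Otimes>\<^sub>M M2). f (fst q) * g (snd q)) = (LINT x|M1. LINT y|M2. f x * g y)" by simp
  then show ?thesis by simp
qed

text \<open>By independence the characteristic function factors, and both factors are those of centred quadratic forms.\<close>
lemma char_row_Vstat:
  assumes p: "0 < p" "p < N"
  shows "(LINT z|gauss ({..<N} \<times> {..<p}). iexp (t * (centered {..<p} C (\<lambda>j. z (0, j)) - \<gamma> * (Vstat N p e0 z - real (N - p)))))
    = (LINT x|gauss {..<p}. iexp (t * centered {..<p} C x))
      * (LINT w|gauss {..<N - p}. iexp (t * centered {..<N - p} (scaled_id (- \<gamma>)) w))"
proof -
  let ?G = "gauss ({..<N} \<times> {..<p})" and ?m = "N - p" and ?P = "gauss {..<p} \<Otimes>\<^sub>M chisq (N - p)"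
  let ?F = "\<lambda>z. (\<lambda>j\<in>{..<p}. z (0, j), Vstat N p e0 z)"
  let ?f = "\<lambda>x. iexp (t * centered {..<p} C x)" and ?g = "\<lambda>v. iexp (t * - \<gamma> * (v - real ?m))"
  have F: "?F \<in> measurable ?G ?P"
  proof (rule measurable_Pair)
    show "(\<lambda>z. \<lambda>j\<in>{..<p}. z (0, j)) \<in> measurable ?G (gauss {..<p})" by (rule measurable_row) (use assms in simp)
    show "Vstat N p e0 \<in> measurable ?G (chisq (N - p))"
      using borel_measurable_Vstat[OF p(1), of N e0] by (simp cong: measurable_cong_sets)
  qed
  have cm: "centered {..<p} C \<in> borel_measurable (gauss {..<p})" by (rule all_moments_measurable[OF all_moments_centered])
  have f: "?f \<in> borel_measurable (gauss {..<p})" using cm by measurable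
  have g: "?g \<in> borel_measurable borel" by measurable
  have g': "?g \<in> borel_measurable (chisq ?m)" using g by (simp cong: measurable_cong_sets)
  have h: "(\<lambda>q. ?f (fst q) * ?g (snd q)) \<in> borel_measurable ?P" using f g' by measurable
  have eq: "iexp (t * (centered {..<p} C (\<lambda>j. z (0, j)) - \<gamma> * (Vstat N p e0 z - real ?m))) = ?f (fst (?F z)) * ?g (snd (?F z))" for z
  proof -
    have "centered {..<p} C (\<lambda>j\<in>{..<p}. z (0, j)) = centered {..<p} C (\<lambda>j. z (0, j))" by (rule centered_cong) simp
    then show ?thesis by (simp add: exp_add[symmetric] algebra_simps)
  qed
  have "(LINT z|?G. iexp (t * (centered {..<p} C (\<lambda>j. z (0, j)) - \<gamma> * (Vstat N p e0 z - real ?m))))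
    = (LINT z|?G. ?f (fst (?F z)) * ?g (snd (?F z)))" by (simp only: eq)
  also have "\<dots> = (LINT q|?P. ?f (fst q) * ?g (snd q))"
    using integral_distr[OF F h] unfolding distr_row_Vstat[OF p] by (rule sym)
  also have "\<dots> = (LINT x|gauss {..<p}. ?f x) * (LINT v|chisq ?m. ?g v)"
    by (rule integral_pair_times[OF prob_space_gauss prob_space_chisq f g']) simp_all
  also have "(LINT v|chisq ?m. ?g v) = (LINT w|gauss {..<?m}. iexp (t * centered {..<?m} (scaled_id (- \<gamma>)) w))"
    unfolding integral_chisq[OF g] by (simp add: scaled_id_facts mult.assoc)
  finally show ?thesis .
qed

section \<open>The test statistic and the variance estimates in rotated coordinates\<close>

text \<open>The trace of the sample covariance matrix.\<close>
definition tau :: "nat \<Rightarrow> nat \<Rightarrow> (nat \<Rightarrow> nat \<Rightarrow> real) \<Rightarrow> (nat \<times> nat \<Rightarrow> real) \<Rightarrow> real" where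
  "tau N p L z = (\<Sum>i\<in>{1..<N}. row_inner p L z i i) / real (N - 1)"

lemma row_inner_self:
  "row_inner p L z i i = centered {..<p} (gramian p L) (\<lambda>j. z (i, j)) + tr_on {..<p} (gramian p L)"
  unfolding row_inner_gramian centered_def quadratic_def mvec_def
  by (simp add: sum_distrib_left mult_ac)

lemma row_inner_square:
  "(row_inner p L z i l)\<^sup>2 = kern p (gramian p L) (\<lambda>j. z (i, j)) (\<lambda>j. z (l, j))
     + centered {..<p} (mmult {..<p} (gramian p L) (gramian p L)) (\<lambda>j. z (i, j))
     + centered {..<p} (mmult {..<p} (gramian p L) (gramian p L)) (\<lambda>j. z (l, j)) + frob2 {..<p} (gramian p L)"
  by (simp add: row_inner_gramian kern_def centered_def tr_on_mmult[OF sym_on_gramian])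

lemma tau_centered:
  assumes "1 < N"
  shows "tau N p L z = tr_on {..<p} (gramian p L) + (\<Sum>i\<in>{1..<N}. centered {..<p} (gramian p L) (\<lambda>j. z (i, j))) / real (N - 1)"
proof -
  have "card {1..<N} = N - 1" by simp
  then have "(\<Sum>i\<in>{1..<N}. row_inner p L z i i) = (\<Sum>i\<in>{1..<N}. centered {..<p} (gramian p L) (\<lambda>j. z (i, j))) + real (N - 1) * tr_on {..<p} (gramian p L)"
    unfolding row_inner_self sum.distrib by (simp only: sum_constant)
  then show ?thesis using assms unfolding tau_def by (simp add: add_divide_distrib)
qed

text \<open>Counting how often a single-row term occurs among ordered pairs of distinct rows.\<close>
lemma off_diagonal_sum:
  fixes K :: "'i \<Rightarrow> 'i \<Rightarrow> real"
  assumes R: "finite R" "R \<noteq> {}"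
  shows "(\<Sum>i\<in>R. \<Sum>l\<in>R - {i}. K i l + c i + c l + F)
    = (\<Sum>i\<in>R. \<Sum>l\<in>R - {i}. K i l) + 2 * (real (card R) - 1) * (\<Sum>i\<in>R. c i) + real (card R) * (real (card R) - 1) * F"
proof -
  have "(\<Sum>l\<in>R - {i}. K i l + c i + c l + F) = (\<Sum>l\<in>R - {i}. K i l) + ((real (card R) - 2) * c i + (\<Sum>l\<in>R. c l) + (real (card R) - 1) * F)"
    if i: "i \<in> R" for i
  proof -
    have "card R \<ge> 1" using R by (simp add: Suc_leI card_gt_0_iff)
    then have "real (card (R - {i})) = real (card R) - 1" using i R by (simp add: of_nat_diff)
    moreover have "(\<Sum>l\<in>R - {i}. K i l + c i + c l + F) = (\<Sum>l\<in>R - {i}. K i l) + real (card (R - {i})) * c i + (\<Sum>l\<in>R - {i}. c l) + real (card (R - {i})) * F"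
      by (simp only: sum.distrib sum_constant)
    moreover have "(\<Sum>l\<in>R - {i}. c l) = (\<Sum>l\<in>R. c l) - c i" using i R by (simp add: sum_diff1)
    ultimately show ?thesis by (simp only:) (simp add: algebra_simps)
  qed
  then have "(\<Sum>i\<in>R. \<Sum>l\<in>R - {i}. K i l + c i + c l + F)
    = (\<Sum>i\<in>R. (\<Sum>l\<in>R - {i}. K i l) + ((real (card R) - 2) * c i + (\<Sum>l\<in>R. c l) + (real (card R) - 1) * F))"
    by (intro sum.cong refl)
  also have "\<dots> = (\<Sum>i\<in>R. \<Sum>l\<in>R - {i}. K i l) + ((real (card R) - 2) * (\<Sum>i\<in>R. c i) + real (card R) * (\<Sum>l\<in>R. c l) + (real (card R) - 1) * (real (card R) * F))"
    by (simp only: sum.distrib sum_distrib_left[symmetric] sum_constant)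
  finally show ?thesis by (simp add: algebra_simps)
qed

context
  fixes N p :: nat and \<mu> \<mu>0 :: "real Matrix.vec" and L :: "nat \<Rightarrow> nat \<Rightarrow> real" and e0 :: "nat \<Rightarrow> real"
    and z :: "nat \<times> nat \<Rightarrow> real"
  assumes p: "0 < p" and N: "p < N" and \<mu>: "\<mu> \<in> carrier_vec p" and \<mu>0: "\<mu>0 \<in> carrier_vec p"
    and L: "lower_triangular p L"
    and e0: "\<And>j. j < p \<Longrightarrow> sqrt (real N) * (\<mu> $ j - \<mu>0 $ j) = (\<Sum>k<p. L j k * e0 k)"
begin

lemma trace_tau: "mtrace (sample_cov N p (canonical_sample N p \<mu> L z)) = tau N p L z"
  unfolding tau_def by (rule trace_canonical[OF p N \<mu> \<mu>0 L]) (rule e0)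

lemma T_stat_canonical:
  assumes inj: "\<And>v. (\<forall>i\<in>{1..<N}. (\<Sum>j<p. z (i, j) * v j) = 0) \<Longrightarrow> (\<forall>j<p. v j = (0::real))"
  shows "T_stat N p \<mu>0 \<rho> (canonical_sample N p \<mu> L z)
    = \<rho> * sqrt (real (N - 1)) * ((\<Sum>j<p. (noncentral e0 z j)\<^sup>2) / Vstat N p e0 z - real p / (real N - real p))
      + (1 - \<rho>) * sqrt (real (N - 1)) * ((\<Sum>j<p. (\<Sum>k<p. L j k * noncentral e0 z k)\<^sup>2) / tau N p L z - 1)"
proof -
  have h: "hotelling_T2 N p \<mu>0 (canonical_sample N p \<mu> L z) / real (N - 1) = (\<Sum>j<p. (noncentral e0 z j)\<^sup>2) / Vstat N p e0 z"
    unfolding Vstat_def by (rule hotelling_canonical[OF p N \<mu> \<mu>0 L]) (rule e0, assumption, rule inj)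
  have d: "real N * ((sample_mean N p (canonical_sample N p \<mu> L z) - \<mu>0) \<bullet> (sample_mean N p (canonical_sample N p \<mu> L z) - \<mu>0))
    = (\<Sum>j<p. (\<Sum>k<p. L j k * noncentral e0 z k)\<^sup>2)"
    by (rule dempster_canonical[OF p N \<mu> \<mu>0 L]) (rule e0)
  show ?thesis unfolding T_stat_def Let_def h dempster_D_def d trace_tau ..
qed

lemma a1_hat_canonical: "a1_hat N p (canonical_sample N p \<mu> L z) = tau N p L z / real p"
  unfolding a1_hat_def trace_tau ..

text \<open>Off the diagonal the squared inner products are decomposed into kernel, single-row terms and a constant; on the diagonal the constant part of each entry cancels against the square of the trace. What remains besides \<open>a\<^sub>2\<close> is a sum of centred quantities and of squares of low order.\<close>
lemma a2_hat_canonical: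
  assumes n: "n = real (N - 1)" "n \<ge> 2"
  defines "B \<equiv> gramian p L"
  defines "\<eta> \<equiv> (\<lambda>i. centered {..<p} B (\<lambda>j. z (i, j)))"
  shows "a2_hat N p (canonical_sample N p \<mu> L z) = n\<^sup>2 / ((n + 2) * (n - 1))
    * ((\<Sum>i\<in>{1..<N}. \<Sum>l\<in>{1..<N} - {i}. kern p B (\<lambda>j. z (i, j)) (\<lambda>j. z (l, j))) / (real p * n\<^sup>2)
       + 2 * (1 - 1 / n) * ((\<Sum>i\<in>{1..<N}. centered {..<p} (mmult {..<p} B B) (\<lambda>j. z (i, j))) / (real p * n))
       + (1 - 1 / n) * (frob2 {..<p} B / real p)
       + ((\<Sum>i\<in>{1..<N}. (\<eta> i)\<^sup>2) / (real p * n\<^sup>2) - ((\<Sum>i\<in>{1..<N}. \<eta> i) / n)\<^sup>2 / (real p * n)))"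
proof -
  let ?R = "{1..<N}"
  define KK where "KK = (\<Sum>i\<in>?R. \<Sum>l\<in>?R - {i}. kern p B (\<lambda>j. z (i, j)) (\<lambda>j. z (l, j)))"
  define Q where "Q = (\<Sum>i\<in>?R. centered {..<p} (mmult {..<p} B B) (\<lambda>j. z (i, j)))"
  define E H F t where "E = (\<Sum>i\<in>?R. (\<eta> i)\<^sup>2)" and "H = (\<Sum>i\<in>?R. \<eta> i)" and "F = frob2 {..<p} B" and "t = tr_on {..<p} B"
  have card: "real (card ?R) = n" using n by simp
  have ne: "?R \<noteq> {}" using n by auto
  have tr: "mtrace (sample_cov N p (canonical_sample N p \<mu> L z)) = (H + n * t) / n"
  proof -
    have "(\<Sum>i\<in>?R. row_inner p L z i i) = H + n * t"
      unfolding row_inner_self sum.distrib H_def \<eta>_def B_def t_def card[symmetric] by (simp only: sum_constant)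
    then show ?thesis unfolding trace_tau tau_def n(1) by (simp only:)
  qed
  have "(\<Sum>i\<in>?R. \<Sum>l\<in>?R. (row_inner p L z i l)\<^sup>2) = (\<Sum>i\<in>?R. (row_inner p L z i i)\<^sup>2 + (\<Sum>l\<in>?R - {i}. (row_inner p L z i l)\<^sup>2))"
    by (intro sum.cong refl) (subst sum.remove, auto)
  also have "\<dots> = (\<Sum>i\<in>?R. (\<eta> i + t)\<^sup>2) + (KK + 2 * (n - 1) * Q + n * (n - 1) * F)"
  proof -
    define cc where "cc i = centered {..<p} (mmult {..<p} B B) (\<lambda>j. z (i, j))" for i
    have "(\<Sum>i\<in>?R. \<Sum>l\<in>?R - {i}. (row_inner p L z i l)\<^sup>2)
      = (\<Sum>i\<in>?R. \<Sum>l\<in>?R - {i}. kern p B (\<lambda>j. z (i, j)) (\<lambda>j. z (l, j)) + cc i + cc l + F)"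
      by (simp only: row_inner_square B_def F_def cc_def)
    also have "\<dots> = KK + 2 * (n - 1) * Q + n * (n - 1) * F"
      unfolding off_diagonal_sum[OF finite_atLeastLessThan ne] KK_def Q_def card cc_def ..
    finally show ?thesis by (simp only: sum.distrib row_inner_self \<eta>_def B_def t_def)
  qed
  also have "(\<Sum>i\<in>?R. (\<eta> i + t)\<^sup>2) = (\<Sum>i\<in>?R. (\<eta> i)\<^sup>2 + 2 * t * \<eta> i + t\<^sup>2)"
    by (intro sum.cong refl) (simp add: power2_eq_square algebra_simps)
  also have "\<dots> = E + 2 * t * H + n * t\<^sup>2"
    unfolding E_def H_def card[symmetric] by (simp only: sum.distrib sum_distrib_left[symmetric] sum_constant)
  finally have S2: "mtrace (sample_cov N p (canonical_sample N p \<mu> L z) ^\<^sub>m 2)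
     = (E + 2 * t * H + n * t\<^sup>2 + (KK + 2 * (n - 1) * Q + n * (n - 1) * F)) / n\<^sup>2"
    using trace_square_canonical[OF p N \<mu> \<mu>0 L, of e0 z] e0 unfolding n(1) by (simp only:)
  have "a2_hat N p (canonical_sample N p \<mu> L z) = n\<^sup>2 / (real p * (n + 2) * (n - 1))
    * ((E + 2 * t * H + n * t\<^sup>2 + (KK + 2 * (n - 1) * Q + n * (n - 1) * F)) / n\<^sup>2 - ((H + n * t) / n)\<^sup>2 / n)"
    unfolding a2_hat_def Let_def S2 tr n(1)[symmetric] ..
  also have "(E + 2 * t * H + n * t\<^sup>2 + (KK + 2 * (n - 1) * Q + n * (n - 1) * F)) / n\<^sup>2 - ((H + n * t) / n)\<^sup>2 / n
    = KK / n\<^sup>2 + 2 * (1 - 1 / n) * (Q / n) + (1 - 1 / n) * F + (E / n\<^sup>2 - (H / n)\<^sup>2 / n)"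
    using n(2) by (simp add: field_simps power2_eq_square)
  also have "n\<^sup>2 / (real p * (n + 2) * (n - 1)) * \<dots> = n\<^sup>2 / ((n + 2) * (n - 1))
    * (KK / (real p * n\<^sup>2) + 2 * (1 - 1 / n) * (Q / (real p * n)) + (1 - 1 / n) * (F / real p) + (E / (real p * n\<^sup>2) - (H / n)\<^sup>2 / (real p * n)))"
  proof -
    have e: "n\<^sup>2 / (real p * (n + 2) * (n - 1)) * X = n\<^sup>2 / ((n + 2) * (n - 1)) * (X / real p)" for X
      by simp
    have d: "(KK / n\<^sup>2 + 2 * (1 - 1 / n) * (Q / n) + (1 - 1 / n) * F + (E / n\<^sup>2 - (H / n)\<^sup>2 / n)) / real p
      = KK / (real p * n\<^sup>2) + 2 * (1 - 1 / n) * (Q / (real p * n)) + (1 - 1 / n) * (F / real p) + (E / (real p * n\<^sup>2) - (H / n)\<^sup>2 / (real p * n))"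
      by (simp add: add_divide_distrib diff_divide_distrib mult.commute)
    show ?thesis unfolding e d ..
  qed
  finally show ?thesis by (simp only: KK_def Q_def E_def H_def F_def)
qed

end

section \<open>The asymptotic regime and the sizes of the error terms\<close>

lemma frob2_add_le3:
  "frob2 K (\<lambda>a b. X a b + Y a b + Z a b) \<le> 3 * (frob2 K X + frob2 K Y + frob2 K Z)"
proof -
  have "(x + y + z)\<^sup>2 \<le> 3 * (x\<^sup>2 + y\<^sup>2 + z\<^sup>2)" for x y z :: real
    using zero_le_power2[of "x - y"] zero_le_power2[of "y - z"] zero_le_power2[of "x - z"]
    by (simp add: power2_eq_square algebra_simps)
  then have "frob2 K (\<lambda>a b. X a b + Y a b + Z a b) \<le> (\<Sum>a\<in>K. \<Sum>b\<in>K. 3 * ((X a b)\<^sup>2 + (Y a b)\<^sup>2 + (Z a b)\<^sup>2))"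
    unfolding frob2_def by (intro sum_mono)
  then show ?thesis by (simp add: frob2_def sum.distrib sum_distrib_left)
qed

text \<open>The combination \<open>x I + y B\<close>: the Hotelling part contributes the identity and the Dempster part contributes \<open>B\<close>.\<close>
definition ridge :: "real \<Rightarrow> real \<Rightarrow> ('i \<Rightarrow> 'i \<Rightarrow> real) \<Rightarrow> 'i \<Rightarrow> 'i \<Rightarrow> real" where
  "ridge x y B a b = scaled_id x a b + y * B a b"

lemma sym_on_ridge: "sym_on K B \<Longrightarrow> sym_on K (ridge x y B)"
  by (simp add: sym_on_def ridge_def scaled_id_def)

lemma centered_ridge:
  assumes "finite K"
  shows "centered K (ridge x y B) v = x * ((\<Sum>k\<in>K. (v k)\<^sup>2) - real (card K)) + y * centered K B v"
proof -
  have "centered K (ridge x y B) v = centered K (scaled_id x) v + y * centered K B v"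
    by (simp add: centered_def quadratic_def tr_on_def ridge_def sum.distrib sum_distrib_left algebra_simps)
  then show ?thesis by (simp only: scaled_id_facts(2)[OF assms])
qed

lemma frob2_ridge:
  assumes "finite K"
  shows "frob2 K (ridge x y B) = x\<^sup>2 * real (card K) + 2 * x * y * tr_on K B + y\<^sup>2 * frob2 K B"
proof -
  have d: "(\<Sum>b\<in>K. scaled_id x a b * B a b) = x * B a a" if "a \<in> K" for a
  proof -
    have "(\<Sum>b\<in>K. scaled_id x a b * B a b) = (\<Sum>b\<in>K. if a = b then x * B a b else 0)"
      by (intro sum.cong refl) (simp add: scaled_id_def)
    then show ?thesis using that assms by simp
  qed
  have "frob2 K (ridge x y B) = frob2 K (scaled_id x) + 2 * y * (\<Sum>a\<in>K. \<Sum>b\<in>K. scaled_id x a b * B a b) + y\<^sup>2 * frob2 K B"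
    by (simp add: frob2_def ridge_def power2_eq_square sum.distrib sum_distrib_left algebra_simps)
  also have "(\<Sum>a\<in>K. \<Sum>b\<in>K. scaled_id x a b * B a b) = x * tr_on K B"
    by (simp add: d tr_on_def sum_distrib_left)
  finally show ?thesis by (simp add: scaled_id_facts(3)[OF assms] algebra_simps)
qed

text \<open>Controls the error of the normal approximation for the combined quadratic form.\<close>
lemma frob2_ridge_square:
  assumes "finite K"
  shows "frob2 K (mmult K (ridge x y B) (ridge x y B))
    \<le> 3 * (x ^ 4 * real (card K) + 4 * x\<^sup>2 * y\<^sup>2 * frob2 K B + y ^ 4 * frob2 K (mmult K B B))"
proof -
  have e: "mmult K (ridge x y B) (ridge x y B) a b = mmult K (scaled_id x) (scaled_id x) a b + 2 * x * y * B a b + y\<^sup>2 * mmult K B B a b"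
    if "a \<in> K" "b \<in> K" for a b
  proof -
    have d1: "(\<Sum>c\<in>K. scaled_id x a c * B c b) = x * B a b"
    proof -
      have "(\<Sum>c\<in>K. scaled_id x a c * B c b) = (\<Sum>c\<in>K. if a = c then x * B c b else 0)"
        by (intro sum.cong refl) (simp add: scaled_id_def)
      then show ?thesis using that assms by simp
    qed
    have d2: "(\<Sum>c\<in>K. B a c * scaled_id x c b) = x * B a b"
    proof -
      have "(\<Sum>c\<in>K. B a c * scaled_id x c b) = (\<Sum>c\<in>K. if b = c then x * B a c else 0)"
        by (intro sum.cong refl) (simp add: scaled_id_def)
      then show ?thesis using that assms by simp
    qed
    have "mmult K (ridge x y B) (ridge x y B) a b = mmult K (scaled_id x) (scaled_id x) a b
        + y * (\<Sum>c\<in>K. scaled_id x a c * B c b) + y * (\<Sum>c\<in>K. B a c * scaled_id x c b) + y\<^sup>2 * mmult K B B a b"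
      by (simp add: mmult_def ridge_def sum.distrib sum_distrib_left power2_eq_square algebra_simps)
    then show ?thesis by (simp add: d1 d2)
  qed
  have sc: "frob2 K (\<lambda>a b. s * X a b) = s\<^sup>2 * frob2 K X" for s X
    by (simp add: frob2_def power_mult_distrib sum_distrib_left)
  have "frob2 K (mmult K (ridge x y B) (ridge x y B))
    = frob2 K (\<lambda>a b. mmult K (scaled_id x) (scaled_id x) a b + 2 * x * y * B a b + y\<^sup>2 * mmult K B B a b)"
    unfolding frob2_def by (intro sum.cong refl) (simp add: e)
  also have "\<dots> \<le> 3 * (frob2 K (mmult K (scaled_id x) (scaled_id x)) + frob2 K (\<lambda>a b. 2 * x * y * B a b) + frob2 K (\<lambda>a b. y\<^sup>2 * mmult K B B a b))"
    by (rule frob2_add_le3)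
  also have "\<dots> = 3 * (x ^ 4 * real (card K) + 4 * x\<^sup>2 * y\<^sup>2 * frob2 K B + y ^ 4 * frob2 K (mmult K B B))"
    unfolding sc scaled_id_facts(4)[OF assms] by (simp add: power_mult_distrib power_mult[symmetric] mult_ac)
  finally show ?thesis .
qed

locale high_dimensional =
  fixes N p :: "nat \<Rightarrow> nat" and L :: "nat \<Rightarrow> nat \<Rightarrow> nat \<Rightarrow> real" and e0 :: "nat \<Rightarrow> nat \<Rightarrow> real"
    and n :: "nat \<Rightarrow> real" and c a1 a2 a4 l lI lS :: real
  assumes p_ge: "2 \<le> p k" and p_less: "p k < N k" and n_eq: "n k = real (N k - 1)"
    and N_lim: "filterlim N at_top sequentially" and p_lim: "filterlim p at_top sequentially"
    and ratio: "(\<lambda>k. real (p k) / n k) \<longlonglongrightarrow> c" and c: "0 < c" "c < 1"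
    and trace_pos: "0 < tr_on {..<p k} (gramian (p k) (L k))"
    and trace_lim: "(\<lambda>k. tr_on {..<p k} (gramian (p k) (L k)) / real (p k)) \<longlonglongrightarrow> a1" and a1: "0 < a1"
    and frob_lim: "(\<lambda>k. frob2 {..<p k} (gramian (p k) (L k)) / real (p k)) \<longlonglongrightarrow> a2" and a2: "0 < a2"
    and fourth_lim: "(\<lambda>k. frob2 {..<p k} (mmult {..<p k} (gramian (p k) (L k)) (gramian (p k) (L k))) / real (p k)) \<longlonglongrightarrow> a4"
    and shift_lim: "(\<lambda>k. (\<Sum>j<p k. (e0 k j)\<^sup>2) / sqrt (n k)) \<longlonglongrightarrow> l"
    and shift_lim_I: "(\<lambda>k. (\<Sum>j<p k. (\<Sum>i<p k. L k j i * e0 k i)\<^sup>2) / sqrt (n k)) \<longlonglongrightarrow> lI"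
    and shift_lim_S: "(\<lambda>k. (\<Sum>i<p k. (\<Sum>j<p k. L k j i * (\<Sum>m<p k. L k j m * e0 k m))\<^sup>2) / sqrt (n k)) \<longlonglongrightarrow> lS"
begin

abbreviation G :: "nat \<Rightarrow> (nat \<times> nat \<Rightarrow> real) measure" where "G k \<equiv> gauss ({..<N k} \<times> {..<p k})"
abbreviation B :: "nat \<Rightarrow> nat \<Rightarrow> nat \<Rightarrow> real" where "B k \<equiv> gramian (p k) (L k)"

text \<open>The rates are \<open>n\<^sup>1\<^sup>/\<^sup>2\<close> and \<open>n\<^sup>3\<^sup>/\<^sup>4\<close>, integral powers of the fourth root of \<open>n\<close>.\<close>
definition q :: "nat \<Rightarrow> real" where "q k = sqrt (sqrt (n k))"
definition P :: "nat \<Rightarrow> real" where "P k = real (p k)"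
definition m :: "nat \<Rightarrow> real" where "m k = real (N k) - real (p k)"
definition tr :: "nat \<Rightarrow> real" where "tr k = tr_on {..<p k} (B k)"
definition F :: "nat \<Rightarrow> real" where "F k = frob2 {..<p k} (B k)"
definition F4 :: "nat \<Rightarrow> real" where "F4 k = frob2 {..<p k} (mmult {..<p k} (B k) (B k))"

sublocale prob_space_sequence G
  by (rule prob_space_sequence.intro) (rule prob_space_gauss)

lemma size: "n k \<ge> 2" "n k > 0" "n k \<noteq> 0" "q k > 0" "q k \<noteq> 0" "(q k)\<^sup>2 = sqrt (n k)" "q k ^ 4 = n k"
    "P k > 0" "P k \<noteq> 0" "m k > 0" "m k \<noteq> 0" "m k = n k - P k + 1" "real (N k - p k) = m k" "N k > 0" "p k > 0"
proof -
  show n: "n k \<ge> 2" using p_ge[of k] p_less[of k] by (simp add: n_eq of_nat_diff)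
  then show "n k > 0" "n k \<noteq> 0" "q k > 0" "q k \<noteq> 0" by (simp_all add: q_def)
  show q2: "(q k)\<^sup>2 = sqrt (n k)" using n by (simp add: q_def)
  have "q k ^ 4 = ((q k)\<^sup>2)\<^sup>2" by simp
  then show "q k ^ 4 = n k" unfolding q2 using n by simp
  show "P k > 0" "P k \<noteq> 0" using p_ge[of k] by (simp_all add: P_def)
  show "m k > 0" "m k \<noteq> 0" using p_less[of k] by (simp_all add: m_def)
  show "m k = n k - P k + 1" using p_less[of k] by (simp add: m_def P_def n_eq of_nat_diff)
  show "real (N k - p k) = m k" using p_less[of k] by (simp add: m_def of_nat_diff)
  show "N k > 0" "p k > 0" using p_ge[of k] p_less[of k] by simp_all
qed

lemma q6: "(q k ^ 3)\<^sup>2 = n k * (q k)\<^sup>2"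
proof -
  have "(q k ^ 3)\<^sup>2 = q k ^ 4 * (q k)\<^sup>2"
    by (simp add: power2_eq_square power3_eq_cube power4_eq_xxxx mult_ac)
  then show ?thesis by (simp only: size(7))
qed

lemma q_split: "(x - y) / q k ^ 3 * (1 / q k) = x / n k - y / n k" "(x - y) / (q k)\<^sup>2 * (1 / (q k)\<^sup>2) = x / n k - y / n k"
proof -
  have "q k ^ 3 * q k = n k" "(q k)\<^sup>2 * (q k)\<^sup>2 = n k"
    using size(7)[of k] by (simp_all add: power3_eq_cube power4_eq_xxxx power2_eq_square mult_ac)
  then have "d / q k ^ 3 * (1 / q k) = d / n k" "d / (q k)\<^sup>2 * (1 / (q k)\<^sup>2) = d / n k" for d
    by (simp_all only: times_divide_times_eq mult_1_right)
  then show "(x - y) / q k ^ 3 * (1 / q k) = x / n k - y / n k" "(x - y) / (q k)\<^sup>2 * (1 / (q k)\<^sup>2) = x / n k - y / n k"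
    by (simp_all only:) (simp_all only: diff_divide_distrib)
qed

lemma n_lim: "filterlim n at_top sequentially"
proof -
  have "filterlim (\<lambda>k. N k - 1) at_top sequentially"
    by (rule filterlim_compose[OF filterlim_minus_const_nat_at_top N_lim])
  from filterlim_compose[OF filterlim_real_sequentially this] show ?thesis by (simp add: n_eq[abs_def])
qed

lemma rates:
  "(\<lambda>k. 1 / n k) \<longlonglongrightarrow> 0" "(\<lambda>k. 1 / q k) \<longlonglongrightarrow> 0" "(\<lambda>k. 1 / P k) \<longlonglongrightarrow> 0" "(\<lambda>k. P k / n k) \<longlonglongrightarrow> c"
  "(\<lambda>k. m k / n k) \<longlonglongrightarrow> 1 - c" "(\<lambda>k. tr k / P k) \<longlonglongrightarrow> a1" "(\<lambda>k. F k / P k) \<longlonglongrightarrow> a2" "(\<lambda>k. F4 k / P k) \<longlonglongrightarrow> a4"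
  "(\<lambda>k. tr k / n k) \<longlonglongrightarrow> c * a1" "(\<lambda>k. 1 / (q k)\<^sup>2) \<longlonglongrightarrow> 0"
proof -
  show n: "(\<lambda>k. 1 / n k) \<longlonglongrightarrow> 0"
    using tendsto_inverse_0_at_top[OF n_lim] by (simp add: inverse_eq_divide)
  have "filterlim q at_top sequentially" unfolding q_def[abs_def]
    by (rule filterlim_compose[OF sqrt_at_top filterlim_compose[OF sqrt_at_top n_lim]])
  then show q: "(\<lambda>k. 1 / q k) \<longlonglongrightarrow> 0"
    using tendsto_inverse_0_at_top by (simp add: inverse_eq_divide)
  from tendsto_power[OF this, of 2] show "(\<lambda>k. 1 / (q k)\<^sup>2) \<longlonglongrightarrow> 0" by (simp add: power_divide)
  have "filterlim P at_top sequentially" unfolding P_def[abs_def]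
    by (rule filterlim_compose[OF filterlim_real_sequentially p_lim])
  then show "(\<lambda>k. 1 / P k) \<longlonglongrightarrow> 0"
    using tendsto_inverse_0_at_top by (simp add: inverse_eq_divide)
  show pn: "(\<lambda>k. P k / n k) \<longlonglongrightarrow> c" using ratio by (simp add: P_def)
  have "m k / n k = 1 - P k / n k + 1 / n k" for k using size[of k] by (simp add: field_simps)
  then show "(\<lambda>k. m k / n k) \<longlonglongrightarrow> 1 - c" using tendsto_add[OF tendsto_diff[OF tendsto_const[of 1] pn] n] by simp
  show t: "(\<lambda>k. tr k / P k) \<longlonglongrightarrow> a1" using trace_lim by (simp add: tr_def P_def)
  show "(\<lambda>k. F k / P k) \<longlonglongrightarrow> a2" using frob_lim by (simp add: F_def P_def)
  show "(\<lambda>k. F4 k / P k) \<longlonglongrightarrow> a4" using fourth_lim by (simp add: F4_def P_def)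
  have "tr k / n k = P k / n k * (tr k / P k)" for k using size[of k] by simp
  then show "(\<lambda>k. tr k / n k) \<longlonglongrightarrow> c * a1" using tendsto_mult[OF pn t] by simp
qed

text \<open>Chebyshev's inequality in the form used for all error terms.\<close>
lemma cip_zero_moments:
  assumes "\<And>k. all_moments (G k) (A k)" "\<And>k. (LINT z|G k. (A k z)\<^sup>2) \<le> r k" "r \<longlonglongrightarrow> 0"
  shows "cip G A 0"
  by (rule cip_zero_L2[OF all_moments_measurable[OF assms(1)] _ assms(2,3)])
     (intro all_moments_integrable gauss_moments assms(1))

lemma all_moments_rows:
  "i < N k \<Longrightarrow> j < p k \<Longrightarrow> all_moments (G k) (\<lambda>z. z (i, j))"
  "i < N k \<Longrightarrow> all_moments (G k) (\<lambda>z. centered {..<p k} C (\<lambda>j. z (i, j)))"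
  by (intro all_moments_coordinate, simp) (intro all_moments_row, simp)

text \<open>A centred quadratic form has standard deviation of order \<open>n\<^sup>1\<^sup>/\<^sup>2\<close>, so it is negligible on the scale \<open>n\<^sup>3\<^sup>/\<^sup>4\<close>. Products of two such terms on the scale \<open>n\<^sup>3\<^sup>/\<^sup>2\<close> are then negligible as well, and this is all that the expansion requires.\<close>
lemma cip_centered_row:
  assumes C: "\<And>k. sym_on {..<p k} (C k)" and lim: "(\<lambda>k. frob2 {..<p k} (C k) / n k) \<longlonglongrightarrow> a"
  shows "cip G (\<lambda>k z. centered {..<p k} (C k) (\<lambda>j. z (0, j)) / q k ^ 3) 0"
proof (rule cip_zero_moments)
  show "all_moments (G k) (\<lambda>z. centered {..<p k} (C k) (\<lambda>j. z (0, j)) / q k ^ 3)" for k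
    by (intro gauss_moments all_moments_rows size)
  show "(LINT z|G k. (centered {..<p k} (C k) (\<lambda>j. z (0, j)) / q k ^ 3)\<^sup>2) \<le> 2 * (frob2 {..<p k} (C k) / n k) * (1 / (q k)\<^sup>2)" for k
  proof -
    have "(LINT z|G k. (centered {..<p k} (C k) (\<lambda>j. z (0, j)) / q k ^ 3)\<^sup>2)
      = (LINT z|G k. (centered {..<p k} (C k) (\<lambda>j. z (0, j)))\<^sup>2) / (n k * (q k)\<^sup>2)"
      unfolding power_divide q6 by simp
    also have "\<dots> = 2 * (frob2 {..<p k} (C k) / n k) * (1 / (q k)\<^sup>2)"
      by (subst centered_row_square) (use size C in simp_all)
    finally show ?thesis by simp
  qed
  show "(\<lambda>k. 2 * (frob2 {..<p k} (C k) / n k) * (1 / (q k)\<^sup>2)) \<longlonglongrightarrow> 0"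
    using tendsto_mult[OF tendsto_mult[OF tendsto_const[of 2] lim] rates(10)] by simp
qed

text \<open>The cross terms between the noise and the shift. The squared shift is of order \<open>n\<^sup>1\<^sup>/\<^sup>2\<close> under local alternatives, hence these are of smaller order.\<close>
lemma cip_linear_row:
  assumes lim: "(\<lambda>k. (\<Sum>j<p k. (h k j)\<^sup>2) / sqrt (n k)) \<longlonglongrightarrow> a"
  shows "cip G (\<lambda>k z. 2 * (\<Sum>j<p k. h k j * z (0, j)) / (q k)\<^sup>2) 0"
proof (rule cip_zero_moments)
  show am: "all_moments (G k) (\<lambda>z. 2 * (\<Sum>j<p k. h k j * z (0, j)) / (q k)\<^sup>2)" for k
    by (intro gauss_moments all_moments_rows size) simp
  show "(LINT z|G k. (2 * (\<Sum>j<p k. h k j * z (0, j)) / (q k)\<^sup>2)\<^sup>2) \<le> 4 * ((\<Sum>j<p k. (h k j)\<^sup>2) / sqrt (n k)) * (1 / (q k)\<^sup>2)" for k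
  proof -
    have "(LINT z|G k. (\<Sum>j<p k. h k j * z (0, j))\<^sup>2) = (LINT x|gauss {..<p k}. (\<Sum>j<p k. h k j * x j)\<^sup>2)"
      by (rule integral_row)
         (use size in \<open>auto intro!: all_moments_measurable gauss_moments all_moments_coordinate\<close>)
    also have "\<dots> = (\<Sum>j<p k. (h k j)\<^sup>2)" by (rule linear_form_square) simp
    finally have e: "(LINT z|G k. (\<Sum>j<p k. h k j * z (0, j))\<^sup>2) = (\<Sum>j<p k. (h k j)\<^sup>2)" .
    have "(LINT z|G k. (2 * (\<Sum>j<p k. h k j * z (0, j)) / (q k)\<^sup>2)\<^sup>2)
      = (LINT z|G k. 4 / ((q k)\<^sup>2)\<^sup>2 * (\<Sum>j<p k. h k j * z (0, j))\<^sup>2)"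
      by (simp add: power_divide power_mult_distrib)
    also have "\<dots> = 4 / ((q k)\<^sup>2)\<^sup>2 * (\<Sum>j<p k. (h k j)\<^sup>2)"
      by (simp only: integral_mult_right_zero e)
    finally have E: "(LINT z|G k. (2 * (\<Sum>j<p k. h k j * z (0, j)) / (q k)\<^sup>2)\<^sup>2) = 4 / ((q k)\<^sup>2)\<^sup>2 * (\<Sum>j<p k. (h k j)\<^sup>2)" .
    show ?thesis unfolding E size(6)[symmetric] by (simp add: power2_eq_square)
  qed
  show "(\<lambda>k. 4 * ((\<Sum>j<p k. (h k j)\<^sup>2) / sqrt (n k)) * (1 / (q k)\<^sup>2)) \<longlonglongrightarrow> 0"
    using tendsto_mult[OF tendsto_mult[OF tendsto_const[of 4] lim] rates(10)] by simp
qed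

lemma cip_V: "cip G (\<lambda>k z. (Vstat (N k) (p k) (e0 k) z - m k) / q k ^ 3) 0"
proof (rule cip_zero_L2)
  show "(\<lambda>z. (Vstat (N k) (p k) (e0 k) z - m k) / q k ^ 3) \<in> borel_measurable (G k)" for k
    by (intro borel_measurable_divide borel_measurable_diff borel_measurable_Vstat size borel_measurable_const)
  note v = Vstat_variance[OF size(15) p_less, unfolded size(13)]
  show "integrable (G k) (\<lambda>z. ((Vstat (N k) (p k) (e0 k) z - m k) / q k ^ 3)\<^sup>2)" for k
    unfolding power_divide by (intro integrable_divide_zero impI v)
  show "(LINT z|G k. ((Vstat (N k) (p k) (e0 k) z - m k) / q k ^ 3)\<^sup>2) \<le> 2 * (m k / n k) * (1 / (q k)\<^sup>2)" for k
  proof -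
    show ?thesis unfolding power_divide q6 by (simp add: v)
  qed
  show "(\<lambda>k. 2 * (m k / n k) * (1 / (q k)\<^sup>2)) \<longlonglongrightarrow> 0"
    using tendsto_mult[OF tendsto_mult[OF tendsto_const[of 2] rates(5)] rates(10)] by simp
qed

lemma rows: "{1..<N k} \<subseteq> {..<N k}" "real (card {1..<N k}) = n k"
  by (auto simp: n_eq)

lemma cip_tau: "cip G (\<lambda>k z. (tau (N k) (p k) (L k) z - tr k) / (q k)\<^sup>2) 0"
proof (rule cip_zero_moments)
  have e: "tau (N k) (p k) (L k) z - tr k = (\<Sum>i\<in>{1..<N k}. centered {..<p k} (B k) (\<lambda>j. z (i, j))) / n k" for k z
  proof -
    have "1 < N k" using p_ge[of k] p_less[of k] by linarith
    show ?thesis unfolding tau_centered[OF \<open>1 < N k\<close>] tr_def n_eq by simp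
  qed
  show "all_moments (G k) (\<lambda>z. (tau (N k) (p k) (L k) z - tr k) / (q k)\<^sup>2)" for k
    unfolding e by (rule gauss_moments(6), rule gauss_moments(6), rule gauss_moments(8), rule all_moments_rows(2)) simp
  show "(LINT z|G k. ((tau (N k) (p k) (L k) z - tr k) / (q k)\<^sup>2)\<^sup>2) \<le> 2 * (P k / n k) * (F k / P k) * (1 / n k)" for k
  proof -
    have e2: "(S / n k / (q k)\<^sup>2)\<^sup>2 = S\<^sup>2 / ((n k)\<^sup>2 * q k ^ 4)" for S
      by (simp add: power_divide power_mult_distrib power_mult[symmetric])
    have "(LINT z|G k. ((tau (N k) (p k) (L k) z - tr k) / (q k)\<^sup>2)\<^sup>2)
      = (LINT z|G k. (\<Sum>i\<in>{1..<N k}. centered {..<p k} (B k) (\<lambda>j. z (i, j)))\<^sup>2) / ((n k)\<^sup>2 * q k ^ 4)"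
      unfolding e e2 by (rule integral_divide_zero)
    also have "\<dots> = n k * (2 * F k) / ((n k)\<^sup>2 * n k)"
      unfolding sum_centered_rows_square[OF rows(1) sym_on_gramian] rows(2) F_def size(7) ..
    also have "\<dots> = 2 * (P k / n k) * (F k / P k) * (1 / n k)" 
    proof -
      have "P k / n k * (F k / P k) = F k / n k" using size(9)[of k] by simp
      moreover have "n k * (2 * F k) / ((n k)\<^sup>2 * n k) = 2 * (F k / n k) * (1 / n k)"
        using size(3)[of k] by (simp add: power2_eq_square)
      ultimately show ?thesis by (simp only: mult.assoc)
    qed
    finally show ?thesis by simp
  qed
  show "(\<lambda>k. 2 * (P k / n k) * (F k / P k) * (1 / n k)) \<longlonglongrightarrow> 0"
    using tendsto_mult[OF tendsto_mult[OF tendsto_mult[OF tendsto_const[of 2] rates(4)] rates(7)] rates(1)] by simp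
qed

lemma cip_v: "cip G (\<lambda>k z. Vstat (N k) (p k) (e0 k) z / n k) (1 - c)"
proof -
  have "Vstat (N k) (p k) (e0 k) z / n k = m k / n k + (Vstat (N k) (p k) (e0 k) z - m k) / q k ^ 3 * (1 / q k)" for k z
    unfolding q_split by simp
  moreover have "cip G (\<lambda>k z. m k / n k + (Vstat (N k) (p k) (e0 k) z - m k) / q k ^ 3 * (1 / q k)) (1 - c + 0 * 0)"
    by (rule cip_add[OF cip_tendsto[OF rates(5)] cip_mult[OF cip_V cip_tendsto[OF rates(2)]]])
  ultimately show ?thesis by (simp only: mult_zero_left add_0_right)
qed

lemma cip_t: "cip G (\<lambda>k z. tau (N k) (p k) (L k) z / n k) (c * a1)"
proof -
  have "tau (N k) (p k) (L k) z / n k = tr k / n k + (tau (N k) (p k) (L k) z - tr k) / (q k)\<^sup>2 * (1 / (q k)\<^sup>2)" for k z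
    unfolding q_split by simp
  moreover have "cip G (\<lambda>k z. tr k / n k + (tau (N k) (p k) (L k) z - tr k) / (q k)\<^sup>2 * (1 / (q k)\<^sup>2)) (c * a1 + 0 * 0)"
    by (rule cip_add[OF cip_tendsto[OF rates(9)] cip_mult[OF cip_tau cip_tendsto[OF rates(10)]]])
  ultimately show ?thesis by (simp only: mult_zero_left add_0_right)
qed

end

section \<open>First-order expansion of the statistic\<close>

text \<open>An exact identity: the left side is the standardised statistic minus its linear part, and on the right every factor converges in probability.\<close>
lemma hotelling_expansion:
  fixes V m q P u x w :: real
  assumes "V \<noteq> 0" "m \<noteq> 0" "q \<noteq> 0" and w: "w = V - m"
  shows "q\<^sup>2 * ((P + u + x) / V - P / m) - (q\<^sup>2 / m * u - q\<^sup>2 * P / m\<^sup>2 * w)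
    = x / q\<^sup>2 / (V / q ^ 4) - (u / q ^ 3 - P / m * (w / q ^ 3)) * (w / q ^ 3) / (m / q ^ 4 * (V / q ^ 4))"
proof -
  have "(P + u + x) / V - P / m - (u / m - P / m\<^sup>2 * w) = x / V - (u - P / m * w) * w / (m * V)"
    using assms(1,2) unfolding w by (simp add: field_simps power2_eq_square)
  then have "q\<^sup>2 * ((P + u + x) / V - P / m - (u / m - P / m\<^sup>2 * w)) = q\<^sup>2 * (x / V - (u - P / m * w) * w / (m * V))"
    by simp
  moreover have "q\<^sup>2 * ((P + u + x) / V - P / m - (u / m - P / m\<^sup>2 * w)) = q\<^sup>2 * ((P + u + x) / V - P / m) - (q\<^sup>2 / m * u - q\<^sup>2 * P / m\<^sup>2 * w)"
    by (simp add: right_diff_distrib)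
  moreover have "x / q\<^sup>2 / (V / q ^ 4) = q\<^sup>2 * (x / V)"
    using assms(1,3) by (simp add: field_simps power2_eq_square power4_eq_xxxx)
  moreover have "(u / q ^ 3 - P / m * (w / q ^ 3)) * (w / q ^ 3) / (m / q ^ 4 * (V / q ^ 4)) = q\<^sup>2 * ((u - P / m * w) * w / (m * V))"
  proof -
    have e: "u / q ^ 3 - P / m * (w / q ^ 3) = (u - P / m * w) / q ^ 3" by (simp add: diff_divide_distrib)
    have "d / q ^ 3 * (w / q ^ 3) / (m / q ^ 4 * (V / q ^ 4)) = q\<^sup>2 * (d * w / (m * V))" for d
      using assms(1,2,3) by (simp add: field_simps power2_eq_square power3_eq_cube power4_eq_xxxx)
    then show ?thesis unfolding e .
  qed
  ultimately show ?thesis by (simp only: right_diff_distrib)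
qed

text \<open>The analogue for the Dempster statistic, whose denominator fluctuates so little that it does not enter the linear part.\<close>
lemma dempster_expansion:
  fixes t0 t q s x w :: real
  assumes "t \<noteq> 0" "t0 \<noteq> 0" "q \<noteq> 0" and w: "w = t - t0"
  shows "q\<^sup>2 * ((t0 + s + x) / t - 1) - q\<^sup>2 / t0 * s
    = (x / q\<^sup>2 - w / q\<^sup>2) / (t / q ^ 4) - 1 / q * (s / q ^ 3) * (w / q\<^sup>2) / (t / q ^ 4 * (t0 / q ^ 4))"
proof -
  have "(t0 + s + x) / t - 1 - s / t0 = (x - w) / t - s * w / (t * t0)"
    using assms(1,2) unfolding w by (simp add: field_simps power2_eq_square)
  then have "q\<^sup>2 * ((t0 + s + x) / t - 1 - s / t0) = q\<^sup>2 * ((x - w) / t - s * w / (t * t0))" by simp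
  moreover have "q\<^sup>2 * ((t0 + s + x) / t - 1 - s / t0) = q\<^sup>2 * ((t0 + s + x) / t - 1) - q\<^sup>2 / t0 * s"
    by (simp add: right_diff_distrib)
  moreover have "(x / q\<^sup>2 - w / q\<^sup>2) / (t / q ^ 4) = q\<^sup>2 * ((x - w) / t)"
    unfolding diff_divide_distrib[symmetric] using assms(1,3) by (simp add: field_simps power2_eq_square power4_eq_xxxx)
  moreover have "1 / q * (s / q ^ 3) * (w / q\<^sup>2) / (t / q ^ 4 * (t0 / q ^ 4)) = q\<^sup>2 * (s * w / (t * t0))"
    using assms(1,2,3) by (simp add: field_simps power2_eq_square power3_eq_cube power4_eq_xxxx)
  ultimately show ?thesis by (simp only: right_diff_distrib)
qed

text \<open>Contributions of the identity part, the mixed part, the Gram part and the residual to the limiting variance, and to the error of the normal approximation, in terms of ratios that converge.\<close>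
lemma variance_rates:
  fixes n m P tr s r r' F F4 :: real
  assumes pos: "n > 0" "m > 0" "P > 0" "tr > 0" and s: "s\<^sup>2 = n"
  defines "x \<equiv> r * s / m" and "y \<equiv> r' * s / tr" and "g \<equiv> r * s * P / m\<^sup>2"
  shows "x\<^sup>2 * P = r\<^sup>2 * (P / n) / (m / n)\<^sup>2" "2 * x * y * tr = 2 * r * r' / (m / n)"
    "y\<^sup>2 * F = r'\<^sup>2 * (F / P) / (P / n * (tr / P)\<^sup>2)" "g\<^sup>2 * m = r\<^sup>2 * (P / n)\<^sup>2 / (m / n) ^ 3"
    "x ^ 4 * P = r ^ 4 * (1 / n) * (P / n) / (m / n) ^ 4"
    "4 * x\<^sup>2 * y\<^sup>2 * F = 4 * r\<^sup>2 * r'\<^sup>2 * (1 / P) * (F / P) / ((m / n)\<^sup>2 * (tr / P)\<^sup>2)"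
    "y ^ 4 * F4 = r' ^ 4 * (1 / n) * (F4 / P) / ((P / n) ^ 3 * (tr / P) ^ 4)"
    "g ^ 4 * m = r ^ 4 * (1 / n) * (P / n) ^ 4 / (m / n) ^ 7"
proof -
  have s0: "s \<noteq> 0" using s pos by auto
  have nz: "m \<noteq> 0" "P \<noteq> 0" "tr \<noteq> 0" using pos by auto
  note nz = s0 nz
  show "x\<^sup>2 * P = r\<^sup>2 * (P / n) / (m / n)\<^sup>2" "2 * x * y * tr = 2 * r * r' / (m / n)"
    "y\<^sup>2 * F = r'\<^sup>2 * (F / P) / (P / n * (tr / P)\<^sup>2)" "g\<^sup>2 * m = r\<^sup>2 * (P / n)\<^sup>2 / (m / n) ^ 3"
    "x ^ 4 * P = r ^ 4 * (1 / n) * (P / n) / (m / n) ^ 4"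
    "4 * x\<^sup>2 * y\<^sup>2 * F = 4 * r\<^sup>2 * r'\<^sup>2 * (1 / P) * (F / P) / ((m / n)\<^sup>2 * (tr / P)\<^sup>2)"
    "y ^ 4 * F4 = r' ^ 4 * (1 / n) * (F4 / P) / ((P / n) ^ 3 * (tr / P) ^ 4)"
    "g ^ 4 * m = r ^ 4 * (1 / n) * (P / n) ^ 4 / (m / n) ^ 7"
    unfolding x_def y_def g_def s[symmetric] using nz by (simp_all add: field_simps eval_nat_numeral)
qed

lemma norm_mult_diff_le:
  fixes a b a' b' :: complex
  assumes "norm b \<le> 1" "norm a' \<le> 1"
  shows "norm (a * b - a' * b') \<le> norm (a - a') + norm (b - b')"
proof -
  have "a * b - a' * b' = (a - a') * b + a' * (b - b')" by (simp add: algebra_simps)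
  then have "norm (a * b - a' * b') \<le> norm (a - a') * norm b + norm a' * norm (b - b')"
    by (metis norm_triangle_ineq norm_mult)
  also have "\<dots> \<le> norm (a - a') * 1 + 1 * norm (b - b')"
    using assms by (intro add_mono mult_left_mono mult_right_mono) auto
  finally show ?thesis by simp
qed

lemma norm_char_le_1:
  assumes "prob_space M"
  shows "norm (LINT x|M. iexp (f x)) \<le> 1"
proof -
  have "norm (LINT x|M. iexp (f x)) \<le> (LINT x|M. norm (iexp (f x)))" by (rule integral_norm_bound)
  also have "\<dots> = 1" using prob_space.prob_space[OF assms] by simp
  finally show ?thesis .
qed

context high_dimensional
begin

lemma tr_pos: "tr k > 0" using trace_pos by (simp add: tr_def)

lemma whp_nonzero:
  assumes "cip G A a" "a \<noteq> 0"
  shows "whp G (\<lambda>k z. A k z \<noteq> 0)"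
  by (rule whp_mono[OF cipD[OF assms(1), of "\<bar>a\<bar>"]]) (use assms(2) in auto)

text \<open>The standardised Hotelling statistic, \<open>T\<^sup>2 / n\<close> being \<open>\<bar>e\<bar>\<^sup>2 / V\<close>.\<close>
definition hot :: "nat \<Rightarrow> (nat \<times> nat \<Rightarrow> real) \<Rightarrow> real" where
  "hot k z = sqrt (n k) * ((\<Sum>j<p k. (noncentral (e0 k) z j)\<^sup>2) / Vstat (N k) (p k) (e0 k) z - P k / m k)"

definition dem :: "nat \<Rightarrow> (nat \<times> nat \<Rightarrow> real) \<Rightarrow> real" where
  "dem k z = sqrt (n k) * ((\<Sum>j<p k. (\<Sum>i<p k. L k j i * noncentral (e0 k) z i)\<^sup>2) / tau (N k) (p k) (L k) z - 1)"

definition sphere :: "nat \<Rightarrow> (nat \<times> nat \<Rightarrow> real) \<Rightarrow> real" where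
  "sphere k z = centered {..<p k} (scaled_id 1) (\<lambda>j. z (0, j))"

definition form :: "nat \<Rightarrow> (nat \<times> nat \<Rightarrow> real) \<Rightarrow> real" where
  "form k z = centered {..<p k} (B k) (\<lambda>j. z (0, j))"

definition dev :: "nat \<Rightarrow> (nat \<times> nat \<Rightarrow> real) \<Rightarrow> real" where
  "dev k z = Vstat (N k) (p k) (e0 k) z - m k"

text \<open>The coefficients of the linear form \<open>(L e0) \<bullet> (L g)\<close> in the first row \<open>g\<close>.\<close>
definition cross :: "nat \<Rightarrow> nat \<Rightarrow> real" where
  "cross k i = (\<Sum>j<p k. L k j i * (\<Sum>l<p k. L k j l * e0 k l))"

lemma noncentral_square:
  "(\<Sum>j<p k. (noncentral (e0 k) z j)\<^sup>2) = P k + sphere k z + (2 * (\<Sum>j<p k. e0 k j * z (0, j)) + (\<Sum>j<p k. (e0 k j)\<^sup>2))"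
  by (simp add: noncentral_def sphere_def P_def scaled_id_facts power2_eq_square algebra_simps sum.distrib sum_distrib_left)

lemma noncentral_form:
  "(\<Sum>j<p k. (\<Sum>i<p k. L k j i * noncentral (e0 k) z i)\<^sup>2)
    = tr k + form k z + (2 * (\<Sum>i<p k. cross k i * z (0, i)) + (\<Sum>j<p k. (\<Sum>i<p k. L k j i * e0 k i)\<^sup>2))"
proof -
  let ?c = "colored (p k) (L k) z 0" and ?e = "\<lambda>j. \<Sum>i<p k. L k j i * e0 k i"
  have "(\<Sum>j<p k. (\<Sum>i<p k. L k j i * noncentral (e0 k) z i)\<^sup>2) = (\<Sum>j<p k. (?c j + ?e j)\<^sup>2)"
    by (simp add: noncentral_def colored_def distrib_left sum.distrib)
  also have "\<dots> = (\<Sum>j<p k. ?c j * ?c j) + (2 * (\<Sum>j<p k. ?c j * ?e j) + (\<Sum>j<p k. (?e j)\<^sup>2))"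
    by (simp add: power2_eq_square algebra_simps sum.distrib sum_distrib_left)
  also have "(\<Sum>j<p k. ?c j * ?c j) = tr k + form k z"
    using row_inner_self[of "p k" "L k" z 0] by (simp add: row_inner_def tr_def form_def)
  also have "(\<Sum>j<p k. ?c j * ?e j) = (\<Sum>i<p k. cross k i * z (0, i))"
    unfolding colored_inner cross_def by (simp add: mult.commute)
  finally show ?thesis .
qed

text \<open>The squared shift survives the normalisation by \<open>V / n\<close>, which tends to \<open>1 - c\<close>; this is the mean of the limit law.\<close>
lemma cip_hot:
  "cip G (\<lambda>k z. hot k z - ((q k)\<^sup>2 / m k * sphere k z - (q k)\<^sup>2 * P k / (m k)\<^sup>2 * dev k z)) (l / (1 - c))"
proof -
  let ?V = "\<lambda>k. Vstat (N k) (p k) (e0 k)"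
  let ?x = "\<lambda>k z. 2 * (\<Sum>j<p k. e0 k j * z (0, j)) / (q k)\<^sup>2 + (\<Sum>j<p k. (e0 k j)\<^sup>2) / sqrt (n k)"
  have frs: "(\<lambda>k. frob2 {..<p k} (scaled_id 1) / n k) \<longlonglongrightarrow> c"
    using rates(4) by (simp add: scaled_id_facts P_def)
  have G1: "cip G (\<lambda>k z. sphere k z / q k ^ 3) 0"
    unfolding sphere_def by (rule cip_centered_row[OF _ frs]) (simp add: scaled_id_facts)
  have H1: "cip G (\<lambda>k z. dev k z / q k ^ 3) 0" unfolding dev_def by (rule cip_V)
  have pm: "(\<lambda>k. P k / m k) \<longlonglongrightarrow> c / (1 - c)"
  proof -
    have "P k / n k / (m k / n k) = P k / m k" for k using size(3)[of k] by simp
    moreover have "(\<lambda>k. P k / n k / (m k / n k)) \<longlonglongrightarrow> c / (1 - c)"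
      by (rule tendsto_divide[OF rates(4,5)]) (use c in simp)
    ultimately show ?thesis by (simp only:)
  qed
  have c1: "1 - c \<noteq> 0" using c by simp
  have "cip G (\<lambda>k z. ?x k z / (?V k z / n k) - (sphere k z / q k ^ 3 - P k / m k * (dev k z / q k ^ 3)) * (dev k z / q k ^ 3) / (m k / n k * (?V k z / n k)))
    ((0 + l) / (1 - c) - (0 - c / (1 - c) * 0) * 0 / ((1 - c) * (1 - c)))"
    by (rule cip_diff[OF cip_divide[OF cip_add[OF cip_linear_row[OF shift_lim] cip_tendsto[OF shift_lim]] cip_v c1]
        cip_divide[OF cip_mult[OF cip_diff[OF G1 cip_mult[OF cip_tendsto[OF pm] H1]] H1] cip_mult[OF cip_tendsto[OF rates(5)] cip_v]]])
       (use c in simp)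
  then have lim: "cip G (\<lambda>k z. ?x k z / (?V k z / n k) - (sphere k z / q k ^ 3 - P k / m k * (dev k z / q k ^ 3)) * (dev k z / q k ^ 3) / (m k / n k * (?V k z / n k))) (l / (1 - c))"
    by (simp only: mult_zero_right mult_zero_left add_0 diff_zero div_0)
  show ?thesis
  proof (rule cip_whp_cong[OF prob_space_M lim], rule whp_mono[OF whp_nonzero[OF cip_v c1]])
    fix k z assume "?V k z / n k \<noteq> 0"
    then have V: "?V k z \<noteq> 0" by simp
    have x: "?x k z = (2 * (\<Sum>j<p k. e0 k j * z (0, j)) + (\<Sum>j<p k. (e0 k j)\<^sup>2)) / (q k)\<^sup>2"
      by (simp only: size(6) add_divide_distrib)
    show "?x k z / (?V k z / n k) - (sphere k z / q k ^ 3 - P k / m k * (dev k z / q k ^ 3)) * (dev k z / q k ^ 3) / (m k / n k * (?V k z / n k))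
      = hot k z - ((q k)\<^sup>2 / m k * sphere k z - (q k)\<^sup>2 * P k / (m k)\<^sup>2 * dev k z)"
      unfolding hot_def noncentral_square x unfolding size(6)[of k, symmetric] unfolding size(7)[of k, symmetric]
      by (rule hotelling_expansion[symmetric]) (use V size in \<open>simp_all only: dev_def not_False_eq_True\<close>)
  qed
qed

text \<open>Here the squared shift is divided by \<open>tr S / n\<close>, which tends to \<open>c a\<^sub>1\<close>.\<close>
lemma cip_dem: "cip G (\<lambda>k z. dem k z - (q k)\<^sup>2 / tr k * form k z) (lI / (c * a1))"
proof -
  let ?t = "\<lambda>k. tau (N k) (p k) (L k)" and ?w = "\<lambda>k z. tau (N k) (p k) (L k) z - tr k"
  let ?x = "\<lambda>k z. 2 * (\<Sum>i<p k. cross k i * z (0, i)) / (q k)\<^sup>2 + (\<Sum>j<p k. (\<Sum>i<p k. L k j i * e0 k i)\<^sup>2) / sqrt (n k)"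
  have fr: "(\<lambda>k. frob2 {..<p k} (B k) / n k) \<longlonglongrightarrow> c * a2"
  proof -
    have "P k / n k * (F k / P k) = frob2 {..<p k} (B k) / n k" for k using size(9)[of k] by (simp add: F_def)
    then show ?thesis using tendsto_mult[OF rates(4,7)] by (simp only:)
  qed
  have G2: "cip G (\<lambda>k z. form k z / q k ^ 3) 0"
    unfolding form_def by (rule cip_centered_row[OF _ fr]) (rule sym_on_gramian)
  have ca: "c * a1 \<noteq> 0" using c a1 by simp
  have E2: "cip G (\<lambda>k z. 2 * (\<Sum>i<p k. cross k i * z (0, i)) / (q k)\<^sup>2) 0"
    by (rule cip_linear_row) (use shift_lim_S in \<open>simp only: cross_def\<close>)
  have "cip G (\<lambda>k z. (?x k z - ?w k z / (q k)\<^sup>2) / (?t k z / n k) - 1 / q k * (form k z / q k ^ 3) * (?w k z / (q k)\<^sup>2) / (?t k z / n k * (tr k / n k)))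
    ((0 + lI - 0) / (c * a1) - 0 * 0 * 0 / ((c * a1) * (c * a1)))"
    by (rule cip_diff[OF cip_divide[OF cip_diff[OF cip_add[OF E2 cip_tendsto[OF shift_lim_I]] cip_tau] cip_t ca]
        cip_divide[OF cip_mult[OF cip_mult[OF cip_tendsto[OF rates(2)] G2] cip_tau] cip_mult[OF cip_t cip_tendsto[OF rates(9)]]]])
       (use c a1 in simp)
  then have lim: "cip G (\<lambda>k z. (?x k z - ?w k z / (q k)\<^sup>2) / (?t k z / n k) - 1 / q k * (form k z / q k ^ 3) * (?w k z / (q k)\<^sup>2) / (?t k z / n k * (tr k / n k))) (lI / (c * a1))"
    by (simp only: mult_zero_right mult_zero_left add_0 diff_zero div_0)
  show ?thesis
  proof (rule cip_whp_cong[OF prob_space_M lim], rule whp_mono[OF whp_nonzero[OF cip_t ca]])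
    fix k z assume "?t k z / n k \<noteq> 0"
    then have t: "?t k z \<noteq> 0" by simp
    have t0: "tr k \<noteq> 0" using tr_pos[of k] by simp
    have x: "?x k z = (2 * (\<Sum>i<p k. cross k i * z (0, i)) + (\<Sum>j<p k. (\<Sum>i<p k. L k j i * e0 k i)\<^sup>2)) / (q k)\<^sup>2"
      by (simp only: size(6) add_divide_distrib)
    show "(?x k z - ?w k z / (q k)\<^sup>2) / (?t k z / n k) - 1 / q k * (form k z / q k ^ 3) * (?w k z / (q k)\<^sup>2) / (?t k z / n k * (tr k / n k))
      = dem k z - (q k)\<^sup>2 / tr k * form k z"
      unfolding dem_def noncentral_form x unfolding size(6)[of k, symmetric] unfolding size(7)[of k, symmetric]
      by (rule dempster_expansion[symmetric]) (use t t0 size in \<open>simp_all only: not_False_eq_True\<close>)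
  qed
qed

text \<open>The part of the statistic that is asymptotically normal: a centred quadratic form in the first row minus an independent centred chi-square variable.\<close>
definition principal :: "real \<Rightarrow> nat \<Rightarrow> (nat \<times> nat \<Rightarrow> real) \<Rightarrow> real" where
  "principal r k z = centered {..<p k} (ridge (r * (q k)\<^sup>2 / m k) ((1 - r) * (q k)\<^sup>2 / tr k) (B k)) (\<lambda>j. z (0, j))
     - r * (q k)\<^sup>2 * P k / (m k)\<^sup>2 * dev k z"

lemma cip_principal:
  assumes \<rho>: "\<rho> \<longlonglongrightarrow> r"
  shows "cip G (\<lambda>k z. \<rho> k * hot k z + (1 - \<rho> k) * dem k z - principal (\<rho> k) k z) (r * (l / (1 - c)) + (1 - r) * (lI / (c * a1)))"
proof -
  have "cip G (\<lambda>k z. \<rho> k * (hot k z - ((q k)\<^sup>2 / m k * sphere k z - (q k)\<^sup>2 * P k / (m k)\<^sup>2 * dev k z))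
      + (1 - \<rho> k) * (dem k z - (q k)\<^sup>2 / tr k * form k z)) (r * (l / (1 - c)) + (1 - r) * (lI / (c * a1)))"
    by (rule cip_add[OF cip_mult[OF cip_tendsto[OF \<rho>] cip_hot] cip_mult[OF cip_tendsto[OF tendsto_diff[OF tendsto_const \<rho>]] cip_dem]])
  moreover have "\<rho> k * (hot k z - ((q k)\<^sup>2 / m k * sphere k z - (q k)\<^sup>2 * P k / (m k)\<^sup>2 * dev k z))
      + (1 - \<rho> k) * (dem k z - (q k)\<^sup>2 / tr k * form k z) = \<rho> k * hot k z + (1 - \<rho> k) * dem k z - principal (\<rho> k) k z" for k z
  proof -
    have s: "sphere k z = (\<Sum>j<p k. (z (0, j))\<^sup>2) - real (card {..<p k})" by (simp add: sphere_def scaled_id_facts)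
    show ?thesis unfolding principal_def centered_ridge[OF finite_lessThan] s[symmetric] form_def[symmetric]
      by (simp add: algebra_simps)
  qed
  ultimately show ?thesis by (simp only:)
qed

end

section \<open>Consistent standardisation and the limit of the rejection probability\<close>

lemma sigma_fun_pos:
  assumes r: "r \<in> {0..1}" and c: "0 < c" "c < 1" and a: "0 < a1" "0 < a2"
  shows "sigma_fun r c a1 a2 > 0"
proof -
  have nn: "0 \<le> r\<^sup>2 * (2 * c / (1 - c) ^ 3)" "0 \<le> (1 - r)\<^sup>2 * (2 * a2 / (c * a1\<^sup>2))" "0 \<le> 2 * r * (1 - r) * (2 / (1 - c))"
    using assms by (auto intro!: mult_nonneg_nonneg divide_nonneg_nonneg)
  have "0 < r\<^sup>2 * (2 * c / (1 - c) ^ 3) + (1 - r)\<^sup>2 * (2 * a2 / (c * a1\<^sup>2)) + 2 * r * (1 - r) * (2 / (1 - c))"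
  proof (cases "r = 1")
    case True
    then show ?thesis using c by simp
  next
    case False
    then have "0 < (1 - r)\<^sup>2 * (2 * a2 / (c * a1\<^sup>2))" using c a by simp
    then show ?thesis using nn by linarith
  qed
  then show ?thesis by (simp add: sigma_fun_def)
qed

context high_dimensional
begin

definition a2_form :: "nat \<Rightarrow> (nat \<times> nat \<Rightarrow> real) \<Rightarrow> real" where
  "a2_form k z = (n k)\<^sup>2 / ((n k + 2) * (n k - 1))
    * ((\<Sum>i\<in>{1..<N k}. \<Sum>l\<in>{1..<N k} - {i}. kern (p k) (B k) (\<lambda>j. z (i, j)) (\<lambda>j. z (l, j))) / (real (p k) * (n k)\<^sup>2)
       + 2 * (1 - 1 / n k) * ((\<Sum>i\<in>{1..<N k}. centered {..<p k} (mmult {..<p k} (B k) (B k)) (\<lambda>j. z (i, j))) / (real (p k) * n k))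
       + (1 - 1 / n k) * (frob2 {..<p k} (B k) / real (p k))
       + ((\<Sum>i\<in>{1..<N k}. (centered {..<p k} (B k) (\<lambda>j. z (i, j)))\<^sup>2) / (real (p k) * (n k)\<^sup>2)
          - ((\<Sum>i\<in>{1..<N k}. centered {..<p k} (B k) (\<lambda>j. z (i, j))) / n k)\<^sup>2 / (real (p k) * n k)))"

text \<open>Each centred term is shown to vanish by its second moment, and the sum of squares by its mean.\<close>
lemma cip_a2_form: "cip G a2_form a2"
proof -
  let ?R = "\<lambda>k. {1..<N k}"
  let ?K = "\<lambda>k z. (\<Sum>i\<in>?R k. \<Sum>l\<in>?R k - {i}. kern (p k) (B k) (\<lambda>j. z (i, j)) (\<lambda>j. z (l, j))) / (P k * (n k)\<^sup>2)"
  let ?Q = "\<lambda>k z. (\<Sum>i\<in>?R k. centered {..<p k} (mmult {..<p k} (B k) (B k)) (\<lambda>j. z (i, j))) / (P k * n k)"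
  let ?E = "\<lambda>k z. (\<Sum>i\<in>?R k. (centered {..<p k} (B k) (\<lambda>j. z (i, j)))\<^sup>2) / (P k * (n k)\<^sup>2)"
  let ?H = "\<lambda>k z. ((\<Sum>i\<in>?R k. centered {..<p k} (B k) (\<lambda>j. z (i, j))) / n k)\<^sup>2 / (P k * n k)"
  have K: "cip G ?K 0"
  proof (rule cip_zero_moments)
    show "all_moments (G k) (?K k)" for k
      by (rule gauss_moments(6), rule gauss_moments(8), rule gauss_moments(8), rule all_moments_kern) auto
    show "(LINT z|G k. (?K k z)\<^sup>2) \<le> 8 * ((F k / P k)\<^sup>2 + 3 * (F4 k / P k) * (1 / P k)) * (1 / n k)\<^sup>2" for k
    proof -
      have "(LINT z|G k. (?K k z)\<^sup>2) = (LINT z|G k. (\<Sum>i\<in>?R k. \<Sum>l\<in>?R k - {i}. kern (p k) (B k) (\<lambda>j. z (i, j)) (\<lambda>j. z (l, j)))\<^sup>2) / (P k * (n k)\<^sup>2)\<^sup>2"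
        unfolding power_divide by (rule integral_divide_zero)
      also have "\<dots> \<le> 2 * (real (card (?R k)))\<^sup>2 * kern_bound (p k) (B k) / (P k * (n k)\<^sup>2)\<^sup>2"
        by (rule divide_right_mono[OF sum_kern_square[OF rows(1) sym_on_gramian]]) simp
      also have "\<dots> = 8 * ((F k / P k)\<^sup>2 + 3 * (F4 k / P k) * (1 / P k)) * (1 / n k)\<^sup>2"
        unfolding rows(2) kern_bound_def F_def[symmetric] F4_def[symmetric]
        using size(3,9)[of k] by (simp add: field_simps power2_eq_square)
      finally show ?thesis .
    qed
    have "(\<lambda>k. 8 * ((F k / P k)\<^sup>2 + 3 * (F4 k / P k) * (1 / P k)) * (1 / n k)\<^sup>2) \<longlonglongrightarrow> 8 * (a2\<^sup>2 + 3 * a4 * 0) * 0\<^sup>2"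
      by (rule tendsto_mult[OF tendsto_mult[OF tendsto_const tendsto_add[OF tendsto_power[OF rates(7)] tendsto_mult[OF tendsto_mult[OF tendsto_const rates(8)] rates(3)]]] tendsto_power[OF rates(1)]])
    then show "(\<lambda>k. 8 * ((F k / P k)\<^sup>2 + 3 * (F4 k / P k) * (1 / P k)) * (1 / n k)\<^sup>2) \<longlonglongrightarrow> 0" by simp
  qed
  have Q: "cip G ?Q 0"
  proof (rule cip_zero_moments)
    show "all_moments (G k) (?Q k)" for k
      by (rule gauss_moments(6), rule gauss_moments(8), rule all_moments_rows(2)) simp
    show "(LINT z|G k. (?Q k z)\<^sup>2) \<le> 2 * (F4 k / P k) * (1 / P k) * (1 / n k)" for k
    proof -
      have "(LINT z|G k. (?Q k z)\<^sup>2) = (LINT z|G k. (\<Sum>i\<in>?R k. centered {..<p k} (mmult {..<p k} (B k) (B k)) (\<lambda>j. z (i, j)))\<^sup>2) / (P k * n k)\<^sup>2"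
        unfolding power_divide by (rule integral_divide_zero)
      also have "\<dots> = n k * (2 * F4 k) / (P k * n k)\<^sup>2"
        unfolding sum_centered_rows_square[OF rows(1) sym_on_mmult[OF sym_on_gramian]] rows(2) F4_def ..
      also have "\<dots> = 2 * (F4 k / P k) * (1 / P k) * (1 / n k)"
        using size(3,9)[of k] by (simp add: field_simps power2_eq_square)
      finally show ?thesis by (rule eq_refl)
    qed
    have "(\<lambda>k. 2 * (F4 k / P k) * (1 / P k) * (1 / n k)) \<longlonglongrightarrow> 2 * a4 * 0 * 0"
      by (rule tendsto_mult[OF tendsto_mult[OF tendsto_mult[OF tendsto_const rates(8)] rates(3)] rates(1)])
    then show "(\<lambda>k. 2 * (F4 k / P k) * (1 / P k) * (1 / n k)) \<longlonglongrightarrow> 0" by simp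
  qed
  have E: "cip G ?E 0"
  proof (rule cip_zero_L1)
    have am: "all_moments (G k) (\<lambda>z. (centered {..<p k} (B k) (\<lambda>j. z (i, j)))\<^sup>2)" if "i \<in> ?R k" for i k
      by (rule gauss_moments(7), rule all_moments_rows(2)) (use that in simp)
    show "integrable (G k) (?E k)" for k
      by (rule all_moments_integrable, rule gauss_moments(6), rule gauss_moments(8), rule am)
    have "(LINT z|G k. \<bar>?E k z\<bar>) = 2 * (F k / P k) * (1 / n k)" for k
    proof -
      have "\<bar>?E k z\<bar> = ?E k z" for z using size(8)[of k] by (simp add: sum_nonneg)
      then have "(LINT z|G k. \<bar>?E k z\<bar>) = (LINT z|G k. (\<Sum>i\<in>?R k. (centered {..<p k} (B k) (\<lambda>j. z (i, j)))\<^sup>2)) / (P k * (n k)\<^sup>2)"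
        by (simp only: integral_divide_zero)
      also have "(LINT z|G k. (\<Sum>i\<in>?R k. (centered {..<p k} (B k) (\<lambda>j. z (i, j)))\<^sup>2)) = (\<Sum>i\<in>?R k. LINT z|G k. (centered {..<p k} (B k) (\<lambda>j. z (i, j)))\<^sup>2)"
        by (rule Bochner_Integration.integral_sum) (rule all_moments_integrable[OF am])
      also have "\<dots> = (\<Sum>i\<in>?R k. 2 * F k)"
        unfolding F_def by (intro sum.cong refl centered_row_square sym_on_gramian) simp
      also have "\<dots> = n k * (2 * F k)" unfolding sum_constant rows(2) ..
      also have "n k * (2 * F k) / (P k * (n k)\<^sup>2) = 2 * (F k / P k) * (1 / n k)"
        using size(3,9)[of k] by (simp add: field_simps power2_eq_square)
      finally show ?thesis .
    qed
    moreover have "(\<lambda>k. 2 * (F k / P k) * (1 / n k)) \<longlonglongrightarrow> 2 * a2 * 0"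
      by (rule tendsto_mult[OF tendsto_mult[OF tendsto_const rates(7)] rates(1)])
    ultimately show "(\<lambda>k. LINT z|G k. \<bar>?E k z\<bar>) \<longlonglongrightarrow> 0" by simp
  qed
  have H: "cip G ?H 0"
  proof -
    have "((tau (N k) (p k) (L k) z - tr k) / (q k)\<^sup>2)\<^sup>2 * (1 / P k) = ?H k z" for k z
    proof -
      have "1 < N k" using p_ge[of k] p_less[of k] by linarith
      then have t: "tau (N k) (p k) (L k) z - tr k = (\<Sum>i\<in>?R k. centered {..<p k} (B k) (\<lambda>j. z (i, j))) / n k"
        unfolding tau_centered[OF \<open>1 < N k\<close>] tr_def n_eq by simp
      have "((q k)\<^sup>2)\<^sup>2 = n k" unfolding size(7)[of k, symmetric] by simp
      then show ?thesis unfolding t by (simp only: power_divide[of "x / y" for x y] times_divide_times_eq mult_1_right mult.commute)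
    qed
    moreover have "cip G (\<lambda>k z. ((tau (N k) (p k) (L k) z - tr k) / (q k)\<^sup>2)\<^sup>2 * (1 / P k)) (0\<^sup>2 * 0)"
      by (rule cip_mult[OF cip_power[OF cip_tau] cip_tendsto[OF rates(3)]])
    ultimately show ?thesis by simp
  qed
  have n1: "(\<lambda>k. 1 - 1 / n k) \<longlonglongrightarrow> 1" using tendsto_diff[OF tendsto_const[of 1] rates(1)] by simp
  have kap: "(\<lambda>k. (n k)\<^sup>2 / ((n k + 2) * (n k - 1))) \<longlonglongrightarrow> 1"
  proof -
    have "(n k)\<^sup>2 / ((n k + 2) * (n k - 1)) = 1 / ((1 + 2 * (1 / n k)) * (1 - 1 / n k))" for k
    proof -
      have "(1 + 2 * (1 / n k)) * (1 - 1 / n k) = (n k + 2) * (n k - 1) / (n k)\<^sup>2"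
        using size(3)[of k] by (simp add: field_simps power2_eq_square)
      then show ?thesis by simp
    qed
    moreover have "(\<lambda>k. 1 / ((1 + 2 * (1 / n k)) * (1 - 1 / n k))) \<longlonglongrightarrow> 1 / ((1 + 2 * 0) * 1)"
      by (rule tendsto_divide[OF tendsto_const tendsto_mult[OF tendsto_add[OF tendsto_const tendsto_mult[OF tendsto_const rates(1)]] n1]]) simp
    ultimately show ?thesis by simp
  qed
  have "cip G (\<lambda>k z. (n k)\<^sup>2 / ((n k + 2) * (n k - 1)) * (?K k z + 2 * (1 - 1 / n k) * ?Q k z + (1 - 1 / n k) * (F k / P k) + (?E k z - ?H k z)))
    (1 * (0 + 2 * 1 * 0 + 1 * a2 + (0 - 0)))"
    by (rule cip_mult[OF cip_tendsto[OF kap] cip_add[OF cip_add[OF cip_add[OF K cip_mult[OF cip_tendsto[OF tendsto_mult[OF tendsto_const n1]] Q]]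
        cip_tendsto[OF tendsto_mult[OF n1 rates(7)]]] cip_diff[OF E H]]])
  then show ?thesis by (simp only: a2_form_def[abs_def] P_def F_def mult_zero_right mult_1_left add_0 diff_zero add_0_right)
qed

lemma cip_sigma_hat:
  assumes \<rho>: "\<rho> \<longlonglongrightarrow> r"
  shows "cip G (\<lambda>k z. sigma_fun (\<rho> k) (P k / n k) (tau (N k) (p k) (L k) z / P k) (a2_form k z)) (sigma_fun r c a1 a2)"
proof -
  have a1h: "cip G (\<lambda>k z. tau (N k) (p k) (L k) z / P k) a1"
  proof -
    have "cip G (\<lambda>k z. tau (N k) (p k) (L k) z / n k / (P k / n k)) (c * a1 / c)"
      by (rule cip_divide[OF cip_t cip_tendsto[OF rates(4)]]) (use c in simp)
    moreover have "tau (N k) (p k) (L k) z / n k / (P k / n k) = tau (N k) (p k) (L k) z / P k" for k z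
      using size(3)[of k] by (simp add: divide_divide_eq_left)
    moreover have "c * a1 / c = a1" using c by simp
    ultimately show ?thesis by (simp only:)
  qed
  note pn = cip_tendsto[OF rates(4)] and one = cip_tendsto[OF tendsto_const] and r = cip_tendsto[OF \<rho>]
  have nz: "(1 - c) ^ 3 \<noteq> 0" "1 - c \<noteq> 0" "c * a1\<^sup>2 \<noteq> 0" using c a1 by auto
  show ?thesis unfolding sigma_fun_def
    by (rule cip_sqrt, rule cip_add, rule cip_add,
      rule cip_mult[OF cip_power[OF r] cip_divide[OF cip_mult[OF one pn] cip_power[OF cip_diff[OF one pn]] nz(1)]],
      rule cip_mult[OF cip_power[OF cip_diff[OF one r]] cip_divide[OF cip_mult[OF one cip_a2_form] cip_mult[OF pn cip_power[OF a1h]] nz(3)]],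
      rule cip_mult[OF cip_mult[OF cip_mult[OF one r] cip_diff[OF one r]] cip_divide[OF one cip_diff[OF one pn] nz(2)]])
qed

lemma measurable_principal: "principal r k \<in> borel_measurable (G k)"
  unfolding principal_def dev_def
  by (intro borel_measurable_diff borel_measurable_times borel_measurable_const borel_measurable_Vstat size
      all_moments_measurable[OF all_moments_rows(2)])

text \<open>Both factors of the characteristic function are replaced by Gaussian ones. The variances add up to \<open>\<sigma>\<^sup>2\<close>, because \<open>c / (1 - c)\<^sup>2 + c\<^sup>2 / (1 - c)\<^sup>3 = c / (1 - c)\<^sup>3\<close>; the first term comes from the row and the second from \<open>V\<close>.\<close>
lemma char_principal_limit:
  assumes \<rho>: "\<rho> \<longlonglongrightarrow> r" and r: "r \<in> {0..1}"
  shows "(\<lambda>k. LINT z|G k. iexp (t * (principal (\<rho> k) k z / sigma_fun r c a1 a2))) \<longlonglongrightarrow> exp (- t\<^sup>2 / 2)"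
proof -
  define \<sigma> where "\<sigma> = sigma_fun r c a1 a2"
  have \<sigma>: "\<sigma> > 0" unfolding \<sigma>_def by (rule sigma_fun_pos[OF r c a1 a2])
  define s where "s = t / \<sigma>"
  define x where "x k = \<rho> k * (q k)\<^sup>2 / m k" for k
  define y where "y k = (1 - \<rho> k) * (q k)\<^sup>2 / tr k" for k
  define g where "g k = \<rho> k * (q k)\<^sup>2 * P k / (m k)\<^sup>2" for k
  let ?C = "\<lambda>k. ridge (x k) (y k) (B k)"
  define f1 where "f1 k = frob2 {..<p k} (?C k)" for k
  define f2 where "f2 k = (g k)\<^sup>2 * m k" for k
  define h1 where "h1 k = frob2 {..<p k} (mmult {..<p k} (?C k) (?C k))" for k
  define h2 where "h2 k = g k ^ 4 * m k" for k
  have q2: "((q k)\<^sup>2)\<^sup>2 = n k" for k unfolding size(7)[of k, symmetric] by simp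
  have vr: "(x k)\<^sup>2 * P k = (\<rho> k)\<^sup>2 * (P k / n k) / (m k / n k)\<^sup>2" "2 * x k * y k * tr k = 2 * \<rho> k * (1 - \<rho> k) / (m k / n k)"
    "(y k)\<^sup>2 * F k = (1 - \<rho> k)\<^sup>2 * (F k / P k) / (P k / n k * (tr k / P k)\<^sup>2)"
    "(g k)\<^sup>2 * m k = (\<rho> k)\<^sup>2 * (P k / n k)\<^sup>2 / (m k / n k) ^ 3"
    "x k ^ 4 * P k = (\<rho> k) ^ 4 * (1 / n k) * (P k / n k) / (m k / n k) ^ 4"
    "4 * (x k)\<^sup>2 * (y k)\<^sup>2 * F k = 4 * (\<rho> k)\<^sup>2 * (1 - \<rho> k)\<^sup>2 * (1 / P k) * (F k / P k) / ((m k / n k)\<^sup>2 * (tr k / P k)\<^sup>2)"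
    "y k ^ 4 * F4 k = (1 - \<rho> k) ^ 4 * (1 / n k) * (F4 k / P k) / ((P k / n k) ^ 3 * (tr k / P k) ^ 4)"
    "g k ^ 4 * m k = (\<rho> k) ^ 4 * (1 / n k) * (P k / n k) ^ 4 / (m k / n k) ^ 7" for k
    unfolding x_def y_def g_def by (rule variance_rates[OF size(2) size(10) size(8) tr_pos q2])+
  have \<rho>': "(\<lambda>k. 1 - \<rho> k) \<longlonglongrightarrow> 1 - r" by (rule tendsto_diff[OF tendsto_const \<rho>])
  have c1: "1 - c \<noteq> 0" using c by simp
  have nz: "(1 - c)\<^sup>2 \<noteq> 0" "(1 - c) ^ 3 \<noteq> 0" "(1 - c) ^ 4 \<noteq> 0" "(1 - c) ^ 7 \<noteq> 0" "c * a1\<^sup>2 \<noteq> 0" "(1 - c)\<^sup>2 * a1\<^sup>2 \<noteq> 0" "c ^ 3 * a1 ^ 4 \<noteq> 0"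
    using c a1 by auto
  have f1: "f1 k = (\<rho> k)\<^sup>2 * (P k / n k) / (m k / n k)\<^sup>2 + 2 * \<rho> k * (1 - \<rho> k) / (m k / n k)
      + (1 - \<rho> k)\<^sup>2 * (F k / P k) / (P k / n k * (tr k / P k)\<^sup>2)" for k
    unfolding f1_def frob2_ridge[OF finite_lessThan] card_lessThan P_def[symmetric] tr_def[symmetric] F_def[symmetric] by (simp only: vr)
  have f1_lim: "f1 \<longlonglongrightarrow> r\<^sup>2 * c / (1 - c)\<^sup>2 + 2 * r * (1 - r) / (1 - c) + (1 - r)\<^sup>2 * a2 / (c * a1\<^sup>2)"
    unfolding f1[abs_def]
    by (rule tendsto_add[OF tendsto_add[OF tendsto_divide[OF tendsto_mult[OF tendsto_power[OF \<rho>] rates(4)] tendsto_power[OF rates(5)] nz(1)]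
        tendsto_divide[OF tendsto_mult[OF tendsto_mult[OF tendsto_const \<rho>] \<rho>'] rates(5) c1]]
        tendsto_divide[OF tendsto_mult[OF tendsto_power[OF \<rho>'] rates(7)] tendsto_mult[OF rates(4) tendsto_power[OF rates(6)]] nz(5)]])
  have f2_lim: "f2 \<longlonglongrightarrow> r\<^sup>2 * c\<^sup>2 / (1 - c) ^ 3"
    unfolding f2_def[abs_def] vr
    by (rule tendsto_divide[OF tendsto_mult[OF tendsto_power[OF \<rho>] tendsto_power[OF rates(4)]] tendsto_power[OF rates(5)] nz(2)])
  have "r\<^sup>2 * c / (1 - c)\<^sup>2 + 2 * r * (1 - r) / (1 - c) + (1 - r)\<^sup>2 * a2 / (c * a1\<^sup>2) + r\<^sup>2 * c\<^sup>2 / (1 - c) ^ 3 = \<sigma>\<^sup>2 / 2"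
  proof -
    have "\<sigma>\<^sup>2 = r\<^sup>2 * (2 * c / (1 - c) ^ 3) + (1 - r)\<^sup>2 * (2 * a2 / (c * a1\<^sup>2)) + 2 * r * (1 - r) * (2 / (1 - c))"
      using \<sigma> by (simp add: \<sigma>_def sigma_fun_def)
    moreover have "r\<^sup>2 * c / (1 - c)\<^sup>2 + r\<^sup>2 * c\<^sup>2 / (1 - c) ^ 3 = r\<^sup>2 * (c / (1 - c) ^ 3)"
    proof -
      have "r\<^sup>2 * c / (1 - c)\<^sup>2 = r\<^sup>2 * c * (1 - c) / (1 - c) ^ 3" using c1 by (simp add: power2_eq_square power3_eq_cube)
      then show ?thesis by (simp add: add_divide_distrib[symmetric]) (simp add: power2_eq_square algebra_simps)
    qed
    moreover have "r\<^sup>2 * (2 * c / (1 - c) ^ 3) = 2 * (r\<^sup>2 * (c / (1 - c) ^ 3))"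
      "(1 - r)\<^sup>2 * (2 * a2 / (c * a1\<^sup>2)) = 2 * ((1 - r)\<^sup>2 * a2 / (c * a1\<^sup>2))"
      "2 * r * (1 - r) * (2 / (1 - c)) = 2 * (2 * r * (1 - r) / (1 - c))" by simp_all
    moreover have "u + z + y + v = S / 2" if "S = X + Y + Z" "u + v = w" "X = 2 * w" "Y = 2 * y" "Z = 2 * z" for S X Y Z u v w y z :: real
      using that by linarith
    ultimately show ?thesis by blast
  qed
  then have f_lim: "(\<lambda>k. f1 k + f2 k) \<longlonglongrightarrow> \<sigma>\<^sup>2 / 2" using tendsto_add[OF f1_lim f2_lim] by (simp only:)
  have h1_le: "h1 k \<le> 3 * ((\<rho> k) ^ 4 * (1 / n k) * (P k / n k) / (m k / n k) ^ 4
      + 4 * (\<rho> k)\<^sup>2 * (1 - \<rho> k)\<^sup>2 * (1 / P k) * (F k / P k) / ((m k / n k)\<^sup>2 * (tr k / P k)\<^sup>2)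
      + (1 - \<rho> k) ^ 4 * (1 / n k) * (F4 k / P k) / ((P k / n k) ^ 3 * (tr k / P k) ^ 4))" for k
    using frob2_ridge_square[OF finite_lessThan, of "p k" "x k" "y k" "B k"]
    unfolding h1_def[symmetric] card_lessThan P_def[symmetric] F_def[symmetric] F4_def[symmetric] vr .
  have "(\<lambda>k. 3 * ((\<rho> k) ^ 4 * (1 / n k) * (P k / n k) / (m k / n k) ^ 4
      + 4 * (\<rho> k)\<^sup>2 * (1 - \<rho> k)\<^sup>2 * (1 / P k) * (F k / P k) / ((m k / n k)\<^sup>2 * (tr k / P k)\<^sup>2)
      + (1 - \<rho> k) ^ 4 * (1 / n k) * (F4 k / P k) / ((P k / n k) ^ 3 * (tr k / P k) ^ 4)))
    \<longlonglongrightarrow> 3 * (r ^ 4 * 0 * c / (1 - c) ^ 4 + 4 * r\<^sup>2 * (1 - r)\<^sup>2 * 0 * a2 / ((1 - c)\<^sup>2 * a1\<^sup>2) + (1 - r) ^ 4 * 0 * a4 / (c ^ 3 * a1 ^ 4))"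
    by (rule tendsto_mult[OF tendsto_const tendsto_add[OF tendsto_add[OF
        tendsto_divide[OF tendsto_mult[OF tendsto_mult[OF tendsto_power[OF \<rho>] rates(1)] rates(4)] tendsto_power[OF rates(5)] nz(3)]
        tendsto_divide[OF tendsto_mult[OF tendsto_mult[OF tendsto_mult[OF tendsto_mult[OF tendsto_const tendsto_power[OF \<rho>]] tendsto_power[OF \<rho>']] rates(3)] rates(7)] tendsto_mult[OF tendsto_power[OF rates(5)] tendsto_power[OF rates(6)]] nz(6)]]
        tendsto_divide[OF tendsto_mult[OF tendsto_mult[OF tendsto_power[OF \<rho>'] rates(1)] rates(8)] tendsto_mult[OF tendsto_power[OF rates(4)] tendsto_power[OF rates(6)]] nz(7)]]])
  then have h1_lim: "h1 \<longlonglongrightarrow> 0"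
    by (intro tendsto_sandwich[OF always_eventually always_eventually tendsto_const, of 0 h1])
       (use h1_le in \<open>auto simp: h1_def\<close>)
  have h2_lim: "h2 \<longlonglongrightarrow> 0"
  proof -
    have "h2 \<longlonglongrightarrow> r ^ 4 * 0 * c ^ 4 / (1 - c) ^ 7"
      unfolding h2_def[abs_def] vr
      by (rule tendsto_divide[OF tendsto_mult[OF tendsto_mult[OF tendsto_power[OF \<rho>] rates(1)] tendsto_power[OF rates(4)]] tendsto_power[OF rates(5)] nz(4)])
    then show ?thesis by simp
  qed
  define X where "X k = (LINT v|gauss {..<p k}. iexp (s * centered {..<p k} (?C k) v))" for k
  define Y where "Y k = (LINT w|gauss {..<N k - p k}. iexp (s * centered {..<N k - p k} (scaled_id (- g k)) w))" for k
  have XY: "(LINT z|G k. iexp (t * (principal (\<rho> k) k z / \<sigma>))) = X k * Y k" for k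
  proof -
    have "t * (principal (\<rho> k) k z / \<sigma>) = s * (centered {..<p k} (?C k) (\<lambda>j. z (0, j)) - g k * (Vstat (N k) (p k) (e0 k) z - real (N k - p k)))" for z
      unfolding principal_def dev_def s_def x_def y_def g_def size(13) by simp
    then show ?thesis
      unfolding X_def Y_def by (simp only: char_row_Vstat[OF size(15) p_less])
  qed
  have Xb: "norm (X k - exp (- s\<^sup>2 * f1 k)) \<le> 2 * s\<^sup>2 * sqrt (2 * h1 k)" for k
    unfolding X_def f1_def h1_def by (rule char_quadratic_bound[OF finite_lessThan sym_on_ridge[OF sym_on_gramian]])
  have Yb: "norm (Y k - exp (- s\<^sup>2 * f2 k)) \<le> 2 * s\<^sup>2 * sqrt (2 * h2 k)" for k
  proof -
    have "frob2 {..<N k - p k} (scaled_id (- g k)) = f2 k" "frob2 {..<N k - p k} (mmult {..<N k - p k} (scaled_id (- g k)) (scaled_id (- g k))) = h2 k"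
      unfolding scaled_id_facts[OF finite_lessThan] card_lessThan size(13) f2_def h2_def by simp_all
    moreover have "norm (Y k - exp (- s\<^sup>2 * frob2 {..<N k - p k} (scaled_id (- g k))))
      \<le> 2 * s\<^sup>2 * sqrt (2 * frob2 {..<N k - p k} (mmult {..<N k - p k} (scaled_id (- g k)) (scaled_id (- g k))))"
      unfolding Y_def by (rule char_quadratic_bound[OF finite_lessThan scaled_id_facts(1)[OF finite_lessThan]])
    ultimately show ?thesis by (simp only:)
  qed
  have f2_nn: "f2 k \<ge> 0" "f1 k \<ge> 0" for k using size(10)[of k] by (simp_all add: f2_def f1_def)
  have bound: "norm (X k * Y k - complex_of_real (exp (- s\<^sup>2 * (f1 k + f2 k)))) \<le> 2 * s\<^sup>2 * sqrt (2 * h1 k) + 2 * s\<^sup>2 * sqrt (2 * h2 k)" for k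
  proof -
    have "norm (X k * Y k - complex_of_real (exp (- s\<^sup>2 * f1 k)) * complex_of_real (exp (- s\<^sup>2 * f2 k))) \<le> norm (X k - exp (- s\<^sup>2 * f1 k)) + norm (Y k - exp (- s\<^sup>2 * f2 k))"
    proof (rule norm_mult_diff_le)
      show "norm (Y k) \<le> 1" unfolding Y_def by (rule norm_char_le_1[OF prob_space_gauss])
      show "norm (complex_of_real (exp (- s\<^sup>2 * f1 k))) \<le> 1" using f2_nn[of k] by (simp add: mult_nonneg_nonneg)
    qed
    also have "\<dots> \<le> 2 * s\<^sup>2 * sqrt (2 * h1 k) + 2 * s\<^sup>2 * sqrt (2 * h2 k)" by (rule add_mono[OF Xb Yb])
    also have "complex_of_real (exp (- s\<^sup>2 * f1 k)) * complex_of_real (exp (- s\<^sup>2 * f2 k)) = complex_of_real (exp (- s\<^sup>2 * (f1 k + f2 k)))"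
      by (simp only: of_real_mult[symmetric] exp_add[symmetric] distrib_left)
    finally show ?thesis .
  qed
  have "(\<lambda>k. 2 * s\<^sup>2 * sqrt (2 * h1 k) + 2 * s\<^sup>2 * sqrt (2 * h2 k)) \<longlonglongrightarrow> 2 * s\<^sup>2 * sqrt (2 * 0) + 2 * s\<^sup>2 * sqrt (2 * 0)"
    by (intro tendsto_add tendsto_mult tendsto_const tendsto_real_sqrt h1_lim h2_lim)
  then have "(\<lambda>k. 2 * s\<^sup>2 * sqrt (2 * h1 k) + 2 * s\<^sup>2 * sqrt (2 * h2 k)) \<longlonglongrightarrow> 0" by simp
  then have d0: "(\<lambda>k. X k * Y k - complex_of_real (exp (- s\<^sup>2 * (f1 k + f2 k)))) \<longlonglongrightarrow> 0"
    by (rule Lim_null_comparison[OF always_eventually[OF allI[OF bound]]])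
  have "(\<lambda>k. complex_of_real (exp (- s\<^sup>2 * (f1 k + f2 k)))) \<longlonglongrightarrow> complex_of_real (exp (- s\<^sup>2 * (\<sigma>\<^sup>2 / 2)))"
    by (intro tendsto_of_real tendsto_exp tendsto_mult tendsto_const f_lim)
  moreover have "- s\<^sup>2 * (\<sigma>\<^sup>2 / 2) = - t\<^sup>2 / 2" using \<sigma> by (simp add: s_def power_divide)
  ultimately have "(\<lambda>k. complex_of_real (exp (- s\<^sup>2 * (f1 k + f2 k)))) \<longlonglongrightarrow> complex_of_real (exp (- t\<^sup>2 / 2))" by (simp only:)
  from tendsto_add[OF d0 this] have "(\<lambda>k. X k * Y k) \<longlonglongrightarrow> complex_of_real (exp (- t\<^sup>2 / 2))" by simp
  then show ?thesis unfolding \<sigma>_def[symmetric] XY by (simp flip: exp_of_real)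
qed

text \<open>The event \<open>T / \<sigma>' \<ge> t\<close> is rewritten as \<open>(T - t \<sigma>') / \<sigma> \<ge> 0\<close>, where \<open>\<sigma>'\<close> is the estimated standard deviation. By consistency of \<open>\<sigma>'\<close> this differs from the asymptotically normal part by a quantity converging to a constant. The weights may vary along the sequence, as the optimal weight does.\<close>
theorem rejection_limit:
  fixes T :: "nat \<Rightarrow> (nat \<times> nat \<Rightarrow> real) \<Rightarrow> real"
  assumes \<rho>: "\<rho> \<longlonglongrightarrow> r" and r: "r \<in> {0..1}"
    and T: "\<And>k. AE z in G k. T k z = (\<rho> k * hot k z + (1 - \<rho> k) * dem k z) / sigma_fun (\<rho> k) (P k / n k) (tau (N k) (p k) (L k) z / P k) (a2_form k z)"
    and meas: "\<And>k. {z \<in> space (G k). T k z \<ge> t} \<in> sets (G k)"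
  shows "(\<lambda>k. measure (G k) {z \<in> space (G k). T k z \<ge> t}) \<longlonglongrightarrow> cdf std_normal_distribution
     ((r * (l / (1 - c)) + (1 - r) * (lI / (c * a1))) / sigma_fun r c a1 a2 - t)"
proof -
  define \<sigma> where "\<sigma> = sigma_fun r c a1 a2"
  have \<sigma>: "\<sigma> > 0" unfolding \<sigma>_def by (rule sigma_fun_pos[OF r c a1 a2])
  define S where "S k z = \<rho> k * hot k z + (1 - \<rho> k) * dem k z" for k z
  define sh where "sh k z = sigma_fun (\<rho> k) (P k / n k) (tau (N k) (p k) (L k) z / P k) (a2_form k z)" for k z
  define b where "b = r * (l / (1 - c)) + (1 - r) * (lI / (c * a1))"
  \<comment> \<open>The last two values only reproduce the event where the estimated standard deviation is not positive or the almost sure formula for \<open>T\<close> fails.\<close>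
  define A where "A k z = (if 0 < sh k z \<and> T k z = S k z / sh k z then (S k z - t * sh k z) / \<sigma> else if T k z \<ge> t then 0 else - 1)" for k z
  have A: "A k z \<ge> 0 \<longleftrightarrow> T k z \<ge> t" for k z
    using \<sigma> by (simp add: A_def field_simps)
  have sh: "cip G sh \<sigma>" unfolding sh_def[abs_def] \<sigma>_def by (rule cip_sigma_hat[OF \<rho>])
  have "cip G (\<lambda>k z. (S k z - principal (\<rho> k) k z - t * sh k z) / \<sigma>) ((b - t * \<sigma>) / \<sigma>)"
    unfolding S_def b_def
    by (rule cip_divide[OF cip_diff[OF cip_principal[OF \<rho>] cip_mult[OF cip_tendsto[OF tendsto_const] sh]] cip_tendsto[OF tendsto_const]]) (use \<sigma> in simp)
  then have lim: "cip G (\<lambda>k z. (S k z - principal (\<rho> k) k z - t * sh k z) / \<sigma>) (b / \<sigma> - t)"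
    using \<sigma> by (simp add: diff_divide_distrib)
  have good: "whp G (\<lambda>k z. \<bar>sh k z - \<sigma>\<bar> < \<sigma> \<and> T k z = S k z / sh k z)"
    by (rule whp_conj[OF prob_space_M cipD[OF sh \<sigma>] whp_AE[OF prob_space_M]]) (use T in \<open>simp add: S_def sh_def\<close>)
  have diff: "cip G (\<lambda>k z. A k z - principal (\<rho> k) k z / \<sigma>) (b / \<sigma> - t)"
  proof (rule cip_whp_cong[OF prob_space_M lim], rule whp_mono[OF good])
    fix k z assume "\<bar>sh k z - \<sigma>\<bar> < \<sigma> \<and> T k z = S k z / sh k z"
    then have "0 < sh k z \<and> T k z = S k z / sh k z" by auto
    then have "A k z = (S k z - t * sh k z) / \<sigma>" unfolding A_def by (rule if_P)
    then show "(S k z - principal (\<rho> k) k z - t * sh k z) / \<sigma> = A k z - principal (\<rho> k) k z / \<sigma>"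
      by (simp add: diff_divide_distrib)
  qed
  have R: "(\<lambda>z. principal (\<rho> k) k z / \<sigma>) \<in> borel_measurable (G k)" for k
    by (rule borel_measurable_divide[OF measurable_principal borel_measurable_const])
  have "(\<lambda>k. measure (G k) {z \<in> space (G k). A k z \<ge> 0}) \<longlonglongrightarrow> cdf std_normal_distribution (b / \<sigma> - t - 0)"
    by (rule slutsky_std_normal[OF R _ _ diff]) (use char_principal_limit[OF \<rho> r] meas in \<open>simp_all only: \<sigma>_def[symmetric] A\<close>)
  then show ?thesis by (simp only: A b_def \<sigma>_def diff_zero)
qed

end

section \<open>The optimal weight\<close>

text \<open>In the variables \<open>x = r / (1 - c)\<close> and \<open>y = (1 - r) sqrt ((1 - c) a\<^sub>2) / (c a\<^sub>1)\<close> the signal is \<open>l (x + y)\<close> and the variance is the symmetric form \<open>A (x\<^sup>2 + y\<^sup>2) + 2 B x y\<close>, equal to \<open>(A + B) / 2 * (x + y)\<^sup>2 + (A - B) / 2 * (x - y)\<^sup>2\<close>. The inequality \<open>B \<le> A\<close> follows from \<open>a\<^sub>1\<^sup>2 \<le> a\<^sub>2\<close>, so the ratio is largest where \<open>x = y\<close>, and this equation determines the optimal weight.\<close>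
lemma sigma_fun_maximal:
  fixes c a1 a2 l r :: real
  assumes c: "0 < c" "c < 1" and a: "0 < a1" "0 < a2" and cs: "a1\<^sup>2 \<le> a2" and l: "0 < l" and r: "r \<in> {0..1}"
  defines "lI \<equiv> l * sqrt ((1 - c) * a2)"
    and "V \<equiv> l * sqrt (1 - c) / sqrt (c * (a1 * sqrt ((1 - c) / a2) + 1))"
  shows "(r * (l / (1 - c)) + (1 - r) * (lI / (c * a1))) / sigma_fun r c a1 a2 \<le> V" (is "?f r \<le> V")
    and "r = rho_star c a1 a2 \<Longrightarrow> (r * (l / (1 - c)) + (1 - r) * (lI / (c * a1))) / sigma_fun r c a1 a2 = V"
proof -
  \<comment> \<open>The scale in which \<open>x\<close> and \<open>y\<close> enter symmetrically.\<close>
  define s where "s = sqrt ((1 - c) * a2)"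
  define x where "x = r / (1 - c)"
  define y where "y = (1 - r) * s / (c * a1)"
  define A where "A = 2 * c / (1 - c)"
  define B where "B = 2 * c * a1 / s"
  have s: "s > 0" "s\<^sup>2 = (1 - c) * a2" using c a by (simp_all add: s_def)
  have c1: "1 - c > 0" using c by simp
  have nz: "c \<noteq> 0" "1 - c \<noteq> 0" "a1 \<noteq> 0" "s \<noteq> 0" using c a s by auto
  have a2: "a2 = s\<^sup>2 / (1 - c)" using s(2) c1 by simp
  have mean: "r * (l / (1 - c)) + (1 - r) * (lI / (c * a1)) = l * (x + y)"
    unfolding lI_def s_def[symmetric] x_def y_def by (simp add: algebra_simps)
  have var: "sigma_fun r c a1 a2 = sqrt (A * (x\<^sup>2 + y\<^sup>2) + 2 * B * x * y)"
  proof -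
    have t1: "r\<^sup>2 * (2 * c / (1 - c) ^ 3) = A * x\<^sup>2"
      using nz by (simp add: A_def x_def power2_eq_square power3_eq_cube mult_ac)
    have t2: "(1 - r)\<^sup>2 * (2 * a2 / (c * a1\<^sup>2)) = A * y\<^sup>2"
      unfolding a2 using nz by (simp add: A_def y_def power2_eq_square mult_ac)
    have t3: "2 * r * (1 - r) * (2 / (1 - c)) = 2 * B * x * y"
      using nz by (simp add: B_def x_def y_def)
    show ?thesis unfolding sigma_fun_def t1 t2 t3 by (simp add: distrib_left)
  qed
  have BA: "B \<le> A"
  proof -
    have "(a1 * (1 - c))\<^sup>2 \<le> s\<^sup>2"
    proof -
      have "(a1 * (1 - c))\<^sup>2 = a1\<^sup>2 * (1 - c) * (1 - c)" by (simp add: power2_eq_square)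
      also have "\<dots> \<le> a2 * (1 - c) * 1" using cs c1 c a by (intro mult_mono) auto
      finally show ?thesis by (simp add: s(2) mult.commute)
    qed
    then have "a1 * (1 - c) \<le> s" using s(1) by (rule power2_le_imp_le[OF _ less_imp_le])
    then have "c * (a1 * (1 - c)) \<le> c * s" using c by (intro mult_left_mono) auto
    then show ?thesis using s(1) c1 by (simp add: A_def B_def field_simps)
  qed
  define \<kappa> where "\<kappa> = (A + B) / 2"
  have AB: "A > 0" "B > 0" using c c1 a s by (simp_all add: A_def B_def)
  then have \<kappa>: "\<kappa> > 0" by (simp add: \<kappa>_def)
  have V: "V = l / sqrt \<kappa>"
  proof -
    have sq: "sqrt ((1 - c) / a2) = (1 - c) / s"
    proof -
      have "(1 - c) / a2 = ((1 - c) / s)\<^sup>2" unfolding a2 using nz by (simp add: power2_eq_square)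
      then show ?thesis using c1 s(1) by simp
    qed
    have k: "c * (a1 * ((1 - c) / s) + 1) = (1 - c) * \<kappa>"
      using nz by (simp add: \<kappa>_def A_def B_def field_simps)
    show ?thesis unfolding V_def sq k using c1 by (simp add: real_sqrt_mult)
  qed
  have xy: "x \<ge> 0" "y \<ge> 0" using r c1 c a s by (simp_all add: x_def y_def)
  have xy0: "x + y > 0"
  proof (cases "r = 0")
    case True
    then show ?thesis using c a s by (simp add: x_def y_def)
  next
    case False
    then have "x > 0" using r c1 by (simp add: x_def)
    then show ?thesis using xy by simp
  qed
  have id: "A * (x\<^sup>2 + y\<^sup>2) + 2 * B * x * y = \<kappa> * (x + y)\<^sup>2 + (A - B) / 2 * (x - y)\<^sup>2"
    by (simp add: \<kappa>_def power2_eq_square field_simps)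
  have root: "sqrt (\<kappa> * (x + y)\<^sup>2) = sqrt \<kappa> * (x + y)" using xy by (simp add: real_sqrt_mult)
  have pos: "0 < sqrt \<kappa> * (x + y)" using \<kappa> xy0 by simp
  have le: "sqrt \<kappa> * (x + y) \<le> sigma_fun r c a1 a2"
    unfolding var id root[symmetric] using BA by simp
  have "0 < sigma_fun r c a1 a2" using le pos by linarith
  then have "0 < sigma_fun r c a1 a2 * (sqrt \<kappa> * (x + y))" by (rule mult_pos_pos[OF _ pos])
  moreover have "0 \<le> l * (x + y)" using l xy0 by simp
  ultimately have "l * (x + y) / sigma_fun r c a1 a2 \<le> l * (x + y) / (sqrt \<kappa> * (x + y))"
    using divide_left_mono[OF le] by blast
  also have "l * (x + y) / (sqrt \<kappa> * (x + y)) = V" unfolding V using xy0 by simp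
  finally show "?f r \<le> V" unfolding mean .
  assume rs: "r = rho_star c a1 a2"
  have "a2 * (1 - c)\<^sup>2 = (1 - c) * s\<^sup>2" "sqrt (a2 * (1 - c)) = s"
    using s(2) by (simp_all add: s_def power2_eq_square mult.commute mult.left_commute)
  then have "r = inverse (a1 * c * s / ((1 - c) * s\<^sup>2) + 1)" unfolding rs rho_star_def by simp
  also have "a1 * c * s / ((1 - c) * s\<^sup>2) + 1 = (a1 * c + (1 - c) * s) / ((1 - c) * s)"
    using nz by (simp add: field_simps power2_eq_square)
  finally have r': "r = (1 - c) * s / (a1 * c + (1 - c) * s)" by simp
  have d: "a1 * c + (1 - c) * s > 0" using a c s by (simp add: add_pos_pos)
  then have "1 - r = a1 * c / (a1 * c + (1 - c) * s)" unfolding r' by (simp add: field_simps)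
  then have "x = y" unfolding x_def y_def using nz r' by (simp add: mult.commute)
  then have "sigma_fun r c a1 a2 = sqrt \<kappa> * (x + y)" unfolding var id root[symmetric] by simp
  then show "?f r = V" unfolding mean V using xy0 by simp
qed

lemma tr_on_gramian_nonneg: "0 \<le> tr_on {..<p} (gramian p L)"
  by (simp add: tr_on_def gramian_def mmult_def transposed_def sum_nonneg)

text \<open>The Cauchy-Schwarz inequality between the first two spectral moments.\<close>
lemma tr_on_square_le: "(tr_on {..<p} C)\<^sup>2 \<le> real p * frob2 {..<p} C"
proof -
  have "(tr_on {..<p} C)\<^sup>2 \<le> real p * (\<Sum>a<p. (C a a)\<^sup>2)"
    using Cauchy_Schwarz_ineq_sum[of "\<lambda>_. 1" "\<lambda>a. C a a" "{..<p}"] by (simp add: tr_on_def)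
  also have "\<dots> \<le> real p * frob2 {..<p} C"
    unfolding frob2_def by (intro mult_left_mono sum_mono member_le_sum) auto
  finally show ?thesis .
qed

lemma isCont_std_normal_cdf: "isCont std_normal_cdf x"
proof -
  interpret real_distribution std_normal_distribution by (rule real_dist_normal_dist)
  have "emeasure std_normal_distribution {x} = 0"
    by (subst emeasure_density) (auto intro!: nn_integral_null_set)
  then show ?thesis unfolding std_normal_cdf_def by (simp add: isCont_cdf measure_def)
qed

lemma std_normal_cdf_mono: "x \<le> y \<Longrightarrow> std_normal_cdf x \<le> std_normal_cdf y"
proof -
  interpret real_distribution std_normal_distribution by (rule real_dist_normal_dist)
  show "x \<le> y \<Longrightarrow> std_normal_cdf x \<le> std_normal_cdf y" unfolding std_normal_cdf_def by (rule cdf_nondecreasing)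
qed

text \<open>The power along a convergent sequence of weights, without a relation between the two noncentrality parameters. The Cholesky factors and the shift \<open>e = L\<^sup>-\<^sup>1 \<delta>\<close> put each member of the sequence into the rotated form.\<close>
theorem reject_prob_limit:
  fixes M :: "nat \<Rightarrow> 'a measure"
    and N p :: "nat \<Rightarrow> nat"
    and X :: "nat \<Rightarrow> nat \<Rightarrow> 'a \<Rightarrow> real Matrix.vec"
    and \<mu> \<mu>\<^sub>0 :: "nat \<Rightarrow> real Matrix.vec"
    and \<Sigma> :: "nat \<Rightarrow> real mat"
    and n :: "nat \<Rightarrow> real"
  assumes mean: "\<And>k. \<mu> k \<in> carrier_vec (p k)" "\<And>k. \<mu>\<^sub>0 k \<in> carrier_vec (p k)"
    and Sigma: "\<And>k. pos_def_mat (p k) (\<Sigma> k)"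
    and sample: "\<And>k. normal_sample (M k) (N k) (p k) (\<mu> k) (\<Sigma> k) (X k)"
    and n_def: "\<And>k. n k = real (N k - 1)"
    and size: "filterlim N at_top sequentially" "filterlim p at_top sequentially"
      "(\<lambda>k. real (p k) / n k) \<longlonglongrightarrow> c" "0 < c" "c < 1"
    and a1: "(\<lambda>k. a_coef 1 (p k) (\<Sigma> k)) \<longlonglongrightarrow> a1" "0 < a1"
    and a2: "(\<lambda>k. a_coef 2 (p k) (\<Sigma> k)) \<longlonglongrightarrow> a2" "0 < a2"
    and a4: "(\<lambda>k. a_coef 4 (p k) (\<Sigma> k)) \<longlonglongrightarrow> a4"
    and l: "(\<lambda>k. sqrt (n k) * Delta2 (\<mu> k) (\<mu>\<^sub>0 k) (\<Sigma> k)) \<longlonglongrightarrow> l"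
    and lI: "(\<lambda>k. sqrt (n k) * DeltaI2 (\<mu> k) (\<mu>\<^sub>0 k)) \<longlonglongrightarrow> lI"
    and lS: "(\<lambda>k. sqrt (n k) * DeltaS2 (\<mu> k) (\<mu>\<^sub>0 k) (\<Sigma> k)) \<longlonglongrightarrow> lS"
    and \<rho>: "\<rho> \<longlonglongrightarrow> r" and r: "r \<in> {0..1}"
  shows "(\<lambda>k. reject_prob (M k) (N k) (p k) (\<mu>\<^sub>0 k) (X k) \<alpha> (\<rho> k)) \<longlonglongrightarrow>
    std_normal_cdf ((r * (l / (1 - c)) + (1 - r) * (lI / (c * a1))) / sigma_fun r c a1 a2 - upper_percentile \<alpha>)"
proof -
  have "\<forall>k. \<exists>L. factorizes (p k) L (\<Sigma> k)" using cholesky[OF Sigma] by blast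
  then obtain L where L: "\<And>k. factorizes (p k) (L k) (\<Sigma> k)" by metis
  have low: "lower_triangular (p k) (L k)" for k using L[of k] by (simp add: factorizes_def)
  have "\<forall>k. \<exists>e. \<forall>j<p k. (\<Sum>i<p k. L k j i * e i) = sqrt (real (N k)) * (\<mu> k $ j - \<mu>\<^sub>0 k $ j)"
    by (intro allI forward_substitution[OF low])
  then obtain e where e': "\<And>k j. j < p k \<Longrightarrow> (\<Sum>i<p k. L k j i * e k i) = sqrt (real (N k)) * (\<mu> k $ j - \<mu>\<^sub>0 k $ j)" by metis
  have e: "\<And>k j. j < p k \<Longrightarrow> sqrt (real (N k)) * (\<mu> k $ j - \<mu>\<^sub>0 k $ j) = (\<Sum>i<p k. L k j i * e k i)" by (simp add: e')
  have "eventually (\<lambda>k. N k \<ge> 2) sequentially" "eventually (\<lambda>k. p k \<ge> 2) sequentially"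
    using size(1,2) by (auto simp: filterlim_at_top)
  moreover have "eventually (\<lambda>k. real (p k) / n k < 1) sequentially" by (rule order_tendstoD(2)[OF size(3,5)])
  moreover have "eventually (\<lambda>k. a_coef 1 (p k) (\<Sigma> k) > 0) sequentially" by (rule order_tendstoD(1)[OF a1])
  ultimately have "eventually (\<lambda>k. 2 \<le> p k \<and> p k < N k \<and> 0 < tr_on {..<p k} (gramian (p k) (L k))) sequentially"
  proof eventually_elim
    case (elim k)
    have "real (p k) < n k" using elim by (simp add: n_def divide_less_eq split: if_splits)
    then have "p k < N k" using elim by (simp add: n_def)
    moreover have "0 < tr_on {..<p k} (gramian (p k) (L k))"
      using elim unfolding a_coef_gramian(1)[OF L] by (simp add: zero_less_divide_iff)
    ultimately show ?case using elim by simp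
  qed
  then obtain K where K: "\<And>k. k \<ge> K \<Longrightarrow> 2 \<le> p k \<and> p k < N k \<and> 0 < tr_on {..<p k} (gramian (p k) (L k))"
    by (auto simp: eventually_sequentially)
  \<comment> \<open>Discarding finitely many members makes the samples nondegenerate.\<close>
  define g where "g k = k + K" for k
  have g: "2 \<le> p (g k)" "p (g k) < N (g k)" "0 < tr_on {..<p (g k)} (gramian (p (g k)) (L (g k)))" for k
    using K[of "g k"] by (simp_all add: g_def)
  have shift: "(\<lambda>k. f (g k)) \<longlonglongrightarrow> x" if "f \<longlonglongrightarrow> x" for f :: "nat \<Rightarrow> real" and x
    unfolding g_def by (rule LIMSEQ_ignore_initial_segment[OF that])
  have g_top: "filterlim g at_top sequentially" unfolding g_def by (rule filterlim_add_const_nat_at_top)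
  have scale: "(\<lambda>k. real (N (g k)) * f (g k) / sqrt (n (g k))) \<longlonglongrightarrow> x" if "(\<lambda>k. sqrt (n k) * f k) \<longlonglongrightarrow> x" for f x
  proof -
    have inv: "(\<lambda>k. 1 / n (g k)) \<longlonglongrightarrow> 0"
    proof -
      have "filterlim (\<lambda>k. N (g k) - 1) at_top sequentially"
        by (rule filterlim_compose[OF filterlim_minus_const_nat_at_top filterlim_compose[OF size(1) g_top]])
      from tendsto_inverse_0_at_top[OF filterlim_compose[OF filterlim_real_sequentially this]]
      show ?thesis by (simp add: n_def inverse_eq_divide)
    qed
    have "real (N (g k)) * f (g k) / sqrt (n (g k)) = (1 + 1 / n (g k)) * (sqrt (n (g k)) * f (g k))" for k
    proof -
      have n0: "n (g k) > 0" "real (N (g k)) = n (g k) + 1" using g[of k] by (simp_all add: n_def of_nat_diff)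
      define s where "s = sqrt (n (g k))"
      have s: "s > 0" "n (g k) = s\<^sup>2" using n0 by (simp_all add: s_def)
      show ?thesis unfolding s_def[symmetric] n0(2) unfolding s(2) using s(1) by (simp add: field_simps power2_eq_square)
    qed
    moreover have "(\<lambda>k. (1 + 1 / n (g k)) * (sqrt (n (g k)) * f (g k))) \<longlonglongrightarrow> (1 + 0) * x"
      by (rule tendsto_mult[OF tendsto_add[OF tendsto_const inv] shift[OF that]])
    ultimately show ?thesis by simp
  qed
  have N0: "0 < N (g k)" "0 < p (g k)" for k using g[of k] by simp_all
  note D = Delta_factorizes[OF L mean N0(1) e]
  interpret H: high_dimensional "\<lambda>k. N (g k)" "\<lambda>k. p (g k)" "\<lambda>k. L (g k)" "\<lambda>k. e (g k)" "\<lambda>k. n (g k)" c a1 a2 a4 l lI lS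
  proof unfold_locales
    show "2 \<le> p (g k)" "p (g k) < N (g k)" "0 < tr_on {..<p (g k)} (gramian (p (g k)) (L (g k)))" for k by (rule g)+
    show "n (g k) = real (N (g k) - 1)" for k by (rule n_def)
    show "filterlim (\<lambda>k. N (g k)) at_top sequentially" "filterlim (\<lambda>k. p (g k)) at_top sequentially"
      by (rule filterlim_compose[OF size(1) g_top], rule filterlim_compose[OF size(2) g_top])
    show "(\<lambda>k. real (p (g k)) / n (g k)) \<longlonglongrightarrow> c" by (rule shift[OF size(3)])
    show "(\<lambda>k. tr_on {..<p (g k)} (gramian (p (g k)) (L (g k))) / real (p (g k))) \<longlonglongrightarrow> a1"
      using shift[OF a1(1)] unfolding a_coef_gramian[OF L] .
    show "(\<lambda>k. frob2 {..<p (g k)} (gramian (p (g k)) (L (g k))) / real (p (g k))) \<longlonglongrightarrow> a2"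
      using shift[OF a2(1)] unfolding a_coef_gramian[OF L] .
    show "(\<lambda>k. frob2 {..<p (g k)} (mmult {..<p (g k)} (gramian (p (g k)) (L (g k))) (gramian (p (g k)) (L (g k)))) / real (p (g k))) \<longlonglongrightarrow> a4"
      using shift[OF a4] unfolding a_coef_gramian[OF L] .
    have d: "(\<Sum>j<p (g k). (e (g k) j)\<^sup>2) = real (N (g k)) * Delta2 (\<mu> (g k)) (\<mu>\<^sub>0 (g k)) (\<Sigma> (g k))"
      "(\<Sum>j<p (g k). (\<Sum>i<p (g k). L (g k) j i * e (g k) i)\<^sup>2) = real (N (g k)) * DeltaI2 (\<mu> (g k)) (\<mu>\<^sub>0 (g k))"
      "(\<Sum>i<p (g k). (\<Sum>j<p (g k). L (g k) j i * (\<Sum>m<p (g k). L (g k) j m * e (g k) m))\<^sup>2) = real (N (g k)) * DeltaS2 (\<mu> (g k)) (\<mu>\<^sub>0 (g k)) (\<Sigma> (g k))" for k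
      by (rule Delta_factorizes[OF L mean N0(1)], rule e, assumption)+
    show "(\<lambda>k. (\<Sum>j<p (g k). (e (g k) j)\<^sup>2) / sqrt (n (g k))) \<longlonglongrightarrow> l" unfolding d by (rule scale[OF l])
    show "(\<lambda>k. (\<Sum>j<p (g k). (\<Sum>i<p (g k). L (g k) j i * e (g k) i)\<^sup>2) / sqrt (n (g k))) \<longlonglongrightarrow> lI" unfolding d by (rule scale[OF lI])
    show "(\<lambda>k. (\<Sum>i<p (g k). (\<Sum>j<p (g k). L (g k) j i * (\<Sum>m<p (g k). L (g k) j m * e (g k) m))\<^sup>2) / sqrt (n (g k))) \<longlonglongrightarrow> lS"
      unfolding d by (rule scale[OF lS])
  qed (use size a1 a2 in simp_all)
  define T where "T k z = test_statistic (N (g k)) (p (g k)) (\<mu>\<^sub>0 (g k)) (\<rho> (g k)) (canonical_sample (N (g k)) (p (g k)) (\<mu> (g k)) (L (g k)) z)" for k z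
  have AE: "AE z in H.G k. T k z = (\<rho> (g k) * H.hot k z + (1 - \<rho> (g k)) * H.dem k z)
      / sigma_fun (\<rho> (g k)) (H.P k / n (g k)) (tau (N (g k)) (p (g k)) (L (g k)) z / H.P k) (H.a2_form k z)" for k
    using AE_gram_injective[OF g(2)[of k]]
  proof eventually_elim
    case (elim z)
    have inj: "\<And>v. (\<forall>i\<in>{1..<N (g k)}. (\<Sum>j<p (g k). z (i, j) * v j) = 0) \<Longrightarrow> (\<forall>j<p (g k). v j = (0::real))"
      using elim by blast
    have t: "T_stat (N (g k)) (p (g k)) (\<mu>\<^sub>0 (g k)) (\<rho> (g k)) (canonical_sample (N (g k)) (p (g k)) (\<mu> (g k)) (L (g k)) z)
      = \<rho> (g k) * H.hot k z + (1 - \<rho> (g k)) * H.dem k z"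
      unfolding H.hot_def H.dem_def H.P_def H.m_def unfolding n_def mult.assoc[symmetric]
      by (rule T_stat_canonical[OF N0(2) g(2) mean low]) (rule e, assumption, rule inj)
    have h1: "a1_hat (N (g k)) (p (g k)) (canonical_sample (N (g k)) (p (g k)) (\<mu> (g k)) (L (g k)) z) = tau (N (g k)) (p (g k)) (L (g k)) z / H.P k"
      unfolding H.P_def by (rule a1_hat_canonical[OF N0(2) g(2) mean low]) (rule e)
    have h2: "a2_hat (N (g k)) (p (g k)) (canonical_sample (N (g k)) (p (g k)) (\<mu> (g k)) (L (g k)) z) = H.a2_form k z"
      unfolding H.a2_form_def by (rule a2_hat_canonical[OF N0(2) g(2) mean low _ n_def H.size(1)]) (rule e)
    show ?case unfolding T_def test_statistic_def t h1 h2 unfolding H.P_def n_def ..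
  qed
  have rp: "reject_prob (M (g k)) (N (g k)) (p (g k)) (\<mu>\<^sub>0 (g k)) (X (g k)) \<alpha> (\<rho> (g k)) = measure (H.G k) {z \<in> space (H.G k). T k z \<ge> upper_percentile \<alpha>}"
    and meas: "{z \<in> space (H.G k). T k z \<ge> upper_percentile \<alpha>} \<in> sets (H.G k)" for k
    unfolding T_def by (rule reject_prob_canonical[OF sample L mean N0])+
  have "(\<lambda>k. reject_prob (M (g k)) (N (g k)) (p (g k)) (\<mu>\<^sub>0 (g k)) (X (g k)) \<alpha> (\<rho> (g k))) \<longlonglongrightarrow>
    std_normal_cdf ((r * (l / (1 - c)) + (1 - r) * (lI / (c * a1))) / sigma_fun r c a1 a2 - upper_percentile \<alpha>)"
    unfolding rp std_normal_cdf_def by (rule H.rejection_limit[OF shift[OF \<rho>] r AE meas])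
  then show ?thesis unfolding g_def by (rule LIMSEQ_offset)
qed

text \<open>On \<open>\<Omega>\<^sub>0\<close> the two noncentrality parameters are tied so that the optimisation applies. Since the plug-in weights converge to the optimal weight, the limit along them is the maximum, and both the power and the stated approximation converge to the same value of the continuous function \<open>\<Phi>\<close>.\<close>
theorem proposition2p1:
  fixes M :: "nat \<Rightarrow> 'a measure"
    and N p :: "nat \<Rightarrow> nat"
    and X :: "nat \<Rightarrow> nat \<Rightarrow> 'a \<Rightarrow> real Matrix.vec"
    and \<mu> \<mu>\<^sub>0 :: "nat \<Rightarrow> real Matrix.vec"
    and \<Sigma> :: "nat \<Rightarrow> real mat"
    and a :: "nat \<Rightarrow> nat \<Rightarrow> real"
    and n \<rho>\<^sub>s :: "nat \<Rightarrow> real"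
    and c \<alpha> :: real
  assumes alpha: "0 < \<alpha>" "\<alpha> < 1"
    and mean: "\<And>k. \<mu> k \<in> carrier_vec (p k)" "\<And>k. \<mu>\<^sub>0 k \<in> carrier_vec (p k)"
    and Sigma: "\<And>k. pos_def_mat (p k) (\<Sigma> k)"
    and sample: "\<And>k. normal_sample (M k) (N k) (p k) (\<mu> k) (\<Sigma> k) (X k)"
    and n_def: "\<And>k. n k = real (N k - 1)"
    and a_def: "\<And>i k. a i k = a_coef i (p k) (\<Sigma> k)"
    and rho_s_def: "\<And>k. \<rho>\<^sub>s k = rho_star c (a 1 k) (a 2 k)"
    and A1: "filterlim N at_top sequentially" "filterlim p at_top sequentially"
      "(\<lambda>k. real (p k) / n k) \<longlonglongrightarrow> c" "0 < c" "c < 1"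
    and A2: "\<And>i. i \<in> {1..6} \<Longrightarrow> \<exists>l>0. a i \<longlonglongrightarrow> l"
    and A3: "\<exists>l>0. (\<lambda>k. sqrt (n k) * Delta2 (\<mu> k) (\<mu>\<^sub>0 k) (\<Sigma> k)) \<longlonglongrightarrow> l"
      "\<exists>l>0. (\<lambda>k. sqrt (n k) * DeltaI2 (\<mu> k) (\<mu>\<^sub>0 k)) \<longlonglongrightarrow> l"
      "\<exists>l>0. (\<lambda>k. sqrt (n k) * DeltaS2 (\<mu> k) (\<mu>\<^sub>0 k) (\<Sigma> k)) \<longlonglongrightarrow> l"
    and Omega0: "\<And>k. Delta2 (\<mu> k) (\<mu>\<^sub>0 k) (\<Sigma> k) / DeltaI2 (\<mu> k) (\<mu>\<^sub>0 k)
      = 1 / sqrt ((1 - c) * a 2 k)"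
  shows "(\<forall>k. \<rho>\<^sub>s k \<in> {0..1}) \<and>
    (\<exists>L. (\<lambda>k. reject_prob (M k) (N k) (p k) (\<mu>\<^sub>0 k) (X k) \<alpha> (\<rho>\<^sub>s k)) \<longlonglongrightarrow> L \<and>
      (\<forall>\<rho>\<in>{0..1}. \<exists>l. (\<lambda>k. reject_prob (M k) (N k) (p k) (\<mu>\<^sub>0 k) (X k) \<alpha> \<rho>) \<longlonglongrightarrow> l \<and> l \<le> L)) \<and>
    (\<lambda>k. reject_prob (M k) (N k) (p k) (\<mu>\<^sub>0 k) (X k) \<alpha> (\<rho>\<^sub>s k)
      - std_normal_cdf
          (sqrt (n k * (1 - c)) * Delta2 (\<mu> k) (\<mu>\<^sub>0 k) (\<Sigma> k)
             / sqrt (c * (a 1 k * sqrt ((1 - c) / a 2 k) + 1))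
           - upper_percentile \<alpha>)) \<longlonglongrightarrow> 0"
proof -
  obtain a1 a2 a4 where a1: "0 < a1" "a 1 \<longlonglongrightarrow> a1" and a2: "0 < a2" "a 2 \<longlonglongrightarrow> a2" and a4: "0 < a4" "a 4 \<longlonglongrightarrow> a4"
    using A2[of 1] A2[of 2] A2[of 4] by auto
  obtain l where l: "0 < l" "(\<lambda>k. sqrt (n k) * Delta2 (\<mu> k) (\<mu>\<^sub>0 k) (\<Sigma> k)) \<longlonglongrightarrow> l" using A3(1) by blast
  obtain lI where lI: "0 < lI" "(\<lambda>k. sqrt (n k) * DeltaI2 (\<mu> k) (\<mu>\<^sub>0 k)) \<longlonglongrightarrow> lI" using A3(2) by blast
  obtain lS where lS: "(\<lambda>k. sqrt (n k) * DeltaS2 (\<mu> k) (\<mu>\<^sub>0 k) (\<Sigma> k)) \<longlonglongrightarrow> lS" using A3(3) by blast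
  have c1: "1 - c > 0" using A1(5) by simp
  have coef: "0 \<le> a 1 k" "0 \<le> a 2 k" "(a 1 k)\<^sup>2 \<le> a 2 k" for k
  proof -
    obtain L where L: "factorizes (p k) L (\<Sigma> k)" using cholesky[OF Sigma] by blast
    have e: "a 1 k = tr_on {..<p k} (gramian (p k) L) / real (p k)" "a 2 k = frob2 {..<p k} (gramian (p k) L) / real (p k)"
      unfolding a_def by (rule a_coef_gramian[OF L])+
    show "0 \<le> a 1 k" "0 \<le> a 2 k" unfolding e using tr_on_gramian_nonneg[of "p k" L] by simp_all
    show "(a 1 k)\<^sup>2 \<le> a 2 k"
    proof (cases "p k = 0")
      case False
      have "(tr_on {..<p k} (gramian (p k) L))\<^sup>2 / (real (p k))\<^sup>2 \<le> real (p k) * frob2 {..<p k} (gramian (p k) L) / (real (p k))\<^sup>2"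
        by (rule divide_right_mono[OF tr_on_square_le]) simp
      then show ?thesis unfolding e power_divide using False by (simp add: power2_eq_square)
    qed (use e in simp)
  qed
  have cs: "a1\<^sup>2 \<le> a2"
    by (rule LIMSEQ_le[OF tendsto_power[OF a1(2)] a2(2)]) (use coef in blast)
  have rs: "rho_star c x y \<in> {0..1}" if "0 \<le> x" "0 \<le> y" for x y
  proof -
    have "0 \<le> x * c * sqrt (y * (1 - c)) / (y * (1 - c)\<^sup>2)" using that A1(4) c1 by simp
    then show ?thesis unfolding rho_star_def by (simp add: inverse_le_1_iff)
  qed
  have lI_eq: "lI = l * sqrt ((1 - c) * a2)"
  proof -
    have s: "sqrt ((1 - c) * a2) > 0" using c1 a2 by simp
    have "(\<lambda>k. 1 / sqrt ((1 - c) * a 2 k)) \<longlonglongrightarrow> 1 / sqrt ((1 - c) * a2)"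
      by (rule tendsto_divide[OF tendsto_const tendsto_real_sqrt[OF tendsto_mult[OF tendsto_const a2(2)]]]) (use s in linarith)
    moreover have "(\<lambda>k. 1 / sqrt ((1 - c) * a 2 k)) \<longlonglongrightarrow> l / lI"
    proof (rule Lim_transform_eventually[OF tendsto_divide[OF l(2) lI(2)]])
      show "lI \<noteq> 0" using lI(1) by simp
      have "eventually (\<lambda>k. N k \<ge> 2) sequentially" using A1(1) by (auto simp: filterlim_at_top)
      then show "eventually (\<lambda>k. sqrt (n k) * Delta2 (\<mu> k) (\<mu>\<^sub>0 k) (\<Sigma> k) / (sqrt (n k) * DeltaI2 (\<mu> k) (\<mu>\<^sub>0 k)) = 1 / sqrt ((1 - c) * a 2 k)) sequentially"
      proof eventually_elim
        case (elim k)
        then have "sqrt (n k) \<noteq> 0" by (simp add: n_def)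
        then show ?case unfolding Omega0[symmetric] by simp
      qed
    qed
    ultimately have "1 / sqrt ((1 - c) * a2) = l / lI" by (rule LIMSEQ_unique)
    moreover have "lI = l * S" if "1 / S = l / lI" "S > 0" for S
      using that lI(1) by (simp add: field_simps)
    ultimately show ?thesis using s by blast
  qed
  define V where "V = l * sqrt (1 - c) / sqrt (c * (a1 * sqrt ((1 - c) / a2) + 1))"
  define m where "m r = (r * (l / (1 - c)) + (1 - r) * (lI / (c * a1))) / sigma_fun r c a1 a2" for r
  note lim = reject_prob_limit[OF mean Sigma sample n_def A1 _ a1(1) _ a2(1) _ l(2) lI(2) lS, folded a_def, OF a1(2) a2(2) a4(2), folded m_def]
  define \<rho> where "\<rho> = rho_star c a1 a2"
  have \<rho>01: "\<rho> \<in> {0..1}" unfolding \<rho>_def by (rule rs) (use a1 a2 in simp_all)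
  have \<rho>s: "\<rho>\<^sub>s \<longlonglongrightarrow> \<rho>"
  proof -
    have d: "a2 * (1 - c)\<^sup>2 \<noteq> 0" using a2 c1 by simp
    have "0 \<le> a1 * c * sqrt (a2 * (1 - c)) / (a2 * (1 - c)\<^sup>2)" using a1 a2 A1(4) c1 by simp
    then have d': "a1 * c * sqrt (a2 * (1 - c)) / (a2 * (1 - c)\<^sup>2) + 1 \<noteq> 0" by linarith
    show ?thesis unfolding rho_s_def[abs_def] \<rho>_def rho_star_def
      by (rule tendsto_inverse[OF tendsto_add[OF tendsto_divide[OF tendsto_mult[OF tendsto_mult[OF a1(2) tendsto_const]
          tendsto_real_sqrt[OF tendsto_mult[OF a2(2) tendsto_const]]] tendsto_mult[OF a2(2) tendsto_const] d] tendsto_const] d'])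
  qed
  have top: "m \<rho> = V"
    unfolding m_def V_def lI_eq by (rule sigma_fun_maximal(2)[OF A1(4,5) a1(1) a2(1) cs l(1) \<rho>01]) (rule \<rho>_def)
  have lim_s: "(\<lambda>k. reject_prob (M k) (N k) (p k) (\<mu>\<^sub>0 k) (X k) \<alpha> (\<rho>\<^sub>s k)) \<longlonglongrightarrow> std_normal_cdf (V - upper_percentile \<alpha>)"
    using lim[OF \<rho>s \<rho>01] unfolding top .
  have best: "\<exists>x. (\<lambda>k. reject_prob (M k) (N k) (p k) (\<mu>\<^sub>0 k) (X k) \<alpha> r) \<longlonglongrightarrow> x \<and> x \<le> std_normal_cdf (V - upper_percentile \<alpha>)"
    if r: "r \<in> {0..1}" for r
  proof (intro exI conjI)
    show "(\<lambda>k. reject_prob (M k) (N k) (p k) (\<mu>\<^sub>0 k) (X k) \<alpha> r) \<longlonglongrightarrow> std_normal_cdf (m r - upper_percentile \<alpha>)"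
      by (rule lim[OF tendsto_const r])
    have "m r \<le> V" unfolding m_def V_def lI_eq by (rule sigma_fun_maximal(1)[OF A1(4,5) a1(1) a2(1) cs l(1) r])
    then show "std_normal_cdf (m r - upper_percentile \<alpha>) \<le> std_normal_cdf (V - upper_percentile \<alpha>)"
      by (intro std_normal_cdf_mono) simp
  qed
  have power: "(\<lambda>k. std_normal_cdf (sqrt (n k * (1 - c)) * Delta2 (\<mu> k) (\<mu>\<^sub>0 k) (\<Sigma> k)
      / sqrt (c * (a 1 k * sqrt ((1 - c) / a 2 k) + 1)) - upper_percentile \<alpha>)) \<longlonglongrightarrow> std_normal_cdf (V - upper_percentile \<alpha>)"
  proof (rule isCont_tendsto_compose[OF isCont_std_normal_cdf], rule tendsto_diff[OF _ tendsto_const])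
    have pos: "sqrt (c * (a1 * sqrt ((1 - c) / a2) + 1)) > 0"
      using A1(4) a1(1) a2(1) c1 by (simp add: add_nonneg_pos)
    have "(\<lambda>k. sqrt (n k) * Delta2 (\<mu> k) (\<mu>\<^sub>0 k) (\<Sigma> k) * sqrt (1 - c) / sqrt (c * (a 1 k * sqrt ((1 - c) / a 2 k) + 1))) \<longlonglongrightarrow> V"
      unfolding V_def
      by (rule tendsto_divide[OF tendsto_mult[OF l(2) tendsto_const] tendsto_real_sqrt[OF tendsto_mult[OF tendsto_const
          tendsto_add[OF tendsto_mult[OF a1(2) tendsto_real_sqrt[OF tendsto_divide[OF tendsto_const a2(2)]]] tendsto_const]]]])
         (use pos a2(1) in auto)
    then show "(\<lambda>k. sqrt (n k * (1 - c)) * Delta2 (\<mu> k) (\<mu>\<^sub>0 k) (\<Sigma> k) / sqrt (c * (a 1 k * sqrt ((1 - c) / a 2 k) + 1))) \<longlonglongrightarrow> V"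
      by (simp add: real_sqrt_mult mult_ac)
  qed
  have in01: "\<forall>k. \<rho>\<^sub>s k \<in> {0..1}" unfolding rho_s_def by (intro allI rs coef)
  have diff: "(\<lambda>k. reject_prob (M k) (N k) (p k) (\<mu>\<^sub>0 k) (X k) \<alpha> (\<rho>\<^sub>s k)
      - std_normal_cdf (sqrt (n k * (1 - c)) * Delta2 (\<mu> k) (\<mu>\<^sub>0 k) (\<Sigma> k)
             / sqrt (c * (a 1 k * sqrt ((1 - c) / a 2 k) + 1)) - upper_percentile \<alpha>)) \<longlonglongrightarrow> 0"
    using tendsto_diff[OF lim_s power] by simp
  show ?thesis
  proof (intro conjI in01 diff)
    show "\<exists>L. (\<lambda>k. reject_prob (M k) (N k) (p k) (\<mu>\<^sub>0 k) (X k) \<alpha> (\<rho>\<^sub>s k)) \<longlonglongrightarrow> L \<and>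
      (\<forall>\<rho>\<in>{0..1}. \<exists>l. (\<lambda>k. reject_prob (M k) (N k) (p k) (\<mu>\<^sub>0 k) (X k) \<alpha> \<rho>) \<longlonglongrightarrow> l \<and> l \<le> L)"
      by (rule exI[of _ "std_normal_cdf (V - upper_percentile \<alpha>)"], rule conjI[OF lim_s], rule ballI, rule best)
  qed
qed

end
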